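(* Let $k\in(0,1)$ and an integer $m\ge0$ be fixed, let $\nu\to\infty$, $\kappa=k\sqrt{\nu(\nu+1)}$ and $t=\sqrt{2\kappa}\,\operatorname{sn}(z,k)$. Let $A_s,B_s,P_s,Q_s$ be the polynomials and $\eta_s$ the constants defined in the context ($A_s,P_s$ even, $B_s,Q_s$ odd). Then there are constants $C_\nu^m$ and $S_\nu^{m+1}$ such that for every integer $n\ge1$, as $\kappa\to\infty$ with $z=\mathcal O(\kappa^{-1/2})$ (that is, uniformly for $z$ near $0$ with $|t|\le t_*$, for any fixed $t_*>0$), $$\mathrm{Ec}_\nu^m(z,k^2)=C_\nu^m\left(D_m(t)\sum_{s=0}^n\frac{A_s(t)}{\kappa^s}+D_m'(t)\sum_{s=0}^n\frac{B_s(t)}{\kappa^s}+\mathcal O(\kappa^{-n-1})\right),$$ $$\frac{\mathrm{Es}_\nu^{m+1}(z,k^2)}{\operatorname{cn}(z,k)}=S_\nu^{m+1}\left(D_m(t)\sum_{s=0}^n\frac{P_s(t)}{\kappa^s}+D_m'(t)\sum_{s=0}^n\frac{Q_s(t)}{\kappa^s}+\mathcal O(\kappa^{-n-1})\right),$$ where $C_\nu^m$ and $S_\nu^{m+1}$ both have the asymptotic expansion $$C_\nu^m,\ S_\nu^{m+1}\ \sim\ \frac{(\pi\kappa)^{1/4}}{\sqrt{2\,m!}}\left(1+\sum_{s=1}^\infty\frac{\eta_s}{\kappa^s}\right)^{-1/2}.$$ The first terms are $$A_0=1,\quad A_1=\frac{k^2+1}{32}t^2,\quad B_0=0,\quad B_1=\frac{k^2+1}{16}\big(t^3-(2m+1)t\big),$$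 $$P_0=1,\quad P_1=\frac{k^2+9}{32}t^2,\quad Q_0=0,\quad Q_1=B_1,\quad \eta_1=\frac{3-k^2}{16}(2m+1).$$
   Context: **Lamé functions.** Lamé's equation is $w''(z)+\big(h-\nu(\nu+1)k^2\operatorname{sn}^2(z,k)\big)w(z)=0$, with $0<k<1$, $\nu\ge-\tfrac12$, and $K=K(k)$ the complete elliptic integral of the first kind; $\operatorname{sn},\operatorname{cn},\operatorname{dn}$ are Jacobian elliptic functions. For $m=0,1,2,\dots$, $a_\nu^m$ is the eigenvalue $h$ for which there is a nontrivial solution $\mathrm{Ec}_\nu^m(z,k^2)$ with $w'(-K)=w'(K)=0$ having exactly $m$ zeros in $(-K,K)$; $b_\nu^{m+1}$ is the eigenvalue $h$ for which there is a nontrivial solution $\mathrm{Es}_\nu^{m+1}(z,k^2)$ with $w(-K)=w(K)=0$ having exactly $m$ zeros in $(-K,K)$. They are normalised by $\int_{-K}^K\operatorname{dn}(z,k)\,\mathrm{Ec}_\nu^m(z,k^2)^2dz=\int_{-K}^K\operatorname{dn}(z,k)\,\mathrm{Es}_\nu^{m+1}(z,k^2)^2dz=\frac{\pi}{2}$ together with $\mathrm{Ec}_\nu^m(K,k^2)>0$ and $\frac{d}{dz}\mathrm{Es}_\nu^{m+1}(z,k^2)\big|_{z=K}<0$. $D_m(t)=e^{-t^2/4}\mathrm{He}_m(t)$ is the parabolic cylinder function, a solution of $y''=(\tfrac14t^2-m-\tfrac12)y$. **Coefficients $A_s,B_s$.** Put $\tilde t=\tfrac14t^2-m-\tfrac12$.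 Set $A_0(t)=1$, $B_0(t)=0$, and $A_{-1}=B_{-1}=0$. For $s\ge1$, the even polynomial $A_s(t)$ with $A_s(0)=0$, the odd polynomial $B_s(t)$ and the constant $\mu_s$ are determined recursively by the two identities in $t$ $$2A_s'+B_s''-\tfrac{(1+k^2)t}{2}\big(2tA_{s-1}'+A_{s-1}+tB_{s-1}''+B_{s-1}'+\tilde t\,tB_{s-1}\big)+\tfrac{k^2t^3}{4}\big(2tA_{s-2}'+2A_{s-2}+tB_{s-2}''+2B_{s-2}'+\tilde t\,tB_{s-2}\big)+\sum_{j=1}^s\mu_jB_{s-j}=0,$$ $$A_s''+2\tilde t B_s'+\tfrac t2B_s+\sum_{j=1}^s\mu_jA_{s-j}-\tfrac{(1+k^2)t}{2}\Big(tA_{s-1}''+A_{s-1}'+\tfrac{t^2}{2}B_{s-1}+\tilde t\,(tA_{s-1}+2tB_{s-1}'+B_{s-1})\Big)+\tfrac{k^2t^3}{4}\Big(tA_{s-2}''+2A_{s-2}'+\tfrac{t^2}{2}B_{s-2}+\tilde t\,(tA_{s-2}+2tB_{s-2}'+2B_{s-2})\Big)=0.$$ **Coefficients $P_s,Q_s$.** These are determined recursively by $A_s(t)=\sum_{j=0}^s\binom{1/2}{j}\left(-\tfrac{t^2}{2}\right)^jP_{s-j}(t)$ and $B_s(t)=\sum_{j=0}^s\binom{1/2}{j}\left(-\tfrac{t^2}{2}\right)^jQ_{s-j}(t)$. **Constants $\eta_s$.** For $s\ge1$, $$\eta_s=\frac{1}{m!\sqrt{2\pi}}\int_{-\infty}^\infty\sum_{j=0}^s\binom{-1/2}{j}\left(-\tfrac{t^2}{2}\right)^j\sum_{i=0}^{s-j}\Big(A_iA_{s-j-i}D_m^2+2A_iB_{s-j-i}D_mD_m'+B_iB_{s-j-i}(D_m')^2\Big)dt,$$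 all functions being evaluated at $t$. *)

theory Defs
  imports "HOL-Analysis.Analysis" "HOL-Library.Landau_Symbols"
    "HOL-Computational_Algebra.Polynomial"
begin

subsection \<open>Jacobian elliptic functions of a real argument, with modulus \<open>k\<close>\<close>

definition elliptic_F :: "real \<Rightarrow> real \<Rightarrow> real" where
  "elliptic_F k \<phi> = (LBINT \<theta>=0..\<phi>. 1 / sqrt (1 - k^2 * (sin \<theta>)^2))"

definition elliptic_K :: "real \<Rightarrow> real" where
  "elliptic_K k = elliptic_F k (pi / 2)"

definition jacobi_am :: "real \<Rightarrow> real \<Rightarrow> real" where
  "jacobi_am k z = (THE \<phi>. elliptic_F k \<phi> = z)"

definition jacobi_sn :: "real \<Rightarrow> real \<Rightarrow> real" where
  "jacobi_sn k z = sin (jacobi_am k z)"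

definition jacobi_cn :: "real \<Rightarrow> real \<Rightarrow> real" where
  "jacobi_cn k z = cos (jacobi_am k z)"

text \<open>The positive root is the right one: on the real line \<open>dn > 0\<close> for \<open>0 < k < 1\<close>.\<close>

definition jacobi_dn :: "real \<Rightarrow> real \<Rightarrow> real" where
  "jacobi_dn k z = sqrt (1 - k^2 * (jacobi_sn k z)^2)"


subsection \<open>Lam\'e functions\<close>

definition lame_solution :: "real \<Rightarrow> real \<Rightarrow> real \<Rightarrow> (real \<Rightarrow> real) \<Rightarrow> bool" where
  "lame_solution k \<nu> h w \<longleftrightarrow>
     (\<forall>z. (w has_real_derivative deriv w z) (at z)) \<and>
     (\<forall>z. (deriv w has_real_derivative
            - (h - \<nu> * (\<nu> + 1) * k^2 * (jacobi_sn k z)^2) * w z) (at z))"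

definition lame_zeros :: "real \<Rightarrow> (real \<Rightarrow> real) \<Rightarrow> real set" where
  "lame_zeros k w = {z. - elliptic_K k < z \<and> z < elliptic_K k \<and> w z = 0}"

definition Ec_eigenfunction :: "real \<Rightarrow> real \<Rightarrow> nat \<Rightarrow> real \<Rightarrow> (real \<Rightarrow> real) \<Rightarrow> bool" where
  "Ec_eigenfunction k \<nu> m h w \<longleftrightarrow>
     lame_solution k \<nu> h w \<and> (\<exists>z. w z \<noteq> 0) \<and>
     deriv w (- elliptic_K k) = 0 \<and> deriv w (elliptic_K k) = 0 \<and>
     finite (lame_zeros k w) \<and> card (lame_zeros k w) = m"

text \<open>The index \<open>l\<close> below is \<open>m + 1\<close> when there are \<open>m\<close> interior zeros.\<close>

definition Es_eigenfunction :: "real \<Rightarrow> real \<Rightarrow> nat \<Rightarrow> real \<Rightarrow> (real \<Rightarrow> real) \<Rightarrow> bool" where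
  "Es_eigenfunction k \<nu> l h w \<longleftrightarrow>
     lame_solution k \<nu> h w \<and> (\<exists>z. w z \<noteq> 0) \<and>
     w (- elliptic_K k) = 0 \<and> w (elliptic_K k) = 0 \<and>
     finite (lame_zeros k w) \<and> card (lame_zeros k w) + 1 = l"

definition lame_a :: "real \<Rightarrow> real \<Rightarrow> nat \<Rightarrow> real" where
  "lame_a k \<nu> m = (THE h. \<exists>w. Ec_eigenfunction k \<nu> m h w)"

definition lame_b :: "real \<Rightarrow> real \<Rightarrow> nat \<Rightarrow> real" where
  "lame_b k \<nu> l = (THE h. \<exists>w. Es_eigenfunction k \<nu> l h w)"

definition lame_normalised :: "real \<Rightarrow> (real \<Rightarrow> real) \<Rightarrow> bool" where
  "lame_normalised k w \<longleftrightarrow>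
     (LBINT z=- elliptic_K k..elliptic_K k. jacobi_dn k z * (w z)^2) = pi / 2"

definition lame_Ec :: "real \<Rightarrow> real \<Rightarrow> nat \<Rightarrow> real \<Rightarrow> real" where
  "lame_Ec k \<nu> m = (THE w. Ec_eigenfunction k \<nu> m (lame_a k \<nu> m) w \<and>
     lame_normalised k w \<and> w (elliptic_K k) > 0)"

definition lame_Es :: "real \<Rightarrow> real \<Rightarrow> nat \<Rightarrow> real \<Rightarrow> real" where
  "lame_Es k \<nu> l = (THE w. Es_eigenfunction k \<nu> l (lame_b k \<nu> l) w \<and>
     lame_normalised k w \<and> deriv w (elliptic_K k) < 0)"


subsection \<open>Parabolic cylinder functions \<open>D_m\<close>\<close>

fun hermite_He :: "nat \<Rightarrow> real \<Rightarrow> real" where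
  "hermite_He 0 t = 1"
| "hermite_He (Suc 0) t = t"
| "hermite_He (Suc (Suc n)) t = t * hermite_He (Suc n) t - real (Suc n) * hermite_He n t"

definition parabolic_D :: "nat \<Rightarrow> real \<Rightarrow> real" where
  "parabolic_D m t = exp (- (t^2) / 4) * hermite_He m t"


subsection \<open>The coefficients\<close>

definition even_poly :: "real poly \<Rightarrow> bool" where
  "even_poly p \<longleftrightarrow> (\<forall>t. poly p (- t) = poly p t)"

definition odd_poly :: "real poly \<Rightarrow> bool" where
  "odd_poly p \<longleftrightarrow> (\<forall>t. poly p (- t) = - poly p t)"

text \<open>Coefficients with negative index vanish.\<close>

definition lagged :: "(nat \<Rightarrow> real poly) \<Rightarrow> nat \<Rightarrow> nat \<Rightarrow> real poly" where
  "lagged A s i = (if i \<le> s then A (s - i) else 0)"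

text \<open>The two identities in \<open>t\<close>, as identities of polynomials; \<open>T\<close> is the indeterminate \<open>t\<close>
  and \<open>q\<close> is \<open>t^2/4 - m - 1/2\<close>.\<close>

definition coeff_identity1 ::
  "real \<Rightarrow> nat \<Rightarrow> (nat \<Rightarrow> real poly) \<Rightarrow> (nat \<Rightarrow> real poly) \<Rightarrow> (nat \<Rightarrow> real) \<Rightarrow> nat \<Rightarrow> bool" where
  "coeff_identity1 k m A B \<mu> s \<longleftrightarrow>
    (let T = [:0, 1:]; q = [:- real m - 1/2, 0, 1/4:];
         A1 = lagged A s 1; A2 = lagged A s 2; B1 = lagged B s 1; B2 = lagged B s 2
     in 2 * pderiv (A s) + pderiv (pderiv (B s))
        - smult ((1 + k^2) / 2) (T * (2 * T * pderiv A1 + A1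
            + T * pderiv (pderiv B1) + pderiv B1 + q * T * B1))
        + smult (k^2 / 4) (T^3 * (2 * T * pderiv A2 + 2 * A2
            + T * pderiv (pderiv B2) + 2 * pderiv B2 + q * T * B2))
        + (\<Sum>j=1..s. smult (\<mu> j) (B (s - j))) = 0)"

definition coeff_identity2 ::
  "real \<Rightarrow> nat \<Rightarrow> (nat \<Rightarrow> real poly) \<Rightarrow> (nat \<Rightarrow> real poly) \<Rightarrow> (nat \<Rightarrow> real) \<Rightarrow> nat \<Rightarrow> bool" where
  "coeff_identity2 k m A B \<mu> s \<longleftrightarrow>
    (let T = [:0, 1:]; q = [:- real m - 1/2, 0, 1/4:];
         A1 = lagged A s 1; A2 = lagged A s 2; B1 = lagged B s 1; B2 = lagged B s 2
     in pderiv (pderiv (A s)) + 2 * q * pderiv (B s) + smult (1/2) (T * B s)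
        + (\<Sum>j=1..s. smult (\<mu> j) (A (s - j)))
        - smult ((1 + k^2) / 2) (T * (T * pderiv (pderiv A1) + pderiv A1
            + smult (1/2) (T^2 * B1) + q * (T * A1 + 2 * T * pderiv B1 + B1)))
        + smult (k^2 / 4) (T^3 * (T * pderiv (pderiv A2) + 2 * pderiv A2
            + smult (1/2) (T^2 * B2) + q * (T * A2 + 2 * T * pderiv B2 + 2 * B2))) = 0)"

definition AB_recursion ::
  "real \<Rightarrow> nat \<Rightarrow> (nat \<Rightarrow> real poly) \<Rightarrow> (nat \<Rightarrow> real poly) \<Rightarrow> (nat \<Rightarrow> real) \<Rightarrow> bool" where
  "AB_recursion k m A B \<mu> \<longleftrightarrow>
     A 0 = 1 \<and> B 0 = 0 \<and>
     (\<forall>s\<ge>1. even_poly (A s) \<and> poly (A s) 0 = 0 \<and> odd_poly (B s) \<and>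
        coeff_identity1 k m A B \<mu> s \<and> coeff_identity2 k m A B \<mu> s)"

text \<open>Only the pair \<open>(A, B)\<close> is described uniquely here; \<open>\<mu> 0\<close> is never used.\<close>

definition coeff_AB :: "real \<Rightarrow> nat \<Rightarrow> (nat \<Rightarrow> real poly) \<times> (nat \<Rightarrow> real poly)" where
  "coeff_AB k m = (THE (A, B). \<exists>\<mu>. AB_recursion k m A B \<mu>)"

definition coeff_A :: "real \<Rightarrow> nat \<Rightarrow> nat \<Rightarrow> real poly" where
  "coeff_A k m = fst (coeff_AB k m)"

definition coeff_B :: "real \<Rightarrow> nat \<Rightarrow> nat \<Rightarrow> real poly" where
  "coeff_B k m = snd (coeff_AB k m)"

text \<open>\<open>P = cn_quotient A\<close> is the solution of
  \<open>A s = (\<Sum>j\<le>s. (1/2 gchoose j) * (- t^2/2)^j * P (s - j))\<close>.\<close>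

fun cn_quotient :: "(nat \<Rightarrow> real poly) \<Rightarrow> nat \<Rightarrow> real poly" where
  "cn_quotient A s = A s -
     (\<Sum>j=1..s. smult ((1/2) gchoose j) ([:0, 0, - 1/2:] ^ j * cn_quotient A (s - j)))"

declare cn_quotient.simps [simp del]

lemma cn_quotient_recursion:
  "A s = (\<Sum>j=0..s. smult ((1/2) gchoose j) ([:0, 0, - 1/2:] ^ j * cn_quotient A (s - j)))"
  by (subst sum.atLeast_Suc_atMost) (simp_all add: cn_quotient.simps[of A s])

definition coeff_P :: "real \<Rightarrow> nat \<Rightarrow> nat \<Rightarrow> real poly" where
  "coeff_P k m = cn_quotient (coeff_A k m)"

definition coeff_Q :: "real \<Rightarrow> nat \<Rightarrow> nat \<Rightarrow> real poly" where
  "coeff_Q k m = cn_quotient (coeff_B k m)"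

definition coeff_eta :: "real \<Rightarrow> nat \<Rightarrow> nat \<Rightarrow> real" where
  "coeff_eta k m s = 1 / (fact m * sqrt (2 * pi)) *
     (\<integral>t. (\<Sum>j=0..s. ((- 1/2) gchoose j) * (- (t^2) / 2)^j *
        (\<Sum>i=0..s - j.
           poly (coeff_A k m i) t * poly (coeff_A k m (s - j - i)) t * (parabolic_D m t)^2
         + 2 * poly (coeff_A k m i) t * poly (coeff_B k m (s - j - i)) t
             * parabolic_D m t * deriv (parabolic_D m) t
         + poly (coeff_B k m i) t * poly (coeff_B k m (s - j - i)) t
             * (deriv (parabolic_D m) t)^2)) \<partial>lborel)"


subsection \<open>The large parameter and the asymptotic statements\<close>

definition lame_kappa :: "real \<Rightarrow> real \<Rightarrow> real" where
  "lame_kappa k \<nu> = k * sqrt (\<nu> * (\<nu> + 1))"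

definition lame_t :: "real \<Rightarrow> real \<Rightarrow> real \<Rightarrow> real" where
  "lame_t k \<nu> z = sqrt (2 * lame_kappa k \<nu>) * jacobi_sn k z"

text \<open>\<open>f \<nu> z = C \<nu> * (D\<^sub>m(t) \<Sum> a s / \<kappa>^s + D\<^sub>m'(t) \<Sum> b s / \<kappa>^s + O(\<kappa>^(-n-1)))\<close>, with sums over
  \<open>s \<le> n\<close>, as \<open>\<nu> \<rightarrow> \<infinity>\<close>, for each \<open>n \<ge> 1\<close> and \<open>t\<^sub>0 > 0\<close>
  uniformly in \<open>z \<in> (-K, K)\<close> with \<open>\<bar>t\<bar> \<le> t\<^sub>0\<close>. On \<open>(-K, K)\<close> the function \<open>sn\<close>
  is injective, so for large \<open>\<nu>\<close> the condition \<open>\<bar>t\<bar> \<le> t\<^sub>0\<close> confines \<open>z\<close> to a neighbourhood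
  of \<open>0\<close> of size \<open>O(\<kappa>^(-1/2))\<close>. The number \<open>E\<close> is the \<open>O\<close>-term.\<close>

definition local_expansion ::
  "real \<Rightarrow> nat \<Rightarrow> (real \<Rightarrow> real \<Rightarrow> real) \<Rightarrow> (real \<Rightarrow> real) \<Rightarrow> (nat \<Rightarrow> real poly) \<Rightarrow> (nat \<Rightarrow> real poly) \<Rightarrow> bool"
where
  "local_expansion k m f C a b \<longleftrightarrow>
    (\<forall>n\<ge>1. \<forall>t\<^sub>0>0. \<exists>M. \<forall>\<^sub>F \<nu> in at_top. \<forall>z.
       \<bar>z\<bar> < elliptic_K k \<and> \<bar>lame_t k \<nu> z\<bar> \<le> t\<^sub>0 \<longrightarrow>
       (\<exists>E. \<bar>E\<bar> \<le> M / lame_kappa k \<nu> ^ (n + 1) \<and>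
          f \<nu> z = C \<nu> *
            (parabolic_D m (lame_t k \<nu> z)
               * (\<Sum>s=0..n. poly (a s) (lame_t k \<nu> z) / lame_kappa k \<nu> ^ s)
             + deriv (parabolic_D m) (lame_t k \<nu> z)
               * (\<Sum>s=0..n. poly (b s) (lame_t k \<nu> z) / lame_kappa k \<nu> ^ s)
             + E)))"

text \<open>\<open>C \<nu> \<sim> (\<pi> \<kappa>)^(1/4) / sqrt (2 m!) * (1 + (\<Sum>s\<ge>1. \<eta> s / \<kappa>^s))^(-1/2)\<close>; the series need not
  converge, so truncations of every order are compared.\<close>

definition constant_expansion :: "real \<Rightarrow> nat \<Rightarrow> (real \<Rightarrow> real) \<Rightarrow> bool" where
  "constant_expansion k m C \<longleftrightarrow>
    (\<forall>N. (\<lambda>\<nu>. C \<nu> / ((pi * lame_kappa k \<nu>) powr (1/4) / sqrt (2 * fact m))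
              - (1 + (\<Sum>s=1..N. coeff_eta k m s / lame_kappa k \<nu> ^ s)) powr (- 1/2))
         \<in> O[at_top](\<lambda>\<nu>. 1 / lame_kappa k \<nu> ^ (N + 1)))"

end

(*
In the variable x = sqrt (2 kappa) z Lame's equation is v'' = (tau(x)^2 / 4 - theta) v with
tau(x) = sqrt (2 kappa) sn(z) close to x. The truncated formal series, evaluated at t = tau(x), is
an even or odd approximate solution with approximate eigenvalue theta_n and residual
O(kappa^(-n-1) exp (-|x|)). Shooting from 0 with theta slightly below or above theta_n, the
Wronskian with the approximate solution decides whether the exact solution goes up or down beyond
its last zero; by continuity some theta in between satisfies the Neumann, or the Dirichlet,
condition at K, and a maximum principle keeps that solution within O(kappa^(-n-1)) of the
approximate one on all of [-K, K]. It has m zeros because D_m has m simple zeros, so by Sturm's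
theorem it is the Lame function up to a scalar. The scalar comes from integrating the square of the
approximation; since the eta_s need not give a convergent series, C and S are built from a function
that Borel's lemma attaches to the formal series. Division by cn = sqrt (1 - t^2 / (2 kappa))
turns A, B into P, Q.
*)
theory Submission
  imports Defs "HOL-Probability.Sinc_Integral"
begin

section \<open>Jacobian elliptic functions on the real line\<close>

text \<open>\<open>lame_Ec\<close> and \<open>lame_Es\<close> are definite descriptions, and nothing
  about the eigenvalues is given in advance: eigenvalue and eigenfunction have to be constructed
  together and identified afterwards. Evaluating the formal series at t = tau(x) rather than at x
  pays twice. The potential is then exactly tau^2/4, so that the orders of the residual are those of
  the recursion; and tau' vanishes at the image of K, so the quasi-mode satisfies the Neumann
  condition exactly while its value there is smaller than any power of 1/\<kappa>. One quasi-mode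
  therefore serves both boundary problems, and C and S can be the same function. The obstacle is the
  length of the interval, which grows like sqrt \<kappa>: beyond the turning point the equation has
  an exponentially growing solution, so a Gronwall bound is useful only on a fixed [0, x0], and
  signs and convexity must do the work from x0 on. The weight in eta_s comes from dn dz = dt / (sqrt
  (2 \<kappa>) cn) with 1/cn = (1 - t^2/(2 \<kappa>))^(-1/2).\<close>

locale modulus =
  fixes k :: real
  assumes k0: "0 < k" and k1: "k < 1"
begin

lemma k2_less_1: "k^2 < 1" using k0 k1 by (simp add: power_less_one_iff)

lemma modulus_sin_le: "k^2 * (sin x)^2 \<le> k^2"
  using sin_squared_eq[of x] by (simp add: mult_left_le)

lemma modulus_sin_less_1: "k^2 * (sin x)^2 < 1"
  using modulus_sin_le[of x] k2_less_1 by linarith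

lemma elliptic_F_deriv: "(elliptic_F k has_real_derivative 1 / sqrt (1 - k^2 * (sin x)^2)) (at x)"
proof -
  let ?f = "\<lambda>\<theta>. 1 / sqrt (1 - k^2 * (sin \<theta>)^2)"
  let ?r = "\<bar>x\<bar> + 1"
  have cont: "continuous_on UNIV ?f"
    by (intro continuous_intros) (use modulus_sin_less_1 in \<open>auto simp: less_le\<close>)
  \<comment> \<open>The fundamental theorem is applied on a compact interval with \<open>x\<close>
    in its interior, so that the derivative within the interval is the full derivative.\<close>
  have "((\<lambda>u. LBINT y=0..u. ?f y) has_vector_derivative ?f x) (at x within {-?r..?r})"
    using interval_integral_FTC2[of "-?r" 0 ?r ?f x] continuous_on_subset[OF cont] by (auto simp: zero_ereal_def)
  then have "(elliptic_F k has_real_derivative ?f x) (at x within {-?r..?r})"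
    unfolding has_real_derivative_iff_has_vector_derivative elliptic_F_def[abs_def] by simp
  moreover have "at x within {-?r..?r} = at x" by (rule at_within_interior) auto
  ultimately show ?thesis by metis
qed

lemma elliptic_F_0 [simp]: "elliptic_F k 0 = 0"
  by (simp add: elliptic_F_def zero_ereal_def)

lemma elliptic_F_integrand_bounds:
  "1 \<le> 1 / sqrt (1 - k^2 * (sin x)^2)" "1 / sqrt (1 - k^2 * (sin x)^2) \<le> 1 / sqrt (1 - k^2)"
proof -
  have "0 < sqrt (1 - k^2 * (sin x)^2)" "sqrt (1 - k^2 * (sin x)^2) \<le> 1"
    using modulus_sin_less_1[of x] by auto
  then show "1 \<le> 1 / sqrt (1 - k^2 * (sin x)^2)" by simp
  show "1 / sqrt (1 - k^2 * (sin x)^2) \<le> 1 / sqrt (1 - k^2)"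
    using modulus_sin_le[of x] modulus_sin_less_1[of x] k2_less_1 by (intro divide_left_mono) auto
qed

lemma elliptic_F_strict_mono: "x < y \<Longrightarrow> elliptic_F k x < elliptic_F k y"
  by (rule DERIV_pos_imp_increasing)
     (use elliptic_F_deriv elliptic_F_integrand_bounds(1) in \<open>auto intro: less_le_trans[OF zero_less_one]\<close>)

lemma elliptic_F_less_iff [simp]: "elliptic_F k x < elliptic_F k y \<longleftrightarrow> x < y"
  using elliptic_F_strict_mono by (metis linorder_less_linear order_less_asym)

lemma elliptic_F_eq_iff [simp]: "elliptic_F k x = elliptic_F k y \<longleftrightarrow> x = y"
  using elliptic_F_strict_mono by (metis linorder_less_linear order_less_irrefl)

lemma elliptic_F_odd: "elliptic_F k (- x) = - elliptic_F k x"
proof -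
  have "((\<lambda>x. elliptic_F k (- x)) has_real_derivative - (1 / sqrt (1 - k^2 * (sin (- x))^2))) (at x)" for x
    using DERIV_mirror[of "elliptic_F k" "1 / sqrt (1 - k^2 * (sin (-x))^2)" x] elliptic_F_deriv[of "-x"] by simp
  from DERIV_add[OF this elliptic_F_deriv]
  have "((\<lambda>x. elliptic_F k (- x) + elliptic_F k x) has_real_derivative 0) (at x)" for x by simp
  then have "elliptic_F k (- x) + elliptic_F k x = elliptic_F k (- 0) + elliptic_F k 0"
    using DERIV_isconst_all[of "\<lambda>x. elliptic_F k (- x) + elliptic_F k x" x 0] by blast
  then show ?thesis by simp
qed

text \<open>The integrand lies between 1 and 1 / sqrt (1 - k^2). The lower bound makes
  \<open>elliptic_F k\<close> onto and gives |sn z| \<le> |z|; the upper one bounds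
  \<open>sn\<close> from below on [0, K].\<close>

lemma elliptic_F_bounds:
  assumes "0 \<le> x" shows "x \<le> elliptic_F k x" "elliptic_F k x \<le> x / sqrt (1 - k^2)"
proof -
  have d: "((\<lambda>x. x * c) has_real_derivative c) (at x)" for c x :: real by (auto intro!: derivative_eq_intros)
  have d1: "((\<lambda>x. elliptic_F k x - x) has_real_derivative 1 / sqrt (1 - k^2 * (sin x)^2) - 1) (at x)" for x
    by (rule DERIV_diff[OF elliptic_F_deriv DERIV_ident])
  have d2: "((\<lambda>x. x * (1 / sqrt (1 - k^2)) - elliptic_F k x) has_real_derivative
      1 / sqrt (1 - k^2) - 1 / sqrt (1 - k^2 * (sin x)^2)) (at x)" for x
    by (rule DERIV_diff[OF d elliptic_F_deriv])
  have "x \<le> elliptic_F k x"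
  proof -
    have "(\<lambda>x. elliptic_F k x - x) 0 \<le> (\<lambda>x. elliptic_F k x - x) x"
      by (rule DERIV_nonneg_imp_nondecreasing[OF assms])
         (use d1 elliptic_F_integrand_bounds in \<open>fastforce\<close>)
    then show ?thesis by simp
  qed
  then show "x \<le> elliptic_F k x" .
  have "(\<lambda>x. x * (1 / sqrt (1 - k^2)) - elliptic_F k x) 0 \<le> (\<lambda>x. x * (1 / sqrt (1 - k^2)) - elliptic_F k x) x"
    by (rule DERIV_nonneg_imp_nondecreasing[OF assms])
       (use d2 elliptic_F_integrand_bounds in \<open>fastforce\<close>)
  then show "elliptic_F k x \<le> x / sqrt (1 - k^2)" by simp
qed

lemma elliptic_F_surj: "\<exists>x. elliptic_F k x = z"
proof -
  have "\<exists>x\<ge>-\<bar>z\<bar>. x \<le> \<bar>z\<bar> \<and> elliptic_F k x = z"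
  proof (rule IVT)
    show "elliptic_F k (- \<bar>z\<bar>) \<le> z" using elliptic_F_bounds(1)[of "\<bar>z\<bar>"] by (simp add: elliptic_F_odd)
    show "z \<le> elliptic_F k \<bar>z\<bar>" using elliptic_F_bounds(1)[of "\<bar>z\<bar>"] by simp
  qed (use elliptic_F_deriv DERIV_isCont in auto)
  then show ?thesis by blast
qed

text \<open>Surjectivity and injectivity make the definite description in \<open>jacobi_am\<close>
  meaningful; from here on \<open>jacobi_am k\<close> is the inverse of
  \<open>elliptic_F k\<close>.\<close>

lemma elliptic_F_am [simp]: "elliptic_F k (jacobi_am k z) = z"
  unfolding jacobi_am_def
proof (rule theI')
  show "\<exists>!x. elliptic_F k x = z" using elliptic_F_surj[of z] by (metis elliptic_F_eq_iff)
qed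

lemma am_elliptic_F [simp]: "jacobi_am k (elliptic_F k x) = x"
  by (metis elliptic_F_am elliptic_F_eq_iff)

lemma am_odd: "jacobi_am k (- z) = - jacobi_am k z"
  by (metis am_elliptic_F elliptic_F_am elliptic_F_odd)

lemma am_less_iff [simp]: "jacobi_am k x < jacobi_am k y \<longleftrightarrow> x < y"
  by (metis elliptic_F_am elliptic_F_less_iff)

lemma am_le_iff [simp]: "jacobi_am k x \<le> jacobi_am k y \<longleftrightarrow> x \<le> y"
  by (simp add: linorder_not_less[symmetric])

lemma am_0 [simp]: "jacobi_am k 0 = 0" using am_elliptic_F[of 0] by simp

lemma am_K [simp]: "jacobi_am k (elliptic_K k) = pi / 2" by (simp add: elliptic_K_def)

lemma K_pos: "elliptic_K k > 0" 
  unfolding elliptic_K_def using elliptic_F_strict_mono[of 0 "pi/2"] by simp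

lemma dn_pos: "jacobi_dn k z > 0"
  using modulus_sin_less_1 by (simp add: jacobi_dn_def jacobi_sn_def)

lemma dn_le_1: "jacobi_dn k z \<le> 1" by (simp add: jacobi_dn_def)

lemma dn_squared: "(jacobi_dn k z)^2 = 1 - k^2 * (jacobi_sn k z)^2"
  using modulus_sin_less_1 by (simp add: jacobi_dn_def jacobi_sn_def less_imp_le)

lemma cn_squared: "(jacobi_cn k z)^2 = 1 - (jacobi_sn k z)^2"
  by (simp add: jacobi_sn_def jacobi_cn_def cos_squared_eq)

lemma am_isCont: "isCont (jacobi_am k) z"
proof -
  have "isCont (jacobi_am k) (elliptic_F k (jacobi_am k z))"
    by (rule isCont_inverse_function[of 1]) (auto intro: DERIV_isCont[OF elliptic_F_deriv])
  then show ?thesis by simp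
qed

lemma am_deriv: "(jacobi_am k has_real_derivative jacobi_dn k z) (at z)"
proof -
  have "(jacobi_am k has_real_derivative inverse (1 / sqrt (1 - k^2 * (sin (jacobi_am k z))^2))) (at z)"
    by (rule DERIV_inverse_function[where f = "elliptic_F k" and a = "z - 1" and b = "z + 1"])
       (use elliptic_F_deriv modulus_sin_less_1 am_isCont in \<open>auto simp: less_le\<close>)
  then show ?thesis by (simp add: jacobi_dn_def jacobi_sn_def)
qed

lemma sn_deriv: "(jacobi_sn k has_real_derivative jacobi_cn k z * jacobi_dn k z) (at z)"
  unfolding jacobi_sn_def[abs_def] jacobi_cn_def by (rule derivative_eq_intros am_deriv refl)+

lemma cn_deriv: "(jacobi_cn k has_real_derivative - jacobi_sn k z * jacobi_dn k z) (at z)"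
  unfolding jacobi_sn_def jacobi_cn_def[abs_def] by (rule derivative_eq_intros am_deriv refl)+

lemma dn_deriv: "(jacobi_dn k has_real_derivative - (k^2) * jacobi_sn k z * jacobi_cn k z) (at z)"
proof -
  have pos: "0 < 1 - k^2 * (jacobi_sn k z)^2" using modulus_sin_less_1 by (simp add: jacobi_sn_def)
  have g: "((\<lambda>z. 1 - k^2 * (jacobi_sn k z)^2) has_real_derivative
      - (k^2 * (2 * jacobi_sn k z * (jacobi_cn k z * jacobi_dn k z)))) (at z)"
    by (rule derivative_eq_intros sn_deriv refl)+ (simp add: mult_ac)
  have e: "jacobi_dn k = (\<lambda>z. sqrt (1 - k^2 * (jacobi_sn k z)^2))" by (rule ext) (simp add: jacobi_dn_def)
  have "(jacobi_dn k has_real_derivative inverse (jacobi_dn k z) / 2 *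
      - (k^2 * (2 * jacobi_sn k z * (jacobi_cn k z * jacobi_dn k z)))) (at z)"
    using DERIV_chain2[OF DERIV_real_sqrt[OF pos] g] by (simp only: e)
  then show ?thesis
    by (rule DERIV_cong) (use dn_pos[of z] in \<open>simp add: field_simps\<close>)
qed

text \<open>This is the second derivative of \<open>sn\<close>; rescaled, it supplies the first
  order term of Lame's equation in the variable t.\<close>

lemma sn_cn_dn_deriv:
  "((\<lambda>z. jacobi_cn k z * jacobi_dn k z) has_real_derivative
     - (1 + k^2) * jacobi_sn k z + 2 * k^2 * (jacobi_sn k z)^3) (at z)"
proof (rule DERIV_cong[OF DERIV_mult[OF cn_deriv dn_deriv]])
  show "(- jacobi_sn k z * jacobi_dn k z) * jacobi_dn k z + (- (k^2) * jacobi_sn k z * jacobi_cn k z) * jacobi_cn k z =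
     - (1 + k^2) * jacobi_sn k z + 2 * k^2 * (jacobi_sn k z)^3"
  proof -
    have c: "jacobi_cn k z * jacobi_cn k z = 1 - jacobi_sn k z * jacobi_sn k z"
      and d: "jacobi_dn k z * jacobi_dn k z = 1 - k^2 * (jacobi_sn k z * jacobi_sn k z)"
      using cn_squared[of z] dn_squared[of z] by (simp_all add: power2_eq_square)
    show ?thesis unfolding mult.assoc c d by (simp add: algebra_simps power3_eq_cube power2_eq_square)
  qed
qed

lemma sn_0 [simp]: "jacobi_sn k 0 = 0" and cn_0 [simp]: "jacobi_cn k 0 = 1" and dn_0 [simp]: "jacobi_dn k 0 = 1"
  by (simp_all add: jacobi_sn_def jacobi_cn_def jacobi_dn_def)

lemma sn_K [simp]: "jacobi_sn k (elliptic_K k) = 1" and cn_K [simp]: "jacobi_cn k (elliptic_K k) = 0"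
  by (simp_all add: jacobi_sn_def jacobi_cn_def)

lemma sn_odd: "jacobi_sn k (- z) = - jacobi_sn k z" and cn_even: "jacobi_cn k (- z) = jacobi_cn k z"
  and dn_even: "jacobi_dn k (- z) = jacobi_dn k z"
  by (simp_all add: jacobi_sn_def jacobi_cn_def jacobi_dn_def am_odd)

lemma cn_pos: assumes "\<bar>z\<bar> < elliptic_K k" shows "jacobi_cn k z > 0"
proof -
  have "jacobi_am k (- elliptic_K k) < jacobi_am k z" "jacobi_am k z < jacobi_am k (elliptic_K k)"
    using assms by (auto simp del: am_K)
  then show ?thesis unfolding jacobi_cn_def by (intro cos_gt_zero_pi) (auto simp: am_odd)
qed

lemma cn_nonneg: assumes "\<bar>z\<bar> \<le> elliptic_K k" shows "jacobi_cn k z \<ge> 0"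
  using cn_pos[of z] assms cn_K by (metis abs_if cn_even less_eq_real_def minus_minus order_refl)

lemma abs_sn_le_1: "\<bar>jacobi_sn k z\<bar> \<le> 1" by (simp add: jacobi_sn_def)

text \<open>For z \<ge> 0 and a = am z one has |sin a| \<le> a and a \<le> F(a) = z; oddness gives
  the rest.\<close>

lemma abs_sn_le: "\<bar>jacobi_sn k z\<bar> \<le> \<bar>z\<bar>"
proof -
  have *: "\<bar>jacobi_sn k z\<bar> \<le> z" if "z \<ge> 0" for z
  proof -
    have "jacobi_am k z \<ge> 0" using that am_le_iff[of 0 z] by simp
    then have "\<bar>jacobi_sn k z\<bar> \<le> jacobi_am k z" unfolding jacobi_sn_def using abs_sin_le_one by (metis abs_of_nonneg abs_sin_x_le_abs_x)
    also have "\<dots> \<le> z" using elliptic_F_bounds(1)[of "jacobi_am k z"] \<open>jacobi_am k z \<ge> 0\<close> by simp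
    finally show ?thesis .
  qed
  show ?thesis using *[of z] *[of "-z"] by (cases "z \<ge> 0") (auto simp: sn_odd)
qed

text \<open>A crude slope suffices. Up to pi/3 the derivative, the cosine, is at least 1/2; beyond
  it sin x is at least 1/2, while x/4 is at most pi/8.\<close>

lemma sin_ge_quarter: assumes "0 \<le> x" "x \<le> pi / 2" shows "x / 4 \<le> sin (x::real)"
proof (cases "x \<le> pi / 3")
  case True
  have "(\<lambda>x. sin x - x / 4) 0 \<le> (\<lambda>x. sin x - x / 4) x"
  proof (rule DERIV_nonneg_imp_nondecreasing[OF assms(1)])
    fix y assume y: "0 \<le> y" "y \<le> x"
    have "cos (pi / 3) \<le> cos y" by (rule cos_monotone_0_pi_le) (use y True in auto)
    then show "\<exists>d. ((\<lambda>x. sin x - x / 4) has_real_derivative d) (at y) \<and> 0 \<le> d"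
      by (intro exI[of _ "cos y - 1/4"]) (auto intro!: derivative_eq_intros simp: cos_60)
  qed
  then show ?thesis by simp
next
  case False
  have "sin (pi / 6) \<le> sin x" by (rule sin_monotone_2pi_le) (use False assms in auto)
  then show ?thesis using assms pi_less_4 by (simp add: sin_30)
qed

text \<open>The slope of a line below \<open>sn\<close> on [0, K]: sqrt (1 - k^2) comes from F(x)
  \<le> x / sqrt (1 - k^2), the factor 1/4 from the bound on the sine. It converts decay in t into
  decay in z.\<close>

definition sn_slope :: real where "sn_slope = sqrt (1 - k^2) / 4"

lemma sn_slope_pos: "sn_slope > 0" using k2_less_1 by (simp add: sn_slope_def)

lemma sn_lower: assumes "0 \<le> z" "z \<le> elliptic_K k" shows "sn_slope * z \<le> jacobi_sn k z"
proof -
  have am: "0 \<le> jacobi_am k z" "jacobi_am k z \<le> pi / 2" using assms am_le_iff[of 0 z] am_le_iff[of z "elliptic_K k"] by simp_all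
  have "z \<le> jacobi_am k z / sqrt (1 - k^2)" using elliptic_F_bounds(2)[OF am(1)] by simp
  then have "sqrt (1 - k^2) * z \<le> jacobi_am k z" using k2_less_1 by (simp add: field_simps)
  then show ?thesis using sin_ge_quarter[OF am] by (simp add: sn_slope_def jacobi_sn_def)
qed

text \<open>On this interval cn is nonnegative and k < 1 gives cn \<le> dn, hence cn^2 is a lower
  bound of the product.\<close>

lemma cn_dn_bounds:
  assumes "\<bar>z\<bar> \<le> elliptic_K k"
  shows "1 - (jacobi_sn k z)^2 \<le> jacobi_cn k z * jacobi_dn k z" "jacobi_cn k z * jacobi_dn k z \<le> 1"
    "0 \<le> jacobi_cn k z * jacobi_dn k z"
proof -
  have c: "0 \<le> jacobi_cn k z" "jacobi_cn k z \<le> 1" using cn_nonneg[OF assms] by (auto simp: jacobi_cn_def)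
  have "k^2 * (jacobi_sn k z)^2 \<le> 1 * (jacobi_sn k z)^2" using k2_less_1 by (intro mult_right_mono) auto
  then have "(jacobi_cn k z)^2 \<le> (jacobi_dn k z)^2" unfolding cn_squared dn_squared by simp
  then have "jacobi_cn k z \<le> jacobi_dn k z" using dn_pos[of z] by (simp add: power2_le_iff_abs_le)
  then have "jacobi_cn k z * jacobi_cn k z \<le> jacobi_cn k z * jacobi_dn k z" using c by (intro mult_left_mono) auto
  then show "1 - (jacobi_sn k z)^2 \<le> jacobi_cn k z * jacobi_dn k z" using cn_squared[of z] by (simp add: power2_eq_square)
  show "0 \<le> jacobi_cn k z * jacobi_dn k z" using c dn_pos[of z] by simp
  show "jacobi_cn k z * jacobi_dn k z \<le> 1" using c dn_pos[of z] dn_le_1[of z] by (simp add: mult_le_one)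
qed

end

section \<open>Second order linear differential equations\<close>

text \<open>Stands in for the comparison of two integrals: an inequality between integrands is
  passed on to the increments of antiderivatives, without any question of integrability.\<close>

lemma increment_le_of_deriv_le:
  fixes F G :: "real \<Rightarrow> real"
  assumes "a \<le> b"
    and "\<And>x. a \<le> x \<Longrightarrow> x \<le> b \<Longrightarrow> (F has_real_derivative F' x) (at x)"
    and "\<And>x. a \<le> x \<Longrightarrow> x \<le> b \<Longrightarrow> (G has_real_derivative G' x) (at x)"
    and "\<And>x. a \<le> x \<Longrightarrow> x \<le> b \<Longrightarrow> F' x \<le> G' x"
  shows "F b - F a \<le> G b - G a"
proof -
  have "(\<lambda>x. G x - F x) a \<le> (\<lambda>x. G x - F x) b"
  proof (rule DERIV_nonneg_imp_nondecreasing[OF assms(1)])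
    fix x assume x: "a \<le> x" "x \<le> b"
    have "((\<lambda>x. G x - F x) has_real_derivative (G' x - F' x)) (at x)"
      by (rule DERIV_diff) (use assms x in auto)
    then show "\<exists>y. ((\<lambda>x. G x - F x) has_real_derivative y) (at x) \<and> 0 \<le> y"
      using assms(4)[OF x] by force
  qed
  then show ?thesis by simp
qed

lemma antiderivative_real:
  fixes f :: "real \<Rightarrow> real"
  assumes "\<And>x. isCont f x"
  shows "\<exists>F. F 0 = 0 \<and> (\<forall>x. (F has_real_derivative f x) (at x))"
proof -
  obtain F where F: "\<forall>x::real. -\<infinity> < ereal x \<longrightarrow> ereal x < \<infinity> \<longrightarrow> (F has_vector_derivative f x) (at x)"
    using einterval_antiderivative[of "-\<infinity>" \<infinity> f] assms by auto
  then have "\<And>x. (F has_real_derivative f x) (at x)"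
    by (simp add: has_real_derivative_iff_has_vector_derivative)
  then have "\<And>x. ((\<lambda>x. F x - F 0) has_real_derivative f x) (at x)"
    by (auto intro!: derivative_eq_intros)
  then show ?thesis by (intro exI[of _ "\<lambda>x. F x - F 0"]) auto
qed

text \<open>Half a step of Picard iteration: integration raises the power of |x| by one and divides
  by the new exponent. Negative x are reduced to positive ones by reflection.\<close>

lemma antiderivative_power_bound:
  fixes F f :: "real \<Rightarrow> real"
  assumes F: "F 0 = 0" "\<And>x. (F has_real_derivative f x) (at x)"
    and b: "\<And>y. \<bar>y\<bar> \<le> R \<Longrightarrow> \<bar>f y\<bar> \<le> c * \<bar>y\<bar> ^ n" and x: "\<bar>x\<bar> \<le> R"
  shows "\<bar>F x\<bar> \<le> c * \<bar>x\<bar> ^ Suc n / real (Suc n)"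
proof -
  have pos: "\<bar>G x\<bar> \<le> c * x ^ Suc n / real (Suc n)"
    if G: "G 0 = 0" "\<And>x. (G has_real_derivative g x) (at x)"
      "\<And>y. \<bar>y\<bar> \<le> R \<Longrightarrow> \<bar>g y\<bar> \<le> c * \<bar>y\<bar> ^ n" and x: "0 \<le> x" "x \<le> R" for G g :: "real \<Rightarrow> real" and x
  proof -
    have d: "((\<lambda>x. c * x ^ Suc n / real (Suc n)) has_real_derivative c * x ^ n) (at x)" for x
      using DERIV_cmult[OF DERIV_pow[of "Suc n" x], of "c / real (Suc n)"] by (simp del: of_nat_Suc)
    have d': "((\<lambda>x. - (c * x ^ Suc n / real (Suc n))) has_real_derivative - (c * x ^ n)) (at x)" for x
      by (rule DERIV_minus[OF d])
    have "G x - G 0 \<le> c * x ^ Suc n / real (Suc n) - c * 0 ^ Suc n / real (Suc n)"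
    proof (rule increment_le_of_deriv_le[OF x(1) G(2) d])
      fix y assume "0 \<le> y" "y \<le> x"
      then show "g y \<le> c * y ^ n" using G(3)[of y] x by auto
    qed
    moreover have "- (c * x ^ Suc n / real (Suc n)) - - (c * 0 ^ Suc n / real (Suc n)) \<le> G x - G 0"
    proof (rule increment_le_of_deriv_le[OF x(1) d' G(2)])
      fix y assume "0 \<le> y" "y \<le> x"
      then show "- (c * y ^ n) \<le> g y" using G(3)[of y] x by auto
    qed
    ultimately show ?thesis using G(1) by auto
  qed
  show ?thesis
  proof (cases "x \<ge> 0")
    case True
    then show ?thesis using pos[of F f x] F b x by auto
  next
    case False
    have "((\<lambda>x. F (-x)) has_real_derivative - f (-x)) (at x)" for x
      using DERIV_mirror[of F "f (-x)" x] F(2) by simp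
    moreover have "\<bar>- f (- y)\<bar> \<le> c * \<bar>y\<bar> ^ n" if "\<bar>y\<bar> \<le> R" for y using b[of "-y"] that by simp
    ultimately show ?thesis using pos[of "\<lambda>x. F (-x)" "\<lambda>x. - f (-x)" "-x"] F x False by auto
  qed
qed

text \<open>Picard iteration written as a series v = sum of \<open>f n\<close>, where
  \<open>f (Suc n)\<close> is the double antiderivative of q times \<open>f n\<close>. On [-R, R]
  the n-th term is at most A Q^n |x|^(2n) / (2n)!, so the series converges for every R and the
  solution is global.\<close>

lemma linear_ode_exists:
  fixes q :: "real \<Rightarrow> real"
  assumes q: "\<And>x. isCont q x"
  shows "\<exists>v v'. v 0 = a \<and> v' 0 = b \<and> (\<forall>x. (v has_real_derivative v' x) (at x)) \<and>
     (\<forall>x. (v' has_real_derivative q x * v x) (at x))"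
proof -
  define J where "J f = (SOME F. F 0 = 0 \<and> (\<forall>x. (F has_real_derivative f x) (at x)))" for f :: "real \<Rightarrow> real"
  have J: "J f 0 = 0 \<and> (\<forall>x. (J f has_real_derivative f x) (at x))" if "\<And>x. isCont f x" for f
    unfolding J_def by (rule someI_ex[OF antiderivative_real[OF that]])
  define f where "f = rec_nat (\<lambda>x. a + b * x) (\<lambda>_ f. J (J (\<lambda>x. q x * f x)))"
  \<comment> \<open>\<open>g\<close> and \<open>g'\<close> are the termwise first and second
    derivatives of \<open>f\<close>.\<close>
  define g where "g n = (case n of 0 \<Rightarrow> (\<lambda>x. b) | Suc n \<Rightarrow> J (\<lambda>x. q x * f n x))" for n
  define g' where "g' n = (case n of 0 \<Rightarrow> (\<lambda>x. 0) | Suc n \<Rightarrow> (\<lambda>x. q x * f n x))" for n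
  have f0: "f 0 = (\<lambda>x. a + b * x)" and fS: "f (Suc n) = J (g (Suc n))" for n
    by (simp_all add: f_def g_def)
  have cf: "isCont (f n) x" for n x
  proof (induction n arbitrary: x)
    case 0 then show ?case by (simp add: f0)
  next
    case (Suc n)
    have "isCont (\<lambda>x. q x * f n x) x" for x by (intro continuous_intros q Suc)
    then have "isCont (g (Suc n)) x" for x using J unfolding g_def by (auto intro: DERIV_isCont)
    then show ?case unfolding fS using J by (blast intro: DERIV_isCont)
  qed
  have cqf: "isCont (\<lambda>x. q x * f n x) x" for n x by (intro continuous_intros q cf)
  have dg: "(g n has_real_derivative g' n x) (at x)" for n x
    using J[OF cqf] by (cases n) (auto simp: g_def g'_def)
  have gz: "g (Suc n) 0 = 0" for n using J[OF cqf] by (simp add: g_def)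
  have cg: "isCont (g n) x" for n x using dg by (blast intro: DERIV_isCont)
  have df: "(f n has_real_derivative g n x) (at x)" for n x
  proof (cases n)
    case 0 then show ?thesis by (auto simp: f0 g_def intro!: derivative_eq_intros)
  next
    case (Suc m) then show ?thesis using J[OF cg] by (simp add: fS)
  qed
  have fz: "f (Suc n) 0 = 0" for n using J[OF cg] by (simp add: fS)
  have main: "\<exists>M. summable M \<and> (\<forall>n x. \<bar>x\<bar> \<le> R \<longrightarrow> \<bar>f n x\<bar> \<le> M n \<and> \<bar>g n x\<bar> \<le> M n \<and> \<bar>g' n x\<bar> \<le> M n)"
    if R: "R \<ge> 1" for R
  proof -
    have "bounded (q ` {-R..R})"
      by (intro compact_imp_bounded compact_continuous_image continuous_at_imp_continuous_on) (use q in auto)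
    then obtain Q0 where Q0: "\<And>x. \<bar>x\<bar> \<le> R \<Longrightarrow> \<bar>q x\<bar> \<le> Q0"
      by (force simp: bounded_iff abs_le_iff)
    define Q where "Q = max 1 Q0"
    have Q: "Q \<ge> 1" "\<And>x. \<bar>x\<bar> \<le> R \<Longrightarrow> \<bar>q x\<bar> \<le> Q" using Q0 by (force simp: Q_def)+
    define A where "A = \<bar>a\<bar> + \<bar>b\<bar> * R"
    have A0: "A \<ge> 0" using R by (simp add: A_def)
    \<comment> \<open>The bounds alternate: even powers of |x| for \<open>f n\<close>, odd powers
      for \<open>g (Suc n)\<close>, each obtained from the other by one integration.\<close>
    have bg_step: "\<bar>g (Suc n) x\<bar> \<le> A * Q ^ Suc n / fact (2*n+1) * \<bar>x\<bar>^(2*n+1)"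
      if "\<And>x. \<bar>x\<bar> \<le> R \<Longrightarrow> \<bar>f n x\<bar> \<le> A * Q ^ n / fact (2*n) * \<bar>x\<bar>^(2*n)" "\<bar>x\<bar> \<le> R" for n x
    proof -
      have "\<bar>g (Suc n) x\<bar> \<le> (A * Q ^ Suc n / fact (2*n)) * \<bar>x\<bar> ^ Suc (2*n) / real (Suc (2*n))"
      proof (rule antiderivative_power_bound[OF gz dg _ that(2)])
        fix y assume y: "\<bar>y\<bar> \<le> R"
        have "\<bar>g' (Suc n) y\<bar> \<le> Q * (A * Q ^ n / fact (2*n) * \<bar>y\<bar>^(2*n))"
          unfolding g'_def using mult_mono[OF Q(2)[OF y] that(1)[OF y]] Q by (simp add: abs_mult)
        then show "\<bar>g' (Suc n) y\<bar> \<le> A * Q ^ Suc n / fact (2*n) * \<bar>y\<bar> ^ (2*n)" by (simp add: mult_ac)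
      qed
      then show ?thesis by (simp add: mult_ac)
    qed
    have bf: "\<bar>f n x\<bar> \<le> A * Q ^ n / fact (2*n) * \<bar>x\<bar>^(2*n)" if "\<bar>x\<bar> \<le> R" for n x
      using that
    proof (induction n arbitrary: x)
      case 0
      have "\<bar>a + b * x\<bar> \<le> \<bar>a\<bar> + \<bar>b\<bar> * \<bar>x\<bar>" by (metis abs_mult abs_triangle_ineq)
      also have "\<dots> \<le> A" unfolding A_def using 0 by (simp add: mult_left_mono)
      finally show ?case by (simp add: f0)
    next
      case (Suc n)
      have "\<bar>f (Suc n) x\<bar> \<le> (A * Q ^ Suc n / fact (2*n+1)) * \<bar>x\<bar> ^ Suc (2*n+1) / real (Suc (2*n+1))"
        by (rule antiderivative_power_bound[OF fz df bg_step[OF Suc.IH] Suc.prems])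
      then show ?case by (simp add: mult_ac)
    qed
    \<comment> \<open>One majorant for all three sequences: the first summand covers index 0, the
      second bounds \<open>f n\<close>, the third, with index n - 1, bounds \<open>g n\<close> and
      \<open>g' n\<close>. At n = 0 the truncated difference merely adds a nonnegative term.\<close>
    define M where "M n = (if n = 0 then A + \<bar>b\<bar> else 0) + A * (Q * R^2)^n / fact n + Q * (Q*R^2) * (A * (Q*R^2)^(n - 1) / fact (n - 1))" for n
    have s: "summable (\<lambda>n. A * (Q * R^2)^n / fact n)"
      using summable_mult[OF summable_exp[of "Q * R^2"], of A] by (simp add: field_simps)
    have "summable (\<lambda>n. A * (Q*R^2)^(n - 1) / fact (n - 1))"
      by (subst summable_Suc_iff[symmetric]) (use s in simp)
    moreover have "summable (\<lambda>n::nat. if n = 0 then A + \<bar>b\<bar> else 0)" by (rule summable_finite[of "{0}"]) auto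
    ultimately have sM: "summable M"
      unfolding M_def by (intro summable_add s summable_mult)
    have e1: "A * Q ^ n / fact (2*n) * \<bar>x\<bar>^(2*n) \<le> A * (Q*R^2)^n / fact n" if "\<bar>x\<bar> \<le> R" for n x
    proof -
      have "A * Q ^ n / fact (2*n) * \<bar>x\<bar>^(2*n) \<le> A * Q ^ n / fact (2*n) * R^(2*n)"
        by (intro mult_left_mono power_mono that) (use A0 Q in auto)
      also have "\<dots> \<le> A * Q ^ n / fact n * R^(2*n)"
        by (intro mult_right_mono divide_left_mono fact_mono) (use A0 Q R in auto)
      also have "\<dots> = A * (Q*R^2)^n / fact n" by (simp only: power_mult_distrib power_mult) simp
      finally show ?thesis .
    qed
    have e2: "A * Q ^ Suc n / fact (2*n+1) * \<bar>x\<bar>^(2*n+1) \<le> Q * (Q*R^2) * (A * (Q*R^2)^n / fact n)" if "\<bar>x\<bar> \<le> R" for n x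
    proof -
      have "A * Q ^ Suc n / fact (2*n+1) * \<bar>x\<bar>^(2*n+1) \<le> A * Q ^ Suc n / fact n * R^(2*n+2)"
      proof (intro mult_mono divide_left_mono fact_mono)
        have "\<bar>x\<bar>^(2*n+1) \<le> R^(2*n+1)" by (rule power_mono[OF that abs_ge_zero])
        also have "\<dots> \<le> R^(2*n+2)" by (rule power_increasing) (use R in auto)
        finally show "\<bar>x\<bar>^(2*n+1) \<le> R^(2*n+2)" .
      qed (use A0 Q R in auto)
      also have "\<dots> = (Q * R^2) * (A * (Q*R^2)^n / fact n)"
        by (simp add: power_mult_distrib power_mult power_add power2_eq_square mult_ac)
      also have "\<dots> \<le> Q * ((Q * R^2) * (A * (Q*R^2)^n / fact n))"
        using Q A0 R by (intro mult_right_mono[of 1 Q, simplified mult_1]) auto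
      finally show ?thesis by (simp add: mult_ac)
    qed
    have nn: "0 \<le> A * (Q*R^2)^n / fact n" "0 \<le> Q * (Q*R^2) * (A * (Q*R^2)^n / fact n)" "0 \<le> Q * (Q*R^2)" for n
      using A0 Q R by auto
    have Mf: "\<bar>f n x\<bar> \<le> M n" if "\<bar>x\<bar> \<le> R" for n x
    proof -
      have "\<bar>f n x\<bar> \<le> A * (Q*R^2)^n / fact n" using bf[OF that] e1[OF that] by (rule order_trans)
      also have "\<dots> \<le> M n" unfolding M_def using nn(2)[of "n - 1"] A0 by auto
      finally show ?thesis .
    qed
    have Mg: "\<bar>g n x\<bar> \<le> M n" if "\<bar>x\<bar> \<le> R" for n x
    proof (cases n)
      case 0 then show ?thesis using nn(1)[of 0] nn(2)[of 0] A0 by (simp add: M_def g_def)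
    next
      case (Suc m)
      have "\<bar>g n x\<bar> \<le> Q * (Q*R^2) * (A * (Q*R^2)^m / fact m)"
        unfolding Suc using bg_step[where n=m, OF bf that] e2[OF that, of m] by auto
      also have "\<dots> \<le> M n" unfolding M_def using Suc nn(1)[of n] A0 by auto
      finally show ?thesis .
    qed
    have Mg': "\<bar>g' n x\<bar> \<le> M n" if "\<bar>x\<bar> \<le> R" for n x
    proof (cases n)
      case 0 then show ?thesis using nn(1)[of 0] nn(2)[of 0] A0 by (simp add: M_def g'_def)
    next
      case (Suc m)
      have "\<bar>g' n x\<bar> \<le> Q * (A * (Q*R^2)^m / fact m)"
        unfolding Suc g'_def
        using mult_mono[OF Q(2)[OF that] order_trans[OF bf[OF that, of m] e1[OF that, of m]]] Q(1) by (simp add: abs_mult)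
      also have "\<dots> \<le> Q * (Q*R^2) * (A * (Q*R^2)^m / fact m)"
      proof (intro mult_right_mono)
        have "1 \<le> Q*R^2" using Q R by (metis mult_mono one_le_power mult_1 zero_le_one order_trans)
        then show "Q \<le> Q * (Q*R^2)" using Q by simp
      qed (use nn in auto)
      also have "\<dots> \<le> M n" unfolding M_def using Suc nn(1)[of n] A0 by auto
      finally show ?thesis .
    qed
    show ?thesis using sM Mf Mg Mg' by blast
  qed
  define v where "v x = (\<Sum>n. f n x)" for x
  define v' where "v' x = (\<Sum>n. g n x)" for x
  have sf: "summable (\<lambda>n. f n x)" for x
  proof -
    obtain M where M: "summable M" "\<And>n y. \<bar>y\<bar> \<le> \<bar>x\<bar> + 1 \<Longrightarrow> \<bar>f n y\<bar> \<le> M n" using main[of "\<bar>x\<bar> + 1"] by auto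
    show ?thesis by (rule summable_comparison_test'[OF M(1), of 0]) (use M in auto)
  qed
  have dv: "(v has_real_derivative v' x) (at x) \<and> (v' has_real_derivative q x * v x) (at x)" for x
  proof -
    define R where "R = \<bar>x\<bar> + 1"
    obtain M where M: "summable M" "\<And>n y. \<bar>y\<bar> \<le> R \<Longrightarrow> \<bar>f n y\<bar> \<le> M n"
       "\<And>n y. \<bar>y\<bar> \<le> R \<Longrightarrow> \<bar>g n y\<bar> \<le> M n" "\<And>n y. \<bar>y\<bar> \<le> R \<Longrightarrow> \<bar>g' n y\<bar> \<le> M n"
      using main[of R] by (auto simp: R_def)
    have uc: "uniformly_convergent_on {-R..R} (\<lambda>n x. \<Sum>i<n. h i x)"
      if "\<And>n y. \<bar>y\<bar> \<le> R \<Longrightarrow> \<bar>h n y\<bar> \<le> M n" for h :: "nat \<Rightarrow> real \<Rightarrow> real"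
      by (rule uniformly_convergentI[OF Weierstrass_m_test[OF _ M(1)]]) (use that in auto)
    have int: "x \<in> interior {-R..R}" by (auto simp: R_def)
    have z: "0 \<in> {-R..R}" by (auto simp: R_def)
    have sg0: "summable (\<lambda>n. g n 0)"
      by (rule summable_comparison_test'[OF M(1), of 0]) (use M z in auto)
    have 1: "(v has_real_derivative v' x) (at x)"
      using has_field_derivative_series'(2)[OF convex_closed_interval(1)[of "-R" R] DERIV_subset[OF df] uc[OF M(3)] z sf int] unfolding v_def v'_def by simp
    have 2: "(v' has_real_derivative (\<Sum>n. g' n x)) (at x)"
      using has_field_derivative_series'(2)[OF convex_closed_interval(1)[of "-R" R] DERIV_subset[OF dg] uc[OF M(4)] z sg0 int] unfolding v'_def by simp
    have s2: "summable (\<lambda>n. g' n x)"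
      by (rule summable_comparison_test'[OF M(1), of 0]) (use M R_def in auto)
    \<comment> \<open>The shift by one closes the equation: \<open>g' 0\<close> vanishes and
      \<open>g' (Suc n)\<close> is q times \<open>f n\<close>.\<close>
    have "(\<Sum>n. g' n x) = (\<Sum>n. g' (Suc n) x)" 
      using suminf_split_head[OF s2] by (simp add: g'_def)
    also have "\<dots> = q x * v x" unfolding v_def g'_def by (simp add: suminf_mult[OF sf])
    finally show ?thesis using 1 2 by simp
  qed
  have "v 0 = a" unfolding v_def using suminf_finite[of "{0}" "\<lambda>n. f n 0"] fz
    by (metis (no_types, lifting) f0 finite.emptyI finite.insertI sum.insert sum.empty insertI1 not0_implies_Suc insert_iff add.right_neutral mult_zero_right finite.intros empty_iff)
  moreover have "v' 0 = b" 
  proof -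
    have "(\<Sum>n. g n 0) = (\<Sum>n\<in>{0}. g n 0)"
      by (rule suminf_finite) (use gz in \<open>auto simp: gr0_conv_Suc\<close>)
    then show ?thesis by (simp add: v'_def g_def)
  qed
  ultimately show ?thesis using dv by blast
qed

text \<open>The energy \<open>E^2 + E'^2 + e^2\<close> grows at rate at most \<open>2 + Q\<close>.\<close>

lemma gronwall_second_order:
  fixes E E' q f :: "real \<Rightarrow> real"
  assumes x: "0 \<le> x" and e: "0 \<le> e"
    and d: "\<And>y. 0 \<le> y \<Longrightarrow> y \<le> x \<Longrightarrow> (E has_real_derivative E' y) (at y)"
    and d': "\<And>y. 0 \<le> y \<Longrightarrow> y \<le> x \<Longrightarrow> (E' has_real_derivative q y * E y + f y) (at y)"
    and q: "\<And>y. 0 \<le> y \<Longrightarrow> y \<le> x \<Longrightarrow> \<bar>q y\<bar> \<le> Q"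
    and f: "\<And>y. 0 \<le> y \<Longrightarrow> y \<le> x \<Longrightarrow> \<bar>f y\<bar> \<le> e"
    and 0: "E 0 = 0" "E' 0 = 0"
  shows "\<bar>E x\<bar> \<le> e * exp ((2 + Q) * x / 2) \<and> \<bar>E' x\<bar> \<le> e * exp ((2 + Q) * x / 2)"
proof -
  \<comment> \<open>The summand e^2 absorbs the forcing through 2 E' f \<le> E'^2 + e^2; the
    exponential factor then makes G nonincreasing.\<close>
  define G where "G y = ((E y)^2 + (E' y)^2 + e^2) * exp (- (2 + Q) * y)" for y
  have "G x - G 0 \<le> 0 - 0"
  proof (rule increment_le_of_deriv_le[OF x])
    fix y assume y: "0 \<le> y" "y \<le> x"
    show "(G has_real_derivative (2 * E y * E' y + 2 * E' y * (q y * E y + f y)) * exp (- (2 + Q) * y)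
        + ((E y)^2 + (E' y)^2 + e^2) * (exp (- (2 + Q) * y) * (- (2 + Q)))) (at y)"
      unfolding G_def by (rule derivative_eq_intros d[OF y] d'[OF y] refl | simp)+
    have "2 * E y * E' y + 2 * E' y * (q y * E y + f y) \<le> (2 + Q) * ((E y)^2 + (E' y)^2 + e^2)"
    proof -
      have a: "2 * \<bar>E y * E' y\<bar> \<le> (E y)^2 + (E' y)^2"
        using sum_squares_bound[of "\<bar>E y\<bar>" "\<bar>E' y\<bar>"] by (simp add: abs_mult)
      have "2 * E' y * f y \<le> (E' y)^2 + (f y)^2" using sum_squares_bound[of "E' y" "f y"] by simp
      also have "\<dots> \<le> (E' y)^2 + e^2" using f[OF y] e by (simp add: abs_le_square_iff[symmetric])
      finally have b: "2 * E' y * f y \<le> (E' y)^2 + e^2" .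
      have Q: "0 \<le> Q" using q[OF y] by simp
      have "2 * E' y * (q y * E y) \<le> \<bar>q y\<bar> * (2 * \<bar>E y * E' y\<bar>)"
      proof -
        have "2 * E' y * (q y * E y) \<le> \<bar>2 * E' y * (q y * E y)\<bar>" by simp
        then show ?thesis by (simp add: abs_mult mult_ac)
      qed
      also have "\<dots> \<le> Q * ((E y)^2 + (E' y)^2)"
        by (rule mult_mono) (use q[OF y] a Q in auto)
      finally have c: "2 * E' y * (q y * E y) \<le> Q * ((E y)^2 + (E' y)^2)" .
      have g: "2 * E y * E' y \<le> (E y)^2 + (E' y)^2" using a by (simp add: mult.assoc abs_le_iff)
      have "0 \<le> Q * e^2 + e^2 + (E y)^2" using Q by simp
      moreover have "2 * E y * E' y + 2 * E' y * (q y * E y + f y) = 2 * E y * E' y + 2 * E' y * (q y * E y) + 2 * E' y * f y"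
        by (simp add: algebra_simps)
      ultimately show ?thesis using b c g by (simp add: algebra_simps)
    qed
    then have "(2 * E y * E' y + 2 * E' y * (q y * E y + f y)) * exp (- (2 + Q) * y) \<le>
       (2 + Q) * ((E y)^2 + (E' y)^2 + e^2) * exp (- (2 + Q) * y)"
      by (intro mult_right_mono) auto
    moreover have "S * (Z * (- (2 + Q))) = - ((2 + Q) * S * Z)" for S Z :: real by algebra
    ultimately show "(2 * E y * E' y + 2 * E' y * (q y * E y + f y)) * exp (- (2 + Q) * y)
        + ((E y)^2 + (E' y)^2 + e^2) * (exp (- (2 + Q) * y) * (- (2 + Q))) \<le> 0"
      by simp
  qed simp
  then have "((E x)^2 + (E' x)^2 + e^2) * exp (- (2 + Q) * x) \<le> e^2" by (simp add: G_def 0)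
  then have "((E x)^2 + (E' x)^2 + e^2) * exp (- (2 + Q) * x) * exp ((2 + Q) * x) \<le> e^2 * exp ((2 + Q) * x)"
    by (intro mult_right_mono) auto
  moreover have one: "exp (- (2 + Q) * x) * exp ((2 + Q) * x) = 1" by (simp add: mult_exp_exp algebra_simps)
  ultimately have "(E x)^2 + (E' x)^2 + e^2 \<le> e^2 * exp ((2 + Q) * x)" by (simp only: mult.assoc one mult_1_right)
  also have "\<dots> = (e * exp ((2 + Q) * x / 2))^2"
    by (simp add: power_mult_distrib power2_eq_square mult_exp_exp)
  finally have *: "(E x)^2 + (E' x)^2 \<le> (e * exp ((2 + Q) * x / 2))^2"
    using zero_le_power2[of e] by linarith
  then have "\<bar>E x\<bar>^2 \<le> (e * exp ((2 + Q) * x / 2))^2" "\<bar>E' x\<bar>^2 \<le> (e * exp ((2 + Q) * x / 2))^2"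
    using zero_le_power2[of "E x"] zero_le_power2[of "E' x"] unfolding power2_abs by linarith+
  then show ?thesis using e by (auto intro: power2_le_imp_le)
qed

text \<open>The difference of two solutions obeys Gronwall's estimate with zero forcing.\<close>

lemma linear_ode_unique:
  fixes q :: "real \<Rightarrow> real"
  assumes q: "\<And>x. isCont q x"
    and v: "\<And>x. (v has_real_derivative v' x) (at x)" "\<And>x. (v' has_real_derivative q x * v x) (at x)"
    and w: "\<And>x. (w has_real_derivative w' x) (at x)" "\<And>x. (w' has_real_derivative q x * w x) (at x)"
    and 0: "v z0 = w z0" "v' z0 = w' z0"
  shows "v = w \<and> v' = w'"
proof -
  \<comment> \<open>Stated for arbitrary data because it is applied twice: to the equation itself
    and, for points left of \<open>z0\<close>, to its reflection.\<close>
  have pos: "v (x0 + x) = w (x0 + x) \<and> v' (x0 + x) = w' (x0 + x)"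
    if x: "0 \<le> x"
     and v: "\<And>x. (v has_real_derivative v' x) (at x)" "\<And>x. (v' has_real_derivative q x * v x) (at x)"
     and w: "\<And>x. (w has_real_derivative w' x) (at x)" "\<And>x. (w' has_real_derivative q x * w x) (at x)"
     and 0: "v x0 = w x0" "v' x0 = w' x0"
     and q: "\<And>x. isCont q x" for x x0 v v' w w' q
  proof -
    have "compact (q ` {x0..x0+x})"
      by (intro compact_continuous_image continuous_at_imp_continuous_on) (use q in auto)
    then obtain Q where Q: "\<And>y. y \<in> {x0..x0+x} \<Longrightarrow> \<bar>q y\<bar> \<le> Q"
      by (force dest!: compact_imp_bounded simp: bounded_iff)
    have sh: "((\<lambda>y. h (x0 + y)) has_real_derivative h' (x0 + y)) (at y)" if "\<And>x. (h has_real_derivative h' x) (at x)" for h h' y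
      using that[of "x0 + y"] by (subst (asm) add.commute) (simp add: DERIV_shift[symmetric] add.commute)
    have "\<bar>v (x0 + x) - w (x0 + x)\<bar> \<le> 0 * exp ((2 + Q) * x / 2) \<and> \<bar>v' (x0 + x) - w' (x0 + x)\<bar> \<le> 0 * exp ((2 + Q) * x / 2)"
    proof (rule gronwall_second_order[OF x, where E = "\<lambda>y. v (x0 + y) - w (x0 + y)"
          and E' = "\<lambda>y. v' (x0 + y) - w' (x0 + y)" and q = "\<lambda>y. q (x0 + y)" and f = "\<lambda>_. 0"])
      fix y
      show "((\<lambda>y. v (x0 + y) - w (x0 + y)) has_real_derivative v' (x0 + y) - w' (x0 + y)) (at y)"
        by (intro DERIV_diff sh v w)
      show "((\<lambda>y. v' (x0 + y) - w' (x0 + y)) has_real_derivative q (x0 + y) * (v (x0 + y) - w (x0 + y)) + 0) (at y)"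
        by (rule DERIV_cong[OF DERIV_diff[OF sh[OF v(2)] sh[OF w(2)]]]) (simp add: algebra_simps)
    qed (use Q 0 in auto)
    then show ?thesis by simp
  qed
  have "v x = w x \<and> v' x = w' x" for x
  proof (cases "x \<ge> z0")
    case True
    then show ?thesis using pos[of "x - z0" v v' q w w' z0] v w 0 q by auto
  next
    case False
    have m: "((\<lambda>y. h (- y)) has_real_derivative - h' (- y)) (at y)" if "\<And>x. (h has_real_derivative h' x) (at x)" for h h' y
      using DERIV_mirror[of h "h' (-y)" y] that by simp
    have m2: "((\<lambda>y. - h (- y)) has_real_derivative h' (- y)) (at y)" if "\<And>x. (h has_real_derivative h' x) (at x)" for h h' y
      using DERIV_minus[OF m[OF that]] by simp
    have "isCont (\<lambda>y. q (- y)) y" for y using q by (simp add: continuous_at_compose[of y uminus q, unfolded o_def])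
    then show ?thesis using pos[of "z0 - x" "\<lambda>y. v (-y)" "\<lambda>y. - v' (-y)" "\<lambda>y. q (-y)" "\<lambda>y. w (-y)" "\<lambda>y. - w' (-y)" "-z0"]
      m[OF v(1)] m[OF w(1)] m2[OF v(2)] m2[OF w(2)] False 0 by auto
  qed
  then show ?thesis by auto
qed

text \<open>The difference of the solutions for l and l0 has zero initial data and forcing (l0 - l)
  \<open>v l0\<close>, so Gronwall gives a Lipschitz bound at l0. This continuity feeds the
  intermediate value argument in the spectral parameter.\<close>

lemma linear_ode_parameter_continuous:
  fixes p :: "real \<Rightarrow> real" and v v' :: "real \<Rightarrow> real \<Rightarrow> real"
  assumes p: "\<And>x. isCont p x" and X: "0 \<le> X"
    and v: "\<And>l x. (v l has_real_derivative v' l x) (at x)"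
      "\<And>l x. (v' l has_real_derivative (p x - l) * v l x) (at x)"
    and 0: "\<And>l. v l 0 = a" "\<And>l. v' l 0 = b"
  shows "isCont (\<lambda>l. v l X) l0 \<and> isCont (\<lambda>l. v' l X) l0"
proof -
  have "bounded (p ` {0..X})"
    by (intro compact_imp_bounded compact_continuous_image continuous_at_imp_continuous_on) (use p in auto)
  then obtain P where P: "\<And>x. 0 \<le> x \<Longrightarrow> x \<le> X \<Longrightarrow> \<bar>p x\<bar> \<le> P" by (force simp: bounded_iff)
  have "bounded (v l0 ` {0..X})"
    by (intro compact_imp_bounded compact_continuous_image continuous_at_imp_continuous_on)
       (use DERIV_isCont[OF v(1)] in auto)
  then obtain B where B: "\<And>x. 0 \<le> x \<Longrightarrow> x \<le> X \<Longrightarrow> \<bar>v l0 x\<bar> \<le> B" by (force simp: bounded_iff)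
  define c where "c = B * exp ((2 + (P + \<bar>l0\<bar> + 1)) * X / 2)"
  have est: "\<bar>v l X - v l0 X\<bar> \<le> c * \<bar>l - l0\<bar> \<and> \<bar>v' l X - v' l0 X\<bar> \<le> c * \<bar>l - l0\<bar>" if l: "\<bar>l - l0\<bar> \<le> 1" for l
  proof -
    have "\<bar>v l X - v l0 X\<bar> \<le> (\<bar>l - l0\<bar> * B) * exp ((2 + (P + \<bar>l0\<bar> + 1)) * X / 2) \<and>
      \<bar>v' l X - v' l0 X\<bar> \<le> (\<bar>l - l0\<bar> * B) * exp ((2 + (P + \<bar>l0\<bar> + 1)) * X / 2)"
    proof (rule gronwall_second_order[OF X, where E = "\<lambda>y. v l y - v l0 y" and E' = "\<lambda>y. v' l y - v' l0 y"
          and q = "\<lambda>y. p y - l" and f = "\<lambda>y. (l0 - l) * v l0 y"])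
      fix y assume y: "0 \<le> y" "y \<le> X"
      show "((\<lambda>y. v l y - v l0 y) has_real_derivative v' l y - v' l0 y) (at y)" by (intro DERIV_diff v)
      show "((\<lambda>y. v' l y - v' l0 y) has_real_derivative (p y - l) * (v l y - v l0 y) + (l0 - l) * v l0 y) (at y)"
        using DERIV_diff[OF v(2)[of l y] v(2)[of l0 y]] by (simp add: algebra_simps)
      show "\<bar>p y - l\<bar> \<le> P + \<bar>l0\<bar> + 1" using P[OF y] l by linarith
      show "\<bar>(l0 - l) * v l0 y\<bar> \<le> \<bar>l - l0\<bar> * B" using B[OF y] by (auto simp: abs_mult abs_minus_commute intro: mult_left_mono)
    next
      show "0 \<le> \<bar>l - l0\<bar> * B" using B[of 0] X by (simp add: order_trans[OF abs_ge_zero])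
    qed (use 0 in auto)
    then show ?thesis by (simp add: c_def mult_ac)
  qed
  have near: "eventually (\<lambda>l. \<bar>l - l0\<bar> \<le> 1) (at l0)"
    unfolding eventually_at by (rule exI[of _ 1]) (auto simp: dist_real_def)
  have lim: "((\<lambda>l. c * \<bar>l - l0\<bar>) \<longlongrightarrow> 0) (at l0)"
    by (auto intro!: tendsto_eq_intros)
  have "((\<lambda>l. v l X - v l0 X) \<longlongrightarrow> 0) (at l0)"
    by (rule Lim_null_comparison[OF _ lim]) (use near est in \<open>auto elim: eventually_mono\<close>)
  moreover have "((\<lambda>l. v' l X - v' l0 X) \<longlongrightarrow> 0) (at l0)"
    by (rule Lim_null_comparison[OF _ lim]) (use near est in \<open>auto elim: eventually_mono\<close>)
  ultimately show ?thesis unfolding isCont_def by (simp add: LIM_zero_iff)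
qed

text \<open>The derivative of v v' is v'^2 + q v^2, so v v' stays nonnegative and v^2 does not
  decrease; hence v never reaches 0, and v'' = q v > 0 makes v' increase.\<close>

lemma convex_ode_growth:
  fixes v v' q :: "real \<Rightarrow> real"
  assumes d: "\<And>x. (v has_real_derivative v' x) (at x)"
    and d': "\<And>x. a \<le> x \<Longrightarrow> x \<le> b \<Longrightarrow> (v' has_real_derivative q x * v x) (at x)"
    and q: "\<And>x. a \<le> x \<Longrightarrow> x \<le> b \<Longrightarrow> q x > 0"
    and a: "v a > 0" "v' a \<ge> 0" and x: "a < x" "x \<le> b"
  shows "v x > 0 \<and> v' x > 0"
proof -
  have pr: "0 \<le> v y * v' y" if y: "a \<le> y" "y \<le> b" for y
  proof -
    have "(\<lambda>_. 0) y - (\<lambda>_. 0) a \<le> v y * v' y - v a * v' a"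
    proof (rule increment_le_of_deriv_le[OF y(1)])
      fix z assume z: "a \<le> z" "z \<le> y"
      show "((\<lambda>z. v z * v' z) has_real_derivative v' z * v' z + (q z * v z) * v z) (at z)"
        using DERIV_mult[OF d[of z] d'[of z]] z y by (simp add: algebra_simps)
      show "0 \<le> v' z * v' z + (q z * v z) * v z" using q[of z] z y
        by (simp add: mult.assoc)
    qed auto
    then show ?thesis using a by (auto intro: order_trans[OF mult_nonneg_nonneg[of "v a" "v' a"]])
  qed
  have nz: "(v y)^2 \<ge> (v a)^2" if y: "a \<le> y" "y \<le> b" for y
  proof -
    have "(\<lambda>_. 0) y - (\<lambda>_. 0) a \<le> (v y)^2 - (v a)^2"
    proof (rule increment_le_of_deriv_le[OF y(1)])
      fix z assume z: "a \<le> z" "z \<le> y"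
      show "((\<lambda>z. (v z)^2) has_real_derivative 2 * (v z * v' z)) (at z)"
        by (auto intro!: derivative_eq_intros d)
      show "0 \<le> 2 * (v z * v' z)" using pr[of z] z y by simp
    qed auto
    then show ?thesis by simp
  qed
  have vp: "v y > 0" if y: "a \<le> y" "y \<le> b" for y
  proof (rule ccontr)
    assume "\<not> v y > 0"
    then have "\<exists>z\<ge>a. z \<le> y \<and> v z = 0"
      using IVT2[of v y 0 a] a y d DERIV_isCont by (metis less_imp_le not_less)
    then obtain z where "a \<le> z" "z \<le> y" "v z = 0" by auto
    then show False using nz[of z] y a by auto
  qed
  have "v' a < v' x"
  proof (rule DERIV_pos_imp_increasing[OF x(1)])
    fix y assume y: "a \<le> y" "y \<le> x"
    then show "\<exists>z. (v' has_real_derivative z) (at y) \<and> 0 < z"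
      using d'[of y] q[of y] vp[of y] x by (intro exI[of _ "q y * v y"]) auto
  qed
  then show ?thesis using vp[of x] a x by auto
qed

text \<open>Just to the right of a simple zero both v and v' are positive, and the previous growth
  argument starts there.\<close>

lemma convex_ode_growth_from_zero:
  fixes v v' q :: "real \<Rightarrow> real"
  assumes d: "\<And>x. (v has_real_derivative v' x) (at x)"
    and d': "\<And>x. a \<le> x \<Longrightarrow> x \<le> b \<Longrightarrow> (v' has_real_derivative q x * v x) (at x)"
    and q: "\<And>x. a \<le> x \<Longrightarrow> x \<le> b \<Longrightarrow> q x > 0"
    and a: "v a = 0" "v' a > 0" and x: "a < x" "x \<le> b"
  shows "v x > 0 \<and> v' x > 0"
proof -
  obtain e where e: "e > 0" "\<And>h. 0 < h \<Longrightarrow> h < e \<Longrightarrow> v a < v (a + h)"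
    using DERIV_pos_inc_right[OF d[of a] a(2)] by auto
  have "isCont v' a" using d'[of a] x DERIV_isCont by fastforce
  then have "eventually (\<lambda>y. v' y > 0) (at a)" using a(2)
    by (auto simp: isCont_def intro: order_tendstoD)
  then obtain e2 where e2: "e2 > 0" "\<And>y. y \<noteq> a \<Longrightarrow> \<bar>y - a\<bar> < e2 \<Longrightarrow> v' y > 0"
    by (auto simp: eventually_at dist_real_def)
  define h where "h = min (min e e2) (x - a) / 2"
  have h: "0 < h" "h < e" "h < e2" "a + h < x" using e e2 x by (auto simp: h_def min_def field_simps)
  have "v (a + h) > 0" "v' (a + h) \<ge> 0" using e(2)[of h] e2(2)[of "a + h"] h a by auto
  then show ?thesis using convex_ode_growth[of v v' "a + h" b q x] d d' q h x by force
qed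

text \<open>At a negative interior minimum G'' \<le> q G < 0, so G would drop further to the right.
  A negative minimum at b is excluded by either alternative there: the value serves the Dirichlet
  problem, the strict derivative the Neumann problem.\<close>

lemma maximum_principle:
  fixes G G' G2 q :: "real \<Rightarrow> real"
  assumes d: "\<And>x. a \<le> x \<Longrightarrow> x \<le> b \<Longrightarrow> (G has_real_derivative G' x) (at x)"
    and d': "\<And>x. a \<le> x \<Longrightarrow> x \<le> b \<Longrightarrow> (G' has_real_derivative G2 x) (at x)"
    and le: "\<And>x. a \<le> x \<Longrightarrow> x \<le> b \<Longrightarrow> G2 x \<le> q x * G x" and q: "\<And>x. a \<le> x \<Longrightarrow> x \<le> b \<Longrightarrow> q x > 0"
    and ga: "G a \<ge> 0" and gb: "G b \<ge> 0 \<or> G' b > 0" and x: "a \<le> x" "x \<le> b"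
  shows "G x \<ge> 0"
proof (rule ccontr)
  assume neg: "\<not> G x \<ge> 0"
  have "continuous_on {a..b} G" by (rule DERIV_continuous_on) (use d in \<open>auto intro: DERIV_subset\<close>)
  then obtain y where y: "y \<in> {a..b}" "\<And>z. z \<in> {a..b} \<Longrightarrow> G y \<le> G z"
    using continuous_attains_inf[of "{a..b}" G] x by auto
  have Gy: "G y < 0" using y(2)[of x] neg x by auto
  then have ya: "a < y" using ga y by (cases "a = y") auto
  have yb: "y \<noteq> b"
  proof
    assume yb: "y = b"
    then have "G' b > 0" using gb Gy by auto
    then obtain e where e: "e > 0" "\<And>h. 0 < h \<Longrightarrow> h < e \<Longrightarrow> G (b - h) < G b"
      using DERIV_pos_inc_left[OF d[of b]] x by auto
    define h where "h = min e (b - a) / 2"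
    have "0 < h" "h < e" "a < b - h" using e ya yb by (auto simp: h_def min_def field_simps)
    then show False using e(2)[of h] y(2)[of "b - h"] yb by auto
  qed
  then have yb: "y < b" using y by auto
  have G'0: "G' y = 0"
    by (rule DERIV_local_min[OF d, of y "min (y - a) (b - y)"]) (use y ya yb in \<open>auto simp: abs_less_iff\<close>)
  have "G2 y < 0" using le[of y] q[of y] Gy y by (auto intro: le_less_trans mult_pos_neg)
  then obtain e where e: "e > 0" "\<And>h. 0 < h \<Longrightarrow> h < e \<Longrightarrow> G' (y + h) < G' y"
    using DERIV_neg_dec_right[OF d'[of y]] y by auto
  define h where "h = min e (b - y) / 2"
  have h: "0 < h" "h < e" "y + h < b" using e yb by (auto simp: h_def min_def field_simps)
  have "\<exists>z. z > y \<and> z < y + h \<and> G (y + h) - G y = (y + h - y) * G' z"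
    by (rule MVT2) (use h d y in auto)
  then obtain z where z: "y < z" "z < y + h" "G (y + h) - G y = h * G' z" by auto
  have "G' z < 0" using e(2)[of "z - y"] z h G'0 by auto
  then have "G (y + h) < G y" using z h mult_pos_neg[of h "G' z"] by auto
  moreover have "G y \<le> G (y + h)" by (rule y(2)) (use h ya in auto)
  ultimately show False by simp
qed

section \<open>Shooting from a quasi-mode\<close>

text \<open>An approximate solution \<open>u\<close> with approximate eigenvalue \<open>l\<close> and residual \<open>R\<close> is compared with
  the exact solutions \<open>v \<mu>\<close> sharing its initial values at \<open>0\<close>. On \<open>[0, x0]\<close> Gronwall's inequality
  controls the difference; on \<open>[x0, X]\<close> the equation is of growing type, and the Wronskian of \<open>u\<close>
  and \<open>v \<mu>\<close> forces \<open>v \<mu>\<close> to leave \<open>u\<close> upwards or downwards when \<open>\<mu> = l \<mp> M \<epsilon>\<close>. The number \<open>\<rho>\<close>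
  absorbs the exponentially small failure of \<open>u\<close> to be positive and decreasing near \<open>X\<close>.\<close>

locale quasimode =
  fixes p u u' R :: "real \<Rightarrow> real" and v v' :: "real \<Rightarrow> real \<Rightarrow> real"
    and l \<epsilon> \<rho> C M Q x0 X c err :: real
  assumes x0: "0 < x0" "x0 < X"
    and du: "\<And>x. (u has_real_derivative u' x) (at x)"
    and du': "\<And>x. (u' has_real_derivative (p x - l) * u x + R x) (at x)"
    and p: "\<And>x. isCont p x"
    and v: "\<And>\<mu> x. (v \<mu> has_real_derivative v' \<mu> x) (at x)"
      "\<And>\<mu> x. (v' \<mu> has_real_derivative (p x - \<mu>) * v \<mu> x) (at x)"
    and v0: "\<And>\<mu>. v \<mu> 0 = u 0" "\<And>\<mu>. v' \<mu> 0 = u' 0"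
    and pos: "0 < \<epsilon>" "0 \<le> \<rho>" "0 \<le> C" "0 \<le> M"
    and bu: "\<And>x. 0 \<le> x \<Longrightarrow> x \<le> X \<Longrightarrow> \<bar>u x\<bar> \<le> C * exp (- x)"
      "\<And>x. 0 \<le> x \<Longrightarrow> x \<le> X \<Longrightarrow> \<bar>u' x\<bar> \<le> C"
    and bR: "\<And>x. 0 \<le> x \<Longrightarrow> x \<le> X \<Longrightarrow> \<bar>R x\<bar> \<le> C * \<epsilon> * exp (- x)"
    and Q: "\<And>\<mu> x. \<bar>\<mu> - l\<bar> \<le> M * \<epsilon> \<Longrightarrow> 0 \<le> x \<Longrightarrow> x \<le> x0 \<Longrightarrow> \<bar>p x - \<mu>\<bar> \<le> Q"
    and q2: "\<And>\<mu> x. \<bar>\<mu> - l\<bar> \<le> M * \<epsilon> \<Longrightarrow> x0 \<le> x \<Longrightarrow> x \<le> X \<Longrightarrow> 2 \<le> p x - \<mu>"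
    and low: "\<And>x. x0 \<le> x \<Longrightarrow> x \<le> X \<Longrightarrow> - \<rho> \<le> u x"
      "\<And>x. x0 \<le> x \<Longrightarrow> x \<le> X \<Longrightarrow> u' x \<le> \<rho>"
    and uX: "\<bar>u X\<bar> \<le> \<rho>" "\<bar>u X\<bar> \<le> C * \<epsilon> * exp (- X)" "u' X = 0"
    and square_mass: "\<exists>I. (\<forall>x. (I has_real_derivative (u x)^2) (at x)) \<and> c \<le> I x0 - I 0"
    and M_large: "4 + (x0 + 1) * C * (C + 1) \<le> M * c"
    and err_def: "err = (M + 1) * C * \<epsilon> * exp ((2 + Q) * x0 / 2)"
    and small: "err \<le> 1" "M * C * err * x0 \<le> 1" "err < u x0"
      "M * (C + 1) * \<rho> * X \<le> 1" "(C + 1) * \<rho> \<le> \<epsilon>"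
begin

lemma err_nonneg: "0 \<le> err" using pos by (simp add: err_def)

lemma Q_nonneg: "0 \<le> Q" using Q[of l 0] pos x0 abs_ge_zero order_trans by fastforce

text \<open>Gronwall for v - u, whose forcing (l - \<mu>) u - R is at most (M + 1) C \<epsilon>. The
  exponential factor in \<open>err\<close> is tolerable because x0 stays fixed.\<close>

lemma near:
  assumes l: "\<bar>\<mu> - l\<bar> \<le> M * \<epsilon>" and x: "0 \<le> x" "x \<le> x0"
  shows "\<bar>v \<mu> x - u x\<bar> \<le> err" "\<bar>v' \<mu> x - u' x\<bar> \<le> err"
proof -
  have "\<bar>v \<mu> x - u x\<bar> \<le> ((M + 1) * C * \<epsilon>) * exp ((2 + Q) * x / 2) \<and> \<bar>v' \<mu> x - u' x\<bar> \<le> ((M + 1) * C * \<epsilon>) * exp ((2 + Q) * x / 2)"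
  proof (rule gronwall_second_order[OF x(1), where E = "\<lambda>y. v \<mu> y - u y" and E' = "\<lambda>y. v' \<mu> y - u' y"
        and q = "\<lambda>y. p y - \<mu>" and f = "\<lambda>y. (l - \<mu>) * u y - R y"])
    fix y assume y: "0 \<le> y" "y \<le> x"
    show "((\<lambda>y. v \<mu> y - u y) has_real_derivative v' \<mu> y - u' y) (at y)" by (intro DERIV_diff v du)
    show "((\<lambda>y. v' \<mu> y - u' y) has_real_derivative (p y - \<mu>) * (v \<mu> y - u y) + ((l - \<mu>) * u y - R y)) (at y)"
      by (rule DERIV_cong[OF DERIV_diff[OF v(2) du']]) (simp add: algebra_simps)
    show "\<bar>p y - \<mu>\<bar> \<le> Q" using Q[OF l] y x by simp
    have e: "exp (- y) \<le> 1" using y by simp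
    have "\<bar>u y\<bar> \<le> C" using bu(1)[of y] mult_left_mono[OF e pos(3)] y x x0 by simp
    then have 1: "\<bar>(l - \<mu>) * u y\<bar> \<le> (M * \<epsilon>) * C" unfolding abs_mult using l by (intro mult_mono) auto
    have 2: "\<bar>R y\<bar> \<le> C * \<epsilon>" using bR[of y] mult_left_mono[OF e, of "C * \<epsilon>"] pos y x x0 by simp
    show "\<bar>(l - \<mu>) * u y - R y\<bar> \<le> (M + 1) * C * \<epsilon>" using 1 2 by (simp add: algebra_simps)
  qed (use v0 pos in auto)
  moreover have "((M + 1) * C * \<epsilon>) * exp ((2 + Q) * x / 2) \<le> err"
    unfolding err_def using Q_nonneg x pos by (intro mult_left_mono) (auto intro: mult_left_mono)
  ultimately show "\<bar>v \<mu> x - u x\<bar> \<le> err" "\<bar>v' \<mu> x - u' x\<bar> \<le> err" by auto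
qed

lemma u_le_C: "0 \<le> x \<Longrightarrow> x \<le> X \<Longrightarrow> \<bar>u x\<bar> \<le> C"
  using bu(1)[of x] mult_left_mono[of "exp (- x)" 1 C] pos by auto

lemma R_le_C: "0 \<le> x \<Longrightarrow> x \<le> X \<Longrightarrow> \<bar>R x\<bar> \<le> C * \<epsilon>"
  using bR[of x] mult_left_mono[of "exp (- x)" 1 "C * \<epsilon>"] pos by auto

lemma v_at_x0: assumes "\<bar>\<mu> - l\<bar> \<le> M * \<epsilon>" shows "0 < v \<mu> x0" "\<bar>v \<mu> x0\<bar> \<le> C + 1" "\<bar>v' \<mu> x0\<bar> \<le> C + 1"
  using near[OF assms, of x0] small u_le_C[of x0] bu(2)[of x0] x0 by auto

text \<open>A common zero of v and v' would make v vanish identically, contrary to its positive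
  value at x0.\<close>

lemma v_nontrivial: assumes l: "\<bar>\<mu> - l\<bar> \<le> M * \<epsilon>" and z: "v \<mu> z = 0" shows "v' \<mu> z \<noteq> 0"
proof
  assume z': "v' \<mu> z = 0"
  have "v \<mu> = (\<lambda>_. 0) \<and> v' \<mu> = (\<lambda>_. 0)"
    by (rule linear_ode_unique[where q = "\<lambda>x. p x - \<mu>" and ?z0.0 = z]) (use p v z z' in \<open>auto intro!: continuous_intros\<close>)
  then show False using v_at_x0(1)[OF l] by simp
qed

definition wronskian where "wronskian \<mu> x = u x * v' \<mu> x - v \<mu> x * u' x"

text \<open>The potential p cancels; only the spectral shift and the residual remain. This makes the
  Wronskian a measure of l - \<mu>.\<close>

lemma wronskian_deriv: "(wronskian \<mu> has_real_derivative (l - \<mu>) * u x * v \<mu> x - v \<mu> x * R x) (at x)"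
  unfolding wronskian_def[abs_def]
  by (rule DERIV_cong[OF DERIV_diff[OF DERIV_mult[OF du v(2)] DERIV_mult[OF v(1) du']]]) (simp add: algebra_simps)

lemma wronskian_0: "wronskian \<mu> 0 = 0" by (simp add: wronskian_def v0)

text \<open>With \<open>\<mu>\<close> at distance \<open>M\<epsilon>\<close> from \<open>l\<close>, the mass of \<open>u\<^sup>2\<close> on \<open>[0, x0]\<close> dominates every error
  term in the Wronskian.\<close>

lemma wronskian_big:
  assumes \<sigma>: "\<sigma> = 1 \<or> \<sigma> = -1" and l: "\<mu> = l - \<sigma> * (M * \<epsilon>)"
    and x1: "x0 \<le> x1" "x1 \<le> X"
    and vb: "\<And>x. x0 \<le> x \<Longrightarrow> x \<le> x1 \<Longrightarrow> 0 \<le> v \<mu> x \<and> v \<mu> x \<le> C + 1"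
  shows "2 * \<epsilon> \<le> \<sigma> * wronskian \<mu> x1"
proof -
  have ll: "\<bar>\<mu> - l\<bar> \<le> M * \<epsilon>" using \<sigma> pos unfolding l by (auto simp: abs_mult)
  have ss: "\<sigma> * \<sigma> = 1" "\<bar>\<sigma>\<bar> = 1" using \<sigma> by auto
  have dW: "((\<lambda>x. \<sigma> * wronskian \<mu> x) has_real_derivative M * \<epsilon> * (u x * v \<mu> x) - \<sigma> * (v \<mu> x * R x)) (at x)" for x
  proof (rule DERIV_cong[OF DERIV_cmult[OF wronskian_deriv]])
    show "\<sigma> * ((l - \<mu>) * u x * v \<mu> x - v \<mu> x * R x) = M * \<epsilon> * (u x * v \<mu> x) - \<sigma> * (v \<mu> x * R x)"
      unfolding l using \<sigma> by (auto simp: algebra_simps)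
  qed
  obtain I where I: "\<And>x. (I has_real_derivative (u x)^2) (at x)" "c \<le> I x0 - I 0" using square_mass by auto
  \<comment> \<open>Loss per unit length on [0, x0]: the first term pays for replacing u v by u^2,
    the second for the residual.\<close>
  let ?K = "M * \<epsilon> * C * err + (C + 1) * C * \<epsilon>"
  have dL: "((\<lambda>x. M * \<epsilon> * I x - ?K * x) has_real_derivative M * \<epsilon> * (u x)^2 - ?K) (at x)" for x
    by (rule derivative_eq_intros I refl | simp)+
  have A: "(M * \<epsilon> * I x0 - ?K * x0) - (M * \<epsilon> * I 0 - ?K * 0) \<le> \<sigma> * wronskian \<mu> x0 - \<sigma> * wronskian \<mu> 0"
  proof (rule increment_le_of_deriv_le[OF _ dL dW])
    fix x assume x: "0 \<le> x" "x \<le> x0"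
    have n: "\<bar>v \<mu> x - u x\<bar> \<le> err" using near(1)[OF ll x] .
    have ux: "\<bar>u x\<bar> \<le> C" using u_le_C[of x] x x0 by auto
    have vx: "\<bar>v \<mu> x\<bar> \<le> C + 1" using n ux small(1) by linarith
    have "\<bar>u x * (v \<mu> x - u x)\<bar> \<le> C * err" unfolding abs_mult using n ux pos by (intro mult_mono) auto
    then have "(u x)^2 - C * err \<le> u x * v \<mu> x" by (simp add: algebra_simps power2_eq_square abs_le_iff)
    then have "M * \<epsilon> * ((u x)^2 - C * err) \<le> M * \<epsilon> * (u x * v \<mu> x)" using pos by (intro mult_left_mono) auto
    moreover have "\<bar>\<sigma> * (v \<mu> x * R x)\<bar> \<le> (C + 1) * (C * \<epsilon>)"
      unfolding abs_mult ss mult_1 using vx R_le_C[of x] x x0 pos by (intro mult_mono) auto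
    ultimately show "M * \<epsilon> * (u x)^2 - ?K \<le> M * \<epsilon> * (u x * v \<mu> x) - \<sigma> * (v \<mu> x * R x)"
      by (simp add: algebra_simps abs_le_iff)
  qed (use x0 in auto)
  have A': "\<epsilon> * (M * c - 1 - x0 * C * (C + 1)) \<le> \<sigma> * wronskian \<mu> x0"
  proof -
    have "M * \<epsilon> * c \<le> M * \<epsilon> * (I x0 - I 0)" using I(2) pos by (intro mult_left_mono) auto
    moreover have "\<epsilon> * (M * C * err * x0) \<le> \<epsilon> * 1" using small(2) pos by (intro mult_left_mono) auto
    ultimately show ?thesis using A wronskian_0 by (simp add: algebra_simps)
  qed
  \<comment> \<open>Beyond x0 the product u v cannot fall below -(C + 1) \<rho>; \<open>?b\<close>
    is the resulting loss per unit length.\<close>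
  let ?b = "M * \<epsilon> * (C + 1) * \<rho>"
  have dB: "((\<lambda>x. (C + 1) * C * \<epsilon> * exp (- x) - ?b * x) has_real_derivative - ((C + 1) * C * \<epsilon> * exp (- x)) - ?b) (at x)" for x
    by (rule derivative_eq_intros refl | simp)+
  have B: "((C + 1) * C * \<epsilon> * exp (- x1) - ?b * x1) - ((C + 1) * C * \<epsilon> * exp (- x0) - ?b * x0) \<le> \<sigma> * wronskian \<mu> x1 - \<sigma> * wronskian \<mu> x0"
  proof (rule increment_le_of_deriv_le[OF x1(1) dB dW])
    fix x assume x: "x0 \<le> x" "x \<le> x1"
    have vx: "0 \<le> v \<mu> x" "v \<mu> x \<le> C + 1" using vb[OF x] by auto
    have "- ((C + 1) * \<rho>) \<le> - (v \<mu> x * \<rho>)" using vx pos by (simp add: mult_right_mono)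
    also have "\<dots> = v \<mu> x * (- \<rho>)" by simp
    also have "\<dots> \<le> v \<mu> x * u x" using low(1)[of x] x x1 vx by (intro mult_left_mono) auto
    finally have "M * \<epsilon> * (- ((C + 1) * \<rho>)) \<le> M * \<epsilon> * (v \<mu> x * u x)" using pos by (intro mult_left_mono) auto
    moreover have "\<bar>\<sigma> * (v \<mu> x * R x)\<bar> \<le> (C + 1) * (C * \<epsilon> * exp (- x))"
      unfolding abs_mult ss mult_1 using vx bR[of x] x x1 x0 pos by (intro mult_mono) auto
    ultimately show "- ((C + 1) * C * \<epsilon> * exp (- x)) - ?b \<le> M * \<epsilon> * (u x * v \<mu> x) - \<sigma> * (v \<mu> x * R x)"
      by (simp add: algebra_simps abs_le_iff)
  qed
  have b: "?b * (x1 - x0) \<le> \<epsilon>"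
  proof -
    have "?b * (x1 - x0) \<le> ?b * X" using pos x1 x0 by (intro mult_left_mono) auto
    also have "\<dots> = \<epsilon> * (M * (C + 1) * \<rho> * X)" by (simp add: algebra_simps)
    also have "\<dots> \<le> \<epsilon> * 1" using small(4) pos by (intro mult_left_mono) auto
    finally show ?thesis by simp
  qed
  have "(C + 1) * C * \<epsilon> * exp (- x0) \<le> (C + 1) * C * \<epsilon> * 1" using pos x0 by (intro mult_left_mono) auto
  moreover have "0 \<le> (C + 1) * C * \<epsilon> * exp (- x1)" using pos by auto
  \<comment> \<open>Two of the four units of \<epsilon> in \<open>M_large\<close> have been spent,
    on replacing v by u and on the negative part of u. The residual costs x0 C (C + 1) \<epsilon>
    before x0 and C (C + 1) \<epsilon> after it, and 2 \<epsilon> remain.\<close>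
  ultimately have "\<sigma> * wronskian \<mu> x1 \<ge> \<epsilon> * (M * c - 1 - x0 * C * (C + 1)) - \<epsilon> - (C + 1) * C * \<epsilon>"
    using A' B b by (simp add: algebra_simps)
  also have "\<epsilon> * (M * c - 1 - x0 * C * (C + 1)) - \<epsilon> - (C + 1) * C * \<epsilon> = \<epsilon> * (M * c - 2 - (x0 + 1) * C * (C + 1))"
    by (simp add: algebra_simps)
  also have "\<dots> \<ge> \<epsilon> * 2" using M_large pos by (intro mult_left_mono) auto
  finally show ?thesis by simp
qed

text \<open>While v is nonnegative, v'' = (p - \<mu>) v \<ge> 0, so v' is nondecreasing; a
  nonpositive v' at x1 forces v' \<le> 0 before it, and the values at x0 then bound
  everything.\<close>

lemma decreasing_phase:
  assumes l: "\<bar>\<mu> - l\<bar> \<le> M * \<epsilon>" and x1: "x0 \<le> x1" "x1 \<le> X"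
    and vp: "\<And>x. x0 \<le> x \<Longrightarrow> x \<le> x1 \<Longrightarrow> 0 \<le> v \<mu> x" and v1: "v' \<mu> x1 \<le> 0" and x: "x0 \<le> x" "x \<le> x1"
  shows "v \<mu> x \<le> C + 1" "\<bar>v' \<mu> x\<bar> \<le> C + 1" "v' \<mu> x \<le> 0"
proof -
  have mono: "v' \<mu> y \<le> v' \<mu> z" if "x0 \<le> y" "y \<le> z" "z \<le> x1" for y z
  proof (rule DERIV_nonneg_imp_nondecreasing[OF that(2)])
    fix t assume t: "y \<le> t" "t \<le> z"
    have "0 \<le> (p t - \<mu>) * v \<mu> t" using q2[OF l, of t] vp[of t] t that x1 by auto
    then show "\<exists>d. (v' \<mu> has_real_derivative d) (at t) \<and> 0 \<le> d" using v(2) by blast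
  qed
  show n: "v' \<mu> x \<le> 0" using mono[of x x1] v1 x by auto
  show "\<bar>v' \<mu> x\<bar> \<le> C + 1" using mono[of x0 x] n v_at_x0(3)[OF l] x by auto
  have "v \<mu> x \<le> v \<mu> x0"
  proof (rule DERIV_nonpos_imp_nonincreasing[OF x(1)])
    fix t assume t: "x0 \<le> t" "t \<le> x"
    then show "\<exists>d. (v \<mu> has_real_derivative d) (at t) \<and> d \<le> 0" using v(1) mono[of t x1] v1 x by fastforce
  qed
  then show "v \<mu> x \<le> C + 1" using v_at_x0(2)[OF l] by auto
qed

text \<open>The smallest point with v \<le> 0 exists by compactness; v comes down to it from
  positive values, and its zeros are simple, so the derivative there is negative.\<close>

lemma first_zero:
  assumes l: "\<bar>\<mu> - l\<bar> \<le> M * \<epsilon>" and z: "x0 \<le> z" "z \<le> X" "v \<mu> z \<le> 0"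
  shows "\<exists>x1>x0. x1 \<le> z \<and> v \<mu> x1 = 0 \<and> (\<forall>x. x0 \<le> x \<and> x < x1 \<longrightarrow> 0 < v \<mu> x) \<and> v' \<mu> x1 < 0"
proof -
  let ?Z = "{x \<in> {x0..z}. v \<mu> x \<in> {..0}}"
  have cont: "continuous_on {x0..z} (v \<mu>)" by (rule DERIV_continuous_on) (use v in \<open>auto intro: DERIV_subset\<close>)
  have "closed ?Z" using continuous_closed_preimage[OF cont, of "{..0}"] by (auto simp: vimage_def Int_def conj_commute)
  moreover have "bounded ?Z" by (rule bounded_subset[of "{x0..z}"]) auto
  ultimately have "compact ?Z" by (simp add: compact_eq_bounded_closed)
  moreover have "?Z \<noteq> {}" using z by auto
  ultimately obtain x1 where x1: "x1 \<in> ?Z" "\<And>y. y \<in> ?Z \<Longrightarrow> x1 \<le> y" using compact_attains_inf[of ?Z] by blast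
  have p0: "0 < v \<mu> x0" by (rule v_at_x0(1)[OF l])
  have gt: "x0 < x1" using x1(1) p0 by (cases "x1 = x0") auto
  have posb: "\<forall>x. x0 \<le> x \<and> x < x1 \<longrightarrow> 0 < v \<mu> x" using x1 by force
  have zero: "v \<mu> x1 = 0"
  proof (rule ccontr)
    assume "v \<mu> x1 \<noteq> 0"
    then have neg: "v \<mu> x1 < 0" using x1 by auto
    have "\<exists>y\<ge>x0. y \<le> x1 \<and> v \<mu> y = 0"
      by (rule IVT2) (use neg p0 gt DERIV_isCont[OF v(1)] in \<open>auto intro: less_imp_le\<close>)
    then show False using posb neg by (metis less_irrefl order_le_imp_less_or_eq)
  qed
  have "\<not> v' \<mu> x1 > 0"
  proof
    assume "v' \<mu> x1 > 0"
    then obtain e where e: "e > 0" "\<And>h. 0 < h \<Longrightarrow> h < e \<Longrightarrow> v \<mu> (x1 - h) < v \<mu> x1"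
      using DERIV_pos_inc_left[OF v(1)] by blast
    define h where "h = min e (x1 - x0) / 2"
    have "0 < h" "h < e" "x0 < x1 - h" using e gt by (auto simp: h_def min_def field_simps)
    moreover from this have "0 < v \<mu> (x1 - h)" using posb by auto
    ultimately show False using e(2)[of h] zero by auto
  qed
  then have "v' \<mu> x1 < 0" using v_nontrivial[OF l zero] by linarith
  then show ?thesis using gt x1 zero posb by auto
qed

text \<open>-v satisfies an equation of growing type and leaves a simple zero with positive
  slope.\<close>

lemma negative_after_zero:
  assumes l: "\<bar>\<mu> - l\<bar> \<le> M * \<epsilon>" and z: "x0 < z" "z < X" "v \<mu> z = 0" "v' \<mu> z < 0"
  shows "v \<mu> X < 0" "v' \<mu> X < 0"
proof -
  have "0 < - v \<mu> X \<and> 0 < - v' \<mu> X"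
  proof (rule convex_ode_growth_from_zero[of "\<lambda>x. - v \<mu> x" "\<lambda>x. - v' \<mu> x" z X "\<lambda>x. p x - \<mu>"])
    show "((\<lambda>x. - v \<mu> x) has_real_derivative - v' \<mu> x) (at x)" for x by (rule DERIV_minus[OF v(1)])
    show "((\<lambda>x. - v' \<mu> x) has_real_derivative (p x - \<mu>) * - v \<mu> x) (at x)" for x
      using DERIV_minus[OF v(2)] by simp
    show "0 < p x - \<mu>" if "z \<le> x" "x \<le> X" for x using q2[OF l, of x] that z by auto
  qed (use z in auto)
  then show "v \<mu> X < 0" "v' \<mu> X < 0" by auto
qed

text \<open>Since u' vanishes at X, the Wronskian reduces there to u v', and |u| is at most
  \<rho>.\<close>

lemma wronskian_small_right:
  assumes "\<bar>v' \<mu> X\<bar> \<le> C + 1" shows "\<bar>wronskian \<mu> X\<bar> \<le> \<epsilon>"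
proof -
  have "\<bar>u X * v' \<mu> X\<bar> \<le> \<rho> * (C + 1)" unfolding abs_mult using assms uX pos by (intro mult_mono) auto
  then show ?thesis using small(5) uX by (simp add: wronskian_def mult.commute)
qed

text \<open>Either failure of sign is refuted by the Wronskian. At a first zero of v, and likewise
  at X, it reduces to u v' and is at most \<epsilon>, whereas \<open>wronskian_big\<close> demands 2
  \<epsilon>.\<close>

lemma signs_below:
  assumes l: "\<mu> = l - M * \<epsilon>" shows "0 < v \<mu> X" "0 < v' \<mu> X"
proof -
  have ll: "\<bar>\<mu> - l\<bar> \<le> M * \<epsilon>" using l pos by auto
  have nz: "\<not> v \<mu> z \<le> 0" if z: "x0 \<le> z" "z \<le> X" for z
  proof
    assume "v \<mu> z \<le> 0"
    then obtain x1 where x1: "x0 < x1" "x1 \<le> z" "v \<mu> x1 = 0" "\<forall>x. x0 \<le> x \<and> x < x1 \<longrightarrow> 0 < v \<mu> x" "v' \<mu> x1 < 0"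
      using first_zero[OF ll z] by blast
    have vn: "0 \<le> v \<mu> x" if "x0 \<le> x" "x \<le> x1" for x using x1 that by (metis less_imp_le order_le_imp_less_or_eq order_refl)
    have ph: "v \<mu> x \<le> C + 1" "\<bar>v' \<mu> x\<bar> \<le> C + 1" if "x0 \<le> x" "x \<le> x1" for x
      using decreasing_phase[OF ll _ _ vn _ that] x1 z by auto
    have "2 * \<epsilon> \<le> 1 * wronskian \<mu> x1" by (rule wronskian_big) (use l x1 z vn ph in auto)
    moreover have "wronskian \<mu> x1 \<le> \<epsilon>"
    proof -
      have "wronskian \<mu> x1 = (- u x1) * (- v' \<mu> x1)" by (simp add: wronskian_def x1)
      also have "\<dots> \<le> \<rho> * (- v' \<mu> x1)" using low(1)[of x1] x1 z by (intro mult_right_mono) auto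
      also have "\<dots> \<le> \<rho> * (C + 1)" using ph(2)[of x1] x1 pos by (intro mult_left_mono) auto
      finally show ?thesis using small(5) by (simp add: mult.commute)
    qed
    ultimately show False using pos by auto
  qed
  show "0 < v \<mu> X" using nz[of X] x0 by auto
  show "0 < v' \<mu> X"
  proof (rule ccontr)
    assume n: "\<not> 0 < v' \<mu> X"
    have vn: "0 \<le> v \<mu> x" if "x0 \<le> x" "x \<le> X" for x using nz[OF that] by auto
    have ph: "v \<mu> x \<le> C + 1" "\<bar>v' \<mu> x\<bar> \<le> C + 1" if "x0 \<le> x" "x \<le> X" for x
      using decreasing_phase[OF ll _ _ vn _ that] n x0 by auto
    have "2 * \<epsilon> \<le> 1 * wronskian \<mu> X" by (rule wronskian_big) (use l x0 vn ph in auto)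
    then show False using wronskian_small_right[OF ph(2)[of X]] x0 pos by auto
  qed
qed

text \<open>Now -W has to reach 2 \<epsilon>. If v has a zero before X, convexity carries v and v'
  below zero. If v stays positive, \<open>turn\<close> excludes a point where v stops decreasing,
  because there -W \<le> v u' \<le> (C + 1) \<rho>; and a v that decreases up to X is excluded by
  the size of W at X.\<close>

lemma signs_above:
  assumes l: "\<mu> = l + M * \<epsilon>" shows "v \<mu> X < 0" "v' \<mu> X < 0"
proof -
  have ll: "\<bar>\<mu> - l\<bar> \<le> M * \<epsilon>" using l pos by auto
  have big: "2 * \<epsilon> \<le> - wronskian \<mu> x1" if "x0 \<le> x1" "x1 \<le> X" "\<And>x. x0 \<le> x \<Longrightarrow> x \<le> x1 \<Longrightarrow> 0 \<le> v \<mu> x \<and> v \<mu> x \<le> C + 1" for x1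
    using wronskian_big[of "-1" \<mu> x1] l that by auto
  have "v \<mu> X < 0 \<and> v' \<mu> X < 0"
  proof (cases "\<exists>z. x0 \<le> z \<and> z \<le> X \<and> v \<mu> z \<le> 0")
    case True
    then obtain z where z: "x0 \<le> z" "z \<le> X" "v \<mu> z \<le> 0" by auto
    obtain x1 where x1: "x0 < x1" "x1 \<le> z" "v \<mu> x1 = 0" "\<forall>x. x0 \<le> x \<and> x < x1 \<longrightarrow> 0 < v \<mu> x" "v' \<mu> x1 < 0"
      using first_zero[OF ll z] by blast
    have vn: "0 \<le> v \<mu> x" if "x0 \<le> x" "x \<le> x1" for x using x1 that by (metis less_imp_le order_le_imp_less_or_eq order_refl)
    have ph: "v \<mu> x \<le> C + 1" "\<bar>v' \<mu> x\<bar> \<le> C + 1" if "x0 \<le> x" "x \<le> x1" for x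
      using decreasing_phase[OF ll _ _ vn _ that] x1 z by auto
    have b: "2 * \<epsilon> \<le> - wronskian \<mu> x1" by (rule big) (use x1 z vn ph in auto)
    have "x1 \<noteq> X" using b wronskian_small_right[of \<mu>] ph(2)[of x1] x1 pos by auto
    then show ?thesis using negative_after_zero[OF ll x1(1) _ x1(3,5)] x1 z by auto
  next
    case False
    then have vp: "0 < v \<mu> x" if "x0 \<le> x" "x \<le> X" for x using that by force
    have turn: False if x1: "x0 \<le> x1" "x1 \<le> X" and v1: "0 \<le> v' \<mu> x1"
      and vb: "\<And>x. x0 \<le> x \<Longrightarrow> x \<le> x1 \<Longrightarrow> v \<mu> x \<le> C + 1" and cond: "v' \<mu> x1 = 0 \<or> 0 \<le> u x1" for x1
    proof -
      have "2 * \<epsilon> \<le> - wronskian \<mu> x1" by (rule big) (use x1 vp vb in \<open>auto intro: less_imp_le\<close>)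
      moreover have "v \<mu> x1 * u' x1 \<le> v \<mu> x1 * \<rho>" using low(2)[of x1] vp[of x1] x1 by (intro mult_left_mono) auto
      moreover have "v \<mu> x1 * \<rho> \<le> (C + 1) * \<rho>" using vb[of x1] x1 pos by (intro mult_right_mono) auto
      moreover have "0 \<le> u x1 * v' \<mu> x1" using cond v1 by auto
      ultimately show False using small(5) pos unfolding wronskian_def by linarith
    qed
    have neg: "v' \<mu> x0 < 0"
    proof (rule ccontr)
      assume "\<not> v' \<mu> x0 < 0"
      then show False using turn[of x0] v_at_x0[OF ll] small err_nonneg x0 by fastforce
    qed
    show ?thesis
    proof (cases "v' \<mu> X \<le> 0")
      case True
      have ph: "v \<mu> x \<le> C + 1" "\<bar>v' \<mu> x\<bar> \<le> C + 1" if "x0 \<le> x" "x \<le> X" for x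
        using decreasing_phase[OF ll _ _ less_imp_le[OF vp] _ that] True x0 by auto
      have "2 * \<epsilon> \<le> - wronskian \<mu> X" by (rule big) (use x0 vp ph in \<open>auto intro: less_imp_le\<close>)
      then show ?thesis using wronskian_small_right[OF ph(2)[of X]] x0 pos by auto
    next
      case False
      have "\<exists>x1\<ge>x0. x1 \<le> X \<and> v' \<mu> x1 = 0"
        by (rule IVT) (use neg False x0 DERIV_isCont[OF v(2)] in auto)
      then obtain x1 where x1: "x0 \<le> x1" "x1 \<le> X" "v' \<mu> x1 = 0" by auto
      have "v \<mu> x \<le> C + 1" if "x0 \<le> x" "x \<le> x1" for x
        using decreasing_phase(1)[OF ll x1(1,2) _ _ that] vp x1 by (simp add: less_imp_le)
      then show ?thesis using turn[of x1] x1 by auto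
    qed
  qed
  then show "v \<mu> X < 0" "v' \<mu> X < 0" by auto
qed

lemma param_cont: "isCont (\<lambda>a. v a X) \<mu>" "isCont (\<lambda>a. v' a X) \<mu>"
  using linear_ode_parameter_continuous[OF p, of X v v' "u 0" "u' 0" \<mu>] v v0 x0 by auto

text \<open>The derivative at X changes sign between \<mu> = l - M \<epsilon> and \<mu> = l + M
  \<epsilon>. For the \<mu> in between, a zero in [x0, X] would leave v' negative at X.\<close>

lemma neumann_exists:
  "\<exists>\<mu>. \<bar>\<mu> - l\<bar> \<le> M * \<epsilon> \<and> v' \<mu> X = 0 \<and> (\<forall>x. x0 \<le> x \<and> x \<le> X \<longrightarrow> 0 < v \<mu> x)"
proof -
  have "\<exists>\<mu>\<ge>l - M * \<epsilon>. \<mu> \<le> l + M * \<epsilon> \<and> v' \<mu> X = 0"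
    by (rule IVT2) (use signs_below signs_above pos param_cont in \<open>auto intro: less_imp_le\<close>)
  then obtain \<mu> where m: "l - M * \<epsilon> \<le> \<mu>" "\<mu> \<le> l + M * \<epsilon>" "v' \<mu> X = 0" by auto
  then have l: "\<bar>\<mu> - l\<bar> \<le> M * \<epsilon>" "v' \<mu> X = 0" by auto
  have "0 < v \<mu> x" if x: "x0 \<le> x" "x \<le> X" for x
  proof (rule ccontr)
    assume "\<not> 0 < v \<mu> x"
    then obtain x1 where x1: "x0 < x1" "x1 \<le> x" "v \<mu> x1 = 0" "v' \<mu> x1 < 0"
      using first_zero[OF l(1) x] by auto
    then show False using negative_after_zero(2)[OF l(1) x1(1) _ x1(3,4)] l x by (cases "x1 = X") auto
  qed
  then show ?thesis using l by auto
qed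

text \<open>A first zero before X would make v negative at X, so the zero produced at X is the first
  one.\<close>

lemma dirichlet_exists:
  "\<exists>\<mu>. \<bar>\<mu> - l\<bar> \<le> M * \<epsilon> \<and> v \<mu> X = 0 \<and> v' \<mu> X < 0 \<and> (\<forall>x. x0 \<le> x \<and> x < X \<longrightarrow> 0 < v \<mu> x)"
proof -
  have "\<exists>\<mu>\<ge>l - M * \<epsilon>. \<mu> \<le> l + M * \<epsilon> \<and> v \<mu> X = 0"
    by (rule IVT2) (use signs_below signs_above pos param_cont in \<open>auto intro: less_imp_le\<close>)
  then obtain \<mu> where m: "l - M * \<epsilon> \<le> \<mu>" "\<mu> \<le> l + M * \<epsilon>" "v \<mu> X = 0" by auto
  then have l: "\<bar>\<mu> - l\<bar> \<le> M * \<epsilon>" "v \<mu> X = 0" by auto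
  obtain x1 where x1: "x0 < x1" "x1 \<le> X" "v \<mu> x1 = 0" "\<forall>x. x0 \<le> x \<and> x < x1 \<longrightarrow> 0 < v \<mu> x" "v' \<mu> x1 < 0"
    using first_zero[OF l(1), of X] l x0 by auto
  have "x1 = X" using negative_after_zero(1)[OF l(1) x1(1) _ x1(3,5)] l x1 by (cases "x1 = X") auto
  then show ?thesis using l x1 by auto
qed

text \<open>Up to x0 this is \<open>near\<close>; beyond it a barrier dominates both signs of v - u
  by the maximum principle.\<close>

lemma error_bound:
  assumes l: "\<bar>\<mu> - l\<bar> \<le> M * \<epsilon>" and bc: "v' \<mu> X = 0 \<or> v \<mu> X = 0" and C: "0 < C" and x: "0 \<le> x" "x \<le> X"
  shows "\<bar>v \<mu> x - u x\<bar> \<le> 3 * (err * exp x0) * exp (- x)"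
proof -
  define B where "B = err * exp x0"
  have B0: "(M + 1) * C * \<epsilon> \<le> B"
  proof -
    have "(M + 1) * C * \<epsilon> * 1 \<le> (M + 1) * C * \<epsilon> * exp ((2 + Q) * x0 / 2)" using pos x0 Q_nonneg by (intro mult_left_mono) auto
    also have "\<dots> \<le> err * exp x0" unfolding err_def using x0 pos by (intro mult_left_mono[of 1 "exp x0", simplified mult_1_right]) auto
    finally show ?thesis by (simp add: B_def)
  qed
  have Bpos: "0 < B" using B0 pos C by (smt (verit) mult_pos_pos)
  show ?thesis
  proof (cases "x \<le> x0")
    case True
    have "\<bar>v \<mu> x - u x\<bar> \<le> err * 1" using near(1)[OF l x(1) True] by simp
    also have "\<dots> \<le> err * exp (x0 - x)" using True err_nonneg by (intro mult_left_mono) auto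
    also have "\<dots> = B * exp (- x)" by (simp add: B_def exp_diff exp_minus field_simps)
    also have "\<dots> \<le> 3 * B * exp (- x)" using Bpos by simp
    finally show ?thesis by (simp add: B_def)
  next
    case False
    \<comment> \<open>The barrier satisfies \<psi>'' = \<psi>, and p - \<mu> \<ge> 2 leaves one more
      \<psi> to dominate the forcing. The reflected term 2 exp (x - 2X) makes \<psi>' equal to B exp
      (-X) > 0 at X, as the Neumann alternative requires; it is the source of the factor 3.\<close>
    define \<psi> where "\<psi> x = B * (exp (- x) + 2 * exp (x - 2 * X))" for x
    define \<psi>' where "\<psi>' x = B * (- exp (- x) + 2 * exp (x - 2 * X))" for x
    have d\<psi>: "(\<psi> has_real_derivative \<psi>' x) (at x)" for x
      unfolding \<psi>_def[abs_def] \<psi>'_def by (rule derivative_eq_intros refl | simp)+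
    have d\<psi>': "(\<psi>' has_real_derivative \<psi> x) (at x)" for x
      unfolding \<psi>_def \<psi>'_def[abs_def] by (rule derivative_eq_intros refl | simp)+
    have "0 \<le> \<psi> x - s * (v \<mu> x - u x)" if s: "s = 1 \<or> s = -1" for s
    proof (rule maximum_principle[where a = x0 and b = X and q = "\<lambda>x. p x - \<mu>"
          and G = "\<lambda>x. \<psi> x - s * (v \<mu> x - u x)" and G' = "\<lambda>x. \<psi>' x - s * (v' \<mu> x - u' x)"
          and ?G2.0 = "\<lambda>x. \<psi> x - s * ((p x - \<mu>) * v \<mu> x - ((p x - l) * u x + R x))"])
      fix y assume y: "x0 \<le> y" "y \<le> X"
      show "((\<lambda>x. \<psi> x - s * (v \<mu> x - u x)) has_real_derivative \<psi>' y - s * (v' \<mu> y - u' y)) (at y)"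
        by (intro DERIV_diff DERIV_cmult d\<psi> v du)
      show "((\<lambda>x. \<psi>' x - s * (v' \<mu> x - u' x)) has_real_derivative \<psi> y - s * ((p y - \<mu>) * v \<mu> y - ((p y - l) * u y + R y))) (at y)"
        by (intro DERIV_diff DERIV_cmult d\<psi>' v du')
      have q: "2 \<le> p y - \<mu>" by (rule q2[OF l y])
      then show "0 < p y - \<mu>" by simp
      have 1: "\<bar>(l - \<mu>) * u y\<bar> \<le> (M * \<epsilon>) * (C * exp (- y))"
        unfolding abs_mult using l bu(1)[of y] y x0 by (intro mult_mono) auto
      have "\<bar>(l - \<mu>) * u y - R y\<bar> \<le> (M + 1) * C * \<epsilon> * exp (- y)" using 1 bR[of y] y x0 by (simp add: algebra_simps)
      also have "\<dots> \<le> B * exp (- y)" using B0 by (intro mult_right_mono) auto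
      also have "\<dots> \<le> \<psi> y" unfolding \<psi>_def using Bpos by (intro mult_left_mono) auto
      finally have f: "\<bar>(l - \<mu>) * u y - R y\<bar> \<le> \<psi> y" .
      have "\<psi> y * 2 \<le> \<psi> y * (p y - \<mu>)" using q f by (intro mult_left_mono) auto
      moreover have "- (s * ((l - \<mu>) * u y - R y)) \<le> \<psi> y" using f s by (auto simp: abs_le_iff)
      ultimately show "\<psi> y - s * ((p y - \<mu>) * v \<mu> y - ((p y - l) * u y + R y)) \<le> (p y - \<mu>) * (\<psi> y - s * (v \<mu> y - u y))"
        by (simp add: algebra_simps)
    next
      have "\<bar>v \<mu> x0 - u x0\<bar> \<le> err" using near(1)[OF l, of x0] x0 by auto
      also have "\<dots> = B * exp (- x0)" by (simp add: B_def exp_minus field_simps)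
      also have "\<dots> \<le> \<psi> x0" unfolding \<psi>_def using Bpos by (intro mult_left_mono) auto
      finally show "0 \<le> \<psi> x0 - s * (v \<mu> x0 - u x0)" using s by (auto simp: abs_le_iff)
    next
      show "0 \<le> \<psi> X - s * (v \<mu> X - u X) \<or> 0 < \<psi>' X - s * (v' \<mu> X - u' X)"
      proof (cases "v' \<mu> X = 0")
        case True
        then show ?thesis using uX Bpos by (simp add: \<psi>'_def algebra_simps)
      next
        case False
        then have "v \<mu> X = 0" using bc by auto
        have "\<bar>u X\<bar> \<le> (C * \<epsilon>) * exp (- X)" using uX by simp
        also have "C * \<epsilon> \<le> B" using B0 pos by (simp add: algebra_simps) (smt (verit) mult_nonneg_nonneg)
        finally have "\<bar>u X\<bar> \<le> B * exp (- X)" by (simp add: mult_right_mono)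
        also have "\<dots> \<le> \<psi> X" unfolding \<psi>_def using Bpos by (intro mult_left_mono) auto
        finally show ?thesis using s \<open>v \<mu> X = 0\<close> by (auto simp: abs_le_iff)
      qed
    qed (use x False in auto)
    from this[of 1] this[of "-1"] have "\<bar>v \<mu> x - u x\<bar> \<le> \<psi> x" by (auto simp: abs_le_iff)
    also have "\<dots> \<le> 3 * B * exp (- x)"
    proof -
      have "exp (x - 2 * X) \<le> exp (- x)" using x by simp
      then have "B * (exp (- x) + 2 * exp (x - 2 * X)) \<le> B * (3 * exp (- x))" using Bpos by (intro mult_left_mono) auto
      then show ?thesis by (simp add: \<psi>_def mult_ac)
    qed
    finally show ?thesis by (simp add: B_def)
  qed
qed

end

section \<open>Sturm oscillation and uniqueness of Lam\'e functions\<close>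

text \<open>If w2 had no zero inside, signs could be chosen so that w1 and w2 are positive there.
  Then w1 w2' - w2 w1' is strictly decreasing because h1 < h2, yet the boundary conditions make it
  \<le> 0 at c and \<ge> 0 at d.\<close>

lemma sturm_segment:
  fixes p w1 w1' w2 w2' :: "real \<Rightarrow> real"
  assumes d1: "\<And>x. (w1 has_real_derivative w1' x) (at x)" "\<And>x. (w1' has_real_derivative (p x - h1) * w1 x) (at x)"
    and d2: "\<And>x. (w2 has_real_derivative w2' x) (at x)" "\<And>x. (w2' has_real_derivative (p x - h2) * w2 x) (at x)"
    and h: "h1 < h2" and cd: "c < d"
    and c: "w1 c = 0 \<or> w1' c = 0 \<and> w2' c = 0" and d: "w1 d = 0 \<or> w1' d = 0 \<and> w2' d = 0"
    and nz: "\<And>x. c < x \<Longrightarrow> x < d \<Longrightarrow> w1 x \<noteq> 0"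
  shows "\<exists>x. c < x \<and> x < d \<and> w2 x = 0"
proof (rule ccontr)
  assume "\<nexists>x. c < x \<and> x < d \<and> w2 x = 0"
  then have nz2: "\<And>x. c < x \<Longrightarrow> x < d \<Longrightarrow> w2 x \<noteq> 0" by auto
  have sgn: "\<exists>s. (s = 1 \<or> s = (-1::real)) \<and> (\<forall>x. c < x \<and> x < d \<longrightarrow> 0 < s * w x)"
    if dw: "\<And>x. (w has_real_derivative w' x) (at x)" and nz: "\<And>x. c < x \<Longrightarrow> x < d \<Longrightarrow> w x \<noteq> 0" for w w' :: "real \<Rightarrow> real"
  proof -
    define m where "m = (c + d) / 2"
    have m: "c < m" "m < d" using cd by (auto simp: m_def)
    define s where "s = sgn (w m)"
    have s: "s = 1 \<or> s = -1" "0 < s * w m" using nz[OF m] by (auto simp: s_def sgn_if)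
    have "0 < s * w x" if x: "c < x" "x < d" for x
    proof (rule ccontr)
      assume n: "\<not> 0 < s * w x"
      have cont: "isCont (\<lambda>x. s * w x) y" for y using DERIV_isCont[OF dw] by (intro continuous_intros) 
      have "\<exists>y. min x m \<le> y \<and> y \<le> max x m \<and> s * w y = 0"
      proof (cases "x \<le> m")
        case True
        then show ?thesis using IVT[of "\<lambda>x. s * w x" x 0 m] n s(2) cont by (auto simp: min_def max_def)
      next
        case False
        then show ?thesis using IVT2[of "\<lambda>x. s * w x" x 0 m] n s(2) cont by (auto simp: min_def max_def)
      qed
      then obtain y where y: "min x m \<le> y" "y \<le> max x m" "s * w y = 0" by auto
      moreover have "c < min x m" "max x m < d" using x m by auto
      ultimately have "w y \<noteq> 0" by (intro nz) linarith+
      then show False using y s by auto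
    qed
    then show ?thesis using s by blast
  qed
  obtain s where s: "s = 1 \<or> s = (-1::real)" "\<And>x. c < x \<Longrightarrow> x < d \<Longrightarrow> 0 < s * w1 x"
    using sgn[OF d1(1) nz] by blast
  obtain t where t: "t = 1 \<or> t = (-1::real)" "\<And>x. c < x \<Longrightarrow> x < d \<Longrightarrow> 0 < t * w2 x"
    using sgn[OF d2(1) nz2] by blast
  have nn: "0 \<le> r * w x" if r: "\<And>x. c < x \<Longrightarrow> x < d \<Longrightarrow> 0 < r * w x" and dw: "\<And>x. (w has_real_derivative w' x) (at x)"
    and x: "c \<le> x" "x \<le> d" for r x and w w' :: "real \<Rightarrow> real"
  proof -
    have "continuous_on (closure {c<..<d}) (\<lambda>x. r * w x)"
      using DERIV_isCont[OF dw] by (intro continuous_intros continuous_at_imp_continuous_on) auto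
    then show ?thesis
      by (rule continuous_ge_on_closure[where a = 0]) (use cd x r in \<open>auto intro: less_imp_le\<close>)
  qed
  define W where "W x = (s * w1 x) * (t * w2' x) - (t * w2 x) * (s * w1' x)" for x
  have dW: "(W has_real_derivative (h1 - h2) * ((s * w1 x) * (t * w2 x))) (at x)" for x
    unfolding W_def[abs_def]
    by (rule DERIV_cong[OF DERIV_diff[OF DERIV_mult[OF DERIV_cmult[OF d1(1)] DERIV_cmult[OF d2(2)]]
       DERIV_mult[OF DERIV_cmult[OF d2(1)] DERIV_cmult[OF d1(2)]]]]) (simp add: algebra_simps)
  have "\<exists>z. z > c \<and> z < d \<and> W d - W c = (d - c) * ((h1 - h2) * ((s * w1 z) * (t * w2 z)))"
    by (rule MVT2[OF cd dW])
  then obtain z where z: "c < z" "z < d" "W d - W c = (d - c) * ((h1 - h2) * ((s * w1 z) * (t * w2 z)))" by auto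
  have "(h1 - h2) * ((s * w1 z) * (t * w2 z)) < 0"
    by (intro mult_neg_pos mult_pos_pos[OF s(2)[OF z(1,2)] t(2)[OF z(1,2)]]) (use h in auto)
  then have less: "W d < W c" using z cd mult_pos_neg[of "d - c"] by fastforce
  have "W c \<le> 0"
  proof (cases "w1 c = 0")
    case True
    have "0 \<le> s * w1' c"
    proof (rule ccontr)
      assume "\<not> 0 \<le> s * w1' c"
      then obtain e where e: "e > 0" "\<And>h. 0 < h \<Longrightarrow> h < e \<Longrightarrow> s * w1 (c + h) < s * w1 c"
        using DERIV_neg_dec_right[OF DERIV_cmult[OF d1(1), of s c]] by auto
      define h where "h = min e (d - c) / 2"
      have "0 < h" "h < e" "c + h < d" using e cd by (auto simp: h_def min_def field_simps)
      then show False using e(2)[of h] s(2)[of "c + h"] True by auto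
    qed
    then show ?thesis using True nn[OF t(2) d2(1), of c] cd by (simp add: W_def)
  qed (use c in \<open>simp add: W_def\<close>)
  moreover have "0 \<le> W d"
  proof (cases "w1 d = 0")
    case True
    have "s * w1' d \<le> 0"
    proof (rule ccontr)
      assume "\<not> s * w1' d \<le> 0"
      then obtain e where e: "e > 0" "\<And>h. 0 < h \<Longrightarrow> h < e \<Longrightarrow> s * w1 (d - h) < s * w1 d"
        using DERIV_pos_inc_left[OF DERIV_cmult[OF d1(1), of s d]] by auto
      define h where "h = min e (d - c) / 2"
      have "0 < h" "h < e" "c < d - h" using e cd by (auto simp: h_def min_def field_simps)
      then show False using e(2)[of h] s(2)[of "d - h"] True by auto
    qed
    then show ?thesis using True nn[OF t(2) d2(1), of d] cd by (simp add: W_def mult_nonneg_nonpos)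
  qed (use d in \<open>simp add: W_def\<close>)
  ultimately show False using less by simp
qed

text \<open>The zeros of w1 cut [a, b] into one more segment than there are zeros, and
  \<open>sturm_segment\<close> places a zero of w2 inside each.\<close>

lemma sturm_zero_count:
  fixes p w1 w1' w2 w2' :: "real \<Rightarrow> real"
  assumes d1: "\<And>x. (w1 has_real_derivative w1' x) (at x)" "\<And>x. (w1' has_real_derivative (p x - h1) * w1 x) (at x)"
    and d2: "\<And>x. (w2 has_real_derivative w2' x) (at x)" "\<And>x. (w2' has_real_derivative (p x - h2) * w2 x) (at x)"
    and h: "h1 < h2" and ab: "a < b"
    and a: "w1 a = 0 \<or> w1' a = 0 \<and> w2' a = 0" and b: "w1 b = 0 \<or> w1' b = 0 \<and> w2' b = 0"
    and fin: "finite {x. a < x \<and> x < b \<and> w1 x = 0}" "finite {x. a < x \<and> x < b \<and> w2 x = 0}"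
  shows "card {x. a < x \<and> x < b \<and> w1 x = 0} < card {x. a < x \<and> x < b \<and> w2 x = 0}"
proof -
  let ?Z = "{x. a < x \<and> x < b \<and> w1 x = 0}" and ?Y = "{x. a < x \<and> x < b \<and> w2 x = 0}"
  define nxt where "nxt c = Min {d \<in> insert b ?Z. c < d}" for c
  have nx: "c < nxt c \<and> nxt c \<in> insert b ?Z \<and> (\<forall>d\<in>insert b ?Z. c < d \<longrightarrow> nxt c \<le> d)" if c: "c \<in> insert a ?Z" for c
  proof -
    have f: "finite {d \<in> insert b ?Z. c < d}" using fin(1) by simp
    have ne: "b \<in> {d \<in> insert b ?Z. c < d}" using c ab by auto
    have "nxt c \<in> {d \<in> insert b ?Z. c < d}" unfolding nxt_def by (rule Min_in[OF f]) (use ne in blast)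
    moreover have "nxt c \<le> d" if "d \<in> insert b ?Z" "c < d" for d unfolding nxt_def by (rule Min_le[OF f]) (use that in blast)
    ultimately show ?thesis by blast
  qed
  have "\<exists>x. c < x \<and> x < nxt c \<and> w2 x = 0" if c: "c \<in> insert a ?Z" for c
  proof (rule sturm_segment[OF d1 d2 h])
    show "c < nxt c" using nx[OF c] by simp
    show "w1 c = 0 \<or> w1' c = 0 \<and> w2' c = 0" using c a by auto
    show "w1 (nxt c) = 0 \<or> w1' (nxt c) = 0 \<and> w2' (nxt c) = 0" using nx[OF c] b by auto
    show "w1 x \<noteq> 0" if x: "c < x" "x < nxt c" for x
    proof
      assume "w1 x = 0"
      moreover have "a < x" "x < b" using x c nx[OF c] ab by auto
      ultimately show False using nx[OF c] x by force
    qed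
  qed
  then obtain f where f: "\<And>c. c \<in> insert a ?Z \<Longrightarrow> c < f c \<and> f c < nxt c \<and> w2 (f c) = 0" by metis
  have lt: "f c < f c'" if "c \<in> insert a ?Z" "c' \<in> insert a ?Z" "c < c'" for c c'
  proof -
    have "c' \<in> insert b ?Z" using that by auto
    then have "nxt c \<le> c'" using nx[OF that(1)] that(3) by blast
    then show ?thesis using f[OF that(1)] f[OF that(2)] by linarith
  qed
  have "inj_on f (insert a ?Z)"
  proof (rule inj_onI, rule ccontr)
    fix x y assume xy: "x \<in> insert a ?Z" "y \<in> insert a ?Z" "f x = f y" "x \<noteq> y"
    then have "x < y \<or> y < x" by linarith
    then show False using lt[OF xy(1,2)] lt[OF xy(2,1)] xy(3) by linarith
  qed
  moreover have "f ` insert a ?Z \<subseteq> ?Y"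
  proof
    fix y assume "y \<in> f ` insert a ?Z"
    then obtain c where c: "c \<in> insert a ?Z" "y = f c" by blast
    have "a \<le> c" "nxt c \<le> b" using c nx[OF c(1)] ab by auto
    then show "y \<in> ?Y" using f[OF c(1)] c(2) by auto
  qed
  ultimately have "card (insert a ?Z) \<le> card ?Y" using fin(2) card_inj_on_le by blast
  moreover have "card (insert a ?Z) = Suc (card ?Z)" using fin(1) by simp
  ultimately show ?thesis by linarith
qed

section \<open>Uniqueness of the Lame functions\<close>

context modulus
begin

lemma lame_solutionD:
  assumes "lame_solution k \<nu> h w"
  shows "(w has_real_derivative deriv w z) (at z)"
    "(deriv w has_real_derivative (\<nu> * (\<nu> + 1) * k^2 * (jacobi_sn k z)^2 - h) * w z) (at z)"
  using assms unfolding lame_solution_def by (simp_all add: algebra_simps)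

lemma lame_solution_proportional:
  assumes w: "lame_solution k \<nu> h w" "lame_solution k \<nu> h y"
    and "y z = c * w z" "deriv y z = c * deriv w z"
  shows "y = (\<lambda>x. c * w x)" "deriv y = (\<lambda>x. c * deriv w x)"
proof -
  have "y = (\<lambda>x. c * w x) \<and> deriv y = (\<lambda>x. c * deriv w x)"
  proof (rule linear_ode_unique[where q = "\<lambda>z. \<nu> * (\<nu> + 1) * k^2 * (jacobi_sn k z)^2 - h"])
    show "isCont (\<lambda>z. \<nu> * (\<nu> + 1) * k^2 * (jacobi_sn k z)^2 - h) x" for x
      by (intro continuous_intros DERIV_isCont[OF sn_deriv])
    show "((\<lambda>x. c * w x) has_real_derivative c * deriv w x) (at x)" for x
      by (rule DERIV_cmult[OF lame_solutionD(1)[OF w(1)]])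
    show "((\<lambda>x. c * deriv w x) has_real_derivative (\<nu> * (\<nu> + 1) * k^2 * (jacobi_sn k x)^2 - h) * (c * w x)) (at x)" for x
      by (rule DERIV_cong[OF DERIV_cmult[OF lame_solutionD(2)[OF w(1)]]]) simp
  qed (rule lame_solutionD[OF w(2)] assms)+
  then show "y = (\<lambda>x. c * w x)" "deriv y = (\<lambda>x. c * deriv w x)" by auto
qed

text \<open>For fixed boundary conditions the number of interior zeros is strictly increasing in
  h.\<close>

lemma eigenvalue_unique:
  assumes w: "lame_solution k \<nu> h1 w1" "lame_solution k \<nu> h2 w2"
    and bc: "(\<forall>z\<in>{- elliptic_K k, elliptic_K k}. deriv w1 z = 0 \<and> deriv w2 z = 0) \<or>
      (\<forall>z\<in>{- elliptic_K k, elliptic_K k}. w1 z = 0 \<and> w2 z = 0)"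
    and fin: "finite (lame_zeros k w1)" "finite (lame_zeros k w2)" and card: "card (lame_zeros k w1) = card (lame_zeros k w2)"
  shows "h1 = h2"
proof -
  have "\<not> h < h'" if y: "lame_solution k \<nu> h y" "lame_solution k \<nu> h' y'"
    and bc: "(\<forall>z\<in>{- elliptic_K k, elliptic_K k}. deriv y z = 0 \<and> deriv y' z = 0) \<or>
      (\<forall>z\<in>{- elliptic_K k, elliptic_K k}. y z = 0 \<and> y' z = 0)"
    and fin: "finite (lame_zeros k y)" "finite (lame_zeros k y')" "card (lame_zeros k y) = card (lame_zeros k y')" for h h' y y'
  proof
    assume "h < h'"
    then have "card (lame_zeros k y) < card (lame_zeros k y')"
      unfolding lame_zeros_def
    proof (rule sturm_zero_count[OF lame_solutionD(1)[OF y(1)] lame_solutionD(2)[OF y(1)]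
          lame_solutionD(1)[OF y(2)] lame_solutionD(2)[OF y(2)]])
      show "- elliptic_K k < elliptic_K k" using K_pos by simp
    qed (use fin bc in \<open>auto simp: lame_zeros_def\<close>)
    then show False using fin by simp
  qed
  from this[OF w bc fin card] this[OF w(2,1) _ fin(2,1) card[symmetric]] bc
  show ?thesis by (metis linorder_less_linear)
qed

lemma normalised_scale:
  assumes "lame_normalised k w" "lame_normalised k (\<lambda>z. c * w z)" shows "c = 1 \<or> c = -1"
proof -
  have "(\<lambda>z. jacobi_dn k z * (c * w z)^2) = (\<lambda>z. c^2 * (jacobi_dn k z * (w z)^2))" by (auto simp: power_mult_distrib)
  then have "c^2 * (LBINT z=- elliptic_K k..elliptic_K k. jacobi_dn k z * (w z)^2) = pi / 2"
    using assms(2) unfolding lame_normalised_def by simp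
  then have "c^2 * (pi / 2) = pi / 2" using assms(1) by (simp only: lame_normalised_def)
  then show ?thesis by (simp add: power2_eq_1_iff)
qed

text \<open>Resolves the nested definite descriptions: the zero count determines h, the Neumann
  condition at K makes solutions proportional, the normalisation leaves a factor 1 or -1, and the
  sign at K decides.\<close>

lemma lame_Ec_eqI:
  assumes w: "Ec_eigenfunction k \<nu> m h w" and n: "lame_normalised k w" "w (elliptic_K k) > 0"
  shows "lame_Ec k \<nu> m = w"
proof -
  note w' = w[unfolded Ec_eigenfunction_def]
  have hu: "h' = h" if "Ec_eigenfunction k \<nu> m h' w'" for h' w'
  proof (rule eigenvalue_unique)
    show "lame_solution k \<nu> h' w'" "lame_solution k \<nu> h w" "finite (lame_zeros k w')" "finite (lame_zeros k w)"
      using that w by (simp_all add: Ec_eigenfunction_def)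
  qed (use that w in \<open>simp_all add: Ec_eigenfunction_def\<close>)
  have a: "lame_a k \<nu> m = h" unfolding lame_a_def by (rule the_equality) (use w hu in blast)+
  show ?thesis unfolding lame_Ec_def a
  proof (rule the_equality)
    fix y assume y: "Ec_eigenfunction k \<nu> m h y \<and> lame_normalised k y \<and> y (elliptic_K k) > 0"
    define c where "c = y (elliptic_K k) / w (elliptic_K k)"
    have c: "0 < c" using y n by (simp add: c_def)
    have e: "y = (\<lambda>x. c * w x)"
      by (rule lame_solution_proportional(1)[where z = "elliptic_K k" and \<nu> = \<nu> and h = h])
         (use w' y n in \<open>simp_all add: Ec_eigenfunction_def c_def\<close>)
    then have "c = 1 \<or> c = -1" using normalised_scale n y by metis
    then show "y = w" using c e by auto
  qed (use w n in blast)
qed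

text \<open>As for \<open>lame_Ec_eqI\<close>, except that the function vanishes at K and its
  derivative there fixes the factor.\<close>

lemma lame_Es_eqI:
  assumes w: "Es_eigenfunction k \<nu> j h w" and n: "lame_normalised k w" "deriv w (elliptic_K k) < 0"
  shows "lame_Es k \<nu> j = w"
proof -
  note w' = w[unfolded Es_eigenfunction_def]
  have hu: "h' = h" if "Es_eigenfunction k \<nu> j h' w'" for h' w'
  proof (rule eigenvalue_unique)
    show "lame_solution k \<nu> h' w'" "lame_solution k \<nu> h w" "finite (lame_zeros k w')" "finite (lame_zeros k w)"
      using that w by (simp_all add: Es_eigenfunction_def)
  qed (use that w in \<open>simp_all add: Es_eigenfunction_def\<close>)
  have b: "lame_b k \<nu> j = h" unfolding lame_b_def by (rule the_equality) (use w hu in blast)+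
  show ?thesis unfolding lame_Es_def b
  proof (rule the_equality)
    fix y assume y: "Es_eigenfunction k \<nu> j h y \<and> lame_normalised k y \<and> deriv y (elliptic_K k) < 0"
    define c where "c = deriv y (elliptic_K k) / deriv w (elliptic_K k)"
    have c: "0 < c" using y n by (simp add: c_def divide_neg_neg)
    have e: "y = (\<lambda>x. c * w x)"
      by (rule lame_solution_proportional(1)[where z = "elliptic_K k" and \<nu> = \<nu> and h = h])
         (use w' y n in \<open>simp_all add: Es_eigenfunction_def c_def\<close>)
    then have "c = 1 \<or> c = -1" using normalised_scale n y by metis
    then show "y = w" using c e by auto
  qed (use w n in blast)
qed

end

section \<open>The recursion for \<open>A\<^sub>s\<close> and \<open>B\<^sub>s\<close>\<close>

text \<open>The sign s is a parameter so that even (s = 1) and odd (s = -1) polynomials share one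
  calculus; stated as an identity of polynomials, it can be differentiated.\<close>

definition has_parity :: "real \<Rightarrow> real poly \<Rightarrow> bool" where
  "has_parity s p \<longleftrightarrow> pcompose p [:0, -1:] = smult s p"

lemma has_parity_iff: "has_parity s p \<longleftrightarrow> (\<forall>t. poly p (- t) = s * poly p t)"
proof -
  have "has_parity s p \<longleftrightarrow> poly (pcompose p [:0, -1:]) = poly (smult s p)"
    unfolding has_parity_def poly_eq_poly_eq_iff ..
  then show ?thesis by (auto simp: poly_pcompose fun_eq_iff)
qed

lemma even_poly_iff: "even_poly p \<longleftrightarrow> has_parity 1 p" and odd_poly_iff: "odd_poly p \<longleftrightarrow> has_parity (-1) p"
  by (simp_all add: even_poly_def odd_poly_def has_parity_iff)

lemma has_parity_0 [simp]: "has_parity s 0" and has_parity_1 [simp]: "has_parity 1 1" and has_parity_T: "has_parity (-1) [:0, 1:]"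
  by (simp_all add: has_parity_iff)

lemma has_parity_add: "has_parity s p \<Longrightarrow> has_parity s q \<Longrightarrow> has_parity s (p + q)"
  and has_parity_diff: "has_parity s p \<Longrightarrow> has_parity s q \<Longrightarrow> has_parity s (p - q)"
  and has_parity_smult: "has_parity s p \<Longrightarrow> has_parity s (smult c p)"
  and has_parity_uminus: "has_parity s p \<Longrightarrow> has_parity s (- p)"
  by (simp_all add: has_parity_iff algebra_simps)

lemma has_parity_sum: "(\<And>i. i \<in> I \<Longrightarrow> has_parity s (f i)) \<Longrightarrow> has_parity s (sum f I)"
  by (induction I rule: infinite_finite_induct) (auto intro: has_parity_add)

lemma has_parity_mult: "has_parity s p \<Longrightarrow> has_parity r q \<Longrightarrow> s * r = a \<Longrightarrow> has_parity a (p * q)"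
  by (auto simp: has_parity_iff)

text \<open>The parity of the derivative is r = -s; the side conditions are put as products so that
  simplification settles them also for powers of -1.\<close>

lemma has_parity_pderiv: assumes "has_parity s p" "s * r = - 1" "s * s = 1" shows "has_parity r (pderiv p)"
proof -
  have r: "r = - s" using assms(2,3) by (metis mult.assoc mult.commute mult_1 mult_minus1)
  have "pderiv (pcompose p [:0, -1:]) = pderiv (smult s p)" using assms(1) by (simp add: has_parity_def)
  then have "- pcompose (pderiv p) [:0, -1:] = smult s (pderiv p)" by (simp add: pderiv_pcompose pderiv_smult pderiv_pCons)
  then have "pcompose (pderiv p) [:0, -1:] = - smult s (pderiv p)" by (metis minus_minus)
  then show ?thesis using r by (simp add: has_parity_def)
qed

lemma has_parity_numeral: "has_parity 1 (numeral n)"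
  by (simp add: has_parity_iff)

lemma has_parity_coeff: assumes "has_parity s p" shows "(-1)^i * coeff p i = s * coeff p i"
  using assms coeff_pcompose_linear[of p "-1" i] unfolding has_parity_def by (metis coeff_smult)

lemma pderiv_sum: "pderiv (sum f I) = (\<Sum>i\<in>I. pderiv (f i))"
  by (induction I rule: infinite_finite_induct) (auto simp: pderiv_add)

lemma polynomial_antiderivative: "\<exists>a::real poly. pderiv a = f \<and> poly a 0 = 0"
proof -
  let ?a = "\<Sum>i\<le>degree f. monom (coeff f i / real (Suc i)) (Suc i)"
  have "pderiv ?a = (\<Sum>i\<le>degree f. monom (coeff f i) i)"
    unfolding pderiv_sum by (intro sum.cong refl) (simp add: pderiv_monom del: of_nat_Suc)
  then have "pderiv ?a = f" by (simp add: poly_as_sum_of_monoms)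
  moreover have "poly ?a 0 = 0" by (simp add: poly_sum poly_monom)
  ultimately show ?thesis by blast
qed

lemma even_if_pderiv_odd: assumes "has_parity (-1) (pderiv a)" "poly a 0 = 0" shows "has_parity 1 a"
proof -
  have "pderiv (pcompose a [:0, -1:] - a) = 0"
    using assms(1) by (simp add: has_parity_def pderiv_diff pderiv_pcompose pderiv_pCons)
  then obtain h where h: "pcompose a [:0, -1:] - a = [:h:]" using pderiv_iszero by blast
  then have "poly (pcompose a [:0, -1:] - a) 0 = h" by simp
  then have "h = 0" using assms(2) by (simp add: poly_pcompose)
  then show ?thesis using h by (simp add: has_parity_def)
qed

section \<open>One step of the recursion as a linear problem\<close>

context
  fixes m :: nat
begin

definition qpoly :: "real poly" where "qpoly = [:- real m - 1/2, 0, 1/4:]"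

text \<open>Eliminating \<open>A\<close> between the two recursion identities leaves a third order operator acting
  on \<open>B\<close>; it maps \<open>t^p\<close> to \<open>(p+1)/2 t^(p+1)\<close> plus lower order terms.\<close>

definition elim_op :: "real poly \<Rightarrow> real poly" where
  "elim_op b = - smult (1/2) (pderiv (pderiv (pderiv b))) + 2 * qpoly * pderiv b + smult (1/2) ([:0, 1:] * b)"

lemma elim_op_diff: "elim_op (a - b) = elim_op a - elim_op b"
  by (simp add: elim_op_def pderiv_diff algebra_simps smult_diff_right)

lemma elim_op_parity: assumes "has_parity (-1) b" shows "has_parity 1 (elim_op b)"
proof -
  have 1: "has_parity 1 (pderiv b)" by (rule has_parity_pderiv[OF assms]) auto
  have 2: "has_parity (-1) (pderiv (pderiv b))" by (rule has_parity_pderiv[OF 1]) auto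
  have 3: "has_parity 1 (pderiv (pderiv (pderiv b)))" by (rule has_parity_pderiv[OF 2]) auto
  have q: "has_parity 1 qpoly" by (simp add: has_parity_iff qpoly_def algebra_simps)
  show ?thesis unfolding elim_op_def
    by (intro has_parity_add has_parity_smult has_parity_uminus 3 has_parity_mult[OF has_parity_mult[OF has_parity_numeral q] 1]
      has_parity_mult[OF has_parity_T assms]) auto
qed

lemma degree_elim_op: "degree (elim_op b) \<le> degree b + 1"
proof -
  have "degree (pderiv (pderiv (pderiv b))) \<le> degree b + 1" by (simp add: degree_pderiv)
  moreover have "degree (2 * qpoly * pderiv b) \<le> degree b + 1"
  proof (cases "degree b = 0")
    case True
    then have "pderiv b = 0" by (simp only: pderiv_eq_0_iff)
    then show ?thesis by simp
  next
    case False
    have "degree (2 * qpoly * pderiv b) \<le> degree (2 * qpoly) + degree (pderiv b)" by (rule degree_mult_le)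
    also have "degree (2 * qpoly) \<le> 2"
      using degree_mult_le[of 2 qpoly] by (simp add: qpoly_def)
    finally show ?thesis using False by (simp add: degree_pderiv)
  qed
  moreover have "degree ([:0, 1:] * b) \<le> degree b + 1" using degree_mult_le[of "[:0,1:]" b] by simp
  ultimately show ?thesis unfolding elim_op_def
    by (intro degree_add_le degree_diff_le order_trans[OF degree_smult_le]) (auto intro: order_trans[OF degree_smult_le])
qed

text \<open>d/2 comes from 2 q b' and 1/2 from t b / 2; the third derivative does not reach this
  degree.\<close>

lemma coeff_elim_op: assumes "degree b = d" shows "coeff (elim_op b) (d + 1) = real (d + 1) / 2 * coeff b d"
proof -
  have 1: "coeff (pderiv (pderiv (pderiv b))) (d + 1) = 0"
    by (rule coeff_eq_0) (use assms in \<open>simp add: degree_pderiv\<close>)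
  have 2: "coeff (qpoly * p) (d + 1) = (- real m - 1/2) * coeff p (d + 1) + (case d of 0 \<Rightarrow> 0 | Suc e \<Rightarrow> coeff p e / 4)" for p
    unfolding qpoly_def by (auto simp: mult_pCons_left coeff_pCons split: nat.split)
  have 3: "coeff (pderiv b) (d + 1) = 0" using assms by (simp add: coeff_pderiv coeff_eq_0)
  have 4: "coeff (qpoly * pderiv b) (d + 1) = real d / 4 * coeff b d"
    unfolding 2 3 by (auto simp: coeff_pderiv split: nat.split)
  have "coeff (2 * qpoly * pderiv b) (d + 1) = 2 * coeff (qpoly * pderiv b) (d + 1)"
    by (simp add: numeral_poly)
  then show ?thesis unfolding elim_op_def using 1 4 by (simp add: mult_pCons_left field_simps)
qed

text \<open>Descent on the degree: an even H has even degree n, a monomial of odd degree n - 1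
  removes the top term, and parity is kept, so a constant remains. Nonzero constants are not in the
  image of odd polynomials, which is why each step of the recursion needs its own \<mu>.\<close>

lemma elim_op_solvable:
  assumes "has_parity 1 H" shows "\<exists>b \<mu>. has_parity (-1) b \<and> elim_op b + [:\<mu>:] = H"
  using assms
proof (induction "degree H" arbitrary: H rule: less_induct)
  case less
  show ?case
  proof (cases "degree H = 0")
    case True
    then obtain c where "H = [:c:]" by (metis degree_eq_zeroE)
    then show ?thesis by (intro exI[of _ 0] exI[of _ c]) (simp add: elim_op_def)
  next
    case False
    define n where "n = degree H"
    have lc: "coeff H n \<noteq> 0" using False unfolding n_def by auto
    have "(-1)^n * coeff H n = 1 * coeff H n" by (rule has_parity_coeff[OF less.prems])
    then have "even n" using lc by (cases "even n") auto
    then have n2: "n \<ge> 2" "odd (n - 1)" using False n_def by (auto elim!: evenE)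
    define b0 where "b0 = monom (2 * coeff H n / real n) (n - 1)"
    have b0: "has_parity (-1) b0"
      unfolding has_parity_iff b0_def poly_monom using n2 by (simp add: power_minus_odd)
    have deg: "degree b0 = n - 1" unfolding b0_def using lc n2 by (simp add: degree_monom_eq)
    have "coeff (elim_op b0) (n - 1 + 1) = real (n - 1 + 1) / 2 * coeff b0 (n - 1)" by (rule coeff_elim_op[OF deg])
    then have ce: "coeff (elim_op b0) n = coeff H n" using n2 by (simp add: b0_def)
    have "degree (H - elim_op b0) \<le> n"
      using degree_elim_op[of b0] deg n2 n_def by (intro degree_diff_le) auto
    moreover have "coeff (H - elim_op b0) n = 0" using ce by simp
    ultimately have "degree (H - elim_op b0) < degree H"
      using n2 n_def by (metis degree_0 eq_zero_or_degree_less less_le_trans pos2)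
    then obtain b \<mu> where "has_parity (-1) b" "elim_op b + [:\<mu>:] = H - elim_op b0"
      using less.hyps has_parity_diff[OF less.prems elim_op_parity[OF b0]] by blast
    then show ?thesis using b0 elim_op_diff[of "b + b0" b0]
      by (intro exI[of _ "b + b0"] exI[of _ \<mu>]) (auto intro: has_parity_add simp: algebra_simps)
  qed
qed

text \<open>For b nonzero the image has a nonzero coefficient in degree \<open>degree b + 1\<close>,
  which a constant cannot cancel.\<close>

lemma elim_op_injective:
  assumes "has_parity (-1) b" "elim_op b + [:\<mu>:] = 0" shows "b = 0"
proof (rule ccontr)
  assume "b \<noteq> 0"
  then have "coeff (elim_op b) (degree b + 1) \<noteq> 0" unfolding coeff_elim_op[OF refl] by (simp del: of_nat_add of_nat_Suc)
  then have "coeff (elim_op b + [:\<mu>:]) (degree b + 1) \<noteq> 0" by (simp add: coeff_pCons)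
  then show False using assms(2) by simp
qed

text \<open>The s-th step of the recursion for the unknowns A_s, B_s and \<mu>_s, with everything of
  lower index collected in F and G.\<close>

definition solves :: "real poly \<Rightarrow> real poly \<Rightarrow> real poly \<times> real poly \<times> real \<Rightarrow> bool" where
  "solves F G = (\<lambda>(a, b, \<mu>). has_parity 1 a \<and> poly a 0 = 0 \<and> has_parity (-1) b \<and>
     2 * pderiv a + pderiv (pderiv b) = F \<and>
     pderiv (pderiv a) + 2 * qpoly * pderiv b + smult (1/2) ([:0, 1:] * b) + [:\<mu>:] = G)"

text \<open>Subtracting half the derivative of the first equation from the second eliminates a and
  leaves the equation for \<open>elim_op\<close>; a is then recovered by integration, with the
  constant fixed by a(0) = 0.\<close>

lemma solves_exists: assumes "has_parity (-1) F" "has_parity 1 G" shows "\<exists>r. solves F G r"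
proof -
  have "has_parity 1 (pderiv F)" by (rule has_parity_pderiv[OF assms(1)]) auto
  then have "has_parity 1 (G - smult (1/2) (pderiv F))" by (intro has_parity_diff has_parity_smult assms)
  then obtain b \<mu> where b: "has_parity (-1) b" "elim_op b + [:\<mu>:] = G - smult (1/2) (pderiv F)"
    using elim_op_solvable by blast
  have 1: "has_parity 1 (pderiv b)" by (rule has_parity_pderiv[OF b(1)]) auto
  have 2: "has_parity (-1) (pderiv (pderiv b))" by (rule has_parity_pderiv[OF 1]) auto
  obtain a where a: "pderiv a = smult (1/2) (F - pderiv (pderiv b))" "poly a 0 = 0"
    using polynomial_antiderivative by blast
  have "has_parity 1 a" by (rule even_if_pderiv_odd[OF _ a(2)]) (unfold a, intro has_parity_smult has_parity_diff assms 2)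
  moreover have "2 * pderiv a + pderiv (pderiv b) = F"
    unfolding a by (simp add: numeral_poly)
  moreover have "pderiv (pderiv a) + 2 * qpoly * pderiv b + smult (1/2) ([:0, 1:] * b) + [:\<mu>:] = G"
    using b(2) unfolding a elim_op_def by (simp add: pderiv_smult pderiv_diff smult_diff_right algebra_simps)
  ultimately have "solves F G (a, b, \<mu>)" unfolding solves_def prod.case using a(2) b(1) by blast
  then show ?thesis by blast
qed

lemma solves_unique: assumes "solves F G r" "solves F G r'" shows "r = r'"
proof -
  obtain a b \<mu> a' b' \<mu>' where r: "r = (a, b, \<mu>)" "r' = (a', b', \<mu>')" by (metis prod.exhaust)
  have D: "2 * pderiv c + pderiv (pderiv d) = F \<Longrightarrow> pderiv c = smult (1/2) (F - pderiv (pderiv d))" for c d :: "real poly"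
  proof -
    assume "2 * pderiv c + pderiv (pderiv d) = F"
    then have "F - pderiv (pderiv d) = smult 2 (pderiv c)" by (auto simp: numeral_poly)
    then show ?thesis by simp
  qed
  have p: "pderiv a = smult (1/2) (F - pderiv (pderiv b))" "pderiv a' = smult (1/2) (F - pderiv (pderiv b'))"
    using assms r D by (auto simp: solves_def)
  have e: "elim_op b + [:\<mu>:] = G - smult (1/2) (pderiv F)" "elim_op b' + [:\<mu>':] = G - smult (1/2) (pderiv F)"
    using assms unfolding r solves_def elim_op_def
    by (auto simp: p pderiv_smult pderiv_diff smult_diff_right algebra_simps)
  have "elim_op (b - b') + [:\<mu> - \<mu>':] = (elim_op b + [:\<mu>:]) - (elim_op b' + [:\<mu>':])" by (simp add: elim_op_diff)
  also have "\<dots> = 0" using e by simp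
  finally have z: "elim_op (b - b') + [:\<mu> - \<mu>':] = 0" .
  have "has_parity (-1) b" "has_parity (-1) b'" using assms unfolding r solves_def by auto
  from elim_op_injective[OF has_parity_diff[OF this] z] have "b - b' = 0" .
  then have bb: "b = b'" by simp
  then have "[:\<mu>:] = [:\<mu>':]" using e by (metis add_left_imp_eq)
  then have mm: "\<mu> = \<mu>'" by simp
  have "pderiv (a - a') = 0" using p bb by (simp add: pderiv_diff)
  then obtain h where h: "a - a' = [:h:]" using pderiv_iszero by blast
  have "poly (a - a') 0 = 0" using assms r by (simp add: solves_def)
  then have "a = a'" using h by simp
  then show ?thesis using r bb mm by simp
qed

section \<open>The coefficient sequences\<close>

context
  fixes k :: real
begin

text \<open>Together with \<open>rhs2\<close>: the recursion identities solved for their terms of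
  index s. The sums stop before s because the term j = s is \<mu>_s B_0 = 0 in the first identity,
  and the unknown \<mu>_s A_0 = \<mu>_s in the second.\<close>

definition rhs1 :: "(nat \<Rightarrow> real poly) \<Rightarrow> (nat \<Rightarrow> real poly) \<Rightarrow> (nat \<Rightarrow> real) \<Rightarrow> nat \<Rightarrow> real poly" where
  "rhs1 A B \<mu> s =
    (let T = [:0, 1:]; q = qpoly;
         A1 = lagged A s 1; A2 = lagged A s 2; B1 = lagged B s 1; B2 = lagged B s 2
     in smult ((1 + k^2) / 2) (T * (2 * T * pderiv A1 + A1
            + T * pderiv (pderiv B1) + pderiv B1 + q * T * B1))
        - smult (k^2 / 4) (T^3 * (2 * T * pderiv A2 + 2 * A2
            + T * pderiv (pderiv B2) + 2 * pderiv B2 + q * T * B2))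
        - (\<Sum>j=1..<s. smult (\<mu> j) (B (s - j))))"

definition rhs2 :: "(nat \<Rightarrow> real poly) \<Rightarrow> (nat \<Rightarrow> real poly) \<Rightarrow> (nat \<Rightarrow> real) \<Rightarrow> nat \<Rightarrow> real poly" where
  "rhs2 A B \<mu> s =
    (let T = [:0, 1:]; q = qpoly;
         A1 = lagged A s 1; A2 = lagged A s 2; B1 = lagged B s 1; B2 = lagged B s 2
     in smult ((1 + k^2) / 2) (T * (T * pderiv (pderiv A1) + pderiv A1
            + smult (1/2) (T^2 * B1) + q * (T * A1 + 2 * T * pderiv B1 + B1)))
        - smult (k^2 / 4) (T^3 * (T * pderiv (pderiv A2) + 2 * pderiv A2
            + smult (1/2) (T^2 * B2) + q * (T * A2 + 2 * T * pderiv B2 + 2 * B2)))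
        - (\<Sum>j=1..<s. smult (\<mu> j) (A (s - j))))"

lemma identities_iff_solves:
  assumes s: "1 \<le> s" and A0: "A 0 = 1" and B0: "B 0 = 0"
  shows "even_poly (A s) \<and> poly (A s) 0 = 0 \<and> odd_poly (B s) \<and> coeff_identity1 k m A B \<mu> s \<and> coeff_identity2 k m A B \<mu> s
    \<longleftrightarrow> solves (rhs1 A B \<mu> s) (rhs2 A B \<mu> s) (A s, B s, \<mu> s)"
proof -
  have "{1..s} = insert s {1..<s}" using s by auto
  then have S: "(\<Sum>j=1..s. smult (\<mu> j) (f (s - j))) = smult (\<mu> s) (f 0) + (\<Sum>j=1..<s. smult (\<mu> j) (f (s - j)))" for f :: "nat \<Rightarrow> real poly"
    by simp
  have one: "smult (\<mu> s) 1 = [:\<mu> s:]" by (simp add: one_pCons)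
  have eq: "X - Y + Z + (U + V) = 0 \<longleftrightarrow> X + U = Y - Z - V" for X Y Z U V :: "real poly" by (auto simp: algebra_simps)
  have eq': "X + (U + V) - Y + Z = 0 \<longleftrightarrow> X + U = Y - Z - V" for X Y Z U V :: "real poly" by (auto simp: algebra_simps)
  have "coeff_identity1 k m A B \<mu> s \<longleftrightarrow> 2 * pderiv (A s) + pderiv (pderiv (B s)) = rhs1 A B \<mu> s"
    unfolding coeff_identity1_def rhs1_def Let_def S B0 qpoly_def[symmetric] eq by simp
  moreover have "coeff_identity2 k m A B \<mu> s \<longleftrightarrow>
      pderiv (pderiv (A s)) + 2 * qpoly * pderiv (B s) + smult (1/2) ([:0, 1:] * B s) + [:\<mu> s:] = rhs2 A B \<mu> s"
    unfolding coeff_identity2_def rhs2_def Let_def S A0 qpoly_def[symmetric] one eq' ..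
  ultimately show ?thesis by (simp add: solves_def even_poly_iff odd_poly_iff)
qed

lemma rhs_cong:
  assumes "\<And>j. j < s \<Longrightarrow> A j = A' j" "\<And>j. j < s \<Longrightarrow> B j = B' j" "\<And>j. 1 \<le> j \<Longrightarrow> j < s \<Longrightarrow> \<mu> j = \<mu>' j" "1 \<le> s"
  shows "rhs1 A B \<mu> s = rhs1 A' B' \<mu>' s" "rhs2 A B \<mu> s = rhs2 A' B' \<mu>' s"
proof -
  have l: "lagged A s i = lagged A' s i" "lagged B s i = lagged B' s i" if "i \<ge> 1" for i
    using assms that by (auto simp: lagged_def)
  have "(\<Sum>j=1..<s. smult (\<mu> j) (f (s - j))) = (\<Sum>j=1..<s. smult (\<mu>' j) (g (s - j)))" if "\<And>j. j < s \<Longrightarrow> f j = g j" for f g :: "nat \<Rightarrow> real poly"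
    by (rule sum.cong) (use assms that in auto)
  from this[of A A'] this[of B B']
  show "rhs1 A B \<mu> s = rhs1 A' B' \<mu>' s" "rhs2 A B \<mu> s = rhs2 A' B' \<mu>' s" using assms l[of 1] l[of 2]
    by (simp_all add: rhs1_def rhs2_def)
qed

lemma rhs_parity:
  assumes "\<And>j. j < s \<Longrightarrow> has_parity 1 (A j)" "\<And>j. j < s \<Longrightarrow> has_parity (-1) (B j)" "1 \<le> s"
  shows "has_parity (-1) (rhs1 A B \<mu> s)" "has_parity 1 (rhs2 A B \<mu> s)"
proof -
  have par: "has_parity 1 (lagged A s i)" "has_parity (-1) (lagged B s i)" if "i \<ge> 1" for i
    using assms that by (auto simp: lagged_def)
  have pA: "has_parity (-1) (pderiv (lagged A s i))" if "i \<ge> 1" for i by (rule has_parity_pderiv[OF par(1)[OF that]]) auto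
  have ppA: "has_parity 1 (pderiv (pderiv (lagged A s i)))" if "i \<ge> 1" for i by (rule has_parity_pderiv[OF pA[OF that]]) auto
  have pB: "has_parity 1 (pderiv (lagged B s i))" if "i \<ge> 1" for i by (rule has_parity_pderiv[OF par(2)[OF that]]) auto
  have ppB: "has_parity (-1) (pderiv (pderiv (lagged B s i)))" if "i \<ge> 1" for i by (rule has_parity_pderiv[OF pB[OF that]]) auto
  have T: "has_parity 1 p \<Longrightarrow> has_parity (-1) ([:0, 1:] * p)" "has_parity (-1) p \<Longrightarrow> has_parity 1 ([:0, 1:] * p)" for p
    by (erule has_parity_mult[OF has_parity_T], simp)+
  have two: "has_parity r p \<Longrightarrow> has_parity r (2 * p)" for r p
    by (rule has_parity_mult[OF has_parity_numeral]) auto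
  have "has_parity 1 qpoly" by (simp add: has_parity_iff qpoly_def algebra_simps)
  then have q: "has_parity r p \<Longrightarrow> has_parity r (qpoly * p)" for r p
    by (rule has_parity_mult) auto
  have sA: "has_parity 1 (\<Sum>j=1..<s. smult (\<mu> j) (A (s - j)))" by (intro has_parity_sum has_parity_smult assms) auto
  have sB: "has_parity (-1) (\<Sum>j=1..<s. smult (\<mu> j) (B (s - j)))" by (intro has_parity_sum has_parity_smult assms) auto
  note rules = has_parity_add has_parity_diff has_parity_smult T two q par pA ppA pB ppB sA sB
  show "has_parity (-1) (rhs1 A B \<mu> s)" "has_parity 1 (rhs2 A B \<mu> s)"
    unfolding rhs1_def rhs2_def Let_def mult.assoc power3_eq_cube power2_eq_square
    by (intro rules order_refl one_le_numeral)+
qed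

text \<open>The right-hand sides at s involve only smaller indices, so the triples (A, B, \<mu>)
  come from well-founded choice; the parity of the earlier terms keeps each step solvable.\<close>

lemma AB_recursion_exists: "\<exists>A B \<mu>. AB_recursion k m A B \<mu>"
proof -
  let ?P = "\<lambda>f s r. if s = 0 then r = (1, 0, 0) else
     solves (rhs1 (fst \<circ> f) (fst \<circ> snd \<circ> f) (snd \<circ> snd \<circ> f) s) (rhs2 (fst \<circ> f) (fst \<circ> snd \<circ> f) (snd \<circ> snd \<circ> f) s) r"
  have "\<exists>f :: nat \<Rightarrow> real poly \<times> real poly \<times> real. \<forall>s. ?P f s (f s)"
  proof (rule dependent_wf_choice[OF wf_less_than])
    fix f g :: "nat \<Rightarrow> real poly \<times> real poly \<times> real" and s r
    assume "\<And>z. (z, s) \<in> less_than \<Longrightarrow> f z = g z"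
    then show "?P f s r = ?P g s r"
      using rhs_cong[of s "fst \<circ> f" "fst \<circ> g" "fst \<circ> snd \<circ> f" "fst \<circ> snd \<circ> g" "snd \<circ> snd \<circ> f" "snd \<circ> snd \<circ> g"] by auto
  next
    fix s and f :: "nat \<Rightarrow> real poly \<times> real poly \<times> real"
    assume ih: "\<And>y. (y, s) \<in> less_than \<Longrightarrow> ?P f y (f y)"
    have "has_parity 1 (fst (f j)) \<and> has_parity (-1) (fst (snd (f j)))" if "j < s" for j
      using ih[of j] that by (auto simp: solves_def split: if_splits)
    then show "\<exists>r. ?P f s r"
      using solves_exists rhs_parity[of s "fst \<circ> f" "fst \<circ> snd \<circ> f"] by (cases "s = 0") auto
  qed
  then obtain f where f: "\<And>s. ?P f s (f s)" by blast
  define A where "A = fst \<circ> f"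
  define B where "B = fst \<circ> snd \<circ> f"
  define \<mu> where "\<mu> = snd \<circ> snd \<circ> f"
  have 0: "A 0 = 1" "B 0 = 0" using f[of 0] by (auto simp: A_def B_def)
  have "solves (rhs1 A B \<mu> s) (rhs2 A B \<mu> s) (A s, B s, \<mu> s)" if "1 \<le> s" for s
    using f[of s] that by (simp add: A_def B_def \<mu>_def)
  then have "AB_recursion k m A B \<mu>" unfolding AB_recursion_def using 0 identities_iff_solves by blast
  then show ?thesis by blast
qed

lemma AB_recursion_unique:
  assumes "AB_recursion k m A B \<mu>" "AB_recursion k m A' B' \<mu>'"
  shows "A = A'" "B = B'"
proof -
  have s1: "solves (rhs1 A B \<mu> s) (rhs2 A B \<mu> s) (A s, B s, \<mu> s)" "solves (rhs1 A' B' \<mu>' s) (rhs2 A' B' \<mu>' s) (A' s, B' s, \<mu>' s)" if "1 \<le> s" for s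
    using assms that identities_iff_solves[of s A B \<mu>] identities_iff_solves[of s A' B' \<mu>'] unfolding AB_recursion_def by blast+
  have 0: "A 0 = A' 0" "B 0 = B' 0" using assms by (auto simp: AB_recursion_def)
  have "A s = A' s \<and> B s = B' s \<and> (1 \<le> s \<longrightarrow> \<mu> s = \<mu>' s)" for s
  proof (induction s rule: less_induct)
    case (less s)
    show ?case
    proof (cases "1 \<le> s")
      case True
      then show ?thesis using solves_unique s1[OF True] rhs_cong[of s A A' B B' \<mu> \<mu>'] less by fastforce
    next
      case False
      then have "s = 0" by simp
      then show ?thesis using 0 by simp
    qed
  qed
  then show "A = A'" "B = B'" by auto
qed

text \<open>Replaces the definite description behind \<open>coeff_A\<close> and
  \<open>coeff_B\<close> by the recursion itself.\<close>

lemma coeff_AB_recursion: "\<exists>\<mu>. AB_recursion k m (coeff_A k m) (coeff_B k m) \<mu>"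
proof -
  obtain A B \<mu> where r: "AB_recursion k m A B \<mu>" using AB_recursion_exists by blast
  have "coeff_AB k m = (A, B)"
    unfolding coeff_AB_def by (rule the_equality) (use r AB_recursion_unique in \<open>auto\<close>)
  then show ?thesis using r by (auto simp: coeff_A_def coeff_B_def)
qed

lemma coeff_A_0: "coeff_A k m 0 = 1" and coeff_B_0: "coeff_B k m 0 = 0"
  using coeff_AB_recursion by (auto simp: AB_recursion_def)

lemma coeff_A_even: "has_parity 1 (coeff_A k m s)"
  using coeff_AB_recursion coeff_A_0 by (cases "s \<ge> 1") (auto simp: AB_recursion_def even_poly_iff not_le)

lemma coeff_B_odd: "has_parity (-1) (coeff_B k m s)"
  using coeff_AB_recursion coeff_B_0 by (cases "s \<ge> 1") (auto simp: AB_recursion_def odd_poly_iff not_le)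

lemma coeff_A_1: "coeff_A k m 1 = [:0, 0, (k^2 + 1) / 32:]"
  and coeff_B_1: "coeff_B k m 1 = smult ((k^2 + 1) / 16) [:0, - (2 * real m + 1), 0, 1:]"
proof -
  obtain \<mu> where r: "AB_recursion k m (coeff_A k m) (coeff_B k m) \<mu>" using coeff_AB_recursion by blast
  have 1: "solves (rhs1 (coeff_A k m) (coeff_B k m) \<mu> 1) (rhs2 (coeff_A k m) (coeff_B k m) \<mu> 1) (coeff_A k m 1, coeff_B k m 1, \<mu> 1)"
    using r identities_iff_solves[of 1 "coeff_A k m" "coeff_B k m" \<mu>] unfolding AB_recursion_def by auto
  have F: "rhs1 (coeff_A k m) (coeff_B k m) \<mu> 1 = [:0, (1 + k^2) / 2:]"
    by (simp add: rhs1_def lagged_def coeff_A_0 coeff_B_0)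
  have G: "rhs2 (coeff_A k m) (coeff_B k m) \<mu> 1 = smult ((1 + k^2) / 2) [:0, 0, - real m - 1/2, 0, 1/4:]"
    by (simp add: rhs2_def lagged_def coeff_A_0 coeff_B_0 qpoly_def)
  \<comment> \<open>The values are verified and uniqueness does the rest. The witness for \<mu>_1 is
    half the classical term -(1 + k^2) (1 + (2m + 1)^2) / 8 in the expansion of h, in accordance
    with h = 2 \<kappa> \<theta>.\<close>
  have "solves [:0, (1 + k^2) / 2:] (smult ((1 + k^2) / 2) [:0, 0, - real m - 1/2, 0, 1/4:])
     ([:0, 0, (k^2 + 1) / 32:], smult ((k^2 + 1) / 16) [:0, - (2 * real m + 1), 0, 1:],
      - (k^2 + 1) / 16 * (1 + (2 * real m + 1)^2))"
    unfolding solves_def qpoly_def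
    by (auto simp: has_parity_iff pderiv_pCons pderiv_smult numeral_poly) (simp_all add: field_simps power2_eq_square)
  from solves_unique[OF 1[unfolded F G] this]
  show "coeff_A k m 1 = [:0, 0, (k^2 + 1) / 32:]" "coeff_B k m 1 = smult ((k^2 + 1) / 16) [:0, - (2 * real m + 1), 0, 1:]"
    by auto
qed

end

end

lemma cn_quotient_parity:
  assumes "\<And>s. has_parity r (A s)" shows "has_parity r (cn_quotient A s)"
proof (induction s rule: less_induct)
  case (less s)
  have e: "has_parity 1 ([:0, 0, - 1/2:] ^ j)" for j
    by (simp add: has_parity_iff)
  show ?case
    unfolding cn_quotient.simps[of A s]
    by (intro has_parity_diff assms has_parity_sum has_parity_smult has_parity_mult[OF e less]) auto
qed

lemma cn_quotient_0: "cn_quotient A 0 = A 0" by (subst cn_quotient.simps) simp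

lemma cn_quotient_1: "cn_quotient A 1 = A 1 - smult (1/2) ([:0, 0, - 1/2:] * A 0)"
  by (subst cn_quotient.simps) (simp add: cn_quotient_0)

section \<open>Hermite polynomials and parabolic cylinder functions\<close>

text \<open>Functions decaying faster than every exponential: the class is closed under multiplication by
  polynomials, so the powers of \<open>t\<close> produced by the expansions can be ignored in all estimates.\<close>

definition superexp :: "(real \<Rightarrow> real) \<Rightarrow> bool" where
  "superexp f \<longleftrightarrow> (\<forall>a. \<exists>C. \<forall>t. \<bar>f t\<bar> \<le> C * exp (- a * \<bar>t\<bar>))"

lemma superexpE:
  assumes "superexp f" obtains C where "C > 0" "\<And>t. \<bar>f t\<bar> \<le> C * exp (- a * \<bar>t\<bar>)"
proof -
  obtain C where C: "\<And>t. \<bar>f t\<bar> \<le> C * exp (- a * \<bar>t\<bar>)" using assms unfolding superexp_def by blast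
  have "\<bar>f t\<bar> \<le> (\<bar>C\<bar> + 1) * exp (- a * \<bar>t\<bar>)" for t
    by (rule order_trans[OF C]) (intro mult_right_mono, auto)
  then show ?thesis using that[of "\<bar>C\<bar> + 1"] by auto
qed

lemma superexp_gaussian: "superexp (\<lambda>t. exp (- (t^2) / 4))"
  unfolding superexp_def
proof (intro allI exI)
  fix a t :: real
  have "0 \<le> (\<bar>t\<bar> / 2 - a)^2" by simp
  then have "- (t^2) / 4 \<le> a^2 + (- a * \<bar>t\<bar>)" by (simp add: power2_eq_square field_simps)
  then have "exp (- (t^2) / 4) \<le> exp (a^2) * exp (- a * \<bar>t\<bar>)" by (simp add: exp_add[symmetric])
  then show "\<bar>exp (- (t^2) / 4)\<bar> \<le> exp (a^2) * exp (- a * \<bar>t\<bar>)" by simp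
qed

lemma superexp_0 [simp]: "superexp (\<lambda>t. 0)"
  unfolding superexp_def by (auto intro!: exI[of _ 0])

lemma superexp_add: assumes "superexp f" "superexp g" shows "superexp (\<lambda>t. f t + g t)"
  unfolding superexp_def
proof
  fix a
  obtain C where C: "\<And>t. \<bar>f t\<bar> \<le> C * exp (- a * \<bar>t\<bar>)" using assms unfolding superexp_def by blast
  obtain B where B: "\<And>t. \<bar>g t\<bar> \<le> B * exp (- a * \<bar>t\<bar>)" using assms unfolding superexp_def by blast
  have "\<bar>f t + g t\<bar> \<le> (C + B) * exp (- a * \<bar>t\<bar>)" for t
    using add_mono[OF C[of t] B[of t]] abs_triangle_ineq[of "f t" "g t"] by (simp add: algebra_simps)
  then show "\<exists>C. \<forall>t. \<bar>f t + g t\<bar> \<le> C * exp (- a * \<bar>t\<bar>)" by blast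
qed

text \<open>As the rate a is arbitrary, a factor exp (b |t|) is absorbed by starting from the rate a
  + b; most closure properties below come from this.\<close>

lemma superexp_dominated:
  assumes g: "superexp g" and le: "\<And>t. \<bar>f t\<bar> \<le> K * exp (b * \<bar>t\<bar>) * \<bar>g t\<bar>" shows "superexp f"
  unfolding superexp_def
proof
  fix a
  obtain C where C: "C > 0" "\<And>t. \<bar>g t\<bar> \<le> C * exp (- (a + b) * \<bar>t\<bar>)" using superexpE[OF g] by blast
  have "\<bar>f t\<bar> \<le> \<bar>K\<bar> * C * exp (- a * \<bar>t\<bar>)" for t
  proof -
    have "\<bar>f t\<bar> \<le> \<bar>K\<bar> * exp (b * \<bar>t\<bar>) * \<bar>g t\<bar>"
      by (rule order_trans[OF le]) (intro mult_right_mono, auto)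
    also have "\<dots> \<le> \<bar>K\<bar> * exp (b * \<bar>t\<bar>) * (C * exp (- (a + b) * \<bar>t\<bar>))"
      by (rule mult_left_mono[OF C(2)]) simp
    also have "\<dots> = \<bar>K\<bar> * C * (exp (b * \<bar>t\<bar>) * exp (- (a + b) * \<bar>t\<bar>))" by simp
    also have "exp (b * \<bar>t\<bar>) * exp (- (a + b) * \<bar>t\<bar>) = exp (- a * \<bar>t\<bar>)" by (simp add: exp_add[symmetric] algebra_simps)
    finally show ?thesis .
  qed
  then show "\<exists>C. \<forall>t. \<bar>f t\<bar> \<le> C * exp (- a * \<bar>t\<bar>)" by blast
qed

lemma superexp_cmult: "superexp f \<Longrightarrow> superexp (\<lambda>t. c * f t)"
  by (rule superexp_dominated[of f _ "\<bar>c\<bar>" 0]) (auto simp: abs_mult)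

lemma superexp_uminus: "superexp f \<Longrightarrow> superexp (\<lambda>t. - f t)"
  using superexp_cmult[of f "-1"] by simp

lemma superexp_diff: "superexp f \<Longrightarrow> superexp g \<Longrightarrow> superexp (\<lambda>t. f t - g t)"
  using superexp_add[of f "\<lambda>t. - g t"] superexp_uminus[of g] by simp

lemma superexp_abs: "superexp f \<Longrightarrow> superexp (\<lambda>t. \<bar>f t\<bar>)"
  by (rule superexp_dominated[of f _ 1 0]) auto

lemma superexp_mult_t: "superexp f \<Longrightarrow> superexp (\<lambda>t. t * f t)"
proof (rule superexp_dominated[of f _ 1 1])
  fix t :: real
  have "\<bar>t\<bar> \<le> exp \<bar>t\<bar>" using exp_ge_add_one_self[of "\<bar>t\<bar>"] by linarith
  then show "\<bar>t * f t\<bar> \<le> 1 * exp (1 * \<bar>t\<bar>) * \<bar>f t\<bar>" by (simp add: abs_mult mult_right_mono)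
qed

lemma superexp_mult: assumes "superexp f" "superexp g" shows "superexp (\<lambda>t. f t * g t)"
proof -
  obtain C where C: "C > 0" "\<And>t. \<bar>f t\<bar> \<le> C * exp (- 0 * \<bar>t\<bar>)" using superexpE[OF assms(1)] by blast
  show ?thesis by (rule superexp_dominated[OF assms(2), of _ C 0]) (use C in \<open>auto simp: abs_mult intro!: mult_right_mono\<close>)
qed

lemma superexp_sum: "(\<And>i. i \<in> I \<Longrightarrow> superexp (f i)) \<Longrightarrow> superexp (\<lambda>t. \<Sum>i\<in>I. f i t)"
  by (induction I rule: infinite_finite_induct) (auto intro: superexp_add)

lemma superexp_poly_mult: assumes "superexp f" shows "superexp (\<lambda>t. poly p t * f t)"
proof (induction p)
  case 0 then show ?case by simp
next
  case (pCons a p)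
  have "superexp (\<lambda>t. a * f t + t * (poly p t * f t))"
    by (intro superexp_add superexp_cmult assms superexp_mult_t pCons)
  then show ?case by (simp add: algebra_simps)
qed

lemma superexp_power_mult: "superexp f \<Longrightarrow> superexp (\<lambda>t. t ^ n * f t)"
  using superexp_poly_mult[of f "monom 1 n"] by (simp add: poly_monom)

lemma superexp_tendsto: assumes "superexp f" shows "(f \<longlongrightarrow> 0) at_top" "(f \<longlongrightarrow> 0) at_bot"
proof -
  obtain C where C: "C > 0" "\<And>t. \<bar>f t\<bar> \<le> C * exp (- 1 * \<bar>t\<bar>)" using superexpE[OF assms] by blast
  have 1: "((\<lambda>t. C * exp (- \<bar>t\<bar>)) \<longlongrightarrow> C * 0) F" if "filterlim (\<lambda>t::real. \<bar>t\<bar>) at_top F" for F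
    by (intro tendsto_mult tendsto_const filterlim_compose[OF exp_at_bot] filterlim_compose[OF filterlim_uminus_at_bot_at_top that])
  have b: "filterlim (\<lambda>t::real. \<bar>t\<bar>) at_top at_bot" by (simp add: filterlim_at_bot_mirror filterlim_abs_real)
  have 2: "(f \<longlongrightarrow> 0) F" if "filterlim (\<lambda>t::real. \<bar>t\<bar>) at_top F" for F
    by (rule Lim_null_comparison[OF always_eventually 1[OF that, simplified]]) (use C in simp)
  show "(f \<longlongrightarrow> 0) at_top" "(f \<longlongrightarrow> 0) at_bot" by (rule 2[OF filterlim_abs_real], rule 2[OF b])
qed

lemma integrable_exp_minus_abs: "integrable lborel (\<lambda>t::real. exp (- \<bar>t\<bar>))"
proof -
  have 1: "integrable lborel (\<lambda>t::real. exp (- t) * indicator {0..} t)"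
    using has_bochner_integral_I0i_power_exp_m'[of 0] by (simp add: has_bochner_integral_iff)
  have 2: "integrable lborel (\<lambda>t::real. exp t * indicator {..0} t)"
    using lborel_integrable_real_affine[OF 1, of "-1" 0] by (simp add: indicator_def if_distrib cong: if_cong)
  show ?thesis
  proof (rule Bochner_Integration.integrable_bound[OF Bochner_Integration.integrable_add[OF 1 2]])
    show "AE t in lborel. norm (exp (- \<bar>t\<bar>)) \<le> norm (exp (- t) * indicator {0..} t + exp t * indicator {..0} t :: real)"
      by (auto simp: indicator_def)
  qed measurable
qed

lemma superexp_integrable: assumes "superexp f" "\<And>t. isCont f t" shows "integrable lborel f"
proof -
  obtain C where C: "C > 0" "\<And>t. \<bar>f t\<bar> \<le> C * exp (- 1 * \<bar>t\<bar>)" using superexpE[OF assms(1)] by blast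
  have "integrable lborel (\<lambda>t. C * exp (- \<bar>t\<bar>))" by (intro integrable_mult_right integrable_exp_minus_abs)
  then show ?thesis
  proof (rule Bochner_Integration.integrable_bound)
    show "f \<in> borel_measurable lborel"
      using borel_measurable_continuous_onI[of f] continuous_at_imp_continuous_on[of UNIV f] assms(2) by simp
    show "AE t in lborel. norm (f t) \<le> norm (C * exp (- \<bar>t\<bar>))" using C by (auto simp: abs_mult)
  qed
qed

text \<open>Integration by parts on the whole line: the boundary terms of a decaying F vanish. The
  integral identities below are obtained by exhibiting such an F.\<close>

lemma superexp_integral_deriv:
  fixes F f :: "real \<Rightarrow> real"
  assumes "superexp F" "superexp f" "\<And>t. isCont f t" "\<And>t. (F has_real_derivative f t) (at t)"
  shows "(\<integral>t. f t \<partial>lborel) = 0"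
proof -
  have "(LBINT x=-\<infinity>..\<infinity>. f x) = 0 - 0"
  proof (rule interval_integral_FTC_integrable[where F = F])
    show "set_integrable lborel (einterval (-\<infinity>) \<infinity>) f"
      using superexp_integrable[OF assms(2,3)] by (simp add: set_integrable_def)
    show "((F \<circ> real_of_ereal) \<longlongrightarrow> 0) (at_right (-\<infinity>))"
      using superexp_tendsto(2)[OF assms(1)] by (simp add: ereal_tendsto_simps)
    show "((F \<circ> real_of_ereal) \<longlongrightarrow> 0) (at_left \<infinity>)"
      using superexp_tendsto(1)[OF assms(1)] by (simp add: ereal_tendsto_simps)
  qed (use assms in \<open>auto simp: has_real_derivative_iff_has_vector_derivative\<close>)
  then show ?thesis by (simp add: interval_lebesgue_integral_def set_lebesgue_integral_def)
qed

section \<open>Hermite polynomials, Gaussian weights and integral identities\<close>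

fun hermite_poly :: "nat \<Rightarrow> real poly" where
  "hermite_poly 0 = 1"
| "hermite_poly (Suc n) = [:0, 1:] * hermite_poly n - pderiv (hermite_poly n)"

lemma pderiv_hermite: "pderiv (hermite_poly (Suc n)) = smult (real (Suc n)) (hermite_poly n)"
proof (induction n)
  case 0 then show ?case by (simp add: pderiv_pCons one_pCons)
next
  case (Suc n)
  have "pderiv (hermite_poly (Suc (Suc n))) = hermite_poly (Suc n) + ([:0, 1:] * pderiv (hermite_poly (Suc n)) - pderiv (pderiv (hermite_poly (Suc n))))"
    by (subst hermite_poly.simps(2)) (simp only: pderiv_diff pderiv_mult, simp add: pderiv_pCons)
  also have "[:0, 1:] * pderiv (hermite_poly (Suc n)) - pderiv (pderiv (hermite_poly (Suc n))) = smult (real (Suc n)) (hermite_poly (Suc n))"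
    unfolding Suc by (simp add: pderiv_smult smult_diff_right)
  finally have "pderiv (hermite_poly (Suc (Suc n))) = hermite_poly (Suc n) + smult (real (Suc n)) (hermite_poly (Suc n))" .
  moreover have "real (Suc (Suc n)) = 1 + real (Suc n)" by simp
  ultimately show ?case by (simp only: smult_add_left smult_1_left)
qed

text \<open>The derivative formula turns the raising recursion of \<open>hermite_poly\<close> into
  the three-term recursion of \<open>hermite_He\<close>.\<close>

lemma hermite_He_poly: "hermite_He m t = poly (hermite_poly m) t"
proof (induction m t rule: hermite_He.induct)
  case (3 n t)
  then show ?case by (subst hermite_poly.simps(2)) (simp add: pderiv_hermite del: hermite_poly.simps)
qed auto

lemma hermite_degree: "degree (hermite_poly n) = n \<and> coeff (hermite_poly n) n = 1"
proof (induction n)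
  case (Suc n)
  have c: "coeff (hermite_poly (Suc n)) (Suc n) = 1"
    using Suc by (simp add: coeff_pderiv coeff_eq_0)
  have "degree (hermite_poly (Suc n)) \<le> Suc n"
    unfolding hermite_poly.simps using Suc by (intro degree_diff_le) (auto simp: degree_pderiv intro: order_trans[OF degree_mult_le])
  then have "degree (hermite_poly (Suc n)) = Suc n"
    using le_degree[of "hermite_poly (Suc n)" "Suc n"] c by (simp del: hermite_poly.simps)
  then show ?case using c by (simp del: hermite_poly.simps)
qed simp

lemma hermite_nonzero: "hermite_poly n \<noteq> 0" using hermite_degree[of n] by auto

lemma hermite_parity: "has_parity ((-1)^n) (hermite_poly n)"
proof (induction n)
  case (Suc n)
  have "has_parity ((-1)^Suc n) (pderiv (hermite_poly n))"
    by (rule has_parity_pderiv[OF Suc]) (auto simp: power_mult_distrib[symmetric])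
  then show ?case unfolding hermite_poly.simps
    by (intro has_parity_diff has_parity_mult[OF has_parity_T Suc]) auto
qed simp

definition gauss_poly :: "real poly \<Rightarrow> real \<Rightarrow> real" where "gauss_poly p t = exp (- (t^2) / 4) * poly p t"

lemma gauss_poly_deriv: "(gauss_poly p has_real_derivative gauss_poly (pderiv p - smult (1/2) ([:0, 1:] * p)) t) (at t)"
  unfolding gauss_poly_def[abs_def]
  by (rule DERIV_cong[OF DERIV_mult[OF DERIV_fun_exp poly_DERIV]])
     (auto intro!: derivative_eq_intros simp: algebra_simps power2_eq_square)

lemma gauss_poly_superexp: "superexp (gauss_poly p)"
  using superexp_poly_mult[OF superexp_gaussian, of p] by (simp add: gauss_poly_def[abs_def] mult.commute)

lemma gauss_poly_cont: "isCont (gauss_poly p) t" using gauss_poly_deriv DERIV_isCont by blast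

lemma parabolic_D_gauss_poly: "parabolic_D m = gauss_poly (hermite_poly m)"
  by (rule ext) (simp add: parabolic_D_def gauss_poly_def hermite_He_poly)

definition hermite_poly' :: "nat \<Rightarrow> real poly" where
  "hermite_poly' m = pderiv (hermite_poly m) - smult (1/2) ([:0, 1:] * hermite_poly m)"

abbreviation parabolic_D' :: "nat \<Rightarrow> real \<Rightarrow> real" where "parabolic_D' m \<equiv> gauss_poly (hermite_poly' m)"

lemma parabolic_D_deriv: "(parabolic_D m has_real_derivative parabolic_D' m t) (at t)"
  unfolding parabolic_D_gauss_poly hermite_poly'_def by (rule gauss_poly_deriv)

lemma deriv_parabolic_D: "deriv (parabolic_D m) = parabolic_D' m"
  by (rule ext) (rule DERIV_imp_deriv[OF parabolic_D_deriv])

text \<open>Differentiate the raising recursion for index m + 1 and compare with the derivative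
  formula.\<close>

lemma hermite_ode: "pderiv (pderiv (hermite_poly m)) = [:0, 1:] * pderiv (hermite_poly m) - smult (real m) (hermite_poly m)"
proof -
  have "pderiv ([:0, 1:] * hermite_poly m - pderiv (hermite_poly m)) = smult (real (Suc m)) (hermite_poly m)"
    using pderiv_hermite[of m] by simp
  then have "hermite_poly m + [:0, 1:] * pderiv (hermite_poly m) - pderiv (pderiv (hermite_poly m)) = smult (real (Suc m)) (hermite_poly m)"
    by (simp only: pderiv_diff pderiv_mult) (simp add: pderiv_pCons algebra_simps)
  then have "pderiv (pderiv (hermite_poly m)) = hermite_poly m + [:0, 1:] * pderiv (hermite_poly m) - smult (real (Suc m)) (hermite_poly m)"
    by (simp add: algebra_simps)
  then show ?thesis by (simp add: smult_add_left)
qed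

lemma parabolic_D'_deriv: "(parabolic_D' m has_real_derivative (t^2/4 - real m - 1/2) * parabolic_D m t) (at t)"
proof (rule DERIV_cong[OF gauss_poly_deriv])
  have e: "poly (pderiv (pderiv (hermite_poly m))) t = t * poly (pderiv (hermite_poly m)) t - real m * poly (hermite_poly m) t"
    by (subst hermite_ode) simp
  show "gauss_poly (pderiv (hermite_poly' m) - smult (1/2) ([:0, 1:] * hermite_poly' m)) t = (t^2/4 - real m - 1/2) * parabolic_D m t"
    unfolding hermite_poly'_def parabolic_D_gauss_poly gauss_poly_def
    by (simp add: pderiv_diff pderiv_smult pderiv_mult pderiv_pCons e power2_eq_square algebra_simps)
qed

lemma parabolic_D_parity: "parabolic_D m (- t) = (-1)^m * parabolic_D m t" "parabolic_D' m (- t) = (-1)^Suc m * parabolic_D' m t"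
proof -
  have p: "has_parity ((-1)^Suc m) (pderiv (hermite_poly m))"
    by (rule has_parity_pderiv[OF hermite_parity]) (auto simp: power_mult_distrib[symmetric])
  show "parabolic_D m (- t) = (-1)^m * parabolic_D m t"
    using hermite_parity[of m] by (simp add: parabolic_D_gauss_poly gauss_poly_def has_parity_iff)
  have "has_parity ((-1)^Suc m) (hermite_poly' m)" unfolding hermite_poly'_def
    by (intro has_parity_diff p has_parity_smult has_parity_mult[OF has_parity_T hermite_parity]) auto
  then show "parabolic_D' m (- t) = (-1)^Suc m * parabolic_D' m t"
    by (simp add: gauss_poly_def has_parity_iff)
qed

lemma gauss_poly_square_integrable: "integrable lborel (\<lambda>t. gauss_poly p t * gauss_poly r t)"
  by (intro superexp_integrable superexp_mult gauss_poly_superexp continuous_intros gauss_poly_cont)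

lemma gaussian_integral: "(\<integral>t. exp (- (t^2) / 2) \<partial>lborel) = sqrt (2 * pi)"
proof -
  have "(\<integral>x. std_normal_density x \<partial>lborel) = 1"
    using integral_std_normal_moment_even[of 0] by simp
  then show ?thesis by (simp add: std_normal_density_def)
qed

text \<open>The product D_{m+1} D_m has derivative (m + 1) D_m^2 - D_{m+1}^2, so the norms obey the
  recursion of the factorial; the base case is the Gaussian integral.\<close>

lemma parabolic_D_norm: "(\<integral>t. (parabolic_D m t)^2 \<partial>lborel) = fact m * sqrt (2 * pi)"
proof (induction m)
  case 0
  have "(\<lambda>t. (parabolic_D 0 t)^2) = (\<lambda>t. exp (- (t^2) / 2))"
    by (auto simp: parabolic_D_def power2_eq_square exp_add[symmetric])
  then show ?case using gaussian_integral by simp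
next
  case (Suc m)
  let ?F = "\<lambda>t. gauss_poly (hermite_poly (Suc m)) t * gauss_poly (hermite_poly m) t"
  have d: "(?F has_real_derivative real (Suc m) * (parabolic_D m t)^2 - (parabolic_D (Suc m) t)^2) (at t)" for t
  proof (rule DERIV_cong[OF DERIV_mult[OF gauss_poly_deriv gauss_poly_deriv]])
    have e: "poly (pderiv (hermite_poly (Suc m))) t = real (Suc m) * poly (hermite_poly m) t" by (subst pderiv_hermite) simp
    have e2: "poly (hermite_poly (Suc m)) t = t * poly (hermite_poly m) t - poly (pderiv (hermite_poly m)) t" by simp
    show "gauss_poly (pderiv (hermite_poly (Suc m)) - smult (1/2) ([:0, 1:] * hermite_poly (Suc m))) t * gauss_poly (hermite_poly m) t +
      gauss_poly (pderiv (hermite_poly m) - smult (1/2) ([:0, 1:] * hermite_poly m)) t * gauss_poly (hermite_poly (Suc m)) t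
      = real (Suc m) * (parabolic_D m t)^2 - (parabolic_D (Suc m) t)^2"
      unfolding parabolic_D_gauss_poly gauss_poly_def
      by (simp add: e e2 power2_eq_square algebra_simps del: hermite_poly.simps of_nat_Suc)
  qed
  have i: "integrable lborel (\<lambda>t. (parabolic_D n t)^2)" for n
    unfolding parabolic_D_gauss_poly power2_eq_square by (rule gauss_poly_square_integrable)
  have "(\<integral>t. real (Suc m) * (parabolic_D m t)^2 - (parabolic_D (Suc m) t)^2 \<partial>lborel) = 0"
  proof (rule superexp_integral_deriv[OF _ _ _ d])
    show "superexp ?F" by (intro superexp_mult gauss_poly_superexp)
    show "superexp (\<lambda>t. real (Suc m) * (parabolic_D m t)^2 - (parabolic_D (Suc m) t)^2)"
      unfolding parabolic_D_gauss_poly power2_eq_square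
      by (intro superexp_mult gauss_poly_superexp superexp_diff superexp_cmult)
    show "isCont (\<lambda>t. real (Suc m) * (parabolic_D m t)^2 - (parabolic_D (Suc m) t)^2) t" for t
      unfolding parabolic_D_gauss_poly by (intro continuous_intros gauss_poly_cont)
  qed
  then have "real (Suc m) * (\<integral>t. (parabolic_D m t)^2 \<partial>lborel) = (\<integral>t. (parabolic_D (Suc m) t)^2 \<partial>lborel)"
    using i by (simp add: Bochner_Integration.integral_diff del: of_nat_Suc)
  then show ?case using Suc by (simp add: mult_ac del: of_nat_Suc)
qed

text \<open>The virial identity of the harmonic oscillator: the mean of t^2 is 2m + 1. The
  antiderivative arises from multiplying the equation of D_m by t D_m' and by D_m.\<close>

lemma parabolic_D_virial: "(\<integral>t. (t^2 - (2 * real m + 1)) * (parabolic_D m t)^2 \<partial>lborel) = 0"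
proof -
  let ?D = "parabolic_D m" and ?D' = "parabolic_D' m"
  let ?F = "\<lambda>t. ?D t * ?D' t - t * (?D' t * ?D' t) + poly [:0, - real m - 1/2, 0, 1/4:] t * (?D t * ?D t)"
  show ?thesis
  proof (rule superexp_integral_deriv[where F = ?F])
    show "superexp ?F" unfolding parabolic_D_gauss_poly
      by (intro superexp_add superexp_diff superexp_mult gauss_poly_superexp superexp_mult_t superexp_poly_mult)
    have "superexp (\<lambda>t. poly [:- (2 * real m + 1), 0, 1:] t * (?D t * ?D t))" unfolding parabolic_D_gauss_poly
      by (intro superexp_mult gauss_poly_superexp superexp_poly_mult)
    then show "superexp (\<lambda>t. (t^2 - (2 * real m + 1)) * (?D t)^2)" by (simp add: algebra_simps power2_eq_square)
    show "isCont (\<lambda>t. (t^2 - (2 * real m + 1)) * (?D t)^2) t" for t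
      unfolding parabolic_D_gauss_poly by (intro continuous_intros gauss_poly_cont)
    have q: "(poly [:0, - real m - 1/2, 0, 1/4:] has_real_derivative (3 * t^2 / 4 - real m - 1/2)) (at t)" for t
      by (rule DERIV_cong[OF poly_DERIV]) (simp add: pderiv_pCons power2_eq_square algebra_simps)
    show "(?F has_real_derivative (t^2 - (2 * real m + 1)) * (?D t)^2) (at t)" for t
      by (rule DERIV_cong[OF DERIV_add[OF DERIV_diff[OF DERIV_mult[OF parabolic_D_deriv parabolic_D'_deriv]
            DERIV_mult[OF DERIV_ident DERIV_mult[OF parabolic_D'_deriv parabolic_D'_deriv]]]
            DERIV_mult[OF q DERIV_mult[OF parabolic_D_deriv parabolic_D_deriv]]]])
         (simp add: power2_eq_square algebra_simps)
  qed
qed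

section \<open>Zeros and tails of D_m\<close>

lemma parabolic_D_simple_zeros: assumes "parabolic_D m t = 0" shows "parabolic_D' m t \<noteq> 0"
proof
  assume "parabolic_D' m t = 0"
  have "parabolic_D m = (\<lambda>_. 0) \<and> parabolic_D' m = (\<lambda>_. 0)"
    by (rule linear_ode_unique[where q = "\<lambda>t. t^2/4 - real m - 1/2" and ?z0.0 = t])
       (use assms \<open>parabolic_D' m t = 0\<close> parabolic_D_deriv parabolic_D'_deriv in auto)
  then have "\<And>t. poly (hermite_poly m) t = 0" unfolding parabolic_D_gauss_poly gauss_poly_def by (metis exp_not_eq_zero mult_eq_0_iff)
  then have "hermite_poly m = 0" by (metis poly_all_0_iff_0)
  then show False using hermite_nonzero by blast
qed

text \<open>If g has a nonzero value beyond c, half that value is taken on both sides of it, and the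
  ordinary theorem of Rolle applies between these two points.\<close>

lemma rolle_unbounded:
  fixes g g' :: "real \<Rightarrow> real"
  assumes d: "\<And>x. (g has_real_derivative g' x) (at x)" and c: "g c = 0" and lim: "(g \<longlongrightarrow> 0) at_top"
  shows "\<exists>x>c. g' x = 0"
proof (cases "\<forall>y>c. g y = 0")
  case True
  have "(g has_real_derivative 0) (at (c + 1))"
    by (rule has_field_derivative_transform_within[where f = "\<lambda>_. 0" and d = 1]) (use True in \<open>auto simp: dist_real_def\<close>)
  then show ?thesis using DERIV_unique[OF d] by (intro exI[of _ "c + 1"]) auto
next
  case False
  have main: "\<exists>x>c. g' x = 0" if d: "\<And>x. (g has_real_derivative g' x) (at x)" and c: "g c = 0" and lim: "(g \<longlongrightarrow> 0) at_top"
     and y: "y > c" "g y > 0" for y and g g' :: "real \<Rightarrow> real"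
  proof -
    have "eventually (\<lambda>x. g x < g y / 2) at_top" using order_tendstoD(2)[OF lim, of "g y / 2"] y by auto
    then obtain z0 where z0: "\<And>x. x \<ge> z0 \<Longrightarrow> g x < g y / 2" by (auto simp: eventually_at_top_linorder)
    define z where "z = max z0 (y + 1)"
    have cont: "isCont g x" for x using DERIV_isCont[OF d] .
    obtain a where a: "c \<le> a" "a \<le> y" "g a = g y / 2" using IVT[of g c "g y / 2" y] c y cont by auto
    have "y \<le> z" "g z \<le> g y / 2" using z0[of z] by (auto simp: z_def intro: less_imp_le)
    then obtain b where b: "y \<le> b" "b \<le> z" "g b = g y / 2" using IVT2[of g z "g y / 2" y] y cont by auto
    have "a < b" "c < a" using a b y c by (auto simp: less_le)
    then obtain x where "a < x" "x < b" "(g has_real_derivative 0) (at x)"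
      using Rolle[of a b g] a b cont d by (metis continuous_at_imp_continuous_on real_differentiable_def)
    then show ?thesis using DERIV_unique[OF d] \<open>c < a\<close> by (metis less_trans)
  qed
  obtain y where "y > c" "g y \<noteq> 0" using False by auto
  moreover have "\<And>x. ((\<lambda>x. - g x) has_real_derivative - g' x) (at x)" by (rule DERIV_minus[OF d])
  moreover have "((\<lambda>x. - g x) \<longlongrightarrow> 0) at_top" using tendsto_minus[OF lim] by simp
  ultimately show ?thesis using main[OF d c lim, of y] main[of "\<lambda>x. - g x" "\<lambda>x. - g' x" y] c
    by (cases "g y > 0") auto
qed

text \<open>For g = exp (-t^2/2) He_m one has g' = -exp (-t^2/2) He_{m+1}. Rolle between consecutive
  zeros, and between the extreme zeros and infinity, yields m + 1 zeros of He_{m+1}; the degree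
  allows no more.\<close>

lemma hermite_zero_count: "card {t. poly (hermite_poly m) t = 0} = m"
proof (induction m)
  case (Suc m)
  let ?Z = "{t. poly (hermite_poly m) t = 0}" and ?Y = "{t. poly (hermite_poly (Suc m)) t = 0}"
  have finZ: "finite ?Z" using poly_roots_finite[OF hermite_nonzero] .
  have finY: "finite ?Y" using poly_roots_finite[OF hermite_nonzero] .
  have up: "card ?Y \<le> Suc m" using card_poly_roots_bound[OF hermite_nonzero[of "Suc m"]] hermite_degree[of "Suc m"] by simp
  show ?case
  \<comment> \<open>Without a zero of He_0 there is no point from which Rolle could start.\<close>
  proof (cases "m = 0")
    case True
    have "0 \<in> ?Y" using True by simp
    then have "card ?Y > 0" using finY by (metis card_gt_0_iff empty_iff)
    then show ?thesis using up True by linarith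
  next
    case False
    define g where "g t = exp (- (t^2) / 2) * poly (hermite_poly m) t" for t
    have dg: "(g has_real_derivative - exp (- (t^2) / 2) * poly (hermite_poly (Suc m)) t) (at t)" for t
      unfolding g_def[abs_def]
      by (rule DERIV_cong[OF DERIV_mult[OF DERIV_fun_exp poly_DERIV]])
         (auto intro!: derivative_eq_intros simp: algebra_simps power2_eq_square)
    have "g = (\<lambda>t. exp (- (t^2) / 4) * gauss_poly (hermite_poly m) t)"
      by (rule ext) (simp add: g_def gauss_poly_def exp_add[symmetric] mult.assoc[symmetric])
    then have sg: "superexp g" using superexp_mult[OF superexp_gaussian gauss_poly_superexp] by simp
    have nz: "Z0 \<noteq> 0 \<Longrightarrow> - exp (- (t^2) / 2) * Z0 \<noteq> 0" for t Z0 :: real by simp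
    have gz: "g t = 0 \<longleftrightarrow> t \<in> ?Z" for t by (simp add: g_def)
    define nxt where "nxt c = Min {d \<in> ?Z. c < d}" for c
    have up_zero: "\<exists>x>c. x \<in> ?Y \<and> (\<forall>d\<in>?Z. c < d \<longrightarrow> x < d)" if c: "c \<in> ?Z" for c
    proof (cases "\<exists>d\<in>?Z. c < d")
      case True
      have f: "finite {d \<in> ?Z. c < d}" "{d \<in> ?Z. c < d} \<noteq> {}" using finZ True by auto
      have n: "c < nxt c" "nxt c \<in> ?Z" using Min_in[OF f] by (auto simp: nxt_def)
      have "continuous_on {c..nxt c} g" using DERIV_isCont[OF dg] by (intro continuous_at_imp_continuous_on) auto
      then obtain x where x: "c < x" "x < nxt c" "(g has_real_derivative 0) (at x)"
        using Rolle[of c "nxt c" g] n c gz dg by (metis real_differentiable_def)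
      then have "x \<in> ?Y" using DERIV_unique[OF dg x(3)] by simp
      moreover have "x < d" if "d \<in> ?Z" "c < d" for d using Min_le[OF f(1), of d] that x by (auto simp: nxt_def)
      ultimately show ?thesis using x by blast
    next
      case False
      obtain x where "x > c" "- exp (- (x^2) / 2) * poly (hermite_poly (Suc m)) x = 0"
        using rolle_unbounded[OF dg _ superexp_tendsto(1)[OF sg], of c] c gz by auto
      then have "x > c" "x \<in> ?Y" by (auto simp del: hermite_poly.simps)
      then show ?thesis using False by blast
    qed
    then obtain f where f: "\<And>c. c \<in> ?Z \<Longrightarrow> c < f c \<and> f c \<in> ?Y \<and> (\<forall>d\<in>?Z. c < d \<longrightarrow> f c < d)" by metis
    have neZ: "?Z \<noteq> {}" using Suc False by (metis card.empty)
    define c0 where "c0 = Min ?Z"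
    have c0: "c0 \<in> ?Z" "\<And>d. d \<in> ?Z \<Longrightarrow> c0 \<le> d" using Min_in[OF finZ neZ] Min_le[OF finZ] by (auto simp: c0_def)
    \<comment> \<open>The additional zero, to the left of all zeros of He_m, comes from the
      reflected g.\<close>
    have "\<exists>x>-c0. - (- exp (- ((-x)^2) / 2) * poly (hermite_poly (Suc m)) (-x)) = 0"
    proof (rule rolle_unbounded[where g = "\<lambda>x. g (- x)"])
      show "((\<lambda>x. g (- x)) has_real_derivative - (- exp (- ((- x)^2) / 2) * poly (hermite_poly (Suc m)) (- x))) (at x)" for x
        using DERIV_mirror[of g "- exp (- ((- x)^2) / 2) * poly (hermite_poly (Suc m)) (- x)" x] dg[of "- x"] by simp
      show "g (- (- c0)) = 0" using c0 gz by simp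
      show "((\<lambda>x. g (- x)) \<longlongrightarrow> 0) at_top" using superexp_tendsto(2)[OF sg] by (simp add: filterlim_at_bot_mirror)
    qed
    then obtain x where x: "x > - c0" "poly (hermite_poly (Suc m)) (-x) = 0" by (auto simp del: hermite_poly.simps)
    define e where "e = - x"
    have e: "e < c0" "e \<in> ?Y" using x by (auto simp: e_def simp del: hermite_poly.simps)
    have lt: "f c < f d" if "c \<in> ?Z" "d \<in> ?Z" "c < d" for c d
      using f[OF that(1)] f[OF that(2)] that by (meson less_trans)
    have inj: "inj_on f ?Z"
    proof (rule inj_onI, rule ccontr)
      fix x y assume xy: "x \<in> ?Z" "y \<in> ?Z" "f x = f y" "x \<noteq> y"
      then have "x < y \<or> y < x" by linarith
      then show False using lt[OF xy(1,2)] lt[OF xy(2,1)] xy(3) by linarith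
    qed
    have "e \<notin> f ` ?Z" using f c0 e by fastforce
    then have "card (insert e (f ` ?Z)) = Suc (card ?Z)" using finZ card_image[OF inj] by simp
    moreover have "insert e (f ` ?Z) \<subseteq> ?Y" using e f by blast
    ultimately have "Suc (card ?Z) \<le> card ?Y" using card_mono[OF finY] by metis
    then show ?thesis using up Suc by linarith
  qed
qed simp

lemma parabolic_D_zero_count: "finite {t. parabolic_D m t = 0}" "card {t. parabolic_D m t = 0} = m"
  using hermite_zero_count[of m] poly_roots_finite[OF hermite_nonzero[of m]] by (simp_all add: parabolic_D_gauss_poly gauss_poly_def)

text \<open>The polynomial factors of D_m and -D_m' have leading coefficients 1 and 1/2, hence
  exceed a positive constant for large t.\<close>

lemma parabolic_D_tail:
  "\<exists>c>0. \<exists>t0>0. \<forall>t\<ge>t0. c * exp (- (t^2) / 4) \<le> parabolic_D m t \<and> parabolic_D' m t \<le> - c * exp (- (t^2) / 4)"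
proof -
  have 1: "0 < lead_coeff (hermite_poly m)" using hermite_degree[of m] by simp
  have c: "coeff (- hermite_poly' m) (Suc m) = 1/2"
    using hermite_degree[of m] by (simp add: hermite_poly'_def coeff_pderiv coeff_eq_0)
  have "degree (- hermite_poly' m) \<le> Suc m"
    unfolding hermite_poly'_def using hermite_degree[of m]
    by (auto intro!: degree_diff_le order_trans[OF degree_smult_le] order_trans[OF degree_mult_le] simp: degree_pderiv simp del: mult_pCons_left)
  then have "degree (- hermite_poly' m) = Suc m" using c le_degree[of "- hermite_poly' m" "Suc m"] by auto
  then have 2: "0 < lead_coeff (- hermite_poly' m)" using c by simp
  obtain c1 t1 where 3: "c1 > 0" "\<And>t. t \<ge> t1 \<Longrightarrow> c1 \<le> poly (hermite_poly m) t" using poly_pinfty_gt_lc[OF 1] 1 by blast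
  obtain c2 t2 where 4: "c2 > 0" "\<And>t. t \<ge> t2 \<Longrightarrow> c2 \<le> poly (- hermite_poly' m) t" using poly_pinfty_gt_lc[OF 2] 2 by blast
  define c where "c = min c1 c2"
  define t0 where "t0 = max 1 (max t1 t2)"
  have "c * exp (- (t^2) / 4) \<le> parabolic_D m t \<and> parabolic_D' m t \<le> - c * exp (- (t^2) / 4)" if t: "t \<ge> t0" for t
  proof
    have "c \<le> poly (hermite_poly m) t" using 3(2)[of t] t by (auto simp: c_def t0_def)
    then show "c * exp (- (t^2) / 4) \<le> parabolic_D m t"
      unfolding parabolic_D_gauss_poly gauss_poly_def by (subst mult.commute) (intro mult_left_mono, auto)
    have "poly (hermite_poly' m) t \<le> - c" using 4(2)[of t] t by (auto simp: c_def t0_def)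
    then show "parabolic_D' m t \<le> - c * exp (- (t^2) / 4)"
      unfolding gauss_poly_def by (subst (2) mult.commute) (intro mult_left_mono, auto)
  qed
  moreover have "c > 0" "t0 > 0" using 3 4 by (auto simp: c_def t0_def)
  ultimately show ?thesis by blast
qed

section \<open>Truncated expansions\<close>

text \<open>The pairs with j + s \<le> n form the triangle of the Cauchy product; every other term
  of the rectangle carries at least x^(n+1). J may exceed n because the operator applied to a
  truncated series is summed two orders further.\<close>

lemma truncated_cauchy_product:
  fixes a :: "nat \<Rightarrow> nat \<Rightarrow> real"
  assumes x: "0 \<le> x" "x \<le> 1" and nJ: "n \<le> J"
  shows "\<bar>(\<Sum>j\<le>J. \<Sum>s\<le>n. x^(j + s) * a j s) - (\<Sum>r\<le>n. x^r * (\<Sum>j\<le>r. a j (r - j)))\<bar>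
    \<le> x^(n + 1) * (\<Sum>j\<le>J. \<Sum>s\<le>n. \<bar>a j s\<bar>)"
proof -
  let ?S = "{..J} \<times> {..n}" and ?T = "{(i, j). i + j \<le> n}"
  let ?f = "\<lambda>(j, s). x^(j + s) * a j s"
  have T: "?T \<subseteq> ?S" using nJ by auto
  have "(\<Sum>j\<le>J. \<Sum>s\<le>n. x^(j + s) * a j s) = sum ?f ?S" by (simp add: sum.cartesian_product)
  also have "\<dots> = sum ?f ?T + sum ?f (?S - ?T)" using sum.subset_diff[OF T, of ?f] by simp
  also have "sum ?f ?T = (\<Sum>r\<le>n. \<Sum>j\<le>r. x^(j + (r - j)) * a j (r - j))"
    by (rule sum.triangle_reindex_eq)
  also have "\<dots> = (\<Sum>r\<le>n. x^r * (\<Sum>j\<le>r. a j (r - j)))" by (simp add: sum_distrib_left)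
  finally have "(\<Sum>j\<le>J. \<Sum>s\<le>n. x^(j + s) * a j s) - (\<Sum>r\<le>n. x^r * (\<Sum>j\<le>r. a j (r - j))) = sum ?f (?S - ?T)" by simp
  also have "\<bar>\<dots>\<bar> \<le> (\<Sum>p\<in>?S - ?T. \<bar>?f p\<bar>)" by (rule sum_abs)
  also have "\<dots> \<le> (\<Sum>p\<in>?S - ?T. x^(n + 1) * (case p of (j, s) \<Rightarrow> \<bar>a j s\<bar>))"
  proof (rule sum_mono)
    fix p assume p: "p \<in> ?S - ?T"
    obtain j s where js: "p = (j, s)" by (metis prod.exhaust)
    have "x^(j + s) \<le> x^(n + 1)" by (rule power_decreasing) (use p js x in auto)
    then show "\<bar>?f p\<bar> \<le> x^(n + 1) * (case p of (j, s) \<Rightarrow> \<bar>a j s\<bar>)"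
      using x by (simp add: js abs_mult mult_right_mono)
  qed
  also have "\<dots> \<le> (\<Sum>p\<in>?S. x^(n + 1) * (case p of (j, s) \<Rightarrow> \<bar>a j s\<bar>))"
    by (rule sum_mono2) (use x in auto)
  also have "\<dots> = x^(n + 1) * (\<Sum>j\<le>J. \<Sum>s\<le>n. \<bar>a j s\<bar>)"
    by (simp add: sum_distrib_left sum.cartesian_product split_def)
  finally show ?thesis .
qed

lemma truncated_product:
  fixes a b :: "nat \<Rightarrow> real"
  assumes x: "0 \<le> x" "x \<le> 1" and nJ: "n \<le> J"
  shows "\<bar>(\<Sum>j\<le>J. a j * x^j) * (\<Sum>s\<le>n. b s * x^s) - (\<Sum>r\<le>n. x^r * (\<Sum>j\<le>r. a j * b (r - j)))\<bar>
    \<le> x^(n + 1) * ((\<Sum>j\<le>J. \<bar>a j\<bar>) * (\<Sum>s\<le>n. \<bar>b s\<bar>))"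
proof -
  have "(\<Sum>j\<le>J. a j * x^j) * (\<Sum>s\<le>n. b s * x^s) = (\<Sum>j\<le>J. \<Sum>s\<le>n. x^(j + s) * (a j * b s))"
    by (simp add: sum_product power_add mult_ac)
  moreover have "(\<Sum>j\<le>J. \<bar>a j\<bar>) * (\<Sum>s\<le>n. \<bar>b s\<bar>) = (\<Sum>j\<le>J. \<Sum>s\<le>n. \<bar>a j * b s\<bar>)"
    by (simp add: sum_product abs_mult)
  ultimately show ?thesis using truncated_cauchy_product[OF x nJ, of "\<lambda>j s. a j * b s"] by simp
qed

text \<open>The remainder is y^(n+1) times a series whose absolute values converge even at y =
  1/2.\<close>

lemma binomial_series_remainder:
  fixes r :: real
  shows "\<exists>C>0. \<forall>y. 0 \<le> y \<and> y \<le> 1/2 \<longrightarrow> \<bar>(1 - y) powr r - (\<Sum>j\<le>n. (r gchoose j) * (- y)^j)\<bar> \<le> C * y^(n + 1)"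
proof -
  have s: "(\<lambda>j. (r gchoose j) * z^j) sums (1 + z) powr r" if "\<bar>z\<bar> < 1" for z :: real
    by (rule gen_binomial_real[OF that])
  have "summable (\<lambda>j. norm ((r gchoose j) * (1/2)^j))"
  proof (rule powser_insidea)
    show "summable (\<lambda>j. (r gchoose j) * (3/4)^j)" using s[of "3/4"] by (simp add: sums_iff)
  qed simp
  then have sa: "summable (\<lambda>j. \<bar>r gchoose j\<bar> * (1/2)^j)" by (simp add: abs_mult)
  have sb: "summable (\<lambda>i. \<bar>r gchoose (i + Suc n)\<bar> * (1/2)^i)"
  proof -
    have "summable (\<lambda>i. \<bar>r gchoose (i + Suc n)\<bar> * (1/2)^(i + Suc n))" using sa by (subst summable_iff_shift)
    then have "summable (\<lambda>i. (\<bar>r gchoose (i + Suc n)\<bar> * (1/2)^(i + Suc n)) * 2^Suc n)" by (rule summable_mult2)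
    then show ?thesis by (simp add: power_add power_one_over field_simps)
  qed
  define C where "C = (\<Sum>i. \<bar>r gchoose (i + Suc n)\<bar> * (1/2)^i) + 1"
  have "\<bar>(1 - y) powr r - (\<Sum>j\<le>n. (r gchoose j) * (- y)^j)\<bar> \<le> C * y^(n + 1)" if y: "0 \<le> y" "y \<le> 1/2" for y
  proof -
    have sy: "(\<lambda>j. (r gchoose j) * (- y)^j) sums (1 - y) powr r" using s[of "- y"] y by simp
    then have "(\<lambda>i. (r gchoose (i + Suc n)) * (- y)^(i + Suc n)) sums ((1 - y) powr r - (\<Sum>j<Suc n. (r gchoose j) * (- y)^j))"
      by (rule sums_split_initial_segment)
    then have t: "(\<lambda>i. (r gchoose (i + Suc n)) * (- y)^(i + Suc n)) sums ((1 - y) powr r - (\<Sum>j\<le>n. (r gchoose j) * (- y)^j))"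
      by (simp only: lessThan_Suc_atMost)
    have b: "norm ((r gchoose (i + Suc n)) * (- y)^(i + Suc n)) \<le> (\<bar>r gchoose (i + Suc n)\<bar> * (1/2)^i) * y^Suc n" for i
    proof -
      have "y^i \<le> (1/2)^i" by (rule power_mono) (use y in auto)
      then have "\<bar>r gchoose (i + Suc n)\<bar> * (y^i * y^Suc n) \<le> \<bar>r gchoose (i + Suc n)\<bar> * ((1/2)^i * y^Suc n)"
        using y by (intro mult_left_mono mult_right_mono) auto
      then show ?thesis using y by (simp add: abs_mult power_add power_abs mult_ac)
    qed
    have sc: "summable (\<lambda>i. (\<bar>r gchoose (i + Suc n)\<bar> * (1/2)^i) * y^Suc n)" by (rule summable_mult2[OF sb])
    have "\<bar>(1 - y) powr r - (\<Sum>j\<le>n. (r gchoose j) * (- y)^j)\<bar> = norm (\<Sum>i. (r gchoose (i + Suc n)) * (- y)^(i + Suc n))"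
      using t by (simp add: sums_iff)
    also have "\<dots> \<le> (\<Sum>i. (\<bar>r gchoose (i + Suc n)\<bar> * (1/2)^i) * y^Suc n)"
      by (rule norm_suminf_le[OF b sc])
    also have "\<dots> = (\<Sum>i. \<bar>r gchoose (i + Suc n)\<bar> * (1/2)^i) * y^Suc n" by (rule suminf_mult2[OF sb, symmetric])
    also have "\<dots> \<le> C * y^(n + 1)" using y by (simp add: C_def algebra_simps)
    finally show ?thesis .
  qed
  moreover have "C > 0" unfolding C_def by (intro add_nonneg_pos suminf_nonneg sb) auto
  ultimately show ?thesis by blast
qed

text \<open>Borel's lemma for asymptotic series in \<open>1/x\<close>: the number of summands grows slowly with \<open>x\<close>.\<close>

lemma asymptotic_series_realised:
  fixes c :: "nat \<Rightarrow> real"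
  shows "\<exists>g. \<forall>n. \<exists>B x0. \<forall>x\<ge>x0. \<bar>g x - (\<Sum>s\<le>n. c s / x^s)\<bar> \<le> B / x^(n + 1)"
proof -
  \<comment> \<open>The sum for x runs to the largest N satisfying both conditions. The first makes
    such an N exist; the second bounds everything past index n + 1 by x / x^(n+2) = 1 /
    x^(n+1).\<close>
  define P where "P x N \<longleftrightarrow> real N \<le> x \<and> (\<Sum>s\<le>N. \<bar>c s\<bar>) \<le> x" for x :: real and N
  define N where "N x = (GREATEST n. P x n)" for x
  define g where "g x = (\<Sum>s\<le>N x. c s / x^s)" for x
  have "\<bar>g x - (\<Sum>s\<le>n. c s / x^s)\<bar> \<le> (\<bar>c (n + 1)\<bar> + 1) / x^(n + 1)"
    if x: "x \<ge> max 1 (max (real n) (\<Sum>s\<le>n. \<bar>c s\<bar>))" for n x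
  proof -
    have x1: "x \<ge> 1" "x > 0" using x by auto
    have Pn: "P x n" using x by (simp add: P_def)
    have bd: "P x y \<Longrightarrow> y \<le> nat \<lceil>x\<rceil>" for y unfolding P_def by (metis nat_le_iff le_ceiling_iff of_nat_ceiling of_nat_le_iff order_trans)
    have PN: "P x (N x)" unfolding N_def by (rule GreatestI_nat[of "P x", OF Pn]) (use bd in blast)
    have nN: "n \<le> N x" unfolding N_def by (rule Greatest_le_nat[of "P x", OF Pn]) (use bd in blast)
    have "{..N x} = {..n} \<union> {n<..N x}" using nN by auto
    then have "g x = (\<Sum>s\<le>n. c s / x^s) + (\<Sum>s\<in>{n<..N x}. c s / x^s)"
      unfolding g_def by (simp add: sum.union_disjoint ivl_disj_int)
    then have "\<bar>g x - (\<Sum>s\<le>n. c s / x^s)\<bar> = \<bar>\<Sum>s\<in>{n<..N x}. c s / x^s\<bar>" by simp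
    also have "\<dots> \<le> (\<Sum>s\<in>{n<..N x}. \<bar>c s / x^s\<bar>)" by (rule sum_abs)
    also have "\<dots> \<le> (\<Sum>s\<in>{n<..N x}. (if s = n + 1 then \<bar>c (n + 1)\<bar> / x^(n + 1) else 0) + \<bar>c s\<bar> / x^(n + 2))"
    proof (rule sum_mono)
      fix s assume s: "s \<in> {n<..N x}"
      show "\<bar>c s / x^s\<bar> \<le> (if s = n + 1 then \<bar>c (n + 1)\<bar> / x^(n + 1) else 0) + \<bar>c s\<bar> / x^(n + 2)"
      proof (cases "s = n + 1")
        case True then show ?thesis using x1 by (simp add: abs_divide)
      next
        case False
        then have "x^(n + 2) \<le> x^s" using s x1 by (intro power_increasing) auto
        then have "\<bar>c s\<bar> / x^s \<le> \<bar>c s\<bar> / x^(n + 2)" using x1 by (intro divide_left_mono) auto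
        then show ?thesis using False x1 by (simp add: abs_divide)
      qed
    qed
    also have "\<dots> \<le> \<bar>c (n + 1)\<bar> / x^(n + 1) + (\<Sum>s\<in>{n<..N x}. \<bar>c s\<bar>) / x^(n + 2)"
      using x1 by (simp add: sum.distrib sum_divide_distrib)
    also have "\<dots> \<le> \<bar>c (n + 1)\<bar> / x^(n + 1) + x / x^(n + 2)"
    proof -
      have "(\<Sum>s\<in>{n<..N x}. \<bar>c s\<bar>) \<le> (\<Sum>s\<le>N x. \<bar>c s\<bar>)" by (rule sum_mono2) auto
      also have "\<dots> \<le> x" using PN by (simp add: P_def)
      finally show ?thesis using x1 by (intro add_left_mono divide_right_mono) auto
    qed
    also have "x / x^(n + 2) = 1 / x^(n + 1)" using x1 by simp
    finally show ?thesis by (simp add: add_divide_distrib)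
  qed
  then show ?thesis by blast
qed

text \<open>Around each simple zero there is an interval on which g' keeps its sign and a definite
  size; away from these intervals |g| is bounded below by compactness. A C^1 perturbation below both
  bounds is strictly monotone with a change of sign on each interval and has no zero
  elsewhere.\<close>

lemma zeros_of_perturbation:
  fixes g g' :: "real \<Rightarrow> real"
  assumes dg: "\<And>x. (g has_real_derivative g' x) (at x)" and cg': "\<And>x. isCont g' x"
    and fin: "finite {x. g x = 0}" and inside: "\<And>x. g x = 0 \<Longrightarrow> a < x \<and> x < b"
    and simple: "\<And>x. g x = 0 \<Longrightarrow> g' x \<noteq> 0"
  shows "\<exists>\<eta>>0. \<forall>f f'. (\<forall>x. (f has_real_derivative f' x) (at x)) \<and>
     (\<forall>x. a \<le> x \<and> x \<le> b \<longrightarrow> \<bar>f x - g x\<bar> < \<eta> \<and> \<bar>f' x - g' x\<bar> < \<eta>) \<longrightarrow>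
     finite {x. a \<le> x \<and> x \<le> b \<and> f x = 0} \<and> card {x. a \<le> x \<and> x \<le> b \<and> f x = 0} = card {x. g x = 0}"
proof -
  let ?Z = "{x. g x = 0}"
  \<comment> \<open>The radius is at most half the distance to any other zero, so the balls are
    disjoint and their end points lie outside every ball.\<close>
  have ex: "\<exists>d>0. d \<le> z - a \<and> d \<le> b - z \<and> (\<forall>y\<in>?Z. y \<noteq> z \<longrightarrow> 2 * d \<le> \<bar>z - y\<bar>) \<and>
     (\<forall>y. \<bar>y - z\<bar> \<le> d \<longrightarrow> \<bar>g' z\<bar> / 2 \<le> g' y * sgn (g' z))" if z: "z \<in> ?Z" for z
  proof -
    obtain d1 where d1: "d1 > 0" "\<And>y. y \<in> ?Z \<Longrightarrow> y \<noteq> z \<Longrightarrow> d1 \<le> dist z y"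
      using finite_set_avoid[OF fin, of z] by blast
    have c: "isCont (\<lambda>y. g' y * sgn (g' z)) z" by (intro continuous_intros cg')
    have "g' z \<noteq> 0" using simple z by auto
    then have p: "\<bar>g' z\<bar> / 2 < g' z * sgn (g' z)" by (cases "g' z > 0") (auto simp: sgn_if)
    have "eventually (\<lambda>y. \<bar>g' z\<bar> / 2 < g' y * sgn (g' z)) (at z)"
      by (rule order_tendstoD(1)[OF c[unfolded isCont_def] p])
    then obtain d2 where d2: "d2 > 0" "\<And>y. y \<noteq> z \<Longrightarrow> dist y z < d2 \<Longrightarrow> \<bar>g' z\<bar> / 2 < g' y * sgn (g' z)"
      by (auto simp: eventually_at)
    then have d2: "d2 > 0" "\<And>y. dist y z < d2 \<Longrightarrow> \<bar>g' z\<bar> / 2 < g' y * sgn (g' z)" using p by metis+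
    define d where "d = min (d1 / 2) (min (d2 / 2) (min (z - a) (b - z)))"
    have "d > 0" using d1 d2 inside z by (auto simp: d_def)
    moreover have "d \<le> d1 / 2" unfolding d_def by (rule min.cobounded1)
    moreover have "d \<le> d2 / 2" unfolding d_def by (rule min.coboundedI2, rule min.cobounded1)
    moreover have "d \<le> z - a" "d \<le> b - z" unfolding d_def by (auto simp: min_le_iff_disj)
    ultimately have "d > 0" "d \<le> d1 / 2" "d \<le> d2 / 2" "d \<le> z - a" "d \<le> b - z" by auto
    moreover have "2 * d \<le> \<bar>z - y\<bar>" if "y \<in> ?Z" "y \<noteq> z" for y
      using d1(2)[OF that] \<open>d \<le> d1 / 2\<close> by (simp add: dist_real_def)
    moreover have "\<bar>g' z\<bar> / 2 \<le> g' y * sgn (g' z)" if "\<bar>y - z\<bar> \<le> d" for y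
      using d2(2)[of y] d2(1) that \<open>d \<le> d2 / 2\<close> by (simp add: dist_real_def)
    ultimately show ?thesis by blast
  qed
  then obtain d where d: "\<And>z. z \<in> ?Z \<Longrightarrow> d z > 0 \<and> d z \<le> z - a \<and> d z \<le> b - z \<and> (\<forall>y\<in>?Z. y \<noteq> z \<longrightarrow> 2 * d z \<le> \<bar>z - y\<bar>) \<and>
     (\<forall>y. \<bar>y - z\<bar> \<le> d z \<longrightarrow> \<bar>g' z\<bar> / 2 \<le> g' y * sgn (g' z))" by metis
  define K where "K = {a..b} - (\<Union>z\<in>?Z. ball z (d z))"
  have "compact K" unfolding K_def by (intro compact_diff compact_Icc open_UN ballI open_ball)
  then have cK: "compact ((\<lambda>x. \<bar>g x\<bar>) ` K)"
    by (intro compact_continuous_image continuous_at_imp_continuous_on continuous_intros) (use DERIV_isCont[OF dg] in auto)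
  have "\<exists>e>0. \<forall>x\<in>K. e \<le> \<bar>g x\<bar>"
  proof (cases "K = {}")
    case False
    then obtain x where x: "x \<in> K" "\<And>y. y \<in> K \<Longrightarrow> \<bar>g x\<bar> \<le> \<bar>g y\<bar>" using compact_attains_inf[OF cK] by auto
    have "g x \<noteq> 0" using x(1) d by (force simp: K_def)
    then show ?thesis using x by (intro exI[of _ "\<bar>g x\<bar>"]) auto
  qed (auto intro: exI[of _ 1])
  then obtain e where e: "e > 0" "\<And>x. x \<in> K \<Longrightarrow> e \<le> \<bar>g x\<bar>" by blast
  have "\<exists>e'>0. \<forall>z\<in>?Z. e' \<le> \<bar>g' z\<bar> / 2"
  proof (cases "?Z = {}")
    case False
    have "0 < Min ((\<lambda>z. \<bar>g' z\<bar> / 2) ` ?Z)" using fin False simple by (subst Min_gr_iff) auto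
    moreover have "Min ((\<lambda>z. \<bar>g' z\<bar> / 2) ` ?Z) \<le> \<bar>g' z\<bar> / 2" if "z \<in> ?Z" for z
      by (rule Min_le) (use fin that in auto)
    ultimately show ?thesis by blast
  qed (auto intro: exI[of _ 1])
  then obtain e' where e': "e' > 0" "\<And>z. z \<in> ?Z \<Longrightarrow> e' \<le> \<bar>g' z\<bar> / 2" by blast
  define \<eta> where "\<eta> = min e e'"
  have \<eta>: "\<eta> > 0" "\<eta> \<le> e" "\<eta> \<le> e'" using e e' by (auto simp: \<eta>_def)
  have "finite {x. a \<le> x \<and> x \<le> b \<and> f x = 0} \<and> card {x. a \<le> x \<and> x \<le> b \<and> f x = 0} = card ?Z"
    if df: "\<forall>x. (f has_real_derivative f' x) (at x)" and cl: "\<forall>x. a \<le> x \<and> x \<le> b \<longrightarrow> \<bar>f x - g x\<bar> < \<eta> \<and> \<bar>f' x - g' x\<bar> < \<eta>" for f f'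
  proof -
    let ?Y = "{x. a \<le> x \<and> x \<le> b \<and> f x = 0}"
    have mono: "f x * sgn (g' z) < f y * sgn (g' z)" if z: "z \<in> ?Z" and xy: "z - d z \<le> x" "x < y" "y \<le> z + d z" for x y z
    proof (rule DERIV_pos_imp_increasing[OF xy(2), of "\<lambda>x. f x * sgn (g' z)"])
      fix t assume t: "x \<le> t" "t \<le> y"
      have "\<bar>t - z\<bar> \<le> d z" using t xy by auto
      then have 1: "e' \<le> g' t * sgn (g' z)" using d[OF z] e'(2)[OF z] by force
      have "a \<le> t" "t \<le> b" using t xy d[OF z] by auto
      then have "\<bar>f' t - g' t\<bar> < e'" using cl \<eta> by force
      moreover have "\<bar>(f' t - g' t) * sgn (g' z)\<bar> \<le> \<bar>f' t - g' t\<bar>" by (simp add: abs_mult abs_sgn_eq)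
      ultimately have "0 < f' t * sgn (g' z)" using 1 by (simp add: algebra_simps)
      then show "\<exists>y. ((\<lambda>x. f x * sgn (g' z)) has_real_derivative y) (at t) \<and> 0 < y"
        using df by (intro exI[of _ "f' t * sgn (g' z)"]) (auto intro!: derivative_eq_intros)
    qed
    have gmono: "g x * sgn (g' z) < g y * sgn (g' z)" if z: "z \<in> ?Z" and xy: "z - d z \<le> x" "x < y" "y \<le> z + d z" for x y z
    proof (rule DERIV_pos_imp_increasing[OF xy(2), of "\<lambda>x. g x * sgn (g' z)"])
      fix t assume t: "x \<le> t" "t \<le> y"
      have "\<bar>t - z\<bar> \<le> d z" using t xy by auto
      then have "0 < g' t * sgn (g' z)" using d[OF z] e'(2)[OF z] e'(1) by force
      then show "\<exists>y. ((\<lambda>x. g x * sgn (g' z)) has_real_derivative y) (at t) \<and> 0 < y"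
        using dg by (intro exI[of _ "g' t * sgn (g' z)"]) (auto intro!: derivative_eq_intros)
    qed
    have inK: "z + s * d z \<in> K" if z: "z \<in> ?Z" and s: "s = 1 \<or> s = -1" for z s
    proof -
      have "z + s * d z \<notin> ball y (d y)" if y: "y \<in> ?Z" for y
      proof (cases "y = z")
        case True then show ?thesis using s d[OF z] by (auto simp: dist_real_def)
      next
        case False
        then have "2 * d z \<le> \<bar>z - y\<bar>" "2 * d y \<le> \<bar>y - z\<bar>" using d[OF z] d[OF y] z y by auto
        then show ?thesis using s d[OF z] d[OF y] by (auto simp: dist_real_def)
      qed
      then show ?thesis using d[OF z] s by (auto simp: K_def)
    qed
    have root: "\<exists>x. z - d z < x \<and> x < z + d z \<and> f x = 0" if z: "z \<in> ?Z" for z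
    proof -
      let ?s = "sgn (g' z)"
      have s: "\<bar>?s\<bar> = 1" using simple z by (auto simp: sgn_if)
      have dz: "d z > 0" "d z \<le> z - a" "d z \<le> b - z" using d[OF z] by auto
      have gl: "g (z - d z) * ?s < 0" "0 < g (z + d z) * ?s" using gmono[OF z, of "z - d z" z] gmono[OF z, of z "z + d z"] z dz by auto
      have "e \<le> \<bar>g (z - d z)\<bar>" "e \<le> \<bar>g (z + d z)\<bar>" using e(2)[OF inK[OF z, of "-1"]] e(2)[OF inK[OF z, of 1]] by auto
      then have ge: "g (z - d z) * ?s \<le> - e" "e \<le> g (z + d z) * ?s"
        using gl s by (auto simp: sgn_if split: if_splits)
      have cl1: "\<bar>(f y - g y) * ?s\<bar> < e" if "a \<le> y" "y \<le> b" for y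
        using cl that \<eta>(2) s by (force simp: abs_mult)
      have "f (z - d z) * ?s < 0" "0 < f (z + d z) * ?s"
        using ge cl1[of "z - d z"] cl1[of "z + d z"] dz by (auto simp: algebra_simps abs_less_iff)
      moreover have "isCont (\<lambda>x. f x * ?s) y" for y using df DERIV_isCont by (intro continuous_intros) blast
      ultimately obtain x where x: "z - d z \<le> x" "x \<le> z + d z" "f x * ?s = 0"
        using IVT[of "\<lambda>x. f x * ?s" "z - d z" 0 "z + d z"] dz by auto
      then have "x \<noteq> z - d z" "x \<noteq> z + d z" using \<open>f (z - d z) * ?s < 0\<close> \<open>0 < f (z + d z) * ?s\<close> by auto
      moreover have "?s \<noteq> 0" using s by linarith
      ultimately show ?thesis using x by (intro exI[of _ x]) auto
    qed
    then obtain r where r: "\<And>z. z \<in> ?Z \<Longrightarrow> z - d z < r z \<and> r z < z + d z \<and> f (r z) = 0" by metis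
    have "inj_on r ?Z"
    proof (rule inj_onI, rule ccontr)
      fix x y assume xy: "x \<in> ?Z" "y \<in> ?Z" "r x = r y" "x \<noteq> y"
      then have "2 * d x \<le> \<bar>x - y\<bar>" "2 * d y \<le> \<bar>y - x\<bar>" using d[OF xy(1)] d[OF xy(2)] by auto
      then show False using r[OF xy(1)] r[OF xy(2)] xy(3) by auto
    qed
    moreover have "r ` ?Z = ?Y"
    proof
      show "r ` ?Z \<subseteq> ?Y" using r d by fastforce
      show "?Y \<subseteq> r ` ?Z"
      proof
        fix x assume x: "x \<in> ?Y"
        have "x \<notin> K" using e(2)[of x] cl x \<eta>(2) by force
        then obtain z where z: "z \<in> ?Z" "\<bar>z - x\<bar> < d z" using x by (auto simp: K_def dist_real_def)
        have "x = r z"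
        proof (rule ccontr)
          assume "x \<noteq> r z"
          then have "x < r z \<or> r z < x" by linarith
          moreover have "z - d z \<le> x" "x \<le> z + d z" using z(2) by linarith+
          ultimately have "x < r z \<and> z - d z \<le> x \<or> r z < x \<and> x \<le> z + d z" by blast
          then show False using mono[OF z(1), of x "r z"] mono[OF z(1), of "r z" x] r[OF z(1)] z(2) x by auto
        qed
        then show "x \<in> r ` ?Z" using z(1) by blast
      qed
    qed
    ultimately have "bij_betw r ?Z ?Y" unfolding bij_betw_def by blast
    then show ?thesis using fin bij_betw_same_card[of r ?Z ?Y] bij_betw_finite[of r ?Z ?Y] by presburger
  qed
  then show ?thesis using \<eta>(1) by blast
qed

section \<open>The formal solution\<close>

text \<open>Differentiation conjugated by the Gaussian factor \<open>exp (- t^2 / 4)\<close>.\<close>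

definition gdiff :: "real poly \<Rightarrow> real poly" where
  "gdiff p = pderiv p - smult (1/2) ([:0, 1:] * p)"

lemma gauss_poly_has_deriv: "(gauss_poly p has_real_derivative gauss_poly (gdiff p) t) (at t)"
  unfolding gdiff_def by (rule gauss_poly_deriv)

lemma gdiff_add: "gdiff (p + r) = gdiff p + gdiff r" and gdiff_smult: "gdiff (smult c p) = smult c (gdiff p)"
  by (simp_all add: gdiff_def pderiv_add pderiv_smult smult_add_right smult_diff_right algebra_simps mult.commute)

lemma gdiff_0 [simp]: "gdiff 0 = 0" by (simp add: gdiff_def)

lemma gdiff_mult: "gdiff (p * r) = pderiv p * r + p * gdiff r"
  by (simp add: gdiff_def pderiv_mult algebra_simps)

lemma gdiff_hermite: "gdiff (hermite_poly m) = hermite_poly' m"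
  by (simp add: gdiff_def hermite_poly'_def)

text \<open>The equation of D_m with the Gaussian divided out.\<close>

lemma gdiff_hermite': "gdiff (hermite_poly' m) = qpoly m * hermite_poly m"
proof -
  have "exp (- (t^2) / 4) * poly (gdiff (hermite_poly' m)) t = exp (- (t^2) / 4) * poly (qpoly m * hermite_poly m) t" for t
    using DERIV_unique[OF gauss_poly_has_deriv[of "hermite_poly' m" t] parabolic_D'_deriv]
    by (simp add: gauss_poly_def parabolic_D_gauss_poly qpoly_def power2_eq_square algebra_simps)
  then have "poly (gdiff (hermite_poly' m)) = poly (qpoly m * hermite_poly m)" by (intro ext) simp
  then show ?thesis by (simp only: poly_eq_poly_eq_iff)
qed

text \<open>The polynomial \<open>cylinder_poly m a b\<close> stands for \<open>a D\<^sub>m + b D\<^sub>m'\<close>, with the Gaussian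
  factor removed.\<close>

definition cylinder_poly :: "nat \<Rightarrow> real poly \<Rightarrow> real poly \<Rightarrow> real poly" where
  "cylinder_poly m a b = a * hermite_poly m + b * hermite_poly' m"

lemma gauss_cylinder_poly: "gauss_poly (cylinder_poly m a b) t = poly a t * parabolic_D m t + poly b t * parabolic_D' m t"
  by (simp add: cylinder_poly_def gauss_poly_def parabolic_D_gauss_poly algebra_simps)

lemma gdiff_cylinder: "gdiff (cylinder_poly m a b) = cylinder_poly m (pderiv a + qpoly m * b) (a + pderiv b)"
  by (simp add: cylinder_poly_def gdiff_add gdiff_mult gdiff_hermite gdiff_hermite' algebra_simps)

lemma pderiv_qpoly: "pderiv (qpoly m) = smult (1/2) [:0, 1:]"
  by (simp add: qpoly_def pderiv_pCons)

lemma gdiff2_cylinder: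
  "gdiff (gdiff (cylinder_poly m a b)) = cylinder_poly m
     (pderiv (pderiv a) + smult (1/2) ([:0, 1:] * b) + 2 * qpoly m * pderiv b + qpoly m * a)
     (2 * pderiv a + pderiv (pderiv b) + qpoly m * b)"
proof -
  have "pderiv (pderiv a + qpoly m * b) + qpoly m * (a + pderiv b) =
      pderiv (pderiv a) + smult (1/2) ([:0, 1:] * b) + 2 * qpoly m * pderiv b + qpoly m * a"
    unfolding pderiv_add pderiv_mult pderiv_qpoly by (simp only: mult_smult_left mult_smult_right) (simp add: algebra_simps)
  moreover have "pderiv a + qpoly m * b + pderiv (a + pderiv b) = 2 * pderiv a + pderiv (pderiv b) + qpoly m * b"
    unfolding pderiv_add by (simp add: algebra_simps)
  ultimately show ?thesis unfolding gdiff_cylinder by (simp only:)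
qed

lemma cylinder_poly_add: "cylinder_poly m a b + cylinder_poly m c d = cylinder_poly m (a + c) (b + d)"
  and cylinder_poly_smult: "smult r (cylinder_poly m a b) = cylinder_poly m (smult r a) (smult r b)"
  and cylinder_poly_uminus: "- (cylinder_poly m a b) = cylinder_poly m (- a) (- b)"
  and cylinder_poly_mult: "p * (cylinder_poly m a b) = cylinder_poly m (p * a) (p * b)"
  and cylinder_poly_0: "cylinder_poly m 0 0 = 0"
  by (simp_all add: cylinder_poly_def algebra_simps smult_add_right)

lemma cylinder_poly_sum: "(\<Sum>i\<in>I. cylinder_poly m (a i) (b i)) = cylinder_poly m (\<Sum>i\<in>I. a i) (\<Sum>i\<in>I. b i)"
  by (induction I rule: infinite_finite_induct) (auto simp: cylinder_poly_add cylinder_poly_0)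

text \<open>\<open>coeff_A\<close> and \<open>coeff_B\<close> conceal the constants of the
  recursion; fixing an accompanying sequence \<mu> makes the expansion of the eigenvalue
  available.\<close>

locale expansion = modulus +
  fixes m :: nat and \<mu> :: "nat \<Rightarrow> real"
  assumes rec: "AB_recursion k m (coeff_A k m) (coeff_B k m) \<mu>"
begin

definition term_poly :: "nat \<Rightarrow> real poly" where
  "term_poly s = cylinder_poly m (coeff_A k m s) (coeff_B k m s)"

text \<open>The coefficients of \<open>1/\<kappa>\<close> and \<open>1/\<kappa>^2\<close> in Lam\'e's equation written in the variable \<open>t\<close>.\<close>

definition op1 :: "real poly \<Rightarrow> real poly" where
  "op1 p = - smult ((1 + k^2) / 2) ([:0, 1:] * ([:0, 1:] * gdiff (gdiff p) + gdiff p))"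

definition op2 :: "real poly \<Rightarrow> real poly" where
  "op2 p = smult (k^2 / 4) ([:0, 1:]^3 * ([:0, 1:] * gdiff (gdiff p) + 2 * gdiff p))"

text \<open>The coefficient of \<kappa>^(-j) in the formal operator: j = 0 is the harmonic
  oscillator, \<mu>_j comes from the spectral parameter, and the elliptic corrections enter at j = 1
  and j = 2 only.\<close>

definition expansion_op :: "nat \<Rightarrow> real poly \<Rightarrow> real poly" where
  "expansion_op j p = (if j = 0 then gdiff (gdiff p) - qpoly m * p else smult (\<mu> j) p
     + (if j = 1 then op1 p else 0) + (if j = 2 then op2 p else 0))"

lemma op1_cylinder: "op1 (cylinder_poly m a b) = cylinder_poly m
     (- smult ((1 + k^2) / 2) ([:0, 1:] * ([:0, 1:] * pderiv (pderiv a) + pderiv a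
            + smult (1/2) ([:0, 1:]^2 * b) + qpoly m * ([:0, 1:] * a + 2 * [:0, 1:] * pderiv b + b))))
     (- smult ((1 + k^2) / 2) ([:0, 1:] * (2 * [:0, 1:] * pderiv a + a
            + [:0, 1:] * pderiv (pderiv b) + pderiv b + qpoly m * [:0, 1:] * b)))"
proof -
  define T :: "real poly" where "T = [:0, 1:]"
  have e1: "T * (pderiv (pderiv a) + smult (1/2) (T * b) + 2 * qpoly m * pderiv b + qpoly m * a) + (pderiv a + qpoly m * b)
    = T * pderiv (pderiv a) + pderiv a + smult (1/2) (T^2 * b) + qpoly m * (T * a + 2 * T * pderiv b + b)"
    by (simp add: algebra_simps power2_eq_square smult_add_right)
  have e2: "T * (2 * pderiv a + pderiv (pderiv b) + qpoly m * b) + (a + pderiv b)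
    = 2 * T * pderiv a + a + T * pderiv (pderiv b) + pderiv b + qpoly m * T * b"
    by (simp add: algebra_simps)
  show ?thesis
    unfolding op1_def gdiff2_cylinder unfolding gdiff_cylinder T_def[symmetric] cylinder_poly_mult cylinder_poly_add cylinder_poly_smult cylinder_poly_uminus e1 e2 ..
qed

lemma op2_cylinder: "op2 (cylinder_poly m a b) = cylinder_poly m
     (smult (k^2 / 4) ([:0, 1:]^3 * ([:0, 1:] * pderiv (pderiv a) + 2 * pderiv a
            + smult (1/2) ([:0, 1:]^2 * b) + qpoly m * ([:0, 1:] * a + 2 * [:0, 1:] * pderiv b + 2 * b))))
     (smult (k^2 / 4) ([:0, 1:]^3 * (2 * [:0, 1:] * pderiv a + 2 * a
            + [:0, 1:] * pderiv (pderiv b) + 2 * pderiv b + qpoly m * [:0, 1:] * b)))"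
proof -
  define T :: "real poly" where "T = [:0, 1:]"
  have e1: "T * (pderiv (pderiv a) + smult (1/2) (T * b) + 2 * qpoly m * pderiv b + qpoly m * a) + 2 * (pderiv a + qpoly m * b)
    = T * pderiv (pderiv a) + 2 * pderiv a + smult (1/2) (T^2 * b) + qpoly m * (T * a + 2 * T * pderiv b + 2 * b)"
    by (simp add: algebra_simps power2_eq_square smult_add_right)
  have e2: "T * (2 * pderiv a + pderiv (pderiv b) + qpoly m * b) + 2 * (a + pderiv b)
    = 2 * T * pderiv a + 2 * a + T * pderiv (pderiv b) + 2 * pderiv b + qpoly m * T * b"
    by (simp add: algebra_simps)
  show ?thesis
    unfolding op2_def gdiff2_cylinder unfolding gdiff_cylinder T_def[symmetric] cylinder_poly_mult cylinder_poly_add cylinder_poly_smult e1 e2 ..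
qed

lemma expansion_op_0_cylinder: "expansion_op 0 (cylinder_poly m a b) = cylinder_poly m
    (pderiv (pderiv a) + 2 * qpoly m * pderiv b + smult (1/2) ([:0, 1:] * b)) (2 * pderiv a + pderiv (pderiv b))"
proof -
  have "gdiff (gdiff (cylinder_poly m a b)) - qpoly m * cylinder_poly m a b =
     gdiff (gdiff (cylinder_poly m a b)) + cylinder_poly m (- (qpoly m * a)) (- (qpoly m * b))"
    by (simp add: cylinder_poly_mult cylinder_poly_uminus[symmetric])
  then show ?thesis unfolding expansion_op_def gdiff2_cylinder cylinder_poly_add by (simp add: algebra_simps)
qed

lemma lagged_term: "cylinder_poly m (lagged (coeff_A k m) s i) (lagged (coeff_B k m) s i) = (if i \<le> s then term_poly (s - i) else 0)"
  by (simp add: lagged_def term_poly_def cylinder_poly_0)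

lemma op2_0: "op2 0 = 0" by (simp add: op2_def)

text \<open>The two recursion identities are the D_m' component and the D_m component of this one
  equation.\<close>

lemma term_recursion: "(\<Sum>j\<le>s. expansion_op j (term_poly (s - j))) = 0"
proof (cases "s = 0")
  case True
  then show ?thesis using coeff_A_0[of k m] coeff_B_0[of k m]
    by (simp add: term_poly_def expansion_op_0_cylinder cylinder_poly_0 pderiv_1)
next
  case False
  then have s: "1 \<le> s" by simp
  let ?A = "coeff_A k m" and ?B = "coeff_B k m"
  have "{..s} = insert 0 {1..s}" using s by auto
  then have "(\<Sum>j\<le>s. expansion_op j (term_poly (s - j))) = expansion_op 0 (term_poly s) + (\<Sum>j=1..s. expansion_op j (term_poly (s - j)))" by simp
  also have "(\<Sum>j=1..s. expansion_op j (term_poly (s - j))) = (\<Sum>j=1..s. smult (\<mu> j) (term_poly (s - j)))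
      + (\<Sum>j=1..s. if j = 1 then op1 (term_poly (s - j)) else 0) + (\<Sum>j=1..s. if j = 2 then op2 (term_poly (s - j)) else 0)"
    unfolding sum.distrib[symmetric] by (rule sum.cong) (auto simp: expansion_op_def)
  also have "(\<Sum>j=1..s. if j = 1 then op1 (term_poly (s - j)) else 0) = op1 (cylinder_poly m (lagged ?A s 1) (lagged ?B s 1))"
    unfolding lagged_term using s by (simp add: sum.delta)
  also have "(\<Sum>j=1..s. if j = 2 then op2 (term_poly (s - j)) else 0) = op2 (cylinder_poly m (lagged ?A s 2) (lagged ?B s 2))"
    unfolding lagged_term using s by (simp add: sum.delta op2_0)
  also have "(\<Sum>j=1..s. smult (\<mu> j) (term_poly (s - j))) = cylinder_poly m (\<Sum>j=1..s. smult (\<mu> j) (?A (s - j))) (\<Sum>j=1..s. smult (\<mu> j) (?B (s - j)))"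
    by (simp add: term_poly_def cylinder_poly_smult cylinder_poly_sum)
  finally have 1: "(\<Sum>j\<le>s. expansion_op j (term_poly (s - j))) = expansion_op 0 (term_poly s) +
     (cylinder_poly m (\<Sum>j=1..s. smult (\<mu> j) (?A (s - j))) (\<Sum>j=1..s. smult (\<mu> j) (?B (s - j)))
      + op1 (cylinder_poly m (lagged ?A s 1) (lagged ?B s 1)) + op2 (cylinder_poly m (lagged ?A s 2) (lagged ?B s 2)))" .
  have id: "coeff_identity1 k m ?A ?B \<mu> s" "coeff_identity2 k m ?A ?B \<mu> s" using rec s by (auto simp: AB_recursion_def)
  have alg: "X + (M + (- Y) + Z) = X - Y + Z + M" "X + (M + (- Y) + Z) = X + M - Y + Z" for X Y Z M :: "real poly" by simp_all
  show ?thesis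
    unfolding 1 op1_cylinder op2_cylinder cylinder_poly_add unfolding term_poly_def expansion_op_0_cylinder cylinder_poly_add
    unfolding alg(1)[of "2 * pderiv (?A s) + pderiv (pderiv (?B s))"] alg(2)[of "pderiv (pderiv (?A s)) + 2 * qpoly m * pderiv (?B s) + smult (1/2) ([:0, 1:] * ?B s)"]
    using id[unfolded coeff_identity1_def coeff_identity2_def Let_def qpoly_def[symmetric]]
    by (simp only: cylinder_poly_0)
qed

definition approx_poly :: "nat \<Rightarrow> real \<Rightarrow> real poly" where
  "approx_poly n x = (\<Sum>s\<le>n. smult (x^s) (term_poly s))"

lemma gauss_approx: "gauss_poly (approx_poly n x) t = (\<Sum>s\<le>n. x^s * gauss_poly (term_poly s) t)"
  by (simp add: approx_poly_def gauss_poly_def poly_sum sum_distrib_left mult_ac)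

lemma gdiff_approx: "gdiff (approx_poly n x) = (\<Sum>s\<le>n. smult (x^s) (gdiff (term_poly s)))"
  unfolding approx_poly_def by (induction n) (auto simp: gdiff_add gdiff_smult)

text \<open>The sum runs to n + 2 so that the indices 1 and 2 of the correction operators are always
  in range; the residual then becomes the full double sum of \<open>residual_eq\<close>.\<close>

definition approx_eig :: "nat \<Rightarrow> real \<Rightarrow> real" where
  "approx_eig n x = real m + 1/2 + (\<Sum>j=1..n + 2. \<mu> j * x^j)"

text \<open>Lame's equation in the variable t, with x = 1/\<kappa>, applied to the truncated series:
  the second derivative has coefficient tau'^2 and the first has coefficient tau''.\<close>

definition residual :: "nat \<Rightarrow> real \<Rightarrow> real \<Rightarrow> real" where
  "residual n x t = (1 - x * t^2 / 2) * (1 - k^2 * (x * t^2 / 2)) * gauss_poly (gdiff (gdiff (approx_poly n x))) t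
     - ((1 + k^2) * t * x / 2 - k^2 * t^3 * x^2 / 2) * gauss_poly (gdiff (approx_poly n x)) t
     + (approx_eig n x - t^2 / 4) * gauss_poly (approx_poly n x) t"

lemma expansion_op_linear: "expansion_op j (p + r) = expansion_op j p + expansion_op j r" "expansion_op j (smult c p) = smult c (expansion_op j p)"
  by (simp_all add: expansion_op_def op1_def op2_def gdiff_add gdiff_smult smult_add_right smult_diff_right algebra_simps mult.commute)

lemma expansion_op_approx: "expansion_op j (approx_poly n x) = (\<Sum>s\<le>n. smult (x^s) (expansion_op j (term_poly s)))"
  unfolding approx_poly_def by (induction n) (simp_all add: expansion_op_linear)

lemma residual_eq: "residual n x t = (\<Sum>j\<le>n + 2. \<Sum>s\<le>n. x^(j + s) * gauss_poly (expansion_op j (term_poly s)) t)"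
proof -
  let ?p = "approx_poly n x"
  have "(\<Sum>j\<le>n + 2. \<Sum>s\<le>n. x^(j + s) * gauss_poly (expansion_op j (term_poly s)) t) = (\<Sum>j\<le>n + 2. x^j * gauss_poly (expansion_op j ?p) t)"
    unfolding expansion_op_approx by (simp add: gauss_poly_def poly_sum sum_distrib_left power_add mult_ac)
  also have "\<dots> = gauss_poly (expansion_op 0 ?p) t + (\<Sum>j=1..n + 2. x^j * gauss_poly (expansion_op j ?p) t)"
  proof -
    have "{..n + 2} = insert 0 {1..n + 2}" by auto
    then show ?thesis by simp
  qed
  also have "(\<Sum>j=1..n + 2. x^j * gauss_poly (expansion_op j ?p) t) = (\<Sum>j=1..n + 2. \<mu> j * x^j * gauss_poly ?p t)
     + (\<Sum>j=1..n + 2. if j = 1 then x * gauss_poly (op1 ?p) t else 0) + (\<Sum>j=1..n + 2. if j = 2 then x^2 * gauss_poly (op2 ?p) t else 0)"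
    unfolding sum.distrib[symmetric] by (rule sum.cong) (auto simp: expansion_op_def gauss_poly_def algebra_simps)
  also have "\<dots> = (\<Sum>j=1..n + 2. \<mu> j * x^j) * gauss_poly ?p t + x * gauss_poly (op1 ?p) t + x^2 * gauss_poly (op2 ?p) t"
    by (simp add: sum_distrib_right sum.delta del: sum.cl_ivl_Suc)
  finally have "(\<Sum>j\<le>n + 2. \<Sum>s\<le>n. x^(j + s) * gauss_poly (expansion_op j (term_poly s)) t) = gauss_poly (expansion_op 0 ?p) t +
    ((\<Sum>j=1..n + 2. \<mu> j * x^j) * gauss_poly ?p t + x * gauss_poly (op1 ?p) t + x^2 * gauss_poly (op2 ?p) t)" .
  moreover define M where "M = (\<Sum>j=1..n + 2. \<mu> j * x^j)"
  ultimately have e: "(\<Sum>j\<le>n + 2. \<Sum>s\<le>n. x^(j + s) * gauss_poly (expansion_op j (term_poly s)) t) = gauss_poly (expansion_op 0 ?p) t +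
    (M * gauss_poly ?p t + x * gauss_poly (op1 ?p) t + x^2 * gauss_poly (op2 ?p) t)" by simp
  define p0 where "p0 = poly ?p t"
  define p1 where "p1 = poly (gdiff ?p) t"
  define p2 where "p2 = poly (gdiff (gdiff ?p)) t"
  have o: "poly (expansion_op 0 ?p) t = p2 - (t^2 / 4 - real m - 1/2) * p0"
    "poly (op1 ?p) t = - ((1 + k^2) / 2 * (t * (t * p2 + p1)))"
    "poly (op2 ?p) t = k^2 / 4 * (t^3 * (t * p2 + 2 * p1))"
    by (simp_all add: expansion_op_def op1_def op2_def qpoly_def p0_def p1_def p2_def power2_eq_square algebra_simps)
  have "(1 - x * t^2 / 2) * (1 - k^2 * (x * t^2 / 2)) * p2 - ((1 + k^2) * t * x / 2 - k^2 * t^3 * x^2 / 2) * p1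
      + (real m + 1/2 + M - t^2 / 4) * p0
    = (p2 - (t^2 / 4 - real m - 1/2) * p0) + (M * p0 + x * - ((1 + k^2) / 2 * (t * (t * p2 + p1)))
      + x^2 * (k^2 / 4 * (t^3 * (t * p2 + 2 * p1))))"
    by (simp add: field_simps power2_eq_square power3_eq_cube)
  then show ?thesis
    unfolding e unfolding residual_def approx_eig_def M_def[symmetric] gauss_poly_def o p0_def[symmetric] p1_def[symmetric] p2_def[symmetric]
    by (simp only: mult.left_commute[of _ "exp _"] distrib_left[symmetric] right_diff_distrib[symmetric])
qed

text \<open>By \<open>term_recursion\<close> the orders up to n cancel; what is left is the part of
  the double sum outside the triangle.\<close>

lemma residual_bound:
  assumes "0 \<le> x" "x \<le> 1"
  shows "\<bar>residual n x t\<bar> \<le> x^(n + 1) * (\<Sum>j\<le>n + 2. \<Sum>s\<le>n. \<bar>gauss_poly (expansion_op j (term_poly s)) t\<bar>)"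
proof -
  have "(\<Sum>j\<le>r. gauss_poly (expansion_op j (term_poly (r - j))) t) = gauss_poly (\<Sum>j\<le>r. expansion_op j (term_poly (r - j))) t" for r
    by (simp add: gauss_poly_def poly_sum sum_distrib_left)
  then have z: "(\<Sum>j\<le>r. gauss_poly (expansion_op j (term_poly (r - j))) t) = 0" for r by (simp add: term_recursion gauss_poly_def)
  show ?thesis unfolding residual_eq
    using truncated_cauchy_product[OF assms, of n "n + 2" "\<lambda>j s. gauss_poly (expansion_op j (term_poly s)) t"] by (simp add: z)
qed

end

text \<open>For x \<le> 1 every power x^s with s \<ge> 1 is at most x, and the sum of the absolute
  values of the terms is still superexponentially small.\<close>

lemma gauss_sum_bound:
  "\<exists>C>0. \<forall>x t. 0 \<le> x \<and> x \<le> 1 \<longrightarrow> \<bar>\<Sum>s\<le>n. x^s * gauss_poly (p s) t\<bar> \<le> C * exp (- a * \<bar>t\<bar>) \<and>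
     \<bar>(\<Sum>s\<le>n. x^s * gauss_poly (p s) t) - gauss_poly (p 0) t\<bar> \<le> C * x * exp (- a * \<bar>t\<bar>)"
proof -
  have "superexp (\<lambda>t. \<Sum>s\<le>n. \<bar>gauss_poly (p s) t\<bar>)" by (intro superexp_sum superexp_abs gauss_poly_superexp)
  then obtain C where C: "C > 0" "\<And>t. \<bar>\<Sum>s\<le>n. \<bar>gauss_poly (p s) t\<bar>\<bar> \<le> C * exp (- a * \<bar>t\<bar>)" by (rule superexpE[where a = a]) blast
  have "\<bar>\<Sum>s\<le>n. x^s * gauss_poly (p s) t\<bar> \<le> C * exp (- a * \<bar>t\<bar>) \<and>
     \<bar>(\<Sum>s\<le>n. x^s * gauss_poly (p s) t) - gauss_poly (p 0) t\<bar> \<le> C * x * exp (- a * \<bar>t\<bar>)"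
    if x: "0 \<le> x" "x \<le> 1" for x t
  proof -
    have S: "(\<Sum>s\<le>n. \<bar>gauss_poly (p s) t\<bar>) \<le> C * exp (- a * \<bar>t\<bar>)" using C(2)[of t] by linarith
    have "\<bar>\<Sum>s\<le>n. x^s * gauss_poly (p s) t\<bar> \<le> (\<Sum>s\<le>n. \<bar>gauss_poly (p s) t\<bar>)"
      by (rule order_trans[OF sum_abs]) (rule sum_mono, use x in \<open>simp add: abs_mult power_le_one mult_left_le_one_le\<close>)
    moreover have "(\<Sum>s\<le>n. x^s * gauss_poly (p s) t) - gauss_poly (p 0) t = (\<Sum>s=1..n. x^s * gauss_poly (p s) t)"
    proof -
      have "{..n} = insert 0 {1..n}" by auto
      then show ?thesis by simp
    qed
    moreover have "\<bar>\<Sum>s=1..n. x^s * gauss_poly (p s) t\<bar> \<le> (\<Sum>s=1..n. x * \<bar>gauss_poly (p s) t\<bar>)"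
    proof (rule order_trans[OF sum_abs], rule sum_mono)
      fix s assume "s \<in> {1..n}"
      then have "x^s \<le> x" using power_decreasing[of 1 s x] x by auto
      then show "\<bar>x^s * gauss_poly (p s) t\<bar> \<le> x * \<bar>gauss_poly (p s) t\<bar>" using x by (simp add: abs_mult mult_right_mono)
    qed
    moreover have "(\<Sum>s=1..n. x * \<bar>gauss_poly (p s) t\<bar>) \<le> x * (\<Sum>s\<le>n. \<bar>gauss_poly (p s) t\<bar>)"
      unfolding sum_distrib_left[symmetric] by (intro mult_left_mono sum_mono2) (use x in auto)
    moreover have "x * (\<Sum>s\<le>n. \<bar>gauss_poly (p s) t\<bar>) \<le> x * (C * exp (- a * \<bar>t\<bar>))" by (rule mult_left_mono[OF S x(1)])
    ultimately show ?thesis using S by (simp add: mult_ac)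
  qed
  then show ?thesis using C(1) by blast
qed

text \<open>Where the correction terms could outweigh the leading one, \<open>t\<close> is so large that everything
  is already smaller than any power of \<open>x\<close>.\<close>

lemma gauss_sum_lower:
  assumes c: "0 < c" and p0: "\<And>t. t0 \<le> t \<Longrightarrow> c * exp (- (t^2) / 4) \<le> gauss_poly (p 0) t"
  shows "\<exists>C>0. \<forall>x t. 0 < x \<and> x \<le> 1 \<and> t0 \<le> t \<longrightarrow> - (C * x^(N + 1)) \<le> (\<Sum>s\<le>n. x^s * gauss_poly (p s) t)"
proof -
  define S where "S t = (\<Sum>s=1..n. \<bar>poly (p s) t\<bar>)" for t
  have S0: "0 \<le> S t" for t unfolding S_def by (intro sum_nonneg) auto
  have step: "superexp (\<lambda>t. S t * f t)" if "superexp f" for f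
  proof -
    have "superexp (\<lambda>t. \<Sum>s=1..n. \<bar>poly (p s) t * f t\<bar>)" by (intro superexp_sum superexp_abs superexp_poly_mult that)
    moreover have "(\<lambda>t. \<Sum>s=1..n. \<bar>poly (p s) t * f t\<bar>) = (\<lambda>t. S t * \<bar>f t\<bar>)"
      by (simp add: S_def abs_mult sum_distrib_right)
    ultimately have "superexp (\<lambda>t. S t * \<bar>f t\<bar>)" by simp
    then show ?thesis by (rule superexp_dominated[of _ _ 1 0]) (simp add: abs_mult)
  qed
  have "superexp (\<lambda>t. S t ^ (N + 1) * exp (- (t^2) / 4))" for N
  proof (induction N)
    case 0 then show ?case using step[OF superexp_gaussian] by simp
  next
    case (Suc N) then show ?case using step[OF Suc] by (simp add: mult.assoc)
  qed
  then obtain C where C: "C > 0" "\<And>t. \<bar>S t ^ (N + 1) * exp (- (t^2) / 4)\<bar> \<le> C * exp (- 0 * \<bar>t\<bar>)"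
    using superexpE[of "\<lambda>t. S t ^ (N + 1) * exp (- (t^2) / 4)"] by blast
  have "- (C / c^N * x^(N + 1)) \<le> (\<Sum>s\<le>n. x^s * gauss_poly (p s) t)" if x: "0 < x" "x \<le> 1" and t: "t0 \<le> t" for x t
  proof -
    let ?E = "exp (- (t^2) / 4)"
    have "(\<Sum>s\<le>n. x^s * gauss_poly (p s) t) = gauss_poly (p 0) t + (\<Sum>s=1..n. x^s * gauss_poly (p s) t)"
    proof -
      have "{..n} = insert 0 {1..n}" by auto
      then show ?thesis by simp
    qed
    moreover have "\<bar>\<Sum>s=1..n. x^s * gauss_poly (p s) t\<bar> \<le> x * (S t * ?E)"
    proof -
      have "\<bar>\<Sum>s=1..n. x^s * gauss_poly (p s) t\<bar> \<le> (\<Sum>s=1..n. x * (\<bar>poly (p s) t\<bar> * ?E))"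
      proof (rule order_trans[OF sum_abs], rule sum_mono)
        fix s assume "s \<in> {1..n}"
        then have "x^s \<le> x" using power_decreasing[of 1 s x] x by auto
        then show "\<bar>x^s * gauss_poly (p s) t\<bar> \<le> x * (\<bar>poly (p s) t\<bar> * ?E)"
          using x by (simp add: abs_mult gauss_poly_def mult.commute[of ?E] mult_right_mono)
      qed
      then show ?thesis by (simp add: S_def sum_distrib_left sum_distrib_right)
    qed
    ultimately have low: "(c - x * S t) * ?E \<le> (\<Sum>s\<le>n. x^s * gauss_poly (p s) t)"
      using p0[OF t] by (simp add: algebra_simps abs_le_iff)
    show ?thesis
    proof (cases "x * S t \<le> c")
      case True
      then have "0 \<le> (c - x * S t) * ?E" by simp
      moreover have "0 \<le> C / c^N * x^(N + 1)" using C c x by simp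
      ultimately show ?thesis using low by linarith
    next
      case False
      \<comment> \<open>In this region x S / c exceeds 1, so its N-th power may be inserted. That
        buys powers of x at the price of powers of S, which the Gaussian absorbs.\<close>
      have "1 \<le> (x * S t / c)^N" by (rule one_le_power) (use False c in simp)
      then have "x * (S t * ?E) * 1 \<le> x * (S t * ?E) * (x * S t / c)^N" by (intro mult_left_mono) (use x S0[of t] in auto)
      also have "\<dots> = (S t ^ (N + 1) * ?E) * (x^(N + 1) / c^N)" by (simp add: power_mult_distrib power_divide)
      also have "\<dots> \<le> C * (x^(N + 1) / c^N)" by (rule mult_right_mono) (use C(2)[of t] x c in auto)
      finally have "x * S t * ?E \<le> C / c^N * x^(N + 1)" by (simp add: mult_ac)
      moreover have "0 \<le> c * ?E" using c by simp
      ultimately show ?thesis using low by (simp add: algebra_simps)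
    qed
  qed
  moreover have "0 < C / c^N" using C c by simp
  ultimately show ?thesis by blast
qed

section \<open>The scaled Lam\'e equation\<close>

context modulus
begin

definition tau :: "real \<Rightarrow> real \<Rightarrow> real" where "tau \<kappa> x = sqrt (2 * \<kappa>) * jacobi_sn k (x / sqrt (2 * \<kappa>))"
definition tau' :: "real \<Rightarrow> real \<Rightarrow> real" where
  "tau' \<kappa> x = jacobi_cn k (x / sqrt (2 * \<kappa>)) * jacobi_dn k (x / sqrt (2 * \<kappa>))"
definition right_end :: "real \<Rightarrow> real" where "right_end \<kappa> = sqrt (2 * \<kappa>) * elliptic_K k"

context
  fixes \<kappa> :: real
  assumes \<kappa>: "0 < \<kappa>"
begin

lemma scaled_abs_le: "\<bar>x\<bar> \<le> right_end \<kappa> \<longleftrightarrow> \<bar>x / sqrt (2 * \<kappa>)\<bar> \<le> elliptic_K k"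
  using \<kappa> by (simp add: right_end_def field_simps)

lemma tau_deriv: "(tau \<kappa> has_real_derivative tau' \<kappa> x) (at x)"
proof -
  have "((\<lambda>x. x / sqrt (2 * \<kappa>)) has_real_derivative 1 / sqrt (2 * \<kappa>)) (at x)" by (rule DERIV_cdivide[OF DERIV_ident])
  from DERIV_cmult[OF DERIV_chain2[OF sn_deriv this], of "sqrt (2 * \<kappa>)"]
  show ?thesis unfolding tau_def[abs_def] tau'_def using \<kappa> by simp
qed

lemma tau'_deriv: "(tau' \<kappa> has_real_derivative - (1 + k^2) * tau \<kappa> x / (2 * \<kappa>) + k^2 * (tau \<kappa> x)^3 / (2 * \<kappa>^2)) (at x)"
proof -
  have "((\<lambda>x. x / sqrt (2 * \<kappa>)) has_real_derivative 1 / sqrt (2 * \<kappa>)) (at x)" by (rule DERIV_cdivide[OF DERIV_ident])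
  from DERIV_chain2[OF sn_cn_dn_deriv this]
  have "(tau' \<kappa> has_real_derivative (- (1 + k^2) * jacobi_sn k (x / sqrt (2 * \<kappa>)) + 2 * k^2 * (jacobi_sn k (x / sqrt (2 * \<kappa>)))^3) * (1 / sqrt (2 * \<kappa>))) (at x)"
    unfolding tau'_def[abs_def] .
  then show ?thesis
  proof (rule DERIV_cong)
    define r where "r = sqrt (2 * \<kappa>)"
    have r: "r > 0" "r * r = 2 * \<kappa>" using \<kappa> by (auto simp: r_def)
    define s where "s = jacobi_sn k (x / sqrt (2 * \<kappa>))"
    have k2: "\<kappa> = r * r / 2" using r by simp
    show "(- (1 + k^2) * jacobi_sn k (x / sqrt (2 * \<kappa>)) + 2 * k^2 * (jacobi_sn k (x / sqrt (2 * \<kappa>)))^3) * (1 / sqrt (2 * \<kappa>)) =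
      - (1 + k^2) * tau \<kappa> x / (2 * \<kappa>) + k^2 * (tau \<kappa> x)^3 / (2 * \<kappa>^2)"
      unfolding tau_def s_def[symmetric] r_def[symmetric] k2 using r(1)
      by (simp add: field_simps power2_eq_square power3_eq_cube)
  qed
qed

lemma tau_squared: "(tau \<kappa> x)^2 / (2 * \<kappa>) = (jacobi_sn k (x / sqrt (2 * \<kappa>)))^2"
  using \<kappa> by (simp add: tau_def power_mult_distrib)

lemma tau'_squared: "(tau' \<kappa> x)^2 = (1 - (tau \<kappa> x)^2 / (2 * \<kappa>)) * (1 - k^2 * ((tau \<kappa> x)^2 / (2 * \<kappa>)))"
  unfolding tau_squared tau'_def power_mult_distrib cn_squared dn_squared ..

lemma tau_odd: "tau \<kappa> (- x) = - tau \<kappa> x"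
  by (simp add: tau_def sn_odd minus_divide_left[symmetric])

lemma tau_0 [simp]: "tau \<kappa> 0 = 0" and tau'_0 [simp]: "tau' \<kappa> 0 = 1" by (simp_all add: tau_def tau'_def)

lemma tau_end: "tau \<kappa> (right_end \<kappa>) = sqrt (2 * \<kappa>)" and tau'_end: "tau' \<kappa> (right_end \<kappa>) = 0"
  using \<kappa> by (simp_all add: tau_def tau'_def right_end_def)

lemma abs_tau_le: "\<bar>tau \<kappa> x\<bar> \<le> \<bar>x\<bar>"
  using abs_sn_le[of "x / sqrt (2 * \<kappa>)"] \<kappa> by (simp add: tau_def abs_mult field_simps)

lemma tau_lower: assumes "0 \<le> x" "x \<le> right_end \<kappa>" shows "sn_slope * x \<le> tau \<kappa> x"
proof -
  have "\<bar>x / sqrt (2 * \<kappa>)\<bar> \<le> elliptic_K k" using assms scaled_abs_le[of x] by simp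
  then have "x / sqrt (2 * \<kappa>) \<le> elliptic_K k" by linarith
  then have "sn_slope * (x / sqrt (2 * \<kappa>)) \<le> jacobi_sn k (x / sqrt (2 * \<kappa>))"
    using assms \<kappa> by (intro sn_lower) auto
  then have "sqrt (2 * \<kappa>) * (sn_slope * (x / sqrt (2 * \<kappa>))) \<le> tau \<kappa> x"
    unfolding tau_def using \<kappa> by (intro mult_left_mono) auto
  then show ?thesis using \<kappa> by simp
qed

lemma abs_tau_lower: assumes "\<bar>x\<bar> \<le> right_end \<kappa>" shows "sn_slope * \<bar>x\<bar> \<le> \<bar>tau \<kappa> x\<bar>"
  using tau_lower[of x] tau_lower[of "- x"] assms tau_odd[of x] by (cases "x \<ge> 0") auto

lemma tau'_bounds: assumes "\<bar>x\<bar> \<le> right_end \<kappa>"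
  shows "0 \<le> tau' \<kappa> x" "tau' \<kappa> x \<le> 1" "1 - x^2 / (2 * \<kappa>) \<le> tau' \<kappa> x"
proof -
  have z: "\<bar>x / sqrt (2 * \<kappa>)\<bar> \<le> elliptic_K k" using assms scaled_abs_le by blast
  show "0 \<le> tau' \<kappa> x" "tau' \<kappa> x \<le> 1" unfolding tau'_def by (rule cn_dn_bounds[OF z])+
  have "(jacobi_sn k (x / sqrt (2 * \<kappa>)))^2 \<le> (x / sqrt (2 * \<kappa>))^2" using abs_sn_le by (simp add: abs_le_square_iff)
  also have "\<dots> = x^2 / (2 * \<kappa>)" using \<kappa> by (simp add: power_divide)
  finally show "1 - x^2 / (2 * \<kappa>) \<le> tau' \<kappa> x" unfolding tau'_def using cn_dn_bounds(1)[OF z] by linarith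
qed

text \<open>Integrates the lower bound 1 - x^2/(2 \<kappa>) of tau'; the upper side is |tau| \<le>
  |x|.\<close>

lemma tau_close: assumes "\<bar>x\<bar> \<le> right_end \<kappa>" shows "\<bar>tau \<kappa> x - x\<bar> \<le> \<bar>x\<bar>^3 / (2 * \<kappa>)"
proof -
  have pos: "\<bar>tau \<kappa> x - x\<bar> \<le> x^3 / (2 * \<kappa>)" if x: "0 \<le> x" "x \<le> right_end \<kappa>" for x
  proof -
    have d: "((\<lambda>y. (1 - x^2 / (2 * \<kappa>)) * y) has_real_derivative (1 - x^2 / (2 * \<kappa>))) (at y)" for y
      using DERIV_cmult[OF DERIV_ident, of "1 - x^2 / (2 * \<kappa>)"] by simp
    have "(1 - x^2 / (2 * \<kappa>)) * x - (1 - x^2 / (2 * \<kappa>)) * 0 \<le> tau \<kappa> x - tau \<kappa> 0"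
    proof (rule increment_le_of_deriv_le[OF x(1) d tau_deriv])
      fix y assume y: "0 \<le> y" "y \<le> x"
      have "y^2 / (2 * \<kappa>) \<le> x^2 / (2 * \<kappa>)" using y \<kappa> by (intro divide_right_mono power_mono) auto
      then show "1 - x^2 / (2 * \<kappa>) \<le> tau' \<kappa> y" using tau'_bounds(3)[of y] y x by auto
    qed
    then have "x - tau \<kappa> x \<le> x^3 / (2 * \<kappa>)" by (simp add: algebra_simps power2_eq_square power3_eq_cube)
    moreover have "tau \<kappa> x \<le> x" using abs_tau_le[of x] x by auto
    ultimately show ?thesis by auto
  qed
  show ?thesis using pos[of x] pos[of "- x"] assms tau_odd[of x] by (cases "x \<ge> 0") auto
qed

end

end

section \<open>The quasi-mode in the scaled variable\<close>

context expansion
begin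

text \<open>The quasi-mode of order \<open>n\<close> in the scaled variable \<open>x = sqrt (2\<kappa>) z\<close>, for which \<open>tau \<kappa> x = t\<close>.\<close>

definition approx_mode :: "nat \<Rightarrow> real \<Rightarrow> real \<Rightarrow> real" where
  "approx_mode n \<kappa> x = gauss_poly (approx_poly n (1 / \<kappa>)) (tau \<kappa> x)"
definition approx_mode' :: "nat \<Rightarrow> real \<Rightarrow> real \<Rightarrow> real" where
  "approx_mode' n \<kappa> x = gauss_poly (gdiff (approx_poly n (1 / \<kappa>))) (tau \<kappa> x) * tau' \<kappa> x"

lemma approx_mode_deriv: assumes "0 < \<kappa>" shows "(approx_mode n \<kappa> has_real_derivative approx_mode' n \<kappa> x) (at x)"
  unfolding approx_mode_def[abs_def] approx_mode'_def by (rule DERIV_chain2[OF gauss_poly_has_deriv tau_deriv[OF assms]])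

lemma approx_mode'_deriv: assumes \<kappa>: "0 < \<kappa>"
  shows "(approx_mode' n \<kappa> has_real_derivative ((tau \<kappa> x)^2 / 4 - approx_eig n (1 / \<kappa>)) * approx_mode n \<kappa> x + residual n (1 / \<kappa>) (tau \<kappa> x)) (at x)"
  unfolding approx_mode'_def[abs_def]
proof (rule DERIV_cong[OF DERIV_mult[OF DERIV_chain2[OF gauss_poly_has_deriv tau_deriv[OF \<kappa>]] tau'_deriv[OF \<kappa>]]])
  let ?p = "approx_poly n (1 / \<kappa>)" and ?t = "tau \<kappa> x"
  have e: "gauss_poly (gdiff (gdiff ?p)) ?t * tau' \<kappa> x * tau' \<kappa> x =
      (1 - ?t^2 / (2 * \<kappa>)) * (1 - k^2 * (?t^2 / (2 * \<kappa>))) * gauss_poly (gdiff (gdiff ?p)) ?t"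
    unfolding tau'_squared[OF \<kappa>, symmetric] by (simp add: power2_eq_square)
  show "gauss_poly (gdiff (gdiff ?p)) ?t * tau' \<kappa> x * tau' \<kappa> x
      + (- (1 + k^2) * ?t / (2 * \<kappa>) + k^2 * ?t^3 / (2 * \<kappa>^2)) * gauss_poly (gdiff ?p) ?t
    = (?t^2 / 4 - approx_eig n (1 / \<kappa>)) * approx_mode n \<kappa> x + residual n (1 / \<kappa>) ?t"
  proof -
    have a1: "1 / \<kappa> * ?t^2 / 2 = ?t^2 / (2 * \<kappa>)" by simp
    have a2: "- (1 + k^2) * ?t / (2 * \<kappa>) + k^2 * ?t^3 / (2 * \<kappa>^2) = - ((1 + k^2) * ?t * (1 / \<kappa>) / 2 - k^2 * ?t^3 * (1 / \<kappa>)^2 / 2)"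
      using \<kappa> by (simp add: field_simps power2_eq_square)
    have alg: "Y * a + (- Z) * b = (T - e) * c + (Y * a - Z * b + (e - T) * c)" for Y a Z b T e c :: real
      by (simp add: algebra_simps)
    show ?thesis unfolding e a2 approx_mode_def residual_def a1 by (rule alg)
  qed
qed

lemma approx_poly_parity: "has_parity ((-1)^m) (approx_poly n x)"
proof -
  have p: "has_parity ((-1)^Suc m) (pderiv (hermite_poly m))"
    by (rule has_parity_pderiv[OF hermite_parity]) (auto simp: power_mult_distrib[symmetric])
  have h: "has_parity ((-1)^Suc m) (hermite_poly' m)" unfolding hermite_poly'_def
    by (intro has_parity_diff p has_parity_smult has_parity_mult[OF has_parity_T hermite_parity]) auto
  show ?thesis unfolding approx_poly_def term_poly_def cylinder_poly_def
    by (intro has_parity_sum has_parity_smult has_parity_add has_parity_mult[OF coeff_A_even hermite_parity]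
      has_parity_mult[OF coeff_B_odd h]) auto
qed

lemma approx_mode_parity: assumes "0 < \<kappa>" shows "approx_mode n \<kappa> (- x) = (-1)^m * approx_mode n \<kappa> x"
  using approx_poly_parity[of n "1/\<kappa>"] unfolding approx_mode_def tau_odd[OF assms] gauss_poly_def by (simp add: has_parity_iff)

lemma approx_mode'_parity: assumes \<kappa>: "0 < \<kappa>" shows "approx_mode' n \<kappa> (- x) = (-1)^Suc m * approx_mode' n \<kappa> x"
proof -
  have 1: "((\<lambda>x. approx_mode n \<kappa> (- x)) has_real_derivative - approx_mode' n \<kappa> (- x)) (at x)"
    using DERIV_mirror[of "approx_mode n \<kappa>" "approx_mode' n \<kappa> (- x)" x] approx_mode_deriv[OF \<kappa>] by simp
  have "((\<lambda>x. (-1)^m * approx_mode n \<kappa> x) has_real_derivative (-1)^m * approx_mode' n \<kappa> x) (at x)" by (rule DERIV_cmult[OF approx_mode_deriv[OF \<kappa>]])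
  then have "- approx_mode' n \<kappa> (- x) = (-1)^m * approx_mode' n \<kappa> x"
    using DERIV_unique[OF 1] by (simp only: approx_mode_parity[OF \<kappa>])
  then show ?thesis by simp
qed

lemma term_poly_0: "term_poly 0 = hermite_poly m"
  using coeff_A_0[of k m] coeff_B_0[of k m] by (simp add: term_poly_def cylinder_poly_def)

lemma gdiff_term_poly_0: "gdiff (term_poly 0) = hermite_poly' m" by (simp add: term_poly_0 gdiff_hermite)

lemma gauss_gdiff_approx: "gauss_poly (gdiff (approx_poly n x)) t = (\<Sum>s\<le>n. x^s * gauss_poly (gdiff (term_poly s)) t)"
  by (simp add: gdiff_approx gauss_poly_def poly_sum sum_distrib_left mult_ac)

lemma approx_bounds:
  "\<exists>C>0. \<forall>x t. 0 \<le> x \<and> x \<le> 1 \<longrightarrow>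
     \<bar>gauss_poly (approx_poly n x) t\<bar> \<le> C * exp (- a * \<bar>t\<bar>) \<and>
     \<bar>gauss_poly (gdiff (approx_poly n x)) t\<bar> \<le> C * exp (- a * \<bar>t\<bar>) \<and>
     \<bar>gauss_poly (approx_poly n x) t - parabolic_D m t\<bar> \<le> C * x \<and>
     \<bar>gauss_poly (gdiff (approx_poly n x)) t - parabolic_D' m t\<bar> \<le> C * x \<and>
     \<bar>residual n x t\<bar> \<le> C * x^(n + 1) * exp (- a * \<bar>t\<bar>)"
proof -
  obtain C1 where C1: "C1 > 0" "\<And>x t. 0 \<le> x \<Longrightarrow> x \<le> 1 \<Longrightarrow> \<bar>gauss_poly (approx_poly n x) t\<bar> \<le> C1 * exp (- a * \<bar>t\<bar>)"
    using gauss_sum_bound[where n = n and p = term_poly and a = a] unfolding gauss_approx by blast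
  obtain C2 where C2: "C2 > 0" "\<And>x t. 0 \<le> x \<Longrightarrow> x \<le> 1 \<Longrightarrow> \<bar>gauss_poly (gdiff (approx_poly n x)) t\<bar> \<le> C2 * exp (- a * \<bar>t\<bar>)"
    using gauss_sum_bound[where n = n and p = "\<lambda>s. gdiff (term_poly s)" and a = a] unfolding gauss_gdiff_approx by blast
  obtain C3 where C3: "C3 > 0" "\<And>x t. 0 \<le> x \<Longrightarrow> x \<le> 1 \<Longrightarrow> \<bar>gauss_poly (approx_poly n x) t - parabolic_D m t\<bar> \<le> C3 * x * exp (- 0 * \<bar>t\<bar>)"
    using gauss_sum_bound[where n = n and p = term_poly and a = 0] unfolding gauss_approx parabolic_D_gauss_poly term_poly_0 by blast
  obtain C4 where C4: "C4 > 0" "\<And>x t. 0 \<le> x \<Longrightarrow> x \<le> 1 \<Longrightarrow> \<bar>gauss_poly (gdiff (approx_poly n x)) t - parabolic_D' m t\<bar> \<le> C4 * x * exp (- 0 * \<bar>t\<bar>)"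
    using gauss_sum_bound[where n = n and p = "\<lambda>s. gdiff (term_poly s)" and a = 0] unfolding gauss_gdiff_approx gdiff_term_poly_0 by blast
  have "superexp (\<lambda>t. \<Sum>j\<le>n + 2. \<Sum>s\<le>n. \<bar>gauss_poly (expansion_op j (term_poly s)) t\<bar>)"
    by (intro superexp_sum superexp_abs gauss_poly_superexp)
  then obtain C5 where C5: "C5 > 0" "\<And>t. \<bar>\<Sum>j\<le>n + 2. \<Sum>s\<le>n. \<bar>gauss_poly (expansion_op j (term_poly s)) t\<bar>\<bar> \<le> C5 * exp (- a * \<bar>t\<bar>)"
    by (rule superexpE[where a = a]) blast
  define C where "C = C1 + C2 + C3 + C4 + C5"
  have le: "C1 \<le> C" "C2 \<le> C" "C3 \<le> C" "C4 \<le> C" "C5 \<le> C" "C > 0" using C1(1) C2(1) C3(1) C4(1) C5(1) by (auto simp: C_def)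
  have "\<bar>gauss_poly (approx_poly n x) t\<bar> \<le> C * exp (- a * \<bar>t\<bar>) \<and>
     \<bar>gauss_poly (gdiff (approx_poly n x)) t\<bar> \<le> C * exp (- a * \<bar>t\<bar>) \<and>
     \<bar>gauss_poly (approx_poly n x) t - parabolic_D m t\<bar> \<le> C * x \<and>
     \<bar>gauss_poly (gdiff (approx_poly n x)) t - parabolic_D' m t\<bar> \<le> C * x \<and>
     \<bar>residual n x t\<bar> \<le> C * x^(n + 1) * exp (- a * \<bar>t\<bar>)" if x: "0 \<le> x" "x \<le> 1" for x t
  proof (intro conjI)
    show "\<bar>gauss_poly (approx_poly n x) t\<bar> \<le> C * exp (- a * \<bar>t\<bar>)"
      by (rule order_trans[OF C1(2)[OF x]]) (intro mult_right_mono le, simp)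
    show "\<bar>gauss_poly (gdiff (approx_poly n x)) t\<bar> \<le> C * exp (- a * \<bar>t\<bar>)"
      by (rule order_trans[OF C2(2)[OF x]]) (intro mult_right_mono le, simp)
    have "C3 * x \<le> C * x" "C4 * x \<le> C * x" using le x by (auto intro: mult_right_mono)
    then show "\<bar>gauss_poly (approx_poly n x) t - parabolic_D m t\<bar> \<le> C * x"
      "\<bar>gauss_poly (gdiff (approx_poly n x)) t - parabolic_D' m t\<bar> \<le> C * x"
      using C3(2)[OF x, of t] C4(2)[OF x, of t] by auto
    have "\<bar>residual n x t\<bar> \<le> x^(n + 1) * (\<Sum>j\<le>n + 2. \<Sum>s\<le>n. \<bar>gauss_poly (expansion_op j (term_poly s)) t\<bar>)" by (rule residual_bound[OF x])
    also have "\<dots> \<le> x^(n + 1) * (C5 * exp (- a * \<bar>t\<bar>))" using C5(2)[of t] x by (intro mult_left_mono) auto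
    also have "\<dots> \<le> x^(n + 1) * (C * exp (- a * \<bar>t\<bar>))" using le x by (intro mult_left_mono mult_right_mono) auto
    finally show "\<bar>residual n x t\<bar> \<le> C * x^(n + 1) * exp (- a * \<bar>t\<bar>)" by (simp add: mult_ac)
  qed
  then show ?thesis using le by blast
qed

text \<open>On a fixed interval, passing from the truncated series to its leading term, from tau(x)
  to x, and from tau' to 1 costs O(1/\<kappa>) each.\<close>

lemma approx_mode_close:
  assumes x0: "0 < x0"
  shows "\<exists>C>0. \<forall>\<kappa> x. 1 \<le> \<kappa> \<and> x0 \<le> right_end \<kappa> \<and> \<bar>x\<bar> \<le> x0 \<longrightarrow>
    \<bar>approx_mode n \<kappa> x - parabolic_D m x\<bar> \<le> C / \<kappa> \<and> \<bar>approx_mode' n \<kappa> x - parabolic_D' m x\<bar> \<le> C / \<kappa>"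
proof -
  obtain C where C: "C > 0" "\<And>x t. 0 \<le> x \<Longrightarrow> x \<le> 1 \<Longrightarrow> \<bar>gauss_poly (approx_poly n x) t - parabolic_D m t\<bar> \<le> C * x \<and>
     \<bar>gauss_poly (gdiff (approx_poly n x)) t - parabolic_D' m t\<bar> \<le> C * x"
    using approx_bounds[of n 0] by blast
  \<comment> \<open>Gaussian-weighted polynomials have bounded derivatives, which are again of this
    kind.\<close>
  have lip: "\<exists>L>0. \<forall>s t. \<bar>gauss_poly p s - gauss_poly p t\<bar> \<le> L * \<bar>s - t\<bar>" for p
  proof -
    obtain L where L: "L > 0" "\<And>t. \<bar>gauss_poly (gdiff p) t\<bar> \<le> L * exp (- 0 * \<bar>t\<bar>)" using superexpE[OF gauss_poly_superexp] by blast
    have "norm (gauss_poly p s - gauss_poly p t) \<le> L * norm (s - t)" for s t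
      by (rule field_differentiable_bound[of UNIV "gauss_poly p" "gauss_poly (gdiff p)"]) (use L gauss_poly_has_deriv in auto)
    then show ?thesis using L(1) by auto
  qed
  obtain L1 where L1: "L1 > 0" "\<And>s t. \<bar>parabolic_D m s - parabolic_D m t\<bar> \<le> L1 * \<bar>s - t\<bar>"
    using lip[of "hermite_poly m"] unfolding parabolic_D_gauss_poly by blast
  obtain L2 where L2: "L2 > 0" "\<And>s t. \<bar>parabolic_D' m s - parabolic_D' m t\<bar> \<le> L2 * \<bar>s - t\<bar>"
    using lip[of "hermite_poly' m"] by blast
  obtain L3 where L3: "L3 > 0" "\<And>t. \<bar>parabolic_D' m t\<bar> \<le> L3 * exp (- 0 * \<bar>t\<bar>)" using superexpE[OF gauss_poly_superexp] by blast
  define B where "B = C + L1 * x0^3 + L2 * x0^3 + L3 * x0^2"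
  have main: "\<bar>approx_mode n \<kappa> x - parabolic_D m x\<bar> \<le> B / \<kappa> \<and> \<bar>approx_mode' n \<kappa> x - parabolic_D' m x\<bar> \<le> B / \<kappa>"
    if \<kappa>: "1 \<le> \<kappa>" "x0 \<le> right_end \<kappa>" and x: "\<bar>x\<bar> \<le> x0" for \<kappa> x
  proof -
    have k0: "0 < \<kappa>" using \<kappa> by simp
    have k1: "0 \<le> 1 / \<kappa>" "1 / \<kappa> \<le> 1" using \<kappa> by auto
    have xe: "\<bar>x\<bar> \<le> right_end \<kappa>" using \<kappa> x by linarith
    let ?t = "tau \<kappa> x"
    have "\<bar>x\<bar>^3 / (2 * \<kappa>) \<le> x0^3 / \<kappa>" using x k0 by (intro frac_le power_mono) auto
    then have tc: "\<bar>?t - x\<bar> \<le> x0^3 / \<kappa>" using tau_close[OF k0 xe] by linarith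
    have c1: "\<bar>gauss_poly (approx_poly n (1/\<kappa>)) ?t - parabolic_D m ?t\<bar> \<le> C / \<kappa>"
      "\<bar>gauss_poly (gdiff (approx_poly n (1/\<kappa>))) ?t - parabolic_D' m ?t\<bar> \<le> C / \<kappa>" using C(2)[OF k1, of ?t] by auto
    have "\<bar>parabolic_D m ?t - parabolic_D m x\<bar> \<le> L1 * (x0^3 / \<kappa>)"
      by (rule order_trans[OF L1(2)]) (intro mult_left_mono tc, use L1 in auto)
    then have 1: "\<bar>approx_mode n \<kappa> x - parabolic_D m x\<bar> \<le> (C + L1 * x0^3) / \<kappa>"
      using c1(1) unfolding approx_mode_def by (simp add: add_divide_distrib)
    have d2: "\<bar>parabolic_D' m ?t - parabolic_D' m x\<bar> \<le> L2 * (x0^3 / \<kappa>)"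
      by (rule order_trans[OF L2(2)]) (intro mult_left_mono tc, use L2 in auto)
    have tb: "0 \<le> tau' \<kappa> x" "tau' \<kappa> x \<le> 1" "1 - x^2 / (2 * \<kappa>) \<le> tau' \<kappa> x" using tau'_bounds[OF k0 xe] by auto
    have "x^2 \<le> x0^2" using x by (simp add: abs_le_square_iff[symmetric])
    then have "x^2 / (2 * \<kappa>) \<le> x0^2 / \<kappa>" using k0 by (intro frac_le) auto
    then have t1: "\<bar>tau' \<kappa> x - 1\<bar> \<le> x0^2 / \<kappa>" using tb by linarith
    let ?G = "gauss_poly (gdiff (approx_poly n (1/\<kappa>))) ?t"
    have "approx_mode' n \<kappa> x - parabolic_D' m x = (?G - parabolic_D' m ?t) * tau' \<kappa> x + parabolic_D' m ?t * (tau' \<kappa> x - 1) + (parabolic_D' m ?t - parabolic_D' m x)"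
      by (simp add: approx_mode'_def algebra_simps)
    moreover have "\<bar>(?G - parabolic_D' m ?t) * tau' \<kappa> x\<bar> \<le> (C / \<kappa>) * 1"
      unfolding abs_mult using c1(2) tb C k0 by (intro mult_mono) auto
    moreover have "\<bar>parabolic_D' m ?t * (tau' \<kappa> x - 1)\<bar> \<le> L3 * (x0^2 / \<kappa>)"
      unfolding abs_mult using L3(2)[of ?t] t1 L3(1) k0 by (intro mult_mono) auto
    ultimately have 2: "\<bar>approx_mode' n \<kappa> x - parabolic_D' m x\<bar> \<le> (C + L3 * x0^2 + L2 * x0^3) / \<kappa>"
      using d2 by (simp add: add_divide_distrib)
    have "C + L1 * x0^3 \<le> B" "C + L3 * x0^2 + L2 * x0^3 \<le> B" using L1(1) L2(1) L3(1) x0 by (auto simp: B_def)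
    then have "(C + L1 * x0^3) / \<kappa> \<le> B / \<kappa>" "(C + L3 * x0^2 + L2 * x0^3) / \<kappa> \<le> B / \<kappa>" using k0 by (auto intro: divide_right_mono)
    then show ?thesis using 1 2 by linarith
  qed
  have "B > 0" unfolding B_def using C(1) L1(1) L2(1) L3(1) x0 by (intro add_pos_pos) auto
  then show ?thesis using main by blast
qed

lemma approx_eig_close: "\<exists>S\<ge>0. \<forall>\<kappa>\<ge>1. \<bar>approx_eig n (1 / \<kappa>) - (real m + 1/2)\<bar> \<le> S / \<kappa>"
proof -
  define S where "S = (\<Sum>j=1..n + 2. \<bar>\<mu> j\<bar>)"
  have "\<bar>approx_eig n (1 / \<kappa>) - (real m + 1/2)\<bar> \<le> S / \<kappa>" if \<kappa>: "1 \<le> \<kappa>" for \<kappa>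
  proof -
    have "\<bar>\<Sum>j=1..n + 2. \<mu> j * (1 / \<kappa>)^j\<bar> \<le> (\<Sum>j=1..n + 2. \<bar>\<mu> j\<bar> * (1 / \<kappa>))"
    proof (rule order_trans[OF sum_abs], rule sum_mono)
      fix j assume "j \<in> {1..n + 2}"
      then have "(1 / \<kappa>)^j \<le> 1 / \<kappa>" using power_decreasing[of 1 j "1 / \<kappa>"] \<kappa> by auto
      then show "\<bar>\<mu> j * (1 / \<kappa>)^j\<bar> \<le> \<bar>\<mu> j\<bar> * (1 / \<kappa>)" 
        using mult_left_mono[of "(1 / \<kappa>)^j" "1 / \<kappa>" "\<bar>\<mu> j\<bar>"] \<kappa> by (simp add: abs_mult)
    qed
    also have "\<dots> = S / \<kappa>" unfolding S_def sum_distrib_right[symmetric] by simp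
    finally show ?thesis by (simp only: approx_eig_def add_diff_cancel_left')
  qed
  moreover have "S \<ge> 0" unfolding S_def by (intro sum_nonneg) auto
  ultimately show ?thesis by blast
qed

text \<open>The single term of index 2N of the exponential series suffices. Quantities exponentially
  small in sqrt \<kappa> can thereby be charged to any power of 1/\<kappa>.\<close>

lemma exp_minus_sqrt_le: assumes "0 < \<kappa>" shows "exp (- sqrt (2 * \<kappa>)) \<le> fact (2 * N) / \<kappa>^N"
proof -
  have "sqrt (2 * \<kappa>) ^ (2 * N) / fact (2 * N) \<le> exp (sqrt (2 * \<kappa>))"
  proof -
    have s: "summable (\<lambda>j. sqrt (2 * \<kappa>) ^ j /\<^sub>R fact j)" by (rule summable_exp_generic)
    have "sum (\<lambda>j. sqrt (2 * \<kappa>) ^ j /\<^sub>R fact j) {2 * N} \<le> (\<Sum>j. sqrt (2 * \<kappa>) ^ j /\<^sub>R fact j)"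
      by (rule sum_le_suminf[OF s]) (use assms in auto)
    then show ?thesis by (simp add: exp_def divide_inverse mult.commute)
  qed
  moreover have "\<kappa>^N \<le> sqrt (2 * \<kappa>) ^ (2 * N)"
    unfolding power_mult using assms by (simp add: power_mono)
  ultimately have "\<kappa>^N / fact (2 * N) \<le> exp (sqrt (2 * \<kappa>))"
    by (metis divide_right_mono fact_ge_zero order_trans)
  then show ?thesis using assms by (simp add: exp_minus field_simps)
qed

text \<open>Stated for all antiderivatives at once so that no particular one has to be carried
  along; the increment is positive because D_m has only finitely many zeros.\<close>

lemma D_square_mass:
  assumes "0 < x0"
  shows "\<exists>c>0. \<forall>I. (\<forall>x. (I has_real_derivative (parabolic_D m x)^2) (at x)) \<longrightarrow> c = I x0 - I 0"
proof -
  have "isCont (\<lambda>x. (parabolic_D m x)^2) x" for x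
    unfolding parabolic_D_gauss_poly by (intro continuous_intros gauss_poly_cont)
  from antiderivative_real[OF this] obtain I where I: "\<And>x. (I has_real_derivative (parabolic_D m x)^2) (at x)" by blast
  have mono: "I x \<le> I y" if "x \<le> y" for x y
    by (rule DERIV_nonneg_imp_nondecreasing[OF that]) (use I in \<open>metis zero_le_power2\<close>)
  have "I 0 \<noteq> I x0"
  proof
    assume e: "I 0 = I x0"
    have "parabolic_D m x = 0" if x: "0 < x" "x < x0" for x
    proof -
      have c: "I 0 = I y" if "0 < y" "y < x0" for y using mono[of 0 y] mono[of y x0] that e by auto
      have "(I has_real_derivative 0) (at x)"
      proof (rule has_field_derivative_transform_within_open[of "\<lambda>_. I 0" 0 x "{0<..<x0}"])
        show "I 0 = I y" if "y \<in> {0<..<x0}" for y by (rule c) (use that in auto)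
      qed (use x in auto)
      then have "(parabolic_D m x)^2 = 0" by (rule DERIV_unique[OF I])
      then show ?thesis by simp
    qed
    then have "{0<..<x0} \<subseteq> {t. parabolic_D m t = 0}" by auto
    then have "finite {0<..<x0}" using parabolic_D_zero_count(1) finite_subset by blast
    then show False using assms infinite_Ioo[of 0 x0] by simp
  qed
  then have c: "0 < I x0 - I 0" using mono[of 0 x0] assms by auto
  have "I x0 - I 0 = J x0 - J 0" if J: "\<forall>x. (J has_real_derivative (parabolic_D m x)^2) (at x)" for J
  proof -
    have "((\<lambda>x. I x - J x) has_real_derivative 0) (at x)" for x using DERIV_diff[OF I J[rule_format], of x] by simp
    then have "I x0 - J x0 = I 0 - J 0" using DERIV_isconst_all[of "\<lambda>x. I x - J x" x0 0] by blast
    then show ?thesis by simp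
  qed
  then show ?thesis using c by blast
qed

end

lemma eventually_divide_less: "0 < b \<Longrightarrow> eventually (\<lambda>\<kappa>. G / \<kappa> < (b::real)) at_top"
proof -
  assume b: "0 < b"
  have "((\<lambda>\<kappa>::real. G / \<kappa>) \<longlongrightarrow> 0) at_top"
    by (intro tendsto_divide_0[OF tendsto_const] filterlim_at_top_imp_at_infinity filterlim_ident)
  then show ?thesis by (rule order_tendstoD(2)[OF _ b])
qed

section \<open>Exact solutions close to the quasi-mode\<close>

context expansion
begin

text \<open>The weighted distance to the quasi-mode serves the norm and the expansion; closeness to
  D_m with derivatives on [-x0, x0] and positivity beyond x0 serve the zero count.\<close>

definition near_mode :: "nat \<Rightarrow> real \<Rightarrow> real \<Rightarrow> real \<Rightarrow> real \<Rightarrow> (real \<Rightarrow> real) \<Rightarrow> (real \<Rightarrow> real) \<Rightarrow> bool" where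
  "near_mode n x0 B \<kappa> \<theta> v v' \<longleftrightarrow>
     (\<forall>x. (v has_real_derivative v' x) (at x)) \<and>
     (\<forall>x. (v' has_real_derivative ((tau \<kappa> x)^2 / 4 - \<theta>) * v x) (at x)) \<and>
     (\<forall>x. v (- x) = (-1)^m * v x \<and> v' (- x) = (-1)^Suc m * v' x) \<and>
     (\<forall>x. x0 \<le> x \<and> x < right_end \<kappa> \<longrightarrow> 0 < v x) \<and>
     (\<forall>x. \<bar>x\<bar> \<le> right_end \<kappa> \<longrightarrow> \<bar>v x - approx_mode n \<kappa> x\<bar> \<le> B / \<kappa>^(n + 1) * exp (- \<bar>x\<bar>)) \<and>
     (\<forall>x. \<bar>x\<bar> \<le> x0 \<longrightarrow> \<bar>v x - parabolic_D m x\<bar> \<le> B / \<kappa> \<and> \<bar>v' x - parabolic_D' m x\<bar> \<le> B / \<kappa>)"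

text \<open>The assumptions of \<open>quasimode\<close> are verified with \<epsilon> of order n + 1
  and \<rho> of order n + 2 in 1/\<kappa>; the extra power makes (C + 1) \<rho> \<le> \<epsilon> for
  large \<kappa>.\<close>

lemma near_modes_exist:
  "\<exists>x0>0. \<exists>B>0. \<exists>\<kappa>0\<ge>1. (\<forall>x. parabolic_D m x = 0 \<longrightarrow> \<bar>x\<bar> < x0) \<and> (\<forall>\<kappa>\<ge>\<kappa>0. x0 < right_end \<kappa> \<and>
     (\<exists>\<theta> v v'. near_mode n x0 B \<kappa> \<theta> v v' \<and> v' (right_end \<kappa>) = 0 \<and> 0 < v (right_end \<kappa>)) \<and>
     (\<exists>\<theta> v v'. near_mode n x0 B \<kappa> \<theta> v v' \<and> v (right_end \<kappa>) = 0 \<and> v' (right_end \<kappa>) < 0))"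
proof -
  obtain d t0 where d: "d > 0" "t0 > 0" "\<And>t. t0 \<le> t \<Longrightarrow> d * exp (- (t^2) / 4) \<le> parabolic_D m t"
    "\<And>t. t0 \<le> t \<Longrightarrow> parabolic_D' m t \<le> - d * exp (- (t^2) / 4)"
    using parabolic_D_tail[of m] by blast
  define sl where "sl = sn_slope"
  have sl: "0 < sl" "sl \<le> 1" using sn_slope_pos by (auto simp: sl_def sn_slope_def) (use real_sqrt_le_1_iff[of "1 - k^2"] in \<open>simp add: order_trans[of _ 1]\<close>)
  \<comment> \<open>Beyond this point tau is at least t0 + m + 4. Hence D_m is in its tail, and for
    \<theta> \<le> m + 1 one has tau^2/4 - \<theta> \<ge> (m + 4) - (m + 1) \<ge> 2.\<close>
  define x0 where "x0 = (t0 + real m + 4) / sl"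
  have x0: "0 < x0" "sl * x0 = t0 + real m + 4" using d sl by (auto simp: x0_def intro: divide_pos_pos add_pos_nonneg)
  have "sl * x0 \<le> 1 * x0" using sl x0 by (intro mult_right_mono) auto
  then have x0t: "t0 < x0" using x0 by linarith
  have Dpos: "0 < parabolic_D m t" if "t0 \<le> t" for t
    by (rule less_le_trans[OF _ d(3)[OF that]]) (use d in simp)
  have Dzero: "\<bar>x\<bar> < x0" if "parabolic_D m x = 0" for x
  proof (rule ccontr)
    assume "\<not> \<bar>x\<bar> < x0"
    then have "0 < parabolic_D m \<bar>x\<bar>" using Dpos x0t by simp
    then show False using that parabolic_D_parity(1)[of m x] by (cases "x \<ge> 0") auto
  qed
  define F :: real where "F = fact (2 * (n + 2))"
  have F: "0 < F" by (simp add: F_def)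
  \<comment> \<open>The rate 1/sl turns into decay exp (-x), because tau(x) \<ge> sl x.\<close>
  obtain C1 where C1: "C1 > 0" "\<And>x t. 0 \<le> x \<Longrightarrow> x \<le> 1 \<Longrightarrow>
     \<bar>gauss_poly (approx_poly n x) t\<bar> \<le> C1 * exp (- (1 / sl) * \<bar>t\<bar>) \<and>
     \<bar>gauss_poly (gdiff (approx_poly n x)) t\<bar> \<le> C1 * exp (- (1 / sl) * \<bar>t\<bar>) \<and>
     \<bar>residual n x t\<bar> \<le> C1 * x^(n + 1) * exp (- (1 / sl) * \<bar>t\<bar>)"
    using approx_bounds[of n "1 / sl"] by blast
  \<comment> \<open>At the right end tau is sqrt (2 \<kappa>) and X is K sqrt (2 \<kappa>); the rate
    K + 1 yields exp (-X) and a spare factor exp (-sqrt (2 \<kappa>)), which beats every power of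
    \<kappa>.\<close>
  obtain C2 where C2: "C2 > 0" "\<And>x t. 0 \<le> x \<Longrightarrow> x \<le> 1 \<Longrightarrow>
     \<bar>gauss_poly (approx_poly n x) t\<bar> \<le> C2 * exp (- (elliptic_K k + 1) * \<bar>t\<bar>)"
    using approx_bounds[of n "elliptic_K k + 1"] by blast
  obtain C3 where C3: "C3 > 0" "\<And>x t. 0 < x \<Longrightarrow> x \<le> 1 \<Longrightarrow> t0 \<le> t \<Longrightarrow> - (C3 * x^(n + 2)) \<le> gauss_poly (approx_poly n x) t"
    using gauss_sum_lower[where p = term_poly and n = n and N = "n + 1", OF d(1), of t0] d(3)
    unfolding gauss_approx term_poly_0 parabolic_D_gauss_poly by auto
  have gm: "gauss_poly (- p) t = - gauss_poly p t" for p t by (simp add: gauss_poly_def)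
  obtain C4 where C4: "C4 > 0" "\<And>x t. 0 < x \<Longrightarrow> x \<le> 1 \<Longrightarrow> t0 \<le> t \<Longrightarrow> gauss_poly (gdiff (approx_poly n x)) t \<le> C4 * x^(n + 2)"
  proof -
    have g4: "d * exp (- (t^2) / 4) \<le> gauss_poly (- gdiff (term_poly 0)) t" if "t0 \<le> t" for t
      unfolding gm gdiff_term_poly_0 using d(4)[OF that] by simp
    obtain C where C: "C > 0" "\<forall>x t. 0 < x \<and> x \<le> 1 \<and> t0 \<le> t \<longrightarrow> - (C * x^(n + 1 + 1)) \<le> - gauss_poly (gdiff (approx_poly n x)) t"
      using gauss_sum_lower[where p = "\<lambda>s. - gdiff (term_poly s)" and n = n and N = "n + 1" and ?t0.0 = t0, OF d(1) g4]
      unfolding gauss_gdiff_approx gm mult_minus_right sum_negf by blast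
    show ?thesis
    proof (rule that[OF C(1)])
      fix x t :: real assume "0 < x" "x \<le> 1" "t0 \<le> t"
      then have "- (C * x^(n + 1 + 1)) \<le> - gauss_poly (gdiff (approx_poly n x)) t" using C(2) by blast
      then show "gauss_poly (gdiff (approx_poly n x)) t \<le> C * x^(n + 2)" by simp
    qed
  qed
  obtain C5 where C5: "C5 > 0" "\<And>\<kappa> x. 1 \<le> \<kappa> \<Longrightarrow> x0 \<le> right_end \<kappa> \<Longrightarrow> \<bar>x\<bar> \<le> x0 \<Longrightarrow>
    \<bar>approx_mode n \<kappa> x - parabolic_D m x\<bar> \<le> C5 / \<kappa> \<and> \<bar>approx_mode' n \<kappa> x - parabolic_D' m x\<bar> \<le> C5 / \<kappa>"
    using approx_mode_close[OF x0(1), of n] by blast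
  obtain C6 where C6: "C6 > 0" "\<And>t. \<bar>parabolic_D m t\<bar> \<le> C6 * exp (- 0 * \<bar>t\<bar>)"
    unfolding parabolic_D_gauss_poly using superexpE[OF gauss_poly_superexp] by blast
  obtain S where S: "S \<ge> 0" "\<And>\<kappa>. 1 \<le> \<kappa> \<Longrightarrow> \<bar>approx_eig n (1 / \<kappa>) - (real m + 1/2)\<bar> \<le> S / \<kappa>"
    using approx_eig_close[of n] by blast
  obtain c2 where c2: "c2 > 0" "\<And>I. (\<forall>x. (I has_real_derivative (parabolic_D m x)^2) (at x)) \<Longrightarrow> c2 = I x0 - I 0"
    using D_square_mass[OF x0(1)] by blast
  \<comment> \<open>Half of the mass of D_m^2 is given up to cover the difference between the
    quasi-mode and D_m.\<close>
  define c where "c = c2 / 2"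
  have c: "c > 0" using c2 by (simp add: c_def)
  define C where "C = C1 + C2 * F + C3 + C4 + C5 + C6"
  have Cle: "0 < C" "C1 \<le> C" "C2 * F \<le> C" "C3 \<le> C" "C4 \<le> C" "C5 \<le> C" "C6 \<le> C"
    using C1(1) C2(1) C3(1) C4(1) C5(1) C6(1) F by (auto simp: C_def intro!: add_nonneg_nonneg add_pos_nonneg)
  define M where "M = (4 + (x0 + 1) * C * (C + 1)) / c"
  have M: "0 \<le> M" "4 + (x0 + 1) * C * (C + 1) \<le> M * c" using c Cle x0 by (auto simp: M_def)
  define Q where "Q = x0^2 / 4 + real m + 2"
  define E0 where "E0 = (M + 1) * C * exp ((2 + Q) * x0 / 2)"
  have E0: "0 < E0" using M Cle by (simp add: E0_def add_nonneg_pos)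
  \<comment> \<open>\<open>error_bound\<close> contributes 3 \<open>E0\<close> exp x0; on [0, x0]
    the distance to the quasi-mode contributes \<open>E0\<close>, and the distance from there to D_m
    contributes C.\<close>
  define B where "B = 3 * E0 * exp x0 + E0 + C"
  have B: "0 < B" using E0 Cle by (simp add: B_def add_pos_pos)
  \<comment> \<open>Largeness of \<kappa> is used for x0 < X, for the five smallness assumptions,
    for keeping \<theta> within 1/2 of m + 1/2, and for the mass of the quasi-mode.\<close>
  have "eventually (\<lambda>\<kappa>. 1 \<le> \<kappa> \<and> (x0 / elliptic_K k)^2 < \<kappa> \<and> E0 / \<kappa> < 1 \<and> (M * C * x0 * E0) / \<kappa> < 1 \<and> (E0 + C) / \<kappa> < parabolic_D m x0
     \<and> (2 * M * (C + 1) * C * elliptic_K k) / \<kappa> < 1 \<and> ((C + 1) * C) / \<kappa> < 1 \<and> (S + M) / \<kappa> < 1/2 \<and> (2 * C * C * x0) / \<kappa> < c) at_top"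
    by (intro eventually_conj eventually_divide_less eventually_ge_at_top eventually_gt_at_top)
       (use c Dpos[of x0] x0t in auto)
  then obtain \<kappa>1 where \<kappa>1: "\<And>\<kappa>. \<kappa>1 \<le> \<kappa> \<Longrightarrow> 1 \<le> \<kappa> \<and> (x0 / elliptic_K k)^2 < \<kappa> \<and> E0 / \<kappa> < 1 \<and> (M * C * x0 * E0) / \<kappa> < 1 \<and> (E0 + C) / \<kappa> < parabolic_D m x0
     \<and> (2 * M * (C + 1) * C * elliptic_K k) / \<kappa> < 1 \<and> ((C + 1) * C) / \<kappa> < 1 \<and> (S + M) / \<kappa> < 1/2 \<and> (2 * C * C * x0) / \<kappa> < c"
    by (auto simp: eventually_at_top_linorder)
  have main: "x0 < right_end \<kappa> \<and>
     (\<exists>\<theta> v v'. near_mode n x0 B \<kappa> \<theta> v v' \<and> v' (right_end \<kappa>) = 0 \<and> 0 < v (right_end \<kappa>)) \<and>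
     (\<exists>\<theta> v v'. near_mode n x0 B \<kappa> \<theta> v v' \<and> v (right_end \<kappa>) = 0 \<and> v' (right_end \<kappa>) < 0)" if "max 1 \<kappa>1 \<le> \<kappa>" for \<kappa>
  proof -
    have K: "1 \<le> \<kappa>" "(x0 / elliptic_K k)^2 < \<kappa>" "E0 / \<kappa> < 1" "(M * C * x0 * E0) / \<kappa> < 1" "(E0 + C) / \<kappa> < parabolic_D m x0"
      "(2 * M * (C + 1) * C * elliptic_K k) / \<kappa> < 1" "((C + 1) * C) / \<kappa> < 1" "(S + M) / \<kappa> < 1/2" "(2 * C * C * x0) / \<kappa> < c"
      using \<kappa>1[of \<kappa>] that by auto
    have k0: "0 < \<kappa>" using K by simp
    have k1: "0 < 1 / \<kappa>" "0 \<le> 1 / \<kappa>" "1 / \<kappa> \<le> 1" using K by auto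
    define X where "X = right_end \<kappa>"
    have x0X: "x0 < X"
    proof -
      have "x0 / elliptic_K k < sqrt \<kappa>" by (rule real_less_rsqrt[OF K(2)])
      also have "sqrt \<kappa> \<le> sqrt (2 * \<kappa>)" using k0 by simp
      finally show ?thesis using K_pos by (simp add: X_def right_end_def field_simps)
    qed
    define \<epsilon> where "\<epsilon> = 1 / \<kappa>^(n + 1)"
    define \<rho> where "\<rho> = C / \<kappa>^(n + 2)"
    define err where "err = (M + 1) * C * \<epsilon> * exp ((2 + Q) * x0 / 2)"
    have eps: "0 < \<epsilon>" "\<epsilon> \<le> 1 / \<kappa>" "\<epsilon> = (1 / \<kappa>)^(n + 1)"
    proof -
      show "0 < \<epsilon>" using k0 by (simp add: \<epsilon>_def)
      show "\<epsilon> = (1 / \<kappa>)^(n + 1)" by (simp add: \<epsilon>_def power_one_over)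
      have "(1 / \<kappa>)^(n + 1) \<le> (1 / \<kappa>)^1" by (rule power_decreasing) (use k1 in auto)
      then show "\<epsilon> \<le> 1 / \<kappa>" by (simp add: \<epsilon>_def power_one_over)
    qed
    have rho: "\<rho> = C * (1 / \<kappa>)^(n + 2)" "\<rho> = C / \<kappa> * \<epsilon>" "0 \<le> \<rho>"
      using k0 Cle by (simp_all add: \<rho>_def \<epsilon>_def power_one_over)
    have errE: "err = E0 * \<epsilon>" by (simp add: err_def E0_def)
    have errk: "err \<le> E0 / \<kappa>" using mult_left_mono[OF eps(2), of E0] E0 by (simp add: errE)
    have expt: "exp (- (1 / sl) * \<bar>tau \<kappa> x\<bar>) \<le> exp (- \<bar>x\<bar>)" if "\<bar>x\<bar> \<le> X" for x
      using abs_tau_lower[OF k0, of x] that sl by (simp add: X_def sl_def field_simps)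
    have tlow: "t0 + real m + 4 \<le> tau \<kappa> x" if "x0 \<le> x" "x \<le> X" for x
    proof -
      have "sl * x0 \<le> sl * x" using that sl by (intro mult_left_mono) auto
      also have "\<dots> \<le> tau \<kappa> x" using tau_lower[OF k0, of x] that x0 by (simp add: X_def sl_def)
      finally show ?thesis using x0 by simp
    qed
    have uclose: "\<bar>approx_mode n \<kappa> x - parabolic_D m x\<bar> \<le> C / \<kappa>" "\<bar>approx_mode' n \<kappa> x - parabolic_D' m x\<bar> \<le> C / \<kappa>" if "\<bar>x\<bar> \<le> x0" for x
      using C5(2)[OF K(1) _ that] x0X divide_right_mono[OF Cle(6), of \<kappa>] k0 unfolding X_def by force+
    have lam: "\<bar>\<theta> - (real m + 1/2)\<bar> \<le> 1/2" if "\<bar>\<theta> - approx_eig n (1 / \<kappa>)\<bar> \<le> M * \<epsilon>" for \<theta>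
    proof -
      have "M * \<epsilon> \<le> M / \<kappa>" using mult_left_mono[OF eps(2) M(1)] by simp
      moreover have "S / \<kappa> + M / \<kappa> < 1/2" using K(8) by (simp only: add_divide_distrib)
      ultimately show ?thesis using that S(2)[OF K(1)] by linarith
    qed
    have "\<exists>v v'. v 0 = approx_mode n \<kappa> 0 \<and> v' 0 = approx_mode' n \<kappa> 0 \<and> (\<forall>x. (v has_real_derivative v' x) (at x)) \<and>
       (\<forall>x. (v' has_real_derivative ((tau \<kappa> x)^2 / 4 - \<theta>) * v x) (at x))" for \<theta>
      by (rule linear_ode_exists) (intro continuous_intros DERIV_isCont[OF tau_deriv[OF k0]], simp)
    then obtain v v' where v: "\<And>\<theta>. v \<theta> 0 = approx_mode n \<kappa> 0 \<and> v' \<theta> 0 = approx_mode' n \<kappa> 0 \<and> (\<forall>x. (v \<theta> has_real_derivative v' \<theta> x) (at x)) \<and>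
       (\<forall>x. (v' \<theta> has_real_derivative ((tau \<kappa> x)^2 / 4 - \<theta>) * v \<theta> x) (at x))" by metis
    interpret qm: quasimode "\<lambda>x. (tau \<kappa> x)^2 / 4" "approx_mode n \<kappa>" "approx_mode' n \<kappa>" "\<lambda>x. residual n (1 / \<kappa>) (tau \<kappa> x)" v v'
      "approx_eig n (1 / \<kappa>)" \<epsilon> \<rho> C M Q x0 X c err
    proof
      show "0 < x0" "x0 < X" "0 < \<epsilon>" "0 \<le> \<rho>" "0 \<le> C" "0 \<le> M" using x0 x0X eps rho Cle M by auto
      show "(approx_mode n \<kappa> has_real_derivative approx_mode' n \<kappa> x) (at x)" for x by (rule approx_mode_deriv[OF k0])
      show "(approx_mode' n \<kappa> has_real_derivative ((tau \<kappa> x)^2 / 4 - approx_eig n (1 / \<kappa>)) * approx_mode n \<kappa> x + residual n (1 / \<kappa>) (tau \<kappa> x)) (at x)" for x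
        by (rule approx_mode'_deriv[OF k0])
      show "isCont (\<lambda>x. (tau \<kappa> x)^2 / 4) x" for x by (intro continuous_intros DERIV_isCont[OF tau_deriv[OF k0]]) simp
      show "(v \<theta> has_real_derivative v' \<theta> x) (at x)" "(v' \<theta> has_real_derivative ((tau \<kappa> x)^2 / 4 - \<theta>) * v \<theta> x) (at x)"
        "v \<theta> 0 = approx_mode n \<kappa> 0" "v' \<theta> 0 = approx_mode' n \<kappa> 0" for \<theta> x using v by auto
      fix x :: real assume x: "0 \<le> x" "x \<le> X"
      have ax: "\<bar>x\<bar> \<le> X" "\<bar>x\<bar> = x" using x by auto
      have b: "\<bar>gauss_poly (approx_poly n (1 / \<kappa>)) (tau \<kappa> x)\<bar> \<le> C1 * exp (- (1 / sl) * \<bar>tau \<kappa> x\<bar>)"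
        "\<bar>gauss_poly (gdiff (approx_poly n (1 / \<kappa>))) (tau \<kappa> x)\<bar> \<le> C1 * exp (- (1 / sl) * \<bar>tau \<kappa> x\<bar>)"
        "\<bar>residual n (1 / \<kappa>) (tau \<kappa> x)\<bar> \<le> C1 * (1 / \<kappa>)^(n + 1) * exp (- (1 / sl) * \<bar>tau \<kappa> x\<bar>)"
        using C1(2)[OF k1(2,3), of "tau \<kappa> x"] by auto
      have e1: "C1 * exp (- (1 / sl) * \<bar>tau \<kappa> x\<bar>) \<le> C * exp (- x)"
        using expt[OF ax(1)] ax(2) Cle C1 by (intro mult_mono) auto
      show "\<bar>approx_mode n \<kappa> x\<bar> \<le> C * exp (- x)" unfolding approx_mode_def using b(1) e1 by linarith
      have "\<bar>approx_mode' n \<kappa> x\<bar> \<le> (C * exp (- x)) * 1"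
        unfolding approx_mode'_def abs_mult using b(2) e1 tau'_bounds[OF k0, of x] ax Cle by (intro mult_mono) (auto simp: X_def)
      also have "\<dots> \<le> C" using x Cle by (simp add: mult_left_le)
      finally show "\<bar>approx_mode' n \<kappa> x\<bar> \<le> C" .
      have "\<bar>residual n (1 / \<kappa>) (tau \<kappa> x)\<bar> \<le> \<epsilon> * (C1 * exp (- (1 / sl) * \<bar>tau \<kappa> x\<bar>))" using b(3) unfolding eps(3) by (simp add: mult_ac)
      also have "\<dots> \<le> \<epsilon> * (C * exp (- x))" using e1 eps by (intro mult_left_mono) auto
      finally show "\<bar>residual n (1 / \<kappa>) (tau \<kappa> x)\<bar> \<le> C * \<epsilon> * exp (- x)" by (simp add: mult_ac)
    next
      fix \<theta> x assume l: "\<bar>\<theta> - approx_eig n (1 / \<kappa>)\<bar> \<le> M * \<epsilon>" and x: "0 \<le> x" "x \<le> x0"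
      have "\<bar>tau \<kappa> x\<bar> \<le> x0" using abs_tau_le[OF k0, of x] x by auto
      then have "(tau \<kappa> x)^2 \<le> x0^2" by (simp add: abs_le_square_iff[symmetric])
      then show "\<bar>(tau \<kappa> x)^2 / 4 - \<theta>\<bar> \<le> Q" 
        using lam[OF l] zero_le_power2[of "tau \<kappa> x"] zero_le_power2[of x0] unfolding Q_def by linarith
    next
      fix \<theta> x assume l: "\<bar>\<theta> - approx_eig n (1 / \<kappa>)\<bar> \<le> M * \<epsilon>" and x: "x0 \<le> x" "x \<le> X"
      have t: "real m + 4 \<le> tau \<kappa> x" using tlow[OF x] d by simp
      have "4 * (real m + 4) \<le> (real m + 4) * (real m + 4)" by (intro mult_right_mono) auto
      also have "\<dots> \<le> (tau \<kappa> x)^2" unfolding power2_eq_square using t by (intro mult_mono) auto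
      finally have "real m + 4 \<le> (tau \<kappa> x)^2 / 4" by simp
      moreover have "\<theta> \<le> real m + 1" using abs_le_D1[OF lam[OF l]] by simp
      ultimately show "2 \<le> (tau \<kappa> x)^2 / 4 - \<theta>" by simp
    next
      fix x assume x: "x0 \<le> x" "x \<le> X"
      have t: "t0 \<le> tau \<kappa> x" using tlow[OF x] by simp
      have "- (C3 * (1 / \<kappa>)^(n + 2)) \<le> approx_mode n \<kappa> x" unfolding approx_mode_def by (rule C3(2)[OF k1(1,3) t])
      moreover have "C3 * (1 / \<kappa>)^(n + 2) \<le> \<rho>" unfolding rho(1) using Cle k1 by (intro mult_right_mono) auto
      ultimately show "- \<rho> \<le> approx_mode n \<kappa> x" by linarith
      have tb: "0 \<le> tau' \<kappa> x" "tau' \<kappa> x \<le> 1" using tau'_bounds[OF k0, of x] x x0 by (auto simp: X_def)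
      have g: "gauss_poly (gdiff (approx_poly n (1 / \<kappa>))) (tau \<kappa> x) \<le> C4 * (1 / \<kappa>)^(n + 2)" by (rule C4(2)[OF k1(1,3) t])
      also have "C4 * (1 / \<kappa>)^(n + 2) \<le> \<rho>" unfolding rho(1) using Cle k1 by (intro mult_right_mono) auto
      finally have "gauss_poly (gdiff (approx_poly n (1 / \<kappa>))) (tau \<kappa> x) * tau' \<kappa> x \<le> \<rho> * tau' \<kappa> x" using tb by (intro mult_right_mono) auto
      also have "\<dots> \<le> \<rho>" using tb rho(3) by (simp add: mult_left_le)
      finally show "approx_mode' n \<kappa> x \<le> \<rho>" unfolding approx_mode'_def .
    next
      show "approx_mode' n \<kappa> X = 0" unfolding approx_mode'_def X_def tau'_end[OF k0] by simp
      have "\<bar>approx_mode n \<kappa> X\<bar> \<le> C2 * exp (- (elliptic_K k + 1) * sqrt (2 * \<kappa>))"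
        using C2(2)[OF k1(2,3), of "tau \<kappa> X"] k0 unfolding approx_mode_def X_def tau_end[OF k0] by simp
      also have "exp (- (elliptic_K k + 1) * sqrt (2 * \<kappa>)) = exp (- X) * exp (- sqrt (2 * \<kappa>))"
        by (simp add: X_def right_end_def exp_add[symmetric] algebra_simps)
      also have "C2 * (exp (- X) * exp (- sqrt (2 * \<kappa>))) \<le> C2 * (exp (- X) * (F / \<kappa>^(n + 2)))"
        using C2(1) exp_minus_sqrt_le[OF k0, of "n + 2", folded F_def] by (intro mult_left_mono) auto
      also have "\<dots> = (C2 * F) * (1 / \<kappa>)^(n + 2) * exp (- X)" by (simp add: power_one_over)
      also have "\<dots> \<le> \<rho> * exp (- X)" unfolding rho(1) using Cle k1 by (intro mult_right_mono) auto
      finally have u: "\<bar>approx_mode n \<kappa> X\<bar> \<le> \<rho> * exp (- X)" .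
      also have "\<dots> \<le> \<rho>" using rho(3) x0X x0 by (simp add: mult_left_le)
      finally show "\<bar>approx_mode n \<kappa> X\<bar> \<le> \<rho>" .
      have "C / \<kappa> \<le> C" using Cle(1) K(1) by (simp add: field_simps)
      then have "C / \<kappa> * \<epsilon> \<le> C * \<epsilon>" by (rule mult_right_mono) (rule less_imp_le[OF eps(1)])
      then have "\<rho> * exp (- X) \<le> C * \<epsilon> * exp (- X)" unfolding rho(2) by (rule mult_right_mono) simp
      then show "\<bar>approx_mode n \<kappa> X\<bar> \<le> C * \<epsilon> * exp (- X)" using u by linarith
    next
      have "isCont (\<lambda>x. (parabolic_D m x)^2) x" for x
        unfolding parabolic_D_gauss_poly by (intro continuous_intros gauss_poly_cont)
      from antiderivative_real[OF this] obtain J where J: "\<And>x. (J has_real_derivative (parabolic_D m x)^2) (at x)" by blast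
      have "isCont (\<lambda>x. (approx_mode n \<kappa> x)^2) x" for x by (intro continuous_intros DERIV_isCont[OF approx_mode_deriv[OF k0]])
      from antiderivative_real[OF this] obtain I where I: "\<And>x. (I has_real_derivative (approx_mode n \<kappa> x)^2) (at x)" by blast
      let ?h = "2 * C * (C / \<kappa>)"
      have dJ: "((\<lambda>x. J x - ?h * x) has_real_derivative (parabolic_D m x)^2 - ?h) (at x)" for x
        using DERIV_diff[OF J DERIV_cmult[OF DERIV_ident, of ?h], of x] by simp
      have "(J x0 - ?h * x0) - (J 0 - ?h * 0) \<le> I x0 - I 0"
      proof (rule increment_le_of_deriv_le[OF less_imp_le[OF x0(1)] dJ I])
        fix x assume x: "0 \<le> x" "x \<le> x0"
        let ?u = "approx_mode n \<kappa> x" and ?D = "parabolic_D m x"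
        have "\<bar>?u\<bar> \<le> C1 * exp (- (1 / sl) * \<bar>tau \<kappa> x\<bar>)" unfolding approx_mode_def using C1(2)[OF k1(2,3), of "tau \<kappa> x"] by auto
        also have "\<dots> \<le> C * 1" using Cle C1 sl by (intro mult_mono) auto
        finally have "\<bar>?u + ?D\<bar> \<le> 2 * C" using C6(2)[of x] Cle by simp
        then have "\<bar>(?u + ?D) * (?u - ?D)\<bar> \<le> 2 * C * (C / \<kappa>)"
          unfolding abs_mult using uclose(1)[of x] x Cle by (intro mult_mono) auto
        moreover have "(?u + ?D) * (?u - ?D) = ?u^2 - ?D^2" by (simp add: power2_eq_square algebra_simps)
        ultimately show "?D^2 - ?h \<le> ?u^2" by (simp add: abs_le_iff)
      qed
      moreover have "c2 = J x0 - J 0" using c2(2) J by blast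
      ultimately have "c \<le> I x0 - I 0" using K(9) by (simp add: c_def)
      then show "\<exists>I. (\<forall>x. (I has_real_derivative (approx_mode n \<kappa> x)^2) (at x)) \<and> c \<le> I x0 - I 0" using I by blast
    next
      show "4 + (x0 + 1) * C * (C + 1) \<le> M * c" by (rule M(2))
      show "err = (M + 1) * C * \<epsilon> * exp ((2 + Q) * x0 / 2)" by (rule err_def)
      show "err \<le> 1" using errk K(3) by linarith
      have "M * C * err * x0 = (M * C * x0) * err" by simp
      also have "\<dots> \<le> (M * C * x0) * (E0 / \<kappa>)" using errk M Cle x0 by (intro mult_left_mono) auto
      also have "\<dots> \<le> 1" using K(4) by simp
      finally show "M * C * err * x0 \<le> 1" .
      show "err < approx_mode n \<kappa> x0" using uclose(1)[of x0] errk K(5) x0 by (auto simp: add_divide_distrib abs_le_iff)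
      have "(C + 1) * \<rho> = ((C + 1) * C / \<kappa>) * \<epsilon>" unfolding rho(2) by simp
      also have "\<dots> \<le> 1 * \<epsilon>" using K(7) eps by (intro mult_right_mono) auto
      finally show "(C + 1) * \<rho> \<le> \<epsilon>" by simp
      have "\<rho> * X \<le> (C / \<kappa> * (1 / \<kappa>)) * (2 * \<kappa> * elliptic_K k)"
      proof (rule mult_mono)
        show "\<rho> \<le> C / \<kappa> * (1 / \<kappa>)" unfolding rho(2) using eps Cle k0 by (intro mult_left_mono) auto
        have "sqrt (2 * \<kappa>) \<le> 2 * \<kappa>"
        proof (rule real_le_lsqrt)
          have "1 * (2 * \<kappa>) \<le> (2 * \<kappa>) * (2 * \<kappa>)" using K(1) by (intro mult_right_mono) auto
          then show "2 * \<kappa> \<le> (2 * \<kappa>)^2" by (simp add: power2_eq_square)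
        qed (use k0 in auto)
        then show "X \<le> 2 * \<kappa> * elliptic_K k" unfolding X_def right_end_def using K_pos by (intro mult_right_mono) auto
      qed (use x0X x0 Cle k0 in auto)
      also have "\<dots> = 2 * C * elliptic_K k / \<kappa>" using k0 by simp
      finally have "M * (C + 1) * (\<rho> * X) \<le> M * (C + 1) * (2 * C * elliptic_K k / \<kappa>)" using M Cle by (intro mult_left_mono) auto
      also have "\<dots> \<le> 1" using K(6) by (simp add: mult_ac)
      finally show "M * (C + 1) * \<rho> * X \<le> 1" by (simp add: mult.assoc)
    qed
    \<comment> \<open>The reflected solution times (-1)^m has the same initial values at 0, since
      the quasi-mode has this parity. The conditions at -K will thus follow from those at K.\<close>
    have parity: "v \<theta> (- x) = (-1)^m * v \<theta> x \<and> v' \<theta> (- x) = (-1)^Suc m * v' \<theta> x" for \<theta> x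
    proof -
      let ?s = "(-1)^m :: real"
      have ss: "?s * ?s = 1" by (simp add: power_mult_distrib[symmetric])
      have "v \<theta> = (\<lambda>x. ?s * v \<theta> (- x)) \<and> v' \<theta> = (\<lambda>x. ?s * - v' \<theta> (- x))"
      proof (rule linear_ode_unique[where q = "\<lambda>x. (tau \<kappa> x)^2 / 4 - \<theta>" and ?z0.0 = 0])
        show "isCont (\<lambda>x. (tau \<kappa> x)^2 / 4 - \<theta>) x" for x by (intro continuous_intros qm.p)
        show "((\<lambda>x. ?s * v \<theta> (- x)) has_real_derivative ?s * - v' \<theta> (- x)) (at x)" for x
          using DERIV_mirror[of "v \<theta>" "v' \<theta> (- x)" x] v by (intro DERIV_cmult) auto
        have m: "((\<lambda>x. - v' \<theta> (- x)) has_real_derivative ((tau \<kappa> (- x))^2 / 4 - \<theta>) * v \<theta> (- x)) (at x)" for x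
          using DERIV_minus[OF iffD1[OF DERIV_mirror, of "v' \<theta>" "((tau \<kappa> (- x))^2 / 4 - \<theta>) * v \<theta> (- x)" x]] v by simp
        show "((\<lambda>x. ?s * - v' \<theta> (- x)) has_real_derivative ((tau \<kappa> x)^2 / 4 - \<theta>) * (?s * v \<theta> (- x))) (at x)" for x
          by (rule DERIV_cong[OF DERIV_cmult[OF m]]) (simp add: tau_odd[OF k0])
        show "v \<theta> 0 = ?s * v \<theta> (- 0)" using v approx_mode_parity[OF k0, of n 0] by simp
        show "v' \<theta> 0 = ?s * - v' \<theta> (- 0)" using v approx_mode'_parity[OF k0, of n 0] by simp
      qed (use v in auto)
      then have "v \<theta> x = ?s * v \<theta> (- x)" "v' \<theta> x = ?s * - v' \<theta> (- x)" by metis+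
      then show ?thesis using ss by (simp add: mult.assoc[symmetric])
    qed
    have nm: "near_mode n x0 B \<kappa> \<theta> (v \<theta>) (v' \<theta>)"
      if l: "\<bar>\<theta> - approx_eig n (1 / \<kappa>)\<bar> \<le> M * \<epsilon>" and bc: "v' \<theta> X = 0 \<or> v \<theta> X = 0" and p: "\<forall>x. x0 \<le> x \<and> x < X \<longrightarrow> 0 < v \<theta> x" for \<theta>
    proof -
      have e: "\<bar>v \<theta> x - approx_mode n \<kappa> x\<bar> \<le> B / \<kappa>^(n + 1) * exp (- x)" if x: "0 \<le> x" "x \<le> X" for x
      proof -
        have "\<bar>v \<theta> x - approx_mode n \<kappa> x\<bar> \<le> 3 * (err * exp x0) * exp (- x)" by (rule qm.error_bound[OF l bc Cle(1) x])
        also have "3 * (err * exp x0) = (3 * E0 * exp x0) * \<epsilon>" by (simp add: errE)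
        also have "(3 * E0 * exp x0) * \<epsilon> * exp (- x) \<le> B * \<epsilon> * exp (- x)" using E0 Cle eps by (intro mult_right_mono) (auto simp: B_def)
        finally show ?thesis by (simp add: \<epsilon>_def)
      qed
      have e': "\<bar>v \<theta> x - approx_mode n \<kappa> x\<bar> \<le> B / \<kappa>^(n + 1) * exp (- \<bar>x\<bar>)" if x: "\<bar>x\<bar> \<le> X" for x
      proof (cases "x \<ge> 0")
        case False
        have "v \<theta> x - approx_mode n \<kappa> x = (-1)^m * (v \<theta> (- x) - approx_mode n \<kappa> (- x))"
          using parity[of \<theta> "- x"] approx_mode_parity[OF k0, of n "- x"] by (simp add: algebra_simps)
        then have "\<bar>v \<theta> x - approx_mode n \<kappa> x\<bar> = \<bar>v \<theta> (- x) - approx_mode n \<kappa> (- x)\<bar>" by (simp add: abs_mult power_abs)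
        then show ?thesis using e[of "- x"] x False by simp
      qed (use e x in auto)
      have w: "\<bar>v \<theta> x - parabolic_D m x\<bar> \<le> B / \<kappa> \<and> \<bar>v' \<theta> x - parabolic_D' m x\<bar> \<le> B / \<kappa>" if x: "0 \<le> x" "x \<le> x0" for x
      proof -
        have "(E0 + C) / \<kappa> \<le> B / \<kappa>" using E0 k0 by (intro divide_right_mono) (auto simp: B_def)
        then show ?thesis using qm.near[OF l x] uclose[of x] x errk by (auto simp: add_divide_distrib abs_le_iff)
      qed
      have w': "\<bar>v \<theta> x - parabolic_D m x\<bar> \<le> B / \<kappa> \<and> \<bar>v' \<theta> x - parabolic_D' m x\<bar> \<le> B / \<kappa>" if x: "\<bar>x\<bar> \<le> x0" for x
      proof (cases "x \<ge> 0")
        case False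
        have "v \<theta> x - parabolic_D m x = (-1)^m * (v \<theta> (- x) - parabolic_D m (- x))"
          using parity[of \<theta> "- x"] parabolic_D_parity(1)[of m "- x"] by (simp add: algebra_simps)
        then have 1: "\<bar>v \<theta> x - parabolic_D m x\<bar> = \<bar>v \<theta> (- x) - parabolic_D m (- x)\<bar>" by (simp add: abs_mult power_abs)
        have "v' \<theta> x - parabolic_D' m x = (-1)^Suc m * (v' \<theta> (- x) - parabolic_D' m (- x))"
          using parity[of \<theta> "- x"] parabolic_D_parity(2)[of m "- x"] by (simp add: algebra_simps)
        then have 2: "\<bar>v' \<theta> x - parabolic_D' m x\<bar> = \<bar>v' \<theta> (- x) - parabolic_D' m (- x)\<bar>" by (simp add: abs_mult power_abs)
        show ?thesis unfolding 1 2 using w[of "- x"] x False by simp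
      qed (use w x in auto)
      show ?thesis unfolding near_mode_def X_def[symmetric] using v parity p e' w' by blast
    qed
    obtain \<theta> where N: "\<bar>\<theta> - approx_eig n (1 / \<kappa>)\<bar> \<le> M * \<epsilon>" "v' \<theta> X = 0" "\<forall>x. x0 \<le> x \<and> x \<le> X \<longrightarrow> 0 < v \<theta> x"
      using qm.neumann_exists by blast
    obtain \<theta>' where D: "\<bar>\<theta>' - approx_eig n (1 / \<kappa>)\<bar> \<le> M * \<epsilon>" "v \<theta>' X = 0" "v' \<theta>' X < 0" "\<forall>x. x0 \<le> x \<and> x < X \<longrightarrow> 0 < v \<theta>' x"
      using qm.dirichlet_exists by blast
    have "near_mode n x0 B \<kappa> \<theta> (v \<theta>) (v' \<theta>)" by (rule nm[OF N(1)]) (use N in auto)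
    moreover have "near_mode n x0 B \<kappa> \<theta>' (v \<theta>') (v' \<theta>')" by (rule nm[OF D(1)]) (use D in auto)
    ultimately show ?thesis using N D x0X unfolding X_def by (metis less_imp_le order_refl)
  qed
  have "\<forall>\<kappa>\<ge>max 1 \<kappa>1. x0 < right_end \<kappa> \<and>
     (\<exists>\<theta> v v'. near_mode n x0 B \<kappa> \<theta> v v' \<and> v' (right_end \<kappa>) = 0 \<and> 0 < v (right_end \<kappa>)) \<and>
     (\<exists>\<theta> v v'. near_mode n x0 B \<kappa> \<theta> v v' \<and> v (right_end \<kappa>) = 0 \<and> v' (right_end \<kappa>) < 0)"
    using main by blast
  moreover have "1 \<le> max 1 \<kappa>1" by simp
  ultimately show ?thesis using x0(1) B Dzero by blast
qed

end

section \<open>The normalisation integral\<close>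

text \<open>Outside [-T, T], half of the decay rate 2 yields the factor exp (-T) and the other half
  keeps the integral finite.\<close>

lemma superexp_integral_truncation:
  fixes f :: "real \<Rightarrow> real"
  assumes f: "superexp f" and cf: "\<And>t. isCont f t" and F: "\<And>t. (F has_real_derivative f t) (at t)"
  shows "\<exists>C>0. \<forall>T\<ge>0. \<bar>(\<integral>t. f t \<partial>lborel) - (F T - F (- T))\<bar> \<le> C * exp (- T)"
proof -
  obtain C where C: "C > 0" "\<And>t. \<bar>f t\<bar> \<le> C * exp (- 2 * \<bar>t\<bar>)" using superexpE[OF f] by blast
  define I0 :: real where "I0 = (\<integral>t. exp (- \<bar>t\<bar>) \<partial>lborel)"
  have I0: "0 \<le> I0" unfolding I0_def by (intro integral_nonneg_AE) auto
  have "\<bar>(\<integral>t. f t \<partial>lborel) - (F T - F (- T))\<bar> \<le> (C * I0 + 1) * exp (- T)" if T: "0 \<le> T" for T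
  proof -
    have fi: "integrable lborel f" by (rule superexp_integrable[OF f cf])
    have in1: "integrable lborel (\<lambda>t. f t * indicator {-T..T} t)"
      using integrable_mult_indicator[OF _ fi, of "{-T..T}"] by (simp add: mult.commute)
    have e: "(\<integral>t. f t * indicator {-T..T} t \<partial>lborel) = F T - F (- T)"
      by (rule integral_FTC_Icc_real) (use T F cf in auto)
    have "(\<integral>t. f t \<partial>lborel) - (F T - F (- T)) = (\<integral>t. f t - f t * indicator {-T..T} t \<partial>lborel)"
      unfolding e[symmetric] by (rule Bochner_Integration.integral_diff[OF fi in1, symmetric])
    also have "\<bar>\<dots>\<bar> \<le> (\<integral>t. C * exp (- T) * exp (- \<bar>t\<bar>) \<partial>lborel)"
    proof (rule order_trans[OF integral_abs_bound], rule integral_mono)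
      show "integrable lborel (\<lambda>t. \<bar>f t - f t * indicator {-T..T} t\<bar>)" by (intro integrable_abs Bochner_Integration.integrable_diff fi in1)
      show "integrable lborel (\<lambda>t. C * exp (- T) * exp (- \<bar>t\<bar>))" by (intro integrable_mult_right integrable_exp_minus_abs)
      fix t :: real
      show "\<bar>f t - f t * indicator {-T..T} t\<bar> \<le> C * exp (- T) * exp (- \<bar>t\<bar>)"
      proof (cases "t \<in> {-T..T}")
        case True then show ?thesis using C(1) by simp
      next
        case False
        then have "T < \<bar>t\<bar>" by auto
        then have "exp (- 2 * \<bar>t\<bar>) \<le> exp (- T) * exp (- \<bar>t\<bar>)" by (simp add: exp_add[symmetric])
        then have "C * exp (- 2 * \<bar>t\<bar>) \<le> C * (exp (- T) * exp (- \<bar>t\<bar>))" using C(1) by (intro mult_left_mono) auto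
        then show ?thesis using False C(2)[of t] by (simp add: mult.assoc)
      qed
    qed
    also have "\<dots> = C * I0 * exp (- T)" by (simp add: I0_def)
    also have "\<dots> \<le> (C * I0 + 1) * exp (- T)" by (simp add: algebra_simps)
    finally show ?thesis .
  qed
  moreover have "0 < C * I0 + 1" using C I0 by (simp add: add_nonneg_pos)
  ultimately show ?thesis by blast
qed

lemma integral_lincomb3:
  fixes f g h :: "'a \<Rightarrow> real"
  assumes "integrable M f" "integrable M g" "integrable M h"
  shows "(\<integral>x. a * f x + b * g x + c * h x \<partial>M) = a * (\<integral>x. f x \<partial>M) + b * (\<integral>x. g x \<partial>M) + c * (\<integral>x. h x \<partial>M)"
  using assms by simp

context expansion
begin

text \<open>The coefficients of \<kappa>^(-s) in the quasi-mode, in 1/cn, in the square of the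
  quasi-mode, and in the product of the last two; that product is the integrand of
  \<open>coeff_eta\<close>.\<close>

definition mode_term :: "nat \<Rightarrow> real \<Rightarrow> real" where "mode_term s t = gauss_poly (term_poly s) t"
definition weight_term :: "nat \<Rightarrow> real \<Rightarrow> real" where "weight_term j t = ((- 1/2) gchoose j) * (- (t^2) / 2)^j"
definition sq_term :: "nat \<Rightarrow> real \<Rightarrow> real" where "sq_term r t = (\<Sum>i\<le>r. mode_term i t * mode_term (r - i) t)"
definition norm_term :: "nat \<Rightarrow> real \<Rightarrow> real" where "norm_term s t = (\<Sum>j\<le>s. weight_term j t * sq_term (s - j) t)"

lemma mode_term_eq: "mode_term s t = poly (coeff_A k m s) t * parabolic_D m t + poly (coeff_B k m s) t * parabolic_D' m t"
  by (simp add: mode_term_def term_poly_def gauss_cylinder_poly)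

text \<open>The mixed terms A_i B_{r-i} and B_i A_{r-i} agree after reversing the sum, whence the
  factor 2 in eta_s.\<close>

lemma sq_term_eq: "sq_term r t = (\<Sum>i=0..r.
           poly (coeff_A k m i) t * poly (coeff_A k m (r - i)) t * (parabolic_D m t)^2
         + 2 * poly (coeff_A k m i) t * poly (coeff_B k m (r - i)) t * parabolic_D m t * parabolic_D' m t
         + poly (coeff_B k m i) t * poly (coeff_B k m (r - i)) t * (parabolic_D' m t)^2)"
proof -
  let ?A = "\<lambda>i. poly (coeff_A k m i) t" and ?B = "\<lambda>i. poly (coeff_B k m i) t"
  let ?D = "parabolic_D m t" and ?E = "parabolic_D' m t"
  have "(\<Sum>i\<le>r. ?B i * ?A (r - i) * (?D * ?E)) = (\<Sum>i\<le>r. ?A i * ?B (r - i) * (?D * ?E))"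
    by (rule sum.reindex_bij_witness[of _ "\<lambda>i. r - i" "\<lambda>i. r - i"]) auto
  moreover have "sq_term r t = (\<Sum>i\<le>r. ?A i * ?A (r - i) * ?D^2) + (\<Sum>i\<le>r. ?A i * ?B (r - i) * (?D * ?E))
     + (\<Sum>i\<le>r. ?B i * ?A (r - i) * (?D * ?E)) + (\<Sum>i\<le>r. ?B i * ?B (r - i) * ?E^2)"
    unfolding sq_term_def mode_term_eq sum.distrib[symmetric] by (rule sum.cong) (simp_all add: algebra_simps power2_eq_square)
  moreover have "(\<Sum>i\<le>r. ?A i * ?A (r - i) * ?D^2 + 2 * ?A i * ?B (r - i) * ?D * ?E + ?B i * ?B (r - i) * ?E^2)
    = (\<Sum>i\<le>r. ?A i * ?A (r - i) * ?D^2) + (\<Sum>i\<le>r. ?A i * ?B (r - i) * (?D * ?E))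
     + (\<Sum>i\<le>r. ?A i * ?B (r - i) * (?D * ?E)) + (\<Sum>i\<le>r. ?B i * ?B (r - i) * ?E^2)"
    unfolding sum.distrib[symmetric] by (rule sum.cong) (simp_all add: algebra_simps power2_eq_square)
  ultimately show ?thesis unfolding atLeast0AtMost by simp
qed

lemma mode_term_superexp: "superexp (mode_term s)" unfolding mode_term_def[abs_def] by (rule gauss_poly_superexp)

lemma sq_term_superexp: "superexp (sq_term r)"
  unfolding sq_term_def[abs_def] by (intro superexp_sum superexp_mult mode_term_superexp)

lemma weight_term_mult_superexp: assumes "superexp f" shows "superexp (\<lambda>t. weight_term j t * f t)"
proof -
  have "superexp (\<lambda>t. ((- 1/2) gchoose j) * (- 1/2)^j * (t^(2 * j) * f t))" by (intro superexp_cmult superexp_power_mult assms)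
  moreover have "(- (t^2) / 2)^j = (- 1/2)^j * t^(2 * j)" for t :: real
    by (simp add: power_mult power_mult_distrib[symmetric])
  ultimately show ?thesis by (simp add: weight_term_def[abs_def] mult_ac)
qed

lemma norm_term_superexp: "superexp (norm_term s)"
  unfolding norm_term_def[abs_def] by (intro superexp_sum weight_term_mult_superexp sq_term_superexp)

lemma mode_term_cont: "isCont (mode_term s) t" unfolding mode_term_def[abs_def] by (rule gauss_poly_cont)

lemma norm_term_cont: "isCont (norm_term s) t"
  unfolding norm_term_def[abs_def] sq_term_def weight_term_def by (intro continuous_intros mode_term_cont) auto

definition norm0 :: real where "norm0 = fact m * sqrt (2 * pi)"

lemma norm0_pos: "0 < norm0" by (simp add: norm0_def)

lemma eta_integral: "(\<integral>t. norm_term s t \<partial>lborel) = norm0 * coeff_eta k m s"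
  unfolding coeff_eta_def norm0_def norm_term_def weight_term_def sq_term_eq deriv_parabolic_D atLeast0AtMost by simp

lemma coeff_eta_0: "coeff_eta k m 0 = 1"
proof -
  have "norm_term 0 = (\<lambda>t. (parabolic_D m t)^2)"
    by (rule ext) (simp add: norm_term_def weight_term_def sq_term_def mode_term_def term_poly_0 parabolic_D_gauss_poly power2_eq_square)
  then show ?thesis using eta_integral[of 0] parabolic_D_norm[of m] norm0_pos by (simp add: norm0_def)
qed

text \<open>The integrand splits into an exact derivative \<open>?h\<close>, the virial integrand
  \<open>?w\<close> and a multiple of D_m^2; only the last one contributes.\<close>

lemma coeff_eta_1: "coeff_eta k m 1 = (3 - k^2) / 16 * (2 * real m + 1)"
proof -
  define b where "b = (k^2 + 1) / 16"
  let ?D = "parabolic_D m" and ?E = "parabolic_D' m"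
  let ?q = "[:0, - (2 * real m + 1), 0, 1:]"
  have A1: "poly (coeff_A k m 1) t = b / 2 * t^2" for t using coeff_A_1[of k m] by (simp add: b_def power2_eq_square)
  have B1: "poly (coeff_B k m 1) t = b * poly ?q t" for t unfolding coeff_B_1 b_def by (simp only: poly_smult)
  have n1: "norm_term 1 t = (t^2 / 4 + b * t^2) * (?D t)^2 + 2 * b * poly ?q t * ?D t * ?E t" for t
  proof -
    have "norm_term 1 t = sq_term 1 t + t^2 / 4 * sq_term 0 t" by (simp add: norm_term_def weight_term_def)
    also have "sq_term 0 t = (?D t)^2" by (simp add: sq_term_def mode_term_def term_poly_0 parabolic_D_gauss_poly power2_eq_square)
    also have "sq_term 1 t = 2 * mode_term 0 t * mode_term 1 t" by (simp add: sq_term_def)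
    also have "mode_term 0 t = ?D t" by (simp add: mode_term_def term_poly_0 parabolic_D_gauss_poly)
    also have "mode_term 1 t = b / 2 * t^2 * ?D t + b * poly ?q t * ?E t" unfolding mode_term_eq A1 B1 by simp
    finally show ?thesis by (simp add: power2_eq_square algebra_simps)
  qed
  have sq: "superexp (\<lambda>t. poly ?q t * (?D t * ?D t))" unfolding parabolic_D_gauss_poly by (intro superexp_poly_mult superexp_mult gauss_poly_superexp)
  have dq: "(poly ?q has_real_derivative (3 * t^2 - (2 * real m + 1))) (at t)" for t
    by (rule DERIV_cong[OF poly_DERIV]) (simp add: pderiv_pCons power2_eq_square algebra_simps)
  let ?h = "\<lambda>t. (3 * t^2 - (2 * real m + 1)) * (?D t)^2 + 2 * poly ?q t * ?D t * ?E t"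
  have dF: "((\<lambda>t. poly ?q t * (?D t * ?D t)) has_real_derivative ?h t) (at t)" for t
    by (rule DERIV_cong[OF DERIV_mult[OF dq DERIV_mult[OF parabolic_D_deriv parabolic_D_deriv]]]) (simp add: power2_eq_square algebra_simps)
  have D2: "superexp (\<lambda>t. ?D t * ?D t)" unfolding parabolic_D_gauss_poly by (intro superexp_mult gauss_poly_superexp)
  have DE: "superexp (\<lambda>t. ?D t * ?E t)" unfolding parabolic_D_gauss_poly by (intro superexp_mult gauss_poly_superexp)
  have "superexp (\<lambda>t. poly [:- (2 * real m + 1), 0, 3:] t * (?D t * ?D t) + 2 * (poly ?q t * (?D t * ?E t)))"
    by (intro superexp_add superexp_cmult superexp_poly_mult D2 DE)
  then have sh: "superexp ?h" by (simp add: power2_eq_square algebra_simps)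
  have ch: "isCont ?h t" for t unfolding parabolic_D_gauss_poly by (intro continuous_intros gauss_poly_cont)
  have ih: "(\<integral>t. ?h t \<partial>lborel) = 0" by (rule superexp_integral_deriv[OF sq sh ch dF])
  let ?w = "\<lambda>t. (t^2 - (2 * real m + 1)) * (?D t)^2"
  have "superexp (\<lambda>t. poly [:- (2 * real m + 1), 0, 1:] t * (?D t * ?D t))" by (intro superexp_poly_mult D2)
  then have sw: "superexp ?w" by (simp add: power2_eq_square algebra_simps)
  have cw: "isCont ?w t" for t unfolding parabolic_D_gauss_poly by (intro continuous_intros gauss_poly_cont)
  have cd: "isCont (\<lambda>t. (?D t)^2) t" for t unfolding parabolic_D_gauss_poly by (intro continuous_intros gauss_poly_cont)
  have ints: "integrable lborel ?h" "integrable lborel ?w" "integrable lborel (\<lambda>t. (?D t)^2)"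
    using superexp_integrable[OF sh ch] superexp_integrable[OF sw cw] superexp_integrable[OF _ cd] D2 by (simp_all add: power2_eq_square)
  have "norm_term 1 = (\<lambda>t. b * ?h t + (1/4 - 2 * b) * ?w t + (1/4 - b) * (2 * real m + 1) * (?D t)^2)"
    by (rule ext) (unfold n1, simp add: power2_eq_square algebra_simps)
  then have "(\<integral>t. norm_term 1 t \<partial>lborel) = (\<integral>t. b * ?h t + (1/4 - 2 * b) * ?w t + (1/4 - b) * (2 * real m + 1) * (?D t)^2 \<partial>lborel)" by simp
  also have "\<dots> = b * (\<integral>t. ?h t \<partial>lborel) + (1/4 - 2 * b) * (\<integral>t. ?w t \<partial>lborel) + (1/4 - b) * (2 * real m + 1) * (\<integral>t. (?D t)^2 \<partial>lborel)"
    by (rule integral_lincomb3[OF ints])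
  also have "\<dots> = (1/4 - b) * (2 * real m + 1) * norm0"
    unfolding ih parabolic_D_virial parabolic_D_norm norm0_def by simp
  finally have "norm0 * coeff_eta k m 1 = norm0 * ((1/4 - b) * (2 * real m + 1))" unfolding eta_integral by simp
  then have "coeff_eta k m 1 = (1/4 - b) * (2 * real m + 1)" using norm0_pos by simp
  then show ?thesis by (simp add: b_def field_simps)
qed

lemma cn_eq: assumes "0 < \<kappa>" "\<bar>z\<bar> \<le> elliptic_K k"
  shows "jacobi_cn k z = sqrt (1 - 1 / \<kappa> * (tau \<kappa> (sqrt (2 * \<kappa>) * z))^2 / 2)"
proof -
  have "(tau \<kappa> (sqrt (2 * \<kappa>) * z))^2 / (2 * \<kappa>) = (jacobi_sn k z)^2" using tau_squared[OF assms(1), of "sqrt (2 * \<kappa>) * z"] assms(1) by simp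
  then have "1 - 1 / \<kappa> * (tau \<kappa> (sqrt (2 * \<kappa>) * z))^2 / 2 = (jacobi_cn k z)^2" by (simp add: cn_squared)
  then show ?thesis using cn_nonneg[OF assms(2)] by simp
qed

definition sum_abs_mode_term :: "nat \<Rightarrow> real \<Rightarrow> real" where "sum_abs_mode_term n t = (\<Sum>s\<le>n. \<bar>mode_term s t\<bar>)"

text \<open>The square of the approximation, multiplied by the weight \<open>1/cn\<close> that the substitution
  \<open>t = sqrt (2\<kappa>) sn z\<close> produces; for large \<open>t\<close> the statement is trivial since both sides are tiny.\<close>

lemma square_expansion:
  "\<exists>C>0. \<forall>x t c. 0 < x \<and> x \<le> 1 \<and> 0 \<le> c \<and> c = sqrt (1 - x * t^2 / 2) \<and> x * t^2 / 2 \<le> 1 \<longrightarrow>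
     \<bar>(gauss_poly (approx_poly n x) t)^2 - c * (\<Sum>s\<le>n. x^s * norm_term s t)\<bar> \<le> C * x^(n + 1) * exp (- a * \<bar>t\<bar>)"
proof -
  obtain R :: real where R: "R > 0" "\<And>y::real. 0 \<le> y \<Longrightarrow> y \<le> 1/2 \<Longrightarrow> \<bar>(1 - y) powr (- 1/2) - (\<Sum>j\<le>n. ((- 1/2) gchoose j) * (- y)^j)\<bar> \<le> R * y^(n + 1)"
    using binomial_series_remainder[of "- 1/2" n] by blast
  \<comment> \<open>The four summands bound the binomial remainder, the truncation of the square,
    the truncation of its product with the weight, and, where x t^2/2 > 1/2, everything at
    once.\<close>
  define H where "H t = R * (t^2 / 2)^(n + 1) * (sum_abs_mode_term n t)^2 + (\<Sum>j\<le>n. \<bar>weight_term j t\<bar>) * (sum_abs_mode_term n t)^2 + (\<Sum>j\<le>n. \<bar>weight_term j t\<bar>) * (\<Sum>r\<le>n. \<bar>sq_term r t\<bar>)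
     + (t^2)^(n + 1) * ((sum_abs_mode_term n t)^2 + (\<Sum>s\<le>n. \<bar>norm_term s t\<bar>))" for t
  have sS: "superexp (\<lambda>t. (sum_abs_mode_term n t)^2)"
    unfolding sum_abs_mode_term_def power2_eq_square by (intro superexp_mult superexp_sum superexp_abs mode_term_superexp)
  have sb: "superexp (\<lambda>t. (\<Sum>j\<le>n. \<bar>weight_term j t\<bar>) * f t)" if "superexp f" for f
  proof -
    have "superexp (\<lambda>t. \<Sum>j\<le>n. \<bar>weight_term j t * f t\<bar>)" by (intro superexp_sum superexp_abs weight_term_mult_superexp that)
    moreover have "(\<lambda>t. \<Sum>j\<le>n. \<bar>weight_term j t * f t\<bar>) = (\<lambda>t. (\<Sum>j\<le>n. \<bar>weight_term j t\<bar>) * \<bar>f t\<bar>)" by (simp add: abs_mult sum_distrib_right)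
    ultimately have "superexp (\<lambda>t. (\<Sum>j\<le>n. \<bar>weight_term j t\<bar>) * \<bar>f t\<bar>)" by simp
    then show ?thesis by (rule superexp_dominated[of _ _ 1 0]) (simp add: abs_mult)
  qed
  have p1: "(\<lambda>t::real. R * (t^2 / 2)^(n + 1) * (sum_abs_mode_term n t)^2) = (\<lambda>t. R / 2^(n + 1) * (t^(2 * (n + 1)) * (sum_abs_mode_term n t)^2))"
    by (simp add: power_divide power_mult[symmetric] fun_eq_iff del: power_Suc)
  have p2: "(\<lambda>t::real. (t^2)^(n + 1) * ((sum_abs_mode_term n t)^2 + (\<Sum>s\<le>n. \<bar>norm_term s t\<bar>))) = (\<lambda>t. t^(2 * (n + 1)) * ((sum_abs_mode_term n t)^2 + (\<Sum>s\<le>n. \<bar>norm_term s t\<bar>)))"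
    by (simp only: power_mult)
  have h1: "superexp (\<lambda>t::real. R * (t^2 / 2)^(n + 1) * (sum_abs_mode_term n t)^2)"
    unfolding p1 by (intro superexp_cmult superexp_power_mult sS)
  have h2: "superexp (\<lambda>t. (\<Sum>j\<le>n. \<bar>weight_term j t\<bar>) * (sum_abs_mode_term n t)^2)" by (rule sb[OF sS])
  have h3: "superexp (\<lambda>t. (\<Sum>j\<le>n. \<bar>weight_term j t\<bar>) * (\<Sum>r\<le>n. \<bar>sq_term r t\<bar>))"
    by (intro sb superexp_sum superexp_abs sq_term_superexp)
  have h4: "superexp (\<lambda>t::real. (t^2)^(n + 1) * ((sum_abs_mode_term n t)^2 + (\<Sum>s\<le>n. \<bar>norm_term s t\<bar>)))"
    unfolding p2 by (intro superexp_power_mult superexp_add sS superexp_sum superexp_abs norm_term_superexp)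
  have "superexp H" unfolding H_def[abs_def] by (rule superexp_add[OF superexp_add[OF superexp_add[OF h1 h2] h3] h4])
  then obtain C where C: "C > 0" "\<And>t. \<bar>H t\<bar> \<le> C * exp (- a * \<bar>t\<bar>)" by (rule superexpE[where a = a]) blast
  have main: "\<bar>(gauss_poly (approx_poly n x) t)^2 - c * (\<Sum>s\<le>n. x^s * norm_term s t)\<bar> \<le> x^(n + 1) * H t"
    if x: "0 < x" "x \<le> 1" and c: "0 \<le> c" "c = sqrt (1 - x * t^2 / 2)" "x * t^2 / 2 \<le> 1" for x t c
  proof -
    define y where "y = x * t^2 / 2"
    define U where "U = gauss_poly (approx_poly n x) t"
    define Y where "Y = (\<Sum>s\<le>n. x^s * norm_term s t)"
    let ?S = "sum_abs_mode_term n t"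
    have y0: "0 \<le> y" using x by (simp add: y_def)
    have c1: "c \<le> 1" using c y0 by (simp add: y_def)
    have Ue: "U = (\<Sum>s\<le>n. mode_term s t * x^s)" by (simp add: U_def gauss_approx mode_term_def mult.commute)
    have S0: "0 \<le> ?S" unfolding sum_abs_mode_term_def by (intro sum_nonneg) auto
    have US: "\<bar>U\<bar> \<le> ?S" unfolding Ue sum_abs_mode_term_def
      by (rule order_trans[OF sum_abs]) (rule sum_mono, use x in \<open>simp add: abs_mult power_le_one mult_left_le\<close>)
    have US2: "U^2 \<le> ?S^2" using US S0 by (simp add: abs_le_square_iff[symmetric])
    have YS: "\<bar>Y\<bar> \<le> (\<Sum>s\<le>n. \<bar>norm_term s t\<bar>)" unfolding Y_def
      by (rule order_trans[OF sum_abs]) (rule sum_mono, use x in \<open>simp add: abs_mult power_le_one mult_left_le_one_le\<close>)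
    have bb: "0 \<le> (\<Sum>j\<le>n. \<bar>weight_term j t\<bar>)" "0 \<le> (\<Sum>r\<le>n. \<bar>sq_term r t\<bar>)" "0 \<le> (\<Sum>s\<le>n. \<bar>norm_term s t\<bar>)" by (intro sum_nonneg; simp)+
    have xn: "0 \<le> x^(n + 1)" using x by simp
    show ?thesis
    proof (cases "y \<le> 1/2")
      case True
      define \<beta> where "\<beta> = (1 - y) powr (- 1/2)"
      have c0: "0 < c" using c True by (simp add: y_def)
      have cb: "c * \<beta> = 1"
      proof -
        have "c = (1 - y) powr (1/2)" using c True y_def by (simp add: powr_half_sqrt)
        then show ?thesis using True by (simp add: \<beta>_def powr_add[symmetric])
      qed
      define b where "b = (\<Sum>j\<le>n. weight_term j t * x^j)"
      have "(- y)^j = (- (t^2) / 2)^j * x^j" for j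
        unfolding power_mult_distrib[symmetric] y_def by (simp add: mult.commute)
      then have "((- 1/2) gchoose j) * (- y)^j = weight_term j t * x^j" for j by (simp add: weight_term_def)
      then have rb: "\<bar>\<beta> - b\<bar> \<le> R * y^(n + 1)" using R(2)[OF y0 True] by (simp add: \<beta>_def b_def)
      have bS: "\<bar>b\<bar> \<le> (\<Sum>j\<le>n. \<bar>weight_term j t\<bar>)" unfolding b_def
        by (rule order_trans[OF sum_abs]) (rule sum_mono, use x in \<open>simp add: abs_mult power_le_one mult_left_le\<close>)
      define V where "V = (\<Sum>r\<le>n. sq_term r t * x^r)"
      have e2: "\<bar>U^2 - V\<bar> \<le> x^(n + 1) * ?S^2"
        using truncated_product[of x n n "\<lambda>s. mode_term s t" "\<lambda>s. mode_term s t"] x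
        unfolding Ue power2_eq_square V_def sq_term_def sum_abs_mode_term_def by (simp add: mult.commute)
      have e3: "\<bar>b * V - Y\<bar> \<le> x^(n + 1) * ((\<Sum>j\<le>n. \<bar>weight_term j t\<bar>) * (\<Sum>r\<le>n. \<bar>sq_term r t\<bar>))"
        using truncated_product[of x n n "\<lambda>j. weight_term j t" "\<lambda>r. sq_term r t"] x
        unfolding b_def V_def Y_def norm_term_def by simp
      have "\<beta> * U^2 - Y = (\<beta> - b) * U^2 + b * (U^2 - V) + (b * V - Y)" by (simp add: algebra_simps)
      moreover have "\<bar>(\<beta> - b) * U^2\<bar> \<le> (R * y^(n + 1)) * ?S^2"
        unfolding abs_mult using rb US2 R(1) y0 by (intro mult_mono) auto
      moreover have "\<bar>b * (U^2 - V)\<bar> \<le> (\<Sum>j\<le>n. \<bar>weight_term j t\<bar>) * (x^(n + 1) * ?S^2)"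
        unfolding abs_mult using bS e2 bb by (intro mult_mono) auto
      moreover have "(R * y^(n + 1)) * ?S^2 = x^(n + 1) * (R * (t^2 / 2)^(n + 1) * ?S^2)"
      proof -
        have "y^(n + 1) = x^(n + 1) * (t^2 / 2)^(n + 1)" unfolding power_mult_distrib[symmetric] y_def by simp
        then show ?thesis by (simp only: mult_ac)
      qed
      moreover have "(\<Sum>j\<le>n. \<bar>weight_term j t\<bar>) * (x^(n + 1) * ?S^2) = x^(n + 1) * ((\<Sum>j\<le>n. \<bar>weight_term j t\<bar>) * ?S^2)" by (rule mult.left_commute)
      ultimately have "\<bar>\<beta> * U^2 - Y\<bar> \<le> x^(n + 1) * (R * (t^2 / 2)^(n + 1) * ?S^2 + (\<Sum>j\<le>n. \<bar>weight_term j t\<bar>) * ?S^2 + (\<Sum>j\<le>n. \<bar>weight_term j t\<bar>) * (\<Sum>r\<le>n. \<bar>sq_term r t\<bar>))"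
        using e3 unfolding distrib_left by linarith
      also have "\<dots> \<le> x^(n + 1) * H t" unfolding H_def using bb xn
        by (intro mult_left_mono) (auto intro!: mult_nonneg_nonneg add_nonneg_nonneg simp del: power_Suc)
      finally have e5: "\<bar>\<beta> * U^2 - Y\<bar> \<le> x^(n + 1) * H t" .
      have e4: "U^2 - c * Y = c * (\<beta> * U^2 - Y)" using cb by (simp add: algebra_simps mult.assoc[symmetric])
      have e6: "\<bar>U^2 - c * Y\<bar> \<le> 1 * \<bar>\<beta> * U^2 - Y\<bar>" unfolding e4 abs_mult using c c1 by (intro mult_right_mono) auto
      show ?thesis unfolding U_def[symmetric] Y_def[symmetric] by (rule order_trans[OF e6[unfolded mult_1] e5])
    next
      case False
      then have "1 \<le> x * t^2" by (simp add: y_def)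
      then have big: "1 \<le> x^(n + 1) * (t^2)^(n + 1)" unfolding power_mult_distrib[symmetric] by (rule one_le_power)
      have "\<bar>c * Y\<bar> \<le> 1 * \<bar>Y\<bar>" unfolding abs_mult using c c1 by (intro mult_right_mono) auto
      then have "\<bar>U^2 - c * Y\<bar> \<le> ?S^2 + (\<Sum>s\<le>n. \<bar>norm_term s t\<bar>)" using US2 YS zero_le_power2[of U] by linarith
      also have "\<dots> \<le> (x^(n + 1) * (t^2)^(n + 1)) * (?S^2 + (\<Sum>s\<le>n. \<bar>norm_term s t\<bar>))"
        using mult_right_mono[OF big, of "?S^2 + (\<Sum>s\<le>n. \<bar>norm_term s t\<bar>)"] bb by simp
      also have "\<dots> = x^(n + 1) * ((t^2)^(n + 1) * (?S^2 + (\<Sum>s\<le>n. \<bar>norm_term s t\<bar>)))" by (simp only: mult.assoc)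
      also have "\<dots> \<le> x^(n + 1) * H t" unfolding H_def using bb xn R(1)
        by (intro mult_left_mono) (auto intro!: mult_nonneg_nonneg add_nonneg_nonneg simp del: power_Suc)
      finally show ?thesis unfolding U_def[symmetric] Y_def[symmetric] .
    qed
  qed
  have "\<bar>(gauss_poly (approx_poly n x) t)^2 - c * (\<Sum>s\<le>n. x^s * norm_term s t)\<bar> \<le> C * x^(n + 1) * exp (- a * \<bar>t\<bar>)"
    if x: "0 < x" "x \<le> 1" and c: "0 \<le> c" "c = sqrt (1 - x * t^2 / 2)" "x * t^2 / 2 \<le> 1" for x t c
  proof -
    have "x^(n + 1) * H t \<le> x^(n + 1) * (C * exp (- a * \<bar>t\<bar>))" using C(2)[of t] x by (intro mult_left_mono) auto
    then show ?thesis using main[OF x c] by (simp add: mult_ac)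
  qed
  then show ?thesis using C(1) by blast
qed

end

context expansion
begin

definition eta_sum :: "nat \<Rightarrow> real \<Rightarrow> real" where "eta_sum n \<kappa> = (\<Sum>s\<le>n. coeff_eta k m s / \<kappa>^s)"

lemma approx_mode_bound: "\<exists>C>0. \<forall>\<kappa>\<ge>1. \<forall>x. \<bar>approx_mode n \<kappa> x\<bar> \<le> C"
proof -
  obtain C where C: "C > 0" "\<And>x t. 0 \<le> x \<Longrightarrow> x \<le> 1 \<Longrightarrow> \<bar>gauss_poly (approx_poly n x) t\<bar> \<le> C * exp (- 0 * \<bar>t\<bar>)"
    using approx_bounds[of n 0] by blast
  have "\<bar>approx_mode n \<kappa> x\<bar> \<le> C" if "1 \<le> \<kappa>" for \<kappa> x using C(2)[of "1 / \<kappa>" "tau \<kappa> x"] that by (simp add: approx_mode_def)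
  then show ?thesis using C(1) by blast
qed

text \<open>The substitution t = r sn z, r = sqrt (2 \<kappa>), is carried out on antiderivatives:
  dn v^2 is compared with cn dn Y(t), where Y is the truncated series of the
  \<open>norm_term\<close>, and r cn dn = dt/dz. Extending the range of t from [-r, r] to the line
  costs a multiple of exp (-r).\<close>

lemma weighted_norm_expansion:
  assumes B: "0 < B"
  shows "\<exists>M>0. \<forall>\<kappa>\<ge>1. \<forall>\<theta> v v'. near_mode n x0 B \<kappa> \<theta> v v' \<longrightarrow>
    \<bar>sqrt (2 * \<kappa>) * (LBINT z=- elliptic_K k..elliptic_K k. jacobi_dn k z * (v (sqrt (2 * \<kappa>) * z))^2) - norm0 * eta_sum n \<kappa>\<bar> \<le> M / \<kappa>^(n + 1)"
proof -
  let ?K = "elliptic_K k"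
  have sl: "0 < sn_slope" by (rule sn_slope_pos)
  obtain C1 where C1: "C1 > 0" "\<And>\<kappa> x. 1 \<le> \<kappa> \<Longrightarrow> \<bar>approx_mode n \<kappa> x\<bar> \<le> C1" using approx_mode_bound[of n] by blast
  obtain C2 where C2: "C2 > 0" "\<And>x t c. 0 < x \<Longrightarrow> x \<le> 1 \<Longrightarrow> 0 \<le> c \<Longrightarrow> c = sqrt (1 - x * t^2 / 2) \<Longrightarrow> x * t^2 / 2 \<le> 1 \<Longrightarrow>
     \<bar>(gauss_poly (approx_poly n x) t)^2 - c * (\<Sum>s\<le>n. x^s * norm_term s t)\<bar> \<le> C2 * x^(n + 1) * exp (- (1 / sn_slope) * \<bar>t\<bar>)"
    using square_expansion[of n "1 / sn_slope"] by blast
  have "\<exists>\<Psi>. \<forall>t. (\<Psi> has_real_derivative norm_term s t) (at t)" for s using antiderivative_real[OF norm_term_cont, of s] by blast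
  then obtain \<Psi> where \<Psi>: "\<And>s t. (\<Psi> s has_real_derivative norm_term s t) (at t)" by metis
  have "\<exists>C>0. \<forall>T\<ge>0. \<bar>norm0 * coeff_eta k m s - (\<Psi> s T - \<Psi> s (- T))\<bar> \<le> C * exp (- T)" for s
    using superexp_integral_truncation[OF norm_term_superexp norm_term_cont \<Psi>, of s] unfolding eta_integral .
  then obtain Ct where Ct: "\<And>s. Ct s > 0 \<and> (\<forall>T\<ge>0. \<bar>norm0 * coeff_eta k m s - (\<Psi> s T - \<Psi> s (- T))\<bar> \<le> Ct s * exp (- T))" by metis
  define P where "P = B * (2 * C1 + B) + C2"
  have P: "P > 0" using B C1(1) C2(1) by (simp add: P_def add_pos_pos)
  define F :: real where "F = fact (2 * (n + 1))"
  have F: "F > 0" by (simp add: F_def)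
  define M where "M = 2 * P + (\<Sum>s\<le>n. Ct s) * F"
  have M: "M > 0" unfolding M_def using P F Ct by (intro add_pos_nonneg mult_nonneg_nonneg sum_nonneg) (auto intro: less_imp_le)
  have "\<bar>sqrt (2 * \<kappa>) * (LBINT z=- ?K..?K. jacobi_dn k z * (v (sqrt (2 * \<kappa>) * z))^2) - norm0 * eta_sum n \<kappa>\<bar> \<le> M / \<kappa>^(n + 1)"
    if \<kappa>: "1 \<le> \<kappa>" and nm: "near_mode n x0 B \<kappa> \<theta> v v'" for \<kappa> \<theta> v v'
  proof -
    have k0: "0 < \<kappa>" using \<kappa> by simp
    define x where "x = 1 / \<kappa>"
    have x: "0 < x" "x \<le> 1" using \<kappa> by (auto simp: x_def)
    define r where "r = sqrt (2 * \<kappa>)"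
    have r: "0 < r" using k0 by (simp add: r_def)
    define t where "t z = tau \<kappa> (r * z)" for z
    define \<epsilon> where "\<epsilon> = x^(n + 1)"
    have eps: "0 < \<epsilon>" "\<epsilon> = 1 / \<kappa>^(n + 1)" using x by (simp_all add: \<epsilon>_def x_def power_one_over)
    have e1: "\<epsilon> \<le> 1" unfolding \<epsilon>_def using x by (intro power_le_one) auto
    define Y where "Y t = (\<Sum>s\<le>n. x^s * norm_term s t)" for t
    define \<Psi>Y where "\<Psi>Y t = (\<Sum>s\<le>n. x^s * \<Psi> s t)" for t
    have d\<Psi>: "(\<Psi>Y has_real_derivative Y t) (at t)" for t
      unfolding \<Psi>Y_def[abs_def] Y_def by (intro DERIV_sum DERIV_cmult \<Psi>)
    have dv: "(v has_real_derivative v' y) (at y)" for y using nm by (simp add: near_mode_def)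
    have clv: "\<bar>v y - approx_mode n \<kappa> y\<bar> \<le> B / \<kappa>^(n + 1) * exp (- \<bar>y\<bar>)" if "\<bar>y\<bar> \<le> right_end \<kappa>" for y using nm that unfolding near_mode_def by blast
    let ?f = "\<lambda>z. jacobi_dn k z * (v (r * z))^2"
    have cf: "isCont ?f z" for z
    proof -
      have "isCont (\<lambda>z. v (r * z)) z"
        by (rule isCont_o2[where g = v and f = "\<lambda>z. r * z"]) (auto intro: DERIV_isCont[OF dv])
      then show ?thesis by (intro continuous_intros DERIV_isCont[OF dn_deriv])
    qed
    from antiderivative_real[OF cf] obtain \<Phi> where \<Phi>: "\<And>z. (\<Phi> has_real_derivative ?f z) (at z)" by blast
    have I: "(LBINT z=- ?K..?K. ?f z) = \<Phi> ?K - \<Phi> (- ?K)"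
    proof (rule interval_integral_FTC_finite)
      show "continuous_on {min (- ?K) ?K..max (- ?K) ?K} ?f" by (intro continuous_at_imp_continuous_on ballI cf)
      show "(\<Phi> has_vector_derivative ?f z) (at z within {min (- ?K) ?K..max (- ?K) ?K})" for z
        by (rule has_vector_derivative_at_within) (use \<Phi> in \<open>simp add: has_real_derivative_iff_has_vector_derivative\<close>)
    qed
    have dt: "(t has_real_derivative r * (jacobi_cn k z * jacobi_dn k z)) (at z)" for z
    proof -
      have "t = (\<lambda>z. r * jacobi_sn k z)" by (rule ext) (use r in \<open>simp add: t_def tau_def r_def[symmetric]\<close>)
      then show ?thesis using DERIV_cmult[OF sn_deriv, of r] by simp
    qed
    have point: "\<bar>?f z - jacobi_cn k z * jacobi_dn k z * Y (t z)\<bar> \<le> P * \<epsilon> * exp (- (r * \<bar>z\<bar>))" if z: "\<bar>z\<bar> \<le> ?K" for z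
    proof -
      have rz: "\<bar>r * z\<bar> = r * \<bar>z\<bar>" using r by (simp add: abs_mult)
      have rend: "\<bar>r * z\<bar> \<le> right_end \<kappa>" using z r unfolding rz right_end_def r_def[symmetric] by simp
      define U where "U = approx_mode n \<kappa> (r * z)"
      have U: "\<bar>U\<bar> \<le> C1" unfolding U_def by (rule C1(2)[OF \<kappa>])
      have d1: "\<bar>v (r * z) - U\<bar> \<le> B * \<epsilon> * exp (- (r * \<bar>z\<bar>))" using clv[OF rend] unfolding U_def eps(2) rz by simp
      have "B * \<epsilon> * exp (- (r * \<bar>z\<bar>)) \<le> B * 1 * 1" using B e1 eps r by (intro mult_mono) auto
      then have "\<bar>v (r * z) + U\<bar> \<le> 2 * C1 + B" using d1 U by linarith
      then have "\<bar>(v (r * z) - U) * (v (r * z) + U)\<bar> \<le> (B * \<epsilon> * exp (- (r * \<bar>z\<bar>))) * (2 * C1 + B)"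
        unfolding abs_mult using d1 B eps by (intro mult_mono) auto
      then have s1: "\<bar>(v (r * z))^2 - U^2\<bar> \<le> B * (2 * C1 + B) * \<epsilon> * exp (- (r * \<bar>z\<bar>))"
        by (simp add: power2_eq_square algebra_simps)
      have cn: "jacobi_cn k z = sqrt (1 - x * (t z)^2 / 2)" using cn_eq[OF k0 z] by (simp add: x_def t_def r_def)
      have "x * (t z)^2 / 2 = (t z)^2 / (2 * \<kappa>)" by (simp add: x_def)
      also have "\<dots> = (jacobi_sn k z)^2" unfolding t_def using tau_squared[OF k0, of "r * z"] r by (simp only: r_def[symmetric]) simp
      also have "\<dots> \<le> 1" using abs_sn_le_1[of z] by (simp only: abs_square_le_1)
      finally have sn: "x * (t z)^2 / 2 \<le> 1" .
      have "\<bar>U^2 - jacobi_cn k z * Y (t z)\<bar> \<le> C2 * x^(n + 1) * exp (- (1 / sn_slope) * \<bar>t z\<bar>)"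
        unfolding Y_def using C2(2)[OF x cn_nonneg[OF z] cn sn] by (simp add: U_def approx_mode_def x_def t_def)
      moreover have "exp (- (1 / sn_slope) * \<bar>t z\<bar>) \<le> exp (- (r * \<bar>z\<bar>))"
        using abs_tau_lower[OF k0 rend] sl unfolding t_def rz by (simp add: field_simps)
      then have "C2 * x^(n + 1) * exp (- (1 / sn_slope) * \<bar>t z\<bar>) \<le> C2 * x^(n + 1) * exp (- (r * \<bar>z\<bar>))"
        using C2(1) x by (intro mult_left_mono) auto
      ultimately have s2: "\<bar>U^2 - jacobi_cn k z * Y (t z)\<bar> \<le> C2 * \<epsilon> * exp (- (r * \<bar>z\<bar>))" unfolding \<epsilon>_def by linarith
      have "?f z - jacobi_cn k z * jacobi_dn k z * Y (t z) = jacobi_dn k z * (((v (r * z))^2 - U^2) + (U^2 - jacobi_cn k z * Y (t z)))"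
        by (simp add: algebra_simps)
      also have "\<bar>\<dots>\<bar> \<le> 1 * \<bar>((v (r * z))^2 - U^2) + (U^2 - jacobi_cn k z * Y (t z))\<bar>"
        unfolding abs_mult using dn_pos[of z] dn_le_1[of z] by (intro mult_right_mono) auto
      also have "\<dots> \<le> B * (2 * C1 + B) * \<epsilon> * exp (- (r * \<bar>z\<bar>)) + C2 * \<epsilon> * exp (- (r * \<bar>z\<bar>))"
        using abs_triangle_ineq[of "(v (r * z))^2 - U^2" "U^2 - jacobi_cn k z * Y (t z)"] s1 s2 by linarith
      also have "\<dots> = P * \<epsilon> * exp (- (r * \<bar>z\<bar>))" by (simp add: P_def algebra_simps)
      finally show ?thesis .
    qed
    \<comment> \<open>The derivative of \<open>D\<close> is r times the pointwise error, hence at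
      most r P \<epsilon> exp (-r |z|) in size, and each half of [-K, K] contributes at most P
      \<epsilon>.\<close>
    define D where "D z = r * \<Phi> z - \<Psi>Y (t z)" for z
    have dD: "(D has_real_derivative r * (?f z - jacobi_cn k z * jacobi_dn k z * Y (t z))) (at z)" for z
      unfolding D_def[abs_def]
      by (rule DERIV_cong[OF DERIV_diff[OF DERIV_cmult[OF \<Phi>] DERIV_chain2[OF d\<Psi> dt]]]) (simp add: algebra_simps)
    have pD: "\<bar>r * (?f z - jacobi_cn k z * jacobi_dn k z * Y (t z))\<bar> \<le> r * (P * \<epsilon> * exp (- (r * \<bar>z\<bar>)))" if "\<bar>z\<bar> \<le> ?K" for z
      unfolding abs_mult using point[OF that] r by (simp add: mult_left_mono)
    have g1: "((\<lambda>z. s * (P * \<epsilon> * exp (- (r * z)))) has_real_derivative - s * (r * (P * \<epsilon> * exp (- (r * z))))) (at z)" for s z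
      by (rule derivative_eq_intros refl | simp)+
    have g2: "((\<lambda>z. s * (P * \<epsilon> * exp (r * z))) has_real_derivative s * (r * (P * \<epsilon> * exp (r * z)))) (at z)" for s z
      by (rule derivative_eq_intros refl | simp)+
    have Pe: "0 \<le> P * \<epsilon>" using P eps by simp
    have K0: "0 \<le> ?K" using K_pos by simp
    have e0: "0 \<le> P * \<epsilon> * exp (- (r * ?K))" using Pe by simp
    have "D ?K - D 0 \<le> - 1 * (P * \<epsilon> * exp (- (r * ?K))) - - 1 * (P * \<epsilon> * exp (- (r * 0)))"
      by (rule increment_le_of_deriv_le[OF K0 dD g1]) (use pD in \<open>force simp: abs_le_iff\<close>)
    then have a1: "D ?K - D 0 \<le> P * \<epsilon>" using e0 by simp
    have "1 * (P * \<epsilon> * exp (- (r * ?K))) - 1 * (P * \<epsilon> * exp (- (r * 0))) \<le> D ?K - D 0"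
      by (rule increment_le_of_deriv_le[OF K0 g1 dD]) (use pD in \<open>force simp: abs_le_iff\<close>)
    then have a2: "- (P * \<epsilon>) \<le> D ?K - D 0" using e0 by simp
    have K1: "- ?K \<le> 0" using K_pos by simp
    have pDn: "\<bar>r * (?f z - jacobi_cn k z * jacobi_dn k z * Y (t z))\<bar> \<le> r * (P * \<epsilon> * exp (r * z))" if "- ?K \<le> z" "z \<le> 0" for z
      using pD[of z] that by simp
    have "D 0 - D (- ?K) \<le> 1 * (P * \<epsilon> * exp (r * 0)) - 1 * (P * \<epsilon> * exp (r * - ?K))"
      by (rule increment_le_of_deriv_le[OF K1 dD g2]) (use abs_le_D1[OF pDn] in simp)
    then have a3: "D 0 - D (- ?K) \<le> P * \<epsilon>" using e0 by simp
    have "- 1 * (P * \<epsilon> * exp (r * 0)) - - 1 * (P * \<epsilon> * exp (r * - ?K)) \<le> D 0 - D (- ?K)"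
      by (rule increment_le_of_deriv_le[OF K1 g2 dD]) (use abs_le_D2[OF pDn] in force)
    then have a4: "- (P * \<epsilon>) \<le> D 0 - D (- ?K)" using e0 by simp
    have tK: "t ?K = r" "t (- ?K) = - r"
      using tau_end[OF k0] tau_odd[OF k0, of "right_end \<kappa>"] by (simp_all add: t_def r_def right_end_def)
    have b1: "\<bar>r * (LBINT z=- ?K..?K. ?f z) - (\<Psi>Y r - \<Psi>Y (- r))\<bar> \<le> 2 * P * \<epsilon>"
    proof -
      have "r * (LBINT z=- ?K..?K. ?f z) - (\<Psi>Y r - \<Psi>Y (- r)) = (D ?K - D 0) + (D 0 - D (- ?K))"
        unfolding I D_def tK by (simp add: algebra_simps)
      then show ?thesis using a1 a2 a3 a4 by linarith
    qed
    have "norm0 * eta_sum n \<kappa> - (\<Psi>Y r - \<Psi>Y (- r)) = (\<Sum>s\<le>n. x^s * (norm0 * coeff_eta k m s - (\<Psi> s r - \<Psi> s (- r))))"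
      by (simp add: eta_sum_def \<Psi>Y_def sum_distrib_left sum_subtractf x_def power_one_over algebra_simps sum.distrib)
    also have "\<bar>\<dots>\<bar> \<le> (\<Sum>s\<le>n. Ct s * (F * \<epsilon>))"
    proof (rule order_trans[OF sum_abs], rule sum_mono)
      fix s
      have "exp (- r) \<le> F * \<epsilon>" using exp_minus_sqrt_le[OF k0, of "n + 1"] by (simp add: F_def r_def eps(2))
      then have "Ct s * exp (- r) \<le> Ct s * (F * \<epsilon>)" using Ct[of s] by (intro mult_left_mono) auto
      then have c: "\<bar>norm0 * coeff_eta k m s - (\<Psi> s r - \<Psi> s (- r))\<bar> \<le> Ct s * (F * \<epsilon>)" using Ct[of s] r by (meson less_imp_le order_trans)
      have "\<bar>x^s * (norm0 * coeff_eta k m s - (\<Psi> s r - \<Psi> s (- r)))\<bar> \<le> 1 * (Ct s * (F * \<epsilon>))"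
        unfolding abs_mult using c x by (intro mult_mono) (auto simp: power_le_one)
      then show "\<bar>x^s * (norm0 * coeff_eta k m s - (\<Psi> s r - \<Psi> s (- r)))\<bar> \<le> Ct s * (F * \<epsilon>)" by simp
    qed
    also have "(\<Sum>s\<le>n. Ct s * (F * \<epsilon>)) = (\<Sum>s\<le>n. Ct s) * F * \<epsilon>" by (simp add: sum_distrib_right mult.assoc)
    finally have b2: "\<bar>norm0 * eta_sum n \<kappa> - (\<Psi>Y r - \<Psi>Y (- r))\<bar> \<le> (\<Sum>s\<le>n. Ct s) * F * \<epsilon>" .
    have "\<bar>r * (LBINT z=- ?K..?K. ?f z) - norm0 * eta_sum n \<kappa>\<bar> \<le> 2 * P * \<epsilon> + (\<Sum>s\<le>n. Ct s) * F * \<epsilon>"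
      using b1 b2 by linarith
    also have "\<dots> = M / \<kappa>^(n + 1)" unfolding M_def eps(2) by (simp add: add_divide_distrib)
    finally show ?thesis unfolding r_def .
  qed
  then show ?thesis using M by blast
qed

lemma eta_sum_close: "\<exists>G\<ge>0. \<forall>\<kappa>\<ge>1. \<bar>eta_sum n \<kappa> - 1\<bar> \<le> G / \<kappa>"
proof -
  define G where "G = (\<Sum>s=1..n. \<bar>coeff_eta k m s\<bar>)"
  have "\<bar>eta_sum n \<kappa> - 1\<bar> \<le> G / \<kappa>" if \<kappa>: "1 \<le> \<kappa>" for \<kappa>
  proof -
    have "{..n} = insert 0 {1..n}" by auto
    then have "eta_sum n \<kappa> - 1 = (\<Sum>s=1..n. coeff_eta k m s / \<kappa>^s)" by (simp add: eta_sum_def coeff_eta_0)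
    also have "\<bar>\<dots>\<bar> \<le> (\<Sum>s=1..n. \<bar>coeff_eta k m s\<bar> / \<kappa>)"
    proof (rule order_trans[OF sum_abs], rule sum_mono)
      fix s assume "s \<in> {1..n}"
      then have "\<kappa> \<le> \<kappa>^s" using power_increasing[of 1 s \<kappa>] \<kappa> by auto
      then show "\<bar>coeff_eta k m s / \<kappa>^s\<bar> \<le> \<bar>coeff_eta k m s\<bar> / \<kappa>" using \<kappa> by (simp add: abs_divide divide_left_mono)
    qed
    finally show ?thesis by (simp add: G_def sum_divide_distrib)
  qed
  moreover have "G \<ge> 0" unfolding G_def by (intro sum_nonneg) auto
  ultimately show ?thesis by blast
qed

end

section \<open>Asymptotics of the Lam\'e functions\<close>

lemma kappa_at_top: assumes "0 < k" shows "filterlim (lame_kappa k) at_top at_top"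
proof (rule filterlim_at_top_mono)
  show "filterlim (\<lambda>\<nu>. k * \<nu>) at_top at_top"
    by (rule filterlim_tendsto_pos_mult_at_top[OF tendsto_const assms filterlim_ident])
  show "eventually (\<lambda>\<nu>. k * \<nu> \<le> lame_kappa k \<nu>) at_top"
    using eventually_ge_at_top[of 0]
  proof eventually_elim
    case (elim \<nu>)
    have "\<nu> \<le> sqrt (\<nu> * (\<nu> + 1))" by (rule real_le_rsqrt) (use elim in \<open>simp add: power2_eq_square algebra_simps\<close>)
    then show ?case unfolding lame_kappa_def using assms by (intro mult_left_mono) auto
  qed
qed

context expansion
begin

text \<open>In the application J is sqrt (2 \<kappa>) times the weighted square integral of v,
  divided by m! sqrt (2 pi). Scaling that integral to pi/2 gives the factor in front of v; J \<ge>
  1/2 makes divisions by J harmless.\<close>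

definition lame_mode :: "nat \<Rightarrow> real \<Rightarrow> real \<Rightarrow> (real \<Rightarrow> real) \<Rightarrow> bool" where
  "lame_mode n M \<kappa> f \<longleftrightarrow> (\<exists>v J. (\<forall>x. \<bar>x\<bar> \<le> right_end \<kappa> \<longrightarrow> \<bar>v x - approx_mode n \<kappa> x\<bar> \<le> M / \<kappa>^(n + 1)) \<and>
     \<bar>J - eta_sum n \<kappa>\<bar> \<le> M / \<kappa>^(n + 1) \<and> 1/2 \<le> J \<and>
     f = (\<lambda>z. sqrt (sqrt (pi * \<kappa>) / (2 * fact m) / J) * v (sqrt (2 * \<kappa>) * z)))"

text \<open>Inside [-x0, x0] the zeros are counted by the stability of the simple zeros of D_m; from
  x0 to the end v is positive, and parity settles the other side.\<close>

lemma near_mode_zeros: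
  assumes nm: "near_mode n x0 B \<kappa> \<theta> v v'" and k0: "0 < \<kappa>" and x0: "x0 < right_end \<kappa>" and c: "c \<noteq> 0"
    and pert: "\<forall>f f'. (\<forall>x. (f has_real_derivative f' x) (at x)) \<and>
     (\<forall>x. - x0 \<le> x \<and> x \<le> x0 \<longrightarrow> \<bar>f x - parabolic_D m x\<bar> < \<eta> \<and> \<bar>f' x - parabolic_D' m x\<bar> < \<eta>) \<longrightarrow>
     finite {x. - x0 \<le> x \<and> x \<le> x0 \<and> f x = 0} \<and> card {x. - x0 \<le> x \<and> x \<le> x0 \<and> f x = 0} = card {x. parabolic_D m x = 0}"
    and \<eta>: "B / \<kappa> < \<eta>"
  shows "finite (lame_zeros k (\<lambda>z. c * v (sqrt (2 * \<kappa>) * z)))" "card (lame_zeros k (\<lambda>z. c * v (sqrt (2 * \<kappa>) * z))) = m"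
proof -
  define r where "r = sqrt (2 * \<kappa>)"
  have r: "0 < r" using k0 by (simp add: r_def)
  have X: "right_end \<kappa> = r * elliptic_K k" by (simp add: right_end_def r_def)
  let ?Z = "{x. - x0 \<le> x \<and> x \<le> x0 \<and> v x = 0}"
  have Z: "finite ?Z" "card ?Z = m"
  proof -
    have "finite ?Z \<and> card ?Z = card {x. parabolic_D m x = 0}"
    proof (rule pert[rule_format], intro conjI allI impI)
      show "(v has_real_derivative v' x) (at x)" for x using nm by (simp add: near_mode_def)
      fix x assume "- x0 \<le> x \<and> x \<le> x0"
      then have "\<bar>x\<bar> \<le> x0" by auto
      then have "\<bar>v x - parabolic_D m x\<bar> \<le> B / \<kappa>" "\<bar>v' x - parabolic_D' m x\<bar> \<le> B / \<kappa>" using nm unfolding near_mode_def by blast+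
      then show "\<bar>v x - parabolic_D m x\<bar> < \<eta>" "\<bar>v' x - parabolic_D' m x\<bar> < \<eta>" using \<eta> by linarith+
    qed
    then show "finite ?Z" "card ?Z = m" using parabolic_D_zero_count(2) by auto
  qed
  have nz: "v x \<noteq> 0" if x: "x0 \<le> \<bar>x\<bar>" "\<bar>x\<bar> < right_end \<kappa>" for x
  proof -
    have p: "0 < v \<bar>x\<bar>" using nm x unfolding near_mode_def by blast
    have "v (- x) = (-1)^m * v x" using nm unfolding near_mode_def by blast
    then show ?thesis using p by (cases "x \<ge> 0") auto
  qed
  have "bij_betw (\<lambda>z. r * z) (lame_zeros k (\<lambda>z. c * v (r * z))) ?Z"
  proof (rule bij_betw_imageI)
    show "inj_on (\<lambda>z. r * z) (lame_zeros k (\<lambda>z. c * v (r * z)))" using r by (auto intro: inj_onI)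
    show "(\<lambda>z. r * z) ` lame_zeros k (\<lambda>z. c * v (r * z)) = ?Z"
    proof (intro equalityI subsetI)
      fix x assume "x \<in> (\<lambda>z. r * z) ` lame_zeros k (\<lambda>z. c * v (r * z))"
      then obtain z where z: "x = r * z" "- elliptic_K k < z" "z < elliptic_K k" "v (r * z) = 0" using c by (auto simp: lame_zeros_def)
      have "\<bar>x\<bar> < right_end \<kappa>" unfolding X z(1) using z r by (simp add: abs_mult)
      then have "\<not> x0 \<le> \<bar>x\<bar>" using nz[of x] z by auto
      then show "x \<in> ?Z" using z by auto
    next
      fix x assume x: "x \<in> ?Z"
      then have "\<bar>x\<bar> < r * elliptic_K k" using x0 unfolding X by auto
      then have "\<bar>x / r\<bar> < elliptic_K k" using r by (simp add: field_simps)
      then have "- elliptic_K k < x / r" "x / r < elliptic_K k" by linarith+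
      then have "x / r \<in> lame_zeros k (\<lambda>z. c * v (r * z))" using x r by (auto simp: lame_zeros_def)
      then show "x \<in> (\<lambda>z. r * z) ` lame_zeros k (\<lambda>z. c * v (r * z))" using r by (intro image_eqI[of _ _ "x / r"]) auto
    qed
  qed
  then show "finite (lame_zeros k (\<lambda>z. c * v (sqrt (2 * \<kappa>) * z)))" "card (lame_zeros k (\<lambda>z. c * v (sqrt (2 * \<kappa>) * z))) = m"
    unfolding r_def[symmetric] using Z by (simp_all add: bij_betw_finite bij_betw_same_card)
qed

text \<open>Undoes the scaling: \<nu> (\<nu> + 1) k^2 = \<kappa>^2, and differentiating twice in z
  brings out 2 \<kappa>, whence h = 2 \<kappa> \<theta>.\<close>

lemma near_mode_lame_solution:
  assumes nm: "near_mode n x0 B \<kappa> \<theta> v v'" and \<nu>: "0 < \<nu>" and \<kappa>: "\<kappa> = lame_kappa k \<nu>"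
  shows "lame_solution k \<nu> (2 * \<kappa> * \<theta>) (\<lambda>z. c * v (sqrt (2 * \<kappa>) * z))"
    "deriv (\<lambda>z. c * v (sqrt (2 * \<kappa>) * z)) z = c * sqrt (2 * \<kappa>) * v' (sqrt (2 * \<kappa>) * z)"
proof -
  have k0': "0 < \<kappa>" using \<nu> k0 by (simp add: \<kappa> lame_kappa_def)
  have ksq: "\<nu> * (\<nu> + 1) * k^2 = \<kappa>^2" using \<nu> by (simp add: \<kappa> lame_kappa_def power_mult_distrib)
  define r where "r = sqrt (2 * \<kappa>)"
  have r: "0 < r" "r * r = 2 * \<kappa>" using k0' by (auto simp: r_def)
  let ?w = "\<lambda>z. c * v (r * z)"
  have l: "((\<lambda>z. r * z) has_real_derivative r) (at z)" for z using DERIV_cmult[OF DERIV_ident, of r] by simp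
  have d1: "(?w has_real_derivative c * r * v' (r * z)) (at z)" for z
    by (rule DERIV_cong[OF DERIV_cmult[OF DERIV_chain2[OF _ l]]]) (use nm in \<open>auto simp: near_mode_def\<close>)
  have dw: "deriv ?w = (\<lambda>z. c * r * v' (r * z))" by (rule ext) (rule DERIV_imp_deriv[OF d1])
  have v2: "(v' has_real_derivative ((tau \<kappa> x)^2 / 4 - \<theta>) * v x) (at x)" for x using nm unfolding near_mode_def by blast
  have d2: "((\<lambda>z. c * r * v' (r * z)) has_real_derivative - (2 * \<kappa> * \<theta> - \<nu> * (\<nu> + 1) * k^2 * (jacobi_sn k z)^2) * ?w z) (at z)" for z
  proof (rule DERIV_cong[OF DERIV_cmult[OF DERIV_chain2[OF v2 l]]])
    have "(tau \<kappa> (r * z))^2 = 2 * \<kappa> * (jacobi_sn k z)^2" using r unfolding tau_def r_def[symmetric] by (simp add: power_mult_distrib power2_eq_square)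
    then have t: "(tau \<kappa> (r * z))^2 / 4 = \<kappa> * (jacobi_sn k z)^2 / 2" by simp
    have "c * r * (((tau \<kappa> (r * z))^2 / 4 - \<theta>) * v (r * z) * r) = (r * r) * (((tau \<kappa> (r * z))^2 / 4 - \<theta>) * (c * v (r * z)))" by simp
    also have "\<dots> = - (2 * \<kappa> * \<theta> - \<kappa>^2 * (jacobi_sn k z)^2) * (c * v (r * z))"
      unfolding t r(2) by (simp add: power2_eq_square algebra_simps)
    finally show "c * r * (((tau \<kappa> (r * z))^2 / 4 - \<theta>) * v (r * z) * r) = - (2 * \<kappa> * \<theta> - \<nu> * (\<nu> + 1) * k^2 * (jacobi_sn k z)^2) * (c * v (r * z))"
      unfolding ksq .
  qed
  show "lame_solution k \<nu> (2 * \<kappa> * \<theta>) (\<lambda>z. c * v (sqrt (2 * \<kappa>) * z))"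
    unfolding lame_solution_def r_def[symmetric] dw using d1 d2 by blast
  show "deriv (\<lambda>z. c * v (sqrt (2 * \<kappa>) * z)) z = c * sqrt (2 * \<kappa>) * v' (sqrt (2 * \<kappa>) * z)"
    unfolding r_def[symmetric] dw ..
qed

text \<open>The Neumann and the Dirichlet solution, scaled to weighted norm pi/2, have the required
  zeros, boundary values and sign at K, so the two uniqueness lemmas identify them with the Lame
  functions.\<close>

lemma lame_functions_are_modes:
  "\<exists>M>0. eventually (\<lambda>\<nu>. lame_mode n M (lame_kappa k \<nu>) (lame_Ec k \<nu> m) \<and> lame_mode n M (lame_kappa k \<nu>) (lame_Es k \<nu> (m + 1))) at_top"
proof -
  obtain x0 B \<kappa>0 where x0: "0 < x0" and B: "0 < B" and \<kappa>0: "1 \<le> \<kappa>0" and Dz: "\<forall>x. parabolic_D m x = 0 \<longrightarrow> \<bar>x\<bar> < x0"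
    and ex: "\<forall>\<kappa>\<ge>\<kappa>0. x0 < right_end \<kappa> \<and>
     (\<exists>\<theta> v v'. near_mode n x0 B \<kappa> \<theta> v v' \<and> v' (right_end \<kappa>) = 0 \<and> 0 < v (right_end \<kappa>)) \<and>
     (\<exists>\<theta> v v'. near_mode n x0 B \<kappa> \<theta> v v' \<and> v (right_end \<kappa>) = 0 \<and> v' (right_end \<kappa>) < 0)"
    using near_modes_exist[of n] by metis
  obtain M1 where M1: "0 < M1" "\<And>\<kappa> \<theta> v v'. 1 \<le> \<kappa> \<Longrightarrow> near_mode n x0 B \<kappa> \<theta> v v' \<Longrightarrow>
    \<bar>sqrt (2 * \<kappa>) * (LBINT z=- elliptic_K k..elliptic_K k. jacobi_dn k z * (v (sqrt (2 * \<kappa>) * z))^2) - norm0 * eta_sum n \<kappa>\<bar> \<le> M1 / \<kappa>^(n + 1)"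
    using weighted_norm_expansion[OF B, of n x0] by blast
  have "isCont (parabolic_D' m) x" for x by (rule gauss_poly_cont)
  from zeros_of_perturbation[OF parabolic_D_deriv this parabolic_D_zero_count(1), of "- x0" x0] Dz parabolic_D_simple_zeros[of m]
  obtain \<eta> where \<eta>: "\<eta> > 0" and pert: "\<forall>f f'. (\<forall>x. (f has_real_derivative f' x) (at x)) \<and>
     (\<forall>x. - x0 \<le> x \<and> x \<le> x0 \<longrightarrow> \<bar>f x - parabolic_D m x\<bar> < \<eta> \<and> \<bar>f' x - parabolic_D' m x\<bar> < \<eta>) \<longrightarrow>
     finite {x. - x0 \<le> x \<and> x \<le> x0 \<and> f x = 0} \<and> card {x. - x0 \<le> x \<and> x \<le> x0 \<and> f x = 0} = card {x. parabolic_D m x = 0}"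
    by (force simp: abs_less_iff)
  obtain G where G: "0 \<le> G" "\<And>\<kappa>. 1 \<le> \<kappa> \<Longrightarrow> \<bar>eta_sum n \<kappa> - 1\<bar> \<le> G / \<kappa>" using eta_sum_close[of n] by blast
  define M where "M = B + M1 / norm0"
  have M: "0 < M" "B \<le> M" "M1 / norm0 \<le> M" using B M1(1) norm0_pos by (auto simp: M_def add_pos_pos)
  have main: "lame_mode n M (lame_kappa k \<nu>) (lame_Ec k \<nu> m) \<and> lame_mode n M (lame_kappa k \<nu>) (lame_Es k \<nu> (m + 1))"
    if \<nu>: "0 < \<nu>" and kk: "\<kappa>0 \<le> lame_kappa k \<nu>" "B / lame_kappa k \<nu> < \<eta>" "(G + M1 / norm0) / lame_kappa k \<nu> < 1/2" for \<nu>
  proof -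
    define \<kappa> where "\<kappa> = lame_kappa k \<nu>"
    have K: "1 \<le> \<kappa>" "\<kappa>0 \<le> \<kappa>" "B / \<kappa> < \<eta>" "(G + M1 / norm0) / \<kappa> < 1/2" using kk \<kappa>0 by (auto simp: \<kappa>_def)
    have k0': "0 < \<kappa>" using K by simp
    define r where "r = sqrt (2 * \<kappa>)"
    have r: "0 < r" using k0' by (simp add: r_def)
    have X: "right_end \<kappa> = r * elliptic_K k" by (simp add: right_end_def r_def)
    have x0X: "x0 < right_end \<kappa>" using ex K by blast
    define I where "I v = (LBINT z=- elliptic_K k..elliptic_K k. jacobi_dn k z * (v (r * z))^2)" for v
    define J where "J v = r * I v / norm0" for v
    define c where "c v = sqrt (sqrt (pi * \<kappa>) / (2 * fact m) / J v)" for v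
    have J: "\<bar>J v - eta_sum n \<kappa>\<bar> \<le> M / \<kappa>^(n + 1) \<and> 1/2 \<le> J v" if nm: "near_mode n x0 B \<kappa> \<theta> v v'" for \<theta> v v'
    proof -
      have a: "\<bar>r * I v - norm0 * eta_sum n \<kappa>\<bar> \<le> M1 / \<kappa>^(n + 1)" using M1(2)[OF K(1) nm] by (simp add: I_def r_def)
      have e: "J v - eta_sum n \<kappa> = (r * I v - norm0 * eta_sum n \<kappa>) / norm0" using norm0_pos by (simp add: J_def field_simps)
      have "\<bar>J v - eta_sum n \<kappa>\<bar> \<le> M1 / \<kappa>^(n + 1) / norm0"
        unfolding e abs_divide using divide_right_mono[OF a, of norm0] norm0_pos by simp
      then have 1: "\<bar>J v - eta_sum n \<kappa>\<bar> \<le> (M1 / norm0) / \<kappa>^(n + 1)" by (simp add: mult.commute)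
      have "(M1 / norm0) / \<kappa>^(n + 1) \<le> M / \<kappa>^(n + 1)" using M k0' by (intro divide_right_mono) auto
      then have 2: "\<bar>J v - eta_sum n \<kappa>\<bar> \<le> M / \<kappa>^(n + 1)" using 1 by linarith
      have "\<kappa> \<le> \<kappa>^(n + 1)" using power_increasing[of 1 "n + 1" \<kappa>] K by auto
      then have "(M1 / norm0) / \<kappa>^(n + 1) \<le> (M1 / norm0) / \<kappa>" using M1(1) norm0_pos k0' by (intro divide_left_mono) auto
      then have "\<bar>J v - eta_sum n \<kappa>\<bar> \<le> (M1 / norm0) / \<kappa>" using 1 by linarith
      moreover have "G / \<kappa> + (M1 / norm0) / \<kappa> < 1/2" using K(4) by (simp only: add_divide_distrib)
      ultimately have "1/2 \<le> J v" using G(2)[OF K(1)] by (simp only: abs_le_iff) linarith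
      then show ?thesis using 2 by blast
    qed
    have cpos: "0 < c v" if "1/2 \<le> J v" for v using that k0' by (simp add: c_def)
    have norm: "lame_normalised k (\<lambda>z. c v * v (r * z))" if j: "1/2 \<le> J v" for v
    proof -
      have "(LBINT z=- elliptic_K k..elliptic_K k. jacobi_dn k z * (c v * v (r * z))^2) = (c v)^2 * I v"
      proof -
        have "(\<lambda>z. jacobi_dn k z * (c v * v (r * z))^2) = (\<lambda>z. (c v)^2 * (jacobi_dn k z * (v (r * z))^2))" by (auto simp: power_mult_distrib)
        then show ?thesis by (simp add: I_def)
      qed
      also have "(c v)^2 = sqrt (pi * \<kappa>) / (2 * fact m) / J v" using j k0' by (simp add: c_def)
      also have "\<dots> * I v = pi / 2"
      proof -
        have "I v \<noteq> 0" using j by (auto simp: J_def)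
        then have "sqrt (pi * \<kappa>) / (2 * fact m) / J v * I v = sqrt (pi * \<kappa>) * norm0 / (2 * fact m * r)"
          using r by (simp add: J_def)
        also have "\<dots> = sqrt (pi * \<kappa>) * sqrt (2 * pi) / (2 * sqrt (2 * \<kappa>))" by (simp add: norm0_def r_def)
        also have "\<dots> = (sqrt pi * sqrt pi) / 2" using k0' by (simp add: real_sqrt_mult field_simps)
        finally show ?thesis by simp
      qed
      finally show ?thesis by (simp add: lame_normalised_def)
    qed
    have mode: "lame_mode n M \<kappa> (\<lambda>z. c v * v (r * z))" if nm: "near_mode n x0 B \<kappa> \<theta> v v'" for \<theta> v v'
    proof -
      have "\<bar>v x - approx_mode n \<kappa> x\<bar> \<le> M / \<kappa>^(n + 1)" if "\<bar>x\<bar> \<le> right_end \<kappa>" for x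
      proof -
        have "\<bar>v x - approx_mode n \<kappa> x\<bar> \<le> B / \<kappa>^(n + 1) * exp (- \<bar>x\<bar>)" using nm that unfolding near_mode_def by blast
        also have "\<dots> \<le> M / \<kappa>^(n + 1) * 1" using M B k0' by (intro mult_mono divide_right_mono) auto
        finally show ?thesis by simp
      qed
      then show ?thesis unfolding lame_mode_def using J[OF nm] unfolding c_def r_def by blast
    qed
    have zeros: "finite (lame_zeros k (\<lambda>z. c v * v (r * z)))" "card (lame_zeros k (\<lambda>z. c v * v (r * z))) = m" if nm: "near_mode n x0 B \<kappa> \<theta> v v'" for \<theta> v v'
      unfolding r_def using near_mode_zeros[OF nm k0' x0X _ pert K(3), of "c v"] cpos[of v] J[OF nm] by auto
    have par: "v (- x) = (-1)^m * v x \<and> v' (- x) = (-1)^Suc m * v' x" if nm: "near_mode n x0 B \<kappa> \<theta> v v'" for \<theta> v v' x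
      using nm unfolding near_mode_def by blast
    obtain \<theta> v v' where N: "near_mode n x0 B \<kappa> \<theta> v v'" "v' (right_end \<kappa>) = 0" "0 < v (right_end \<kappa>)" using ex K by blast
    obtain \<theta>2 u u' where S: "near_mode n x0 B \<kappa> \<theta>2 u u'" "u (right_end \<kappa>) = 0" "u' (right_end \<kappa>) < 0" using ex K by blast
    have Ec: "lame_Ec k \<nu> m = (\<lambda>z. c v * v (r * z))"
    proof (rule lame_Ec_eqI)
      have cp: "0 < c v" using cpos J[OF N(1)] by blast
      have sol: "lame_solution k \<nu> (2 * \<kappa> * \<theta>) (\<lambda>z. c v * v (r * z))" and d: "\<And>z. deriv (\<lambda>z. c v * v (r * z)) z = c v * r * v' (r * z)"
        using near_mode_lame_solution[OF N(1) \<nu> \<kappa>_def, of "c v"] unfolding r_def by blast+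
      show pos: "0 < c v * v (r * elliptic_K k)" using cp N(3) by (simp add: X)
      show "lame_normalised k (\<lambda>z. c v * v (r * z))" using norm J[OF N(1)] by blast
      have "v' (- (r * elliptic_K k)) = 0" using par[OF N(1), of "r * elliptic_K k"] N(2) by (simp add: X)
      then show "Ec_eigenfunction k \<nu> m (2 * \<kappa> * \<theta>) (\<lambda>z. c v * v (r * z))"
        unfolding Ec_eigenfunction_def d using sol zeros[OF N(1)] pos N(2) by (auto simp: X intro!: exI[of _ "elliptic_K k"])
    qed
    have Es: "lame_Es k \<nu> (m + 1) = (\<lambda>z. c u * u (r * z))"
    proof (rule lame_Es_eqI)
      have cp: "0 < c u" using cpos J[OF S(1)] by blast
      have sol: "lame_solution k \<nu> (2 * \<kappa> * \<theta>2) (\<lambda>z. c u * u (r * z))" and d: "\<And>z. deriv (\<lambda>z. c u * u (r * z)) z = c u * r * u' (r * z)"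
        using near_mode_lame_solution[OF S(1) \<nu> \<kappa>_def, of "c u"] unfolding r_def by blast+
      show dn: "deriv (\<lambda>z. c u * u (r * z)) (elliptic_K k) < 0" unfolding d using cp S(3) r by (simp add: X mult_pos_neg)
      show "lame_normalised k (\<lambda>z. c u * u (r * z))" using norm J[OF S(1)] by blast
      have e: "u (- (r * elliptic_K k)) = 0" using par[OF S(1), of "r * elliptic_K k"] S(2) by (simp add: X)
      have "\<exists>z. c u * u (r * z) \<noteq> 0"
      proof -
        have "0 < u x0" using S(1) x0X unfolding near_mode_def by blast
        then show ?thesis using cp r by (intro exI[of _ "x0 / r"]) simp
      qed
      then show "Es_eigenfunction k \<nu> (m + 1) (2 * \<kappa> * \<theta>2) (\<lambda>z. c u * u (r * z))"
        unfolding Es_eigenfunction_def using sol zeros[OF S(1)] S(2) e by (auto simp: X)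
    qed
    show ?thesis unfolding Ec Es \<kappa>_def[symmetric] using mode[OF N(1)] mode[OF S(1)] by blast
  qed
  have k: "filterlim (lame_kappa k) at_top at_top" by (rule kappa_at_top[OF k0])
  have ev: "eventually (\<lambda>\<nu>. P (lame_kappa k \<nu>)) at_top" if "eventually P at_top" for P
    using k that unfolding filterlim_iff by blast
  have "eventually (\<lambda>\<nu>. 0 < \<nu> \<and> \<kappa>0 \<le> lame_kappa k \<nu> \<and> B / lame_kappa k \<nu> < \<eta> \<and> (G + M1 / norm0) / lame_kappa k \<nu> < 1/2) at_top"
    by (intro eventually_conj eventually_gt_at_top ev[of "\<lambda>\<kappa>. \<kappa>0 \<le> \<kappa>"] ev[of "\<lambda>\<kappa>. B / \<kappa> < \<eta>"] ev[of "\<lambda>\<kappa>. (G + M1 / norm0) / \<kappa> < 1/2"]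
       eventually_ge_at_top eventually_divide_less \<eta>) simp
  then have "eventually (\<lambda>\<nu>. lame_mode n M (lame_kappa k \<nu>) (lame_Ec k \<nu> m) \<and> lame_mode n M (lame_kappa k \<nu>) (lame_Es k \<nu> (m + 1))) at_top"
    by eventually_elim (use main in blast)
  then show ?thesis using M by blast
qed

end

text \<open>1/sqrt a - 1/sqrt b = (b - a) / (sqrt a sqrt b (sqrt a + sqrt b)), where the product of
  roots is at least 1/2 and their sum at least 1.\<close>

lemma powr_minus_half_close:
  fixes a b :: real
  assumes "1/2 \<le> a" "1/2 \<le> b" shows "\<bar>a powr (- 1/2) - b powr (- 1/2)\<bar> \<le> 2 * \<bar>a - b\<bar>"
proof -
  have pos: "0 < a" "0 < b" using assms by auto
  have e: "x powr (- 1/2) = 1 / sqrt x" if "0 < x" for x :: real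
    using that by (simp add: powr_minus powr_half_sqrt[symmetric] inverse_eq_divide)
  have s: "1/2 \<le> sqrt a * sqrt b" "1 \<le> sqrt a + sqrt b"
  proof -
    have h: "1/2 \<le> sqrt x" if "1/2 \<le> x" for x :: real by (rule real_le_rsqrt) (use that in \<open>simp add: power2_eq_square\<close>)
    show "1 \<le> sqrt a + sqrt b" using h[OF assms(1)] h[OF assms(2)] by linarith
    have "(1/2) * (1/2) \<le> a * b" using assms by (intro mult_mono) auto
    then have "(1/2)^2 \<le> a * b" by (simp add: power2_eq_square)
    then have "1/2 \<le> sqrt (a * b)" by (rule real_le_rsqrt)
    then show "1/2 \<le> sqrt a * sqrt b" by (simp add: real_sqrt_mult)
  qed
  have "(sqrt b - sqrt a) * (sqrt a + sqrt b) = b - a" using pos by (simp add: algebra_simps)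
  then have "\<bar>b - a\<bar> = \<bar>sqrt b - sqrt a\<bar> * (sqrt a + sqrt b)" using s by (metis abs_mult abs_of_nonneg order_trans zero_le_one)
  then have d: "\<bar>sqrt b - sqrt a\<bar> \<le> \<bar>b - a\<bar>" using mult_left_mono[OF s(2), of "\<bar>sqrt b - sqrt a\<bar>"] by simp
  have "a powr (- 1/2) - b powr (- 1/2) = (sqrt b - sqrt a) / (sqrt a * sqrt b)"
    unfolding e[OF pos(1)] e[OF pos(2)] using pos by (simp add: field_simps)
  then have "\<bar>a powr (- 1/2) - b powr (- 1/2)\<bar> = \<bar>sqrt b - sqrt a\<bar> / (sqrt a * sqrt b)" using s by (simp add: abs_divide)
  also have "\<dots> \<le> \<bar>b - a\<bar> / (1/2)" using d s by (intro frac_le) auto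
  finally show ?thesis by (simp add: abs_minus_commute)
qed

text \<open>By its recursion, \<open>cn_quotient A\<close> times the binomial series of sqrt (1 - x
  t^2/2) gives back A up to order n. Dividing by the root afterwards is safe because it is at least
  1/2 in this range.\<close>

lemma cn_quotient_expansion:
  fixes A :: "nat \<Rightarrow> real poly"
  assumes t0: "0 < t0"
  shows "\<exists>C>0. \<forall>x t. 0 < x \<and> x \<le> 1 \<and> \<bar>t\<bar> \<le> t0 \<and> x * t^2 / 2 \<le> 1/2 \<longrightarrow>
    \<bar>(\<Sum>s\<le>n. x^s * poly (A s) t) / sqrt (1 - x * t^2 / 2) - (\<Sum>s\<le>n. x^s * poly (cn_quotient A s) t)\<bar> \<le> C * x^(n + 1)"
proof -
  define P where "P = cn_quotient A"
  obtain R :: real where R: "R > 0" "\<And>y::real. 0 \<le> y \<Longrightarrow> y \<le> 1/2 \<Longrightarrow> \<bar>(1 - y) powr (1/2) - (\<Sum>j\<le>n. ((1/2) gchoose j) * (- y)^j)\<bar> \<le> R * y^(n + 1)"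
    using binomial_series_remainder[of "1/2" n] by blast
  define b where "b j t = ((1/2) gchoose j) * (- (t^2) / 2)^j" for j and t :: real
  define H where "H t = (t^2 / 2)^(n + 1) * R * (\<Sum>s\<le>n. \<bar>poly (P s) t\<bar>) + (\<Sum>j\<le>n. \<bar>b j t\<bar>) * (\<Sum>s\<le>n. \<bar>poly (P s) t\<bar>)" for t
  have "continuous_on {-t0..t0} H" unfolding H_def b_def by (intro continuous_intros) auto
  then have "bounded (H ` {-t0..t0})" by (intro compact_imp_bounded compact_continuous_image) auto
  then obtain C0 where C0: "\<And>t. \<bar>t\<bar> \<le> t0 \<Longrightarrow> \<bar>H t\<bar> \<le> C0" by (force simp: bounded_iff abs_le_iff)
  define C where "C = 2 * \<bar>C0\<bar> + 1"
  have "\<bar>(\<Sum>s\<le>n. x^s * poly (A s) t) / sqrt (1 - x * t^2 / 2) - (\<Sum>s\<le>n. x^s * poly (P s) t)\<bar> \<le> C * x^(n + 1)"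
    if x: "0 < x" "x \<le> 1" and t: "\<bar>t\<bar> \<le> t0" and y: "x * t^2 / 2 \<le> 1/2" for x t
  proof -
    define y where "y = x * t^2 / 2"
    have y0: "0 \<le> y" "y \<le> 1/2" using x y by (auto simp: y_def)
    define c where "c = sqrt (1 - y)"
    have c: "1/2 \<le> c" unfolding c_def by (rule real_le_rsqrt) (use y0 in \<open>simp add: power2_eq_square\<close>)
    have cp: "c = (1 - y) powr (1/2)" using y0 by (simp add: c_def powr_half_sqrt)
    define bs where "bs = (\<Sum>j\<le>n. b j t * x^j)"
    have "(- y)^j = (- (t^2) / 2)^j * x^j" for j
      unfolding power_mult_distrib[symmetric] y_def by (simp add: mult.commute)
    then have "((1/2) gchoose j) * (- y)^j = b j t * x^j" for j by (simp add: b_def)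
    then have rb: "\<bar>c - bs\<bar> \<le> R * y^(n + 1)" using R(2)[OF y0] by (simp add: cp bs_def)
    define p where "p = (\<Sum>s\<le>n. poly (P s) t * x^s)"
    let ?S = "\<Sum>s\<le>n. \<bar>poly (P s) t\<bar>"
    have pS: "\<bar>p\<bar> \<le> ?S" unfolding p_def
      by (rule order_trans[OF sum_abs]) (rule sum_mono, use x in \<open>simp add: abs_mult power_le_one mult_left_le\<close>)
    have rec: "poly (A r) t = (\<Sum>j\<le>r. b j t * poly (P (r - j)) t)" for r
    proof -
      have "A r = (\<Sum>j=0..r. smult ((1/2) gchoose j) ([:0, 0, - 1/2:]^j * P (r - j)))" unfolding P_def by (rule cn_quotient_recursion)
      then have "poly (A r) t = (\<Sum>j=0..r. ((1/2) gchoose j) * ((poly [:0, 0, - 1/2:] t)^j * poly (P (r - j)) t))"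
        by (simp only: poly_sum poly_smult poly_mult poly_power)
      also have "poly [:0, 0, - 1/2:] t = - (t^2) / 2" by (simp add: power2_eq_square)
      finally show ?thesis by (simp add: b_def atLeast0AtMost mult.assoc)
    qed
    define a where "a = (\<Sum>s\<le>n. x^s * poly (A s) t)"
    have e: "\<bar>bs * p - a\<bar> \<le> x^(n + 1) * ((\<Sum>j\<le>n. \<bar>b j t\<bar>) * ?S)"
      using truncated_product[of x n n "\<lambda>j. b j t" "\<lambda>s. poly (P s) t"] x unfolding bs_def p_def a_def rec by simp
    have yn: "y^(n + 1) = x^(n + 1) * (t^2 / 2)^(n + 1)" unfolding power_mult_distrib[symmetric] y_def by simp
    have "\<bar>(c - bs) * p\<bar> \<le> (R * y^(n + 1)) * ?S" unfolding abs_mult using rb pS R(1) y0 by (intro mult_mono) auto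
    also have "\<dots> = x^(n + 1) * ((t^2 / 2)^(n + 1) * R * ?S)" unfolding yn by (simp only: mult_ac)
    finally have e2: "\<bar>(c - bs) * p\<bar> \<le> x^(n + 1) * ((t^2 / 2)^(n + 1) * R * ?S)" .
    have "c * p - a = (c - bs) * p + (bs * p - a)" by (simp add: algebra_simps)
    then have "\<bar>c * p - a\<bar> \<le> x^(n + 1) * H t" using e e2 unfolding H_def distrib_left by linarith
    also have "\<dots> \<le> x^(n + 1) * \<bar>C0\<bar>" using C0[OF t] x by (intro mult_left_mono) auto
    finally have f: "\<bar>c * p - a\<bar> \<le> x^(n + 1) * \<bar>C0\<bar>" .
    have "a / c - p = - (c * p - a) / c" using c by (simp add: field_simps)
    then have "\<bar>a / c - p\<bar> = \<bar>c * p - a\<bar> / c" using c by (simp add: abs_divide)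
    also have "\<dots> \<le> (x^(n + 1) * \<bar>C0\<bar>) / (1/2)" using f c x by (intro frac_le) auto
    also have "\<dots> \<le> C * x^(n + 1)" using x by (simp add: C_def algebra_simps)
    finally show ?thesis unfolding a_def c_def y_def p_def by (simp add: mult.commute)
  qed
  moreover have "C > 0" by (simp add: C_def)
  ultimately show ?thesis unfolding P_def by blast
qed

context expansion
begin

lemma approx_mode_eq: "approx_mode n \<kappa> x = parabolic_D m (tau \<kappa> x) * (\<Sum>s\<le>n. (1 / \<kappa>)^s * poly (coeff_A k m s) (tau \<kappa> x))
    + parabolic_D' m (tau \<kappa> x) * (\<Sum>s\<le>n. (1 / \<kappa>)^s * poly (coeff_B k m s) (tau \<kappa> x))"
  unfolding approx_mode_def gauss_approx term_poly_def gauss_cylinder_poly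
  by (simp add: sum_distrib_left sum.distrib[symmetric] algebra_simps)

text \<open>The constant of both expansions. The exact normalising factor has J in place of g; g is
  one function for all orders n.\<close>

definition amplitude :: "(real \<Rightarrow> real) \<Rightarrow> real \<Rightarrow> real" where
  "amplitude g \<kappa> = (pi * \<kappa>) powr (1/4) / sqrt (2 * fact m) * g \<kappa> powr (- 1/2)"

lemma amplitude_eq: assumes "0 < \<kappa>" "0 < g \<kappa>" shows "amplitude g \<kappa> = sqrt (sqrt (pi * \<kappa>) / (2 * fact m) / g \<kappa>)"
proof -
  have q: "(pi * \<kappa>) powr (1/4) = sqrt (sqrt (pi * \<kappa>))"
    using assms by (simp add: powr_half_sqrt[symmetric] powr_powr)
  have "g \<kappa> powr (- 1/2) = 1 / sqrt (g \<kappa>)" using assms by (simp add: powr_minus powr_half_sqrt[symmetric] inverse_eq_divide)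
  then show ?thesis unfolding amplitude_def q by (simp add: real_sqrt_divide real_sqrt_mult)
qed

text \<open>J comes from the construction of order n and depends on the boundary condition. Both J
  and g agree with \<open>eta_sum n\<close> up to O(\<kappa>^(-n-1)), so exchanging J for g
  multiplies the function by sqrt (g/J), which is 1 up to the same order.\<close>

lemma mode_expansion:
  assumes g: "\<And>n. \<exists>B x1. \<forall>x\<ge>x1. \<bar>g x - (\<Sum>s\<le>n. coeff_eta k m s / x^s)\<bar> \<le> B / x^(n + 1)"
    and f: "eventually (\<lambda>\<nu>. lame_mode n M (lame_kappa k \<nu>) (f \<nu>)) at_top"
  shows "\<exists>N. eventually (\<lambda>\<nu>. 1 \<le> lame_kappa k \<nu> \<and> 0 < amplitude g (lame_kappa k \<nu>) \<and> (\<forall>z. \<bar>z\<bar> < elliptic_K k \<longrightarrow>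
    \<bar>f \<nu> z / amplitude g (lame_kappa k \<nu>) - approx_mode n (lame_kappa k \<nu>) (sqrt (2 * lame_kappa k \<nu>) * z)\<bar> \<le> N / lame_kappa k \<nu>^(n + 1))) at_top"
proof -
  obtain B1 x1 where B1: "\<And>x. x1 \<le> x \<Longrightarrow> \<bar>g x - eta_sum n x\<bar> \<le> B1 / x^(n + 1)" using g[of n] unfolding eta_sum_def by blast
  obtain G where G: "0 \<le> G" "\<And>\<kappa>. 1 \<le> \<kappa> \<Longrightarrow> \<bar>eta_sum n \<kappa> - 1\<bar> \<le> G / \<kappa>" using eta_sum_close[of n] by blast
  obtain Cu where Cu: "Cu > 0" "\<And>\<kappa> x. 1 \<le> \<kappa> \<Longrightarrow> \<bar>approx_mode n \<kappa> x\<bar> \<le> Cu" using approx_mode_bound[of n] by blast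
  define N where "N = 2 * (\<bar>B1\<bar> + \<bar>M\<bar>) * (Cu + \<bar>M\<bar>) + \<bar>M\<bar>"
  have main: "1 \<le> \<kappa> \<and> 0 < amplitude g \<kappa> \<and> (\<forall>z. \<bar>z\<bar> < elliptic_K k \<longrightarrow>
    \<bar>h z / amplitude g \<kappa> - approx_mode n \<kappa> (sqrt (2 * \<kappa>) * z)\<bar> \<le> N / \<kappa>^(n + 1))"
    if \<kappa>: "1 \<le> \<kappa>" "x1 \<le> \<kappa>" "(G + \<bar>B1\<bar>) / \<kappa> < 1/2" and lm: "lame_mode n M \<kappa> h" for \<kappa> h
  proof -
    have k0': "0 < \<kappa>" using \<kappa> by simp
    define \<epsilon> where "\<epsilon> = 1 / \<kappa>^(n + 1)"
    have kn: "\<kappa> \<le> \<kappa>^(n + 1)" using power_increasing[of 1 "n + 1" \<kappa>] \<kappa> by auto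
    have eps: "0 < \<epsilon>" "\<epsilon> \<le> 1 / \<kappa>" "\<epsilon> \<le> 1"
    proof -
      show "0 < \<epsilon>" using k0' by (simp add: \<epsilon>_def)
      show "\<epsilon> \<le> 1 / \<kappa>" unfolding \<epsilon>_def using kn k0' by (intro divide_left_mono) auto
      moreover have "1 / \<kappa> \<le> 1" using \<kappa> by simp
      ultimately show "\<epsilon> \<le> 1" by linarith
    qed
    have ge: "\<bar>g \<kappa> - eta_sum n \<kappa>\<bar> \<le> \<bar>B1\<bar> * \<epsilon>"
    proof -
      have "B1 / \<kappa>^(n + 1) \<le> \<bar>B1\<bar> * \<epsilon>" unfolding \<epsilon>_def using k0' by (simp add: divide_right_mono)
      then show ?thesis using B1[OF \<kappa>(2)] by linarith
    qed
    have "\<bar>B1\<bar> * \<epsilon> \<le> \<bar>B1\<bar> / \<kappa>" using mult_left_mono[OF eps(2), of "\<bar>B1\<bar>"] by simp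
    moreover have "G / \<kappa> + \<bar>B1\<bar> / \<kappa> < 1/2" using \<kappa>(3) by (simp only: add_divide_distrib)
    ultimately have gh: "1/2 \<le> g \<kappa>" using ge G(2)[OF \<kappa>(1)] by (simp only: abs_le_iff) linarith
    obtain v J where v: "\<And>x. \<bar>x\<bar> \<le> right_end \<kappa> \<Longrightarrow> \<bar>v x - approx_mode n \<kappa> x\<bar> \<le> M / \<kappa>^(n + 1)"
      and J: "\<bar>J - eta_sum n \<kappa>\<bar> \<le> M / \<kappa>^(n + 1)" "1/2 \<le> J"
      and h: "h = (\<lambda>z. sqrt (sqrt (pi * \<kappa>) / (2 * fact m) / J) * v (sqrt (2 * \<kappa>) * z))"
      using lm unfolding lame_mode_def by blast
    have Me: "M / \<kappa>^(n + 1) \<le> \<bar>M\<bar> * \<epsilon>" unfolding \<epsilon>_def using k0' by (simp add: divide_right_mono)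
    have amp: "amplitude g \<kappa> = sqrt (sqrt (pi * \<kappa>) / (2 * fact m) / g \<kappa>)" using k0' gh by (intro amplitude_eq) auto
    have ap: "0 < amplitude g \<kappa>" unfolding amp using k0' gh by simp
    define \<rho> where "\<rho> = sqrt (g \<kappa> / J)"
    have hr: "h z / amplitude g \<kappa> = \<rho> * v (sqrt (2 * \<kappa>) * z)" for z
    proof -
      have "sqrt (sqrt (pi * \<kappa>) / (2 * fact m) / J) / amplitude g \<kappa> = \<rho>"
        unfolding amp \<rho>_def real_sqrt_divide[symmetric] using k0' gh J by (simp add: field_simps)
      then show ?thesis unfolding h by (metis times_divide_eq_left)
    qed
    \<comment> \<open>From \<rho>^2 - 1 = (g - J)/J, with \<rho> + 1 \<ge> 1 and J \<ge>
      1/2.\<close>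
    have r1: "\<bar>\<rho> - 1\<bar> \<le> 2 * (\<bar>B1\<bar> + \<bar>M\<bar>) * \<epsilon>"
    proof -
      have p: "0 \<le> \<rho>" unfolding \<rho>_def using gh J by simp
      have "\<rho>^2 = g \<kappa> / J" unfolding \<rho>_def using gh J by simp
      then have "(\<rho> - 1) * (\<rho> + 1) = (g \<kappa> - J) / J" using J by (simp add: power2_eq_square field_simps)
      then have "\<bar>(\<rho> - 1) * (\<rho> + 1)\<bar> = \<bar>(g \<kappa> - J) / J\<bar>" by (rule arg_cong)
      then have "\<bar>\<rho> - 1\<bar> * (\<rho> + 1) = \<bar>g \<kappa> - J\<bar> / J" unfolding abs_mult abs_divide using p J by simp
      moreover have "\<bar>\<rho> - 1\<bar> * 1 \<le> \<bar>\<rho> - 1\<bar> * (\<rho> + 1)" using p by (intro mult_left_mono) auto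
      moreover have "\<bar>g \<kappa> - J\<bar> / J \<le> ((\<bar>B1\<bar> + \<bar>M\<bar>) * \<epsilon>) / (1/2)"
      proof (rule frac_le)
        have "\<bar>g \<kappa> - J\<bar> \<le> \<bar>B1\<bar> * \<epsilon> + \<bar>M\<bar> * \<epsilon>" using ge J(1) Me by linarith
        then show "\<bar>g \<kappa> - J\<bar> \<le> (\<bar>B1\<bar> + \<bar>M\<bar>) * \<epsilon>" by (simp add: distrib_right)
      qed (use J eps in auto)
      ultimately have "\<bar>\<rho> - 1\<bar> \<le> ((\<bar>B1\<bar> + \<bar>M\<bar>) * \<epsilon>) / (1/2)" by linarith
      then show ?thesis by (simp add: algebra_simps)
    qed
    have "\<bar>h z / amplitude g \<kappa> - approx_mode n \<kappa> (sqrt (2 * \<kappa>) * z)\<bar> \<le> N / \<kappa>^(n + 1)" if z: "\<bar>z\<bar> < elliptic_K k" for z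
    proof -
      let ?x = "sqrt (2 * \<kappa>) * z"
      have xe: "\<bar>?x\<bar> \<le> right_end \<kappa>" using z k0' by (simp add: right_end_def abs_mult)
      have vu: "\<bar>v ?x - approx_mode n \<kappa> ?x\<bar> \<le> \<bar>M\<bar> * \<epsilon>" using v[OF xe] Me by linarith
      have "\<bar>M\<bar> * \<epsilon> \<le> \<bar>M\<bar>" using eps by (simp add: mult_left_le)
      then have vb: "\<bar>v ?x\<bar> \<le> Cu + \<bar>M\<bar>" using vu Cu(2)[OF \<kappa>(1), of ?x] by linarith
      have "h z / amplitude g \<kappa> - approx_mode n \<kappa> ?x = (\<rho> - 1) * v ?x + (v ?x - approx_mode n \<kappa> ?x)" unfolding hr by (simp add: algebra_simps)
      moreover have "\<bar>(\<rho> - 1) * v ?x\<bar> \<le> (2 * (\<bar>B1\<bar> + \<bar>M\<bar>) * \<epsilon>) * (Cu + \<bar>M\<bar>)"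
        unfolding abs_mult using r1 vb eps by (intro mult_mono) auto
      ultimately have "\<bar>h z / amplitude g \<kappa> - approx_mode n \<kappa> ?x\<bar> \<le> (2 * (\<bar>B1\<bar> + \<bar>M\<bar>) * \<epsilon>) * (Cu + \<bar>M\<bar>) + \<bar>M\<bar> * \<epsilon>" using vu by linarith
      also have "\<dots> = N * \<epsilon>" by (simp add: N_def algebra_simps)
      finally show ?thesis by (simp add: \<epsilon>_def)
    qed
    then show ?thesis using \<kappa> ap by blast
  qed
  have k: "filterlim (lame_kappa k) at_top at_top" by (rule kappa_at_top[OF k0])
  have ev: "eventually (\<lambda>\<nu>. P (lame_kappa k \<nu>)) at_top" if "eventually P at_top" for P
    using k that unfolding filterlim_iff by blast
  have "eventually (\<lambda>\<nu>. lame_mode n M (lame_kappa k \<nu>) (f \<nu>) \<and> 1 \<le> lame_kappa k \<nu> \<and> x1 \<le> lame_kappa k \<nu> \<and> (G + \<bar>B1\<bar>) / lame_kappa k \<nu> < 1/2) at_top"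
    by (intro eventually_conj f ev[of "\<lambda>\<kappa>. 1 \<le> \<kappa>"] ev[of "\<lambda>\<kappa>. x1 \<le> \<kappa>"] ev[of "\<lambda>\<kappa>. (G + \<bar>B1\<bar>) / \<kappa> < 1/2"]
       eventually_ge_at_top eventually_divide_less) simp
  then show ?thesis
    by (intro exI[of _ N]) (erule eventually_mono, use main in blast)
qed

text \<open>For large \<kappa> both g and \<open>eta_sum N\<close> are at least 1/2, so their
  distance is passed on to the power -1/2.\<close>

lemma amplitude_expansion:
  assumes g: "\<And>n. \<exists>B x1. \<forall>x\<ge>x1. \<bar>g x - (\<Sum>s\<le>n. coeff_eta k m s / x^s)\<bar> \<le> B / x^(n + 1)"
  shows "constant_expansion k m (\<lambda>\<nu>. amplitude g (lame_kappa k \<nu>))"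
  unfolding constant_expansion_def
proof
  fix N
  obtain B1 x1 where B1: "\<And>x. x1 \<le> x \<Longrightarrow> \<bar>g x - eta_sum N x\<bar> \<le> B1 / x^(N + 1)" using g[of N] unfolding eta_sum_def by blast
  obtain G where G: "0 \<le> G" "\<And>\<kappa>. 1 \<le> \<kappa> \<Longrightarrow> \<bar>eta_sum N \<kappa> - 1\<bar> \<le> G / \<kappa>" using eta_sum_close[of N] by blast
  have k: "filterlim (lame_kappa k) at_top at_top" by (rule kappa_at_top[OF k0])
  have ev: "eventually (\<lambda>\<nu>. P (lame_kappa k \<nu>)) at_top" if "eventually P at_top" for P
    using k that unfolding filterlim_iff by blast
  have es: "eta_sum N \<kappa> = 1 + (\<Sum>s=1..N. coeff_eta k m s / \<kappa>^s)" for \<kappa>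
  proof -
    have "{..N} = insert 0 {1..N}" by auto
    then show ?thesis by (simp add: eta_sum_def coeff_eta_0)
  qed
  show "(\<lambda>\<nu>. amplitude g (lame_kappa k \<nu>) / ((pi * lame_kappa k \<nu>) powr (1/4) / sqrt (2 * fact m))
              - (1 + (\<Sum>s=1..N. coeff_eta k m s / lame_kappa k \<nu>^s)) powr (- 1/2))
         \<in> O(\<lambda>\<nu>. 1 / lame_kappa k \<nu>^(N + 1))"
  proof (rule bigoI)
    have "eventually (\<lambda>\<nu>. 1 \<le> lame_kappa k \<nu> \<and> x1 \<le> lame_kappa k \<nu> \<and> (G + \<bar>B1\<bar>) / lame_kappa k \<nu> < 1/2) at_top"
      by (intro eventually_conj ev[of "\<lambda>\<kappa>. 1 \<le> \<kappa>"] ev[of "\<lambda>\<kappa>. x1 \<le> \<kappa>"] ev[of "\<lambda>\<kappa>. (G + \<bar>B1\<bar>) / \<kappa> < 1/2"]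
       eventually_ge_at_top eventually_divide_less) simp
    then show "eventually (\<lambda>\<nu>. norm (amplitude g (lame_kappa k \<nu>) / ((pi * lame_kappa k \<nu>) powr (1/4) / sqrt (2 * fact m))
              - (1 + (\<Sum>s=1..N. coeff_eta k m s / lame_kappa k \<nu>^s)) powr (- 1/2)) \<le> (2 * \<bar>B1\<bar>) * norm (1 / lame_kappa k \<nu>^(N + 1))) at_top"
    proof eventually_elim
      case (elim \<nu>)
      define \<kappa> where "\<kappa> = lame_kappa k \<nu>"
      have \<kappa>: "1 \<le> \<kappa>" "x1 \<le> \<kappa>" "(G + \<bar>B1\<bar>) / \<kappa> < 1/2" using elim by (auto simp: \<kappa>_def)
      have k0': "0 < \<kappa>" using \<kappa> by simp
      have b: "\<bar>g \<kappa> - eta_sum N \<kappa>\<bar> \<le> \<bar>B1\<bar> * (1 / \<kappa>^(N + 1))"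
      proof -
        have "B1 / \<kappa>^(N + 1) \<le> \<bar>B1\<bar> * (1 / \<kappa>^(N + 1))" using k0' by (simp add: divide_right_mono)
        then show ?thesis using B1[OF \<kappa>(2)] by linarith
      qed
      have "\<kappa> \<le> \<kappa>^(N + 1)" using power_increasing[of 1 "N + 1" \<kappa>] \<kappa> by auto
      then have "1 / \<kappa>^(N + 1) \<le> 1 / \<kappa>" using k0' by (intro divide_left_mono) auto
      then have "\<bar>B1\<bar> * (1 / \<kappa>^(N + 1)) \<le> \<bar>B1\<bar> / \<kappa>" using mult_left_mono[of "1 / \<kappa>^(N + 1)" "1 / \<kappa>" "\<bar>B1\<bar>"] by simp
      moreover have "G / \<kappa> + \<bar>B1\<bar> / \<kappa> < 1/2" using \<kappa>(3) by (simp only: add_divide_distrib)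
      moreover have "0 \<le> \<bar>B1\<bar> / \<kappa>" using k0' by simp
      ultimately have h: "1/2 \<le> g \<kappa>" "1/2 \<le> eta_sum N \<kappa>" using b G(2)[OF \<kappa>(1)] by (simp_all only: abs_le_iff) linarith+
      have "amplitude g \<kappa> / ((pi * \<kappa>) powr (1/4) / sqrt (2 * fact m)) = g \<kappa> powr (- 1/2)"
        unfolding amplitude_def using k0' by simp
      then show ?case unfolding \<kappa>_def[symmetric] es[symmetric] using powr_minus_half_close[OF h] b k0' by simp
    qed
  qed
qed

end

lemma sum_over_powers: "(\<Sum>s=0..n. poly (a s) t / \<kappa>^s) = (\<Sum>s\<le>n. (1 / \<kappa>)^s * poly (a s) (t::real))"
  by (simp add: atLeast0AtMost power_one_over field_simps)

context expansion
begin

lemma tau_scaled: "tau (lame_kappa k \<nu>) (sqrt (2 * lame_kappa k \<nu>) * z) = lame_t k \<nu> z" if "0 < lame_kappa k \<nu>"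
  using that by (simp add: tau_def lame_t_def)

lemma local_expansion_Ec:
  assumes g: "\<And>n. \<exists>B x1. \<forall>x\<ge>x1. \<bar>g x - (\<Sum>s\<le>n. coeff_eta k m s / x^s)\<bar> \<le> B / x^(n + 1)"
  shows "local_expansion k m (\<lambda>\<nu> z. lame_Ec k \<nu> m z) (\<lambda>\<nu>. amplitude g (lame_kappa k \<nu>)) (coeff_A k m) (coeff_B k m)"
  unfolding local_expansion_def
proof (intro allI impI)
  fix n and t0 :: real
  obtain M where "eventually (\<lambda>\<nu>. lame_mode n M (lame_kappa k \<nu>) (lame_Ec k \<nu> m)) at_top"
    using lame_functions_are_modes[of n] by (auto simp: eventually_conj_iff)
  from mode_expansion[OF g this] obtain N where N: "eventually (\<lambda>\<nu>. 1 \<le> lame_kappa k \<nu> \<and> 0 < amplitude g (lame_kappa k \<nu>) \<and> (\<forall>z. \<bar>z\<bar> < elliptic_K k \<longrightarrow>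
    \<bar>lame_Ec k \<nu> m z / amplitude g (lame_kappa k \<nu>) - approx_mode n (lame_kappa k \<nu>) (sqrt (2 * lame_kappa k \<nu>) * z)\<bar> \<le> N / lame_kappa k \<nu>^(n + 1))) at_top"
    by blast
  show "\<exists>N. \<forall>\<^sub>F \<nu> in at_top. \<forall>z.
       \<bar>z\<bar> < elliptic_K k \<and> \<bar>lame_t k \<nu> z\<bar> \<le> t0 \<longrightarrow>
       (\<exists>E. \<bar>E\<bar> \<le> N / lame_kappa k \<nu> ^ (n + 1) \<and>
          lame_Ec k \<nu> m z = amplitude g (lame_kappa k \<nu>) *
            (parabolic_D m (lame_t k \<nu> z) * (\<Sum>s=0..n. poly (coeff_A k m s) (lame_t k \<nu> z) / lame_kappa k \<nu> ^ s)
             + deriv (parabolic_D m) (lame_t k \<nu> z) * (\<Sum>s=0..n. poly (coeff_B k m s) (lame_t k \<nu> z) / lame_kappa k \<nu> ^ s)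
             + E))"
  proof (rule exI[of _ N], rule eventually_mono[OF N], intro allI impI)
    fix \<nu> z
    assume a: "1 \<le> lame_kappa k \<nu> \<and> 0 < amplitude g (lame_kappa k \<nu>) \<and> (\<forall>z. \<bar>z\<bar> < elliptic_K k \<longrightarrow>
      \<bar>lame_Ec k \<nu> m z / amplitude g (lame_kappa k \<nu>) - approx_mode n (lame_kappa k \<nu>) (sqrt (2 * lame_kappa k \<nu>) * z)\<bar> \<le> N / lame_kappa k \<nu>^(n + 1))"
      and z: "\<bar>z\<bar> < elliptic_K k \<and> \<bar>lame_t k \<nu> z\<bar> \<le> t0"
    let ?E = "lame_Ec k \<nu> m z / amplitude g (lame_kappa k \<nu>) - approx_mode n (lame_kappa k \<nu>) (sqrt (2 * lame_kappa k \<nu>) * z)"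
    have k1: "0 < lame_kappa k \<nu>" using a by auto
    show "\<exists>E. \<bar>E\<bar> \<le> N / lame_kappa k \<nu> ^ (n + 1) \<and>
          lame_Ec k \<nu> m z = amplitude g (lame_kappa k \<nu>) *
            (parabolic_D m (lame_t k \<nu> z) * (\<Sum>s=0..n. poly (coeff_A k m s) (lame_t k \<nu> z) / lame_kappa k \<nu> ^ s)
             + deriv (parabolic_D m) (lame_t k \<nu> z) * (\<Sum>s=0..n. poly (coeff_B k m s) (lame_t k \<nu> z) / lame_kappa k \<nu> ^ s)
             + E)"
    proof (intro exI[of _ ?E] conjI)
      show "\<bar>?E\<bar> \<le> N / lame_kappa k \<nu> ^ (n + 1)" using a z by blast
      have "amplitude g (lame_kappa k \<nu>) * (approx_mode n (lame_kappa k \<nu>) (sqrt (2 * lame_kappa k \<nu>) * z) + ?E) = lame_Ec k \<nu> m z" using a by simp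
      then show "lame_Ec k \<nu> m z = amplitude g (lame_kappa k \<nu>) *
            (parabolic_D m (lame_t k \<nu> z) * (\<Sum>s=0..n. poly (coeff_A k m s) (lame_t k \<nu> z) / lame_kappa k \<nu> ^ s)
             + deriv (parabolic_D m) (lame_t k \<nu> z) * (\<Sum>s=0..n. poly (coeff_B k m s) (lame_t k \<nu> z) / lame_kappa k \<nu> ^ s)
             + ?E)"
        unfolding deriv_parabolic_D sum_over_powers approx_mode_eq tau_scaled[OF k1] by (rule sym)
    qed
  qed
qed

text \<open>Once \<kappa> \<ge> t0^2, the bound |t| \<le> t0 keeps cn \<ge> 1/2, so division by cn
  is uniform and turns the series of A and B into those of \<open>coeff_P\<close> and
  \<open>coeff_Q\<close>.\<close>

lemma local_expansion_Es:
  assumes g: "\<And>n. \<exists>B x1. \<forall>x\<ge>x1. \<bar>g x - (\<Sum>s\<le>n. coeff_eta k m s / x^s)\<bar> \<le> B / x^(n + 1)"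
  shows "local_expansion k m (\<lambda>\<nu> z. lame_Es k \<nu> (m + 1) z / jacobi_cn k z) (\<lambda>\<nu>. amplitude g (lame_kappa k \<nu>)) (coeff_P k m) (coeff_Q k m)"
  unfolding local_expansion_def
proof (intro allI impI)
  fix n and t0 :: real
  assume t0: "0 < t0"
  obtain M where "eventually (\<lambda>\<nu>. lame_mode n M (lame_kappa k \<nu>) (lame_Es k \<nu> (m + 1))) at_top"
    using lame_functions_are_modes[of n] by (auto simp: eventually_conj_iff)
  from mode_expansion[OF g this] obtain N where N: "eventually (\<lambda>\<nu>. 1 \<le> lame_kappa k \<nu> \<and> 0 < amplitude g (lame_kappa k \<nu>) \<and> (\<forall>z. \<bar>z\<bar> < elliptic_K k \<longrightarrow>
    \<bar>lame_Es k \<nu> (m + 1) z / amplitude g (lame_kappa k \<nu>) - approx_mode n (lame_kappa k \<nu>) (sqrt (2 * lame_kappa k \<nu>) * z)\<bar> \<le> N / lame_kappa k \<nu>^(n + 1))) at_top"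
    by blast
  obtain CA where CA: "\<And>x t. 0 < x \<Longrightarrow> x \<le> 1 \<Longrightarrow> \<bar>t\<bar> \<le> t0 \<Longrightarrow> x * t^2 / 2 \<le> 1/2 \<Longrightarrow>
    \<bar>(\<Sum>s\<le>n. x^s * poly (coeff_A k m s) t) / sqrt (1 - x * t^2 / 2) - (\<Sum>s\<le>n. x^s * poly (coeff_P k m s) t)\<bar> \<le> CA * x^(n + 1)"
    using cn_quotient_expansion[OF t0, where A = "coeff_A k m" and n = n] unfolding coeff_P_def by blast
  obtain CB where CB: "\<And>x t. 0 < x \<Longrightarrow> x \<le> 1 \<Longrightarrow> \<bar>t\<bar> \<le> t0 \<Longrightarrow> x * t^2 / 2 \<le> 1/2 \<Longrightarrow>
    \<bar>(\<Sum>s\<le>n. x^s * poly (coeff_B k m s) t) / sqrt (1 - x * t^2 / 2) - (\<Sum>s\<le>n. x^s * poly (coeff_Q k m s) t)\<bar> \<le> CB * x^(n + 1)"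
    using cn_quotient_expansion[OF t0, where A = "coeff_B k m" and n = n] unfolding coeff_Q_def by blast
  obtain D where D: "\<And>t. \<bar>parabolic_D m t\<bar> \<le> D * exp (- 0 * \<bar>t\<bar>)"
    using superexpE[OF gauss_poly_superexp[of "hermite_poly m"], of 0] unfolding parabolic_D_gauss_poly by blast
  obtain D' where D': "\<And>t. \<bar>parabolic_D' m t\<bar> \<le> D' * exp (- 0 * \<bar>t\<bar>)"
    using superexpE[OF gauss_poly_superexp[of "hermite_poly' m"], of 0] by blast
  define L where "L = 2 * \<bar>N\<bar> + D * CA + D' * CB"
  have k: "filterlim (lame_kappa k) at_top at_top" by (rule kappa_at_top[OF k0])
  have "eventually (\<lambda>\<nu>. t0^2 \<le> lame_kappa k \<nu>) at_top"
    using k unfolding filterlim_at_top by blast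
  note ev = eventually_conj[OF N this]
  show "\<exists>L. \<forall>\<^sub>F \<nu> in at_top. \<forall>z.
       \<bar>z\<bar> < elliptic_K k \<and> \<bar>lame_t k \<nu> z\<bar> \<le> t0 \<longrightarrow>
       (\<exists>E. \<bar>E\<bar> \<le> L / lame_kappa k \<nu> ^ (n + 1) \<and>
          lame_Es k \<nu> (m + 1) z / jacobi_cn k z = amplitude g (lame_kappa k \<nu>) *
            (parabolic_D m (lame_t k \<nu> z) * (\<Sum>s=0..n. poly (coeff_P k m s) (lame_t k \<nu> z) / lame_kappa k \<nu> ^ s)
             + deriv (parabolic_D m) (lame_t k \<nu> z) * (\<Sum>s=0..n. poly (coeff_Q k m s) (lame_t k \<nu> z) / lame_kappa k \<nu> ^ s)
             + E))"
  proof (rule exI[of _ L], rule eventually_mono[OF ev], intro allI impI)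
    fix \<nu> z
    assume a: "(1 \<le> lame_kappa k \<nu> \<and> 0 < amplitude g (lame_kappa k \<nu>) \<and> (\<forall>z. \<bar>z\<bar> < elliptic_K k \<longrightarrow>
      \<bar>lame_Es k \<nu> (m + 1) z / amplitude g (lame_kappa k \<nu>) - approx_mode n (lame_kappa k \<nu>) (sqrt (2 * lame_kappa k \<nu>) * z)\<bar> \<le> N / lame_kappa k \<nu>^(n + 1)))
        \<and> t0^2 \<le> lame_kappa k \<nu>"
      and z: "\<bar>z\<bar> < elliptic_K k \<and> \<bar>lame_t k \<nu> z\<bar> \<le> t0"
    define \<kappa> where "\<kappa> = lame_kappa k \<nu>"
    define t where "t = lame_t k \<nu> z"
    define \<alpha> where "\<alpha> = amplitude g \<kappa>"
    define c where "c = sqrt (1 - 1 / \<kappa> * t^2 / 2)"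
    define w where "w = lame_Es k \<nu> (m + 1) z"
    define SA where "SA = (\<Sum>s\<le>n. (1 / \<kappa>)^s * poly (coeff_A k m s) t)"
    define SB where "SB = (\<Sum>s\<le>n. (1 / \<kappa>)^s * poly (coeff_B k m s) t)"
    define SP where "SP = (\<Sum>s\<le>n. (1 / \<kappa>)^s * poly (coeff_P k m s) t)"
    define SQ where "SQ = (\<Sum>s\<le>n. (1 / \<kappa>)^s * poly (coeff_Q k m s) t)"
    define e where "e = (1 / \<kappa>)^(n + 1)"
    have \<kappa>: "1 \<le> \<kappa>" "t0^2 \<le> \<kappa>" and \<alpha>: "0 < \<alpha>" using a by (auto simp: \<kappa>_def \<alpha>_def)
    have k1: "0 < lame_kappa k \<nu>" using a by auto
    have e: "0 < e" "1 / \<kappa>^(n + 1) = e" using \<kappa> by (simp_all add: e_def power_one_over)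
    have tt: "\<bar>t\<bar> \<le> t0" using z by (simp add: t_def)
    have x: "0 < 1 / \<kappa>" "1 / \<kappa> \<le> 1" using \<kappa> by auto
    have "t^2 \<le> t0^2" using power_mono[OF tt, of 2] by simp
    then have "t^2 / \<kappa> \<le> 1" using \<kappa> by (simp add: field_simps)
    then have xt: "1 / \<kappa> * t^2 / 2 \<le> 1/2" by simp
    have cn: "jacobi_cn k z = c"
      using cn_eq[of \<kappa> z] k1 z tau_scaled[OF k1, of z] by (simp add: c_def t_def \<kappa>_def)
    have c: "1/2 \<le> c" unfolding c_def by (rule real_le_rsqrt) (use xt in \<open>simp add: power2_eq_square\<close>)
    have "\<bar>w / amplitude g (lame_kappa k \<nu>) - approx_mode n (lame_kappa k \<nu>) (sqrt (2 * lame_kappa k \<nu>) * z)\<bar> \<le> N / lame_kappa k \<nu>^(n + 1)"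
      using a z unfolding w_def by blast
    then have "\<bar>w / \<alpha> - (parabolic_D m t * SA + parabolic_D' m t * SB)\<bar> \<le> N / \<kappa>^(n + 1)"
      unfolding approx_mode_eq tau_scaled[OF k1] unfolding \<kappa>_def[symmetric] t_def[symmetric] \<alpha>_def[symmetric] SA_def[symmetric] SB_def[symmetric] .
    moreover have "N / \<kappa>^(n + 1) = N * e" unfolding e(2)[symmetric] by simp
    ultimately have r: "\<bar>w / \<alpha> - (parabolic_D m t * SA + parabolic_D' m t * SB)\<bar> \<le> N * e" by simp
    define E where "E = w / c / \<alpha> - (parabolic_D m t * SP + parabolic_D' m t * SQ)"
    \<comment> \<open>Three sources of error: the mode itself, divided by cn, and the two quotient
      series.\<close>
    have Eq: "E = (w / \<alpha> - (parabolic_D m t * SA + parabolic_D' m t * SB)) / c + parabolic_D m t * (SA / c - SP) + parabolic_D' m t * (SB / c - SQ)"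
      unfolding E_def using c by (simp add: field_simps)
    have 1: "\<bar>(w / \<alpha> - (parabolic_D m t * SA + parabolic_D' m t * SB)) / c\<bar> \<le> (\<bar>N\<bar> * e) / (1/2)"
    proof -
      have "N * e \<le> \<bar>N\<bar> * e" using e by (intro mult_right_mono) auto
      then have "\<bar>w / \<alpha> - (parabolic_D m t * SA + parabolic_D' m t * SB)\<bar> \<le> \<bar>N\<bar> * e" using r by linarith
      moreover have "\<bar>c\<bar> = c" using c by simp
      ultimately show ?thesis unfolding abs_divide using c e by (simp only:) (intro frac_le, auto)
    qed
    have 2: "\<bar>parabolic_D m t * (SA / c - SP)\<bar> \<le> D * (CA * e)"
      unfolding abs_mult using CA[OF x tt xt] D[of t] e unfolding SA_def SP_def c_def e_def by (intro mult_mono) auto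
    have 3: "\<bar>parabolic_D' m t * (SB / c - SQ)\<bar> \<le> D' * (CB * e)"
      unfolding abs_mult using CB[OF x tt xt] D'[of t] e unfolding SB_def SQ_def c_def e_def by (intro mult_mono) auto
    have "\<bar>E\<bar> \<le> (\<bar>N\<bar> * e) / (1/2) + D * (CA * e) + D' * (CB * e)" unfolding Eq by (rule order_trans[OF abs_triangle_ineq add_mono[OF order_trans[OF abs_triangle_ineq add_mono[OF 1 2]] 3]])
    also have "\<dots> = L * e" by (simp add: L_def algebra_simps)
    finally have Eb: "\<bar>E\<bar> \<le> L / \<kappa>^(n + 1)" using e(2) by (simp add: divide_inverse)
    have "w / c = \<alpha> * (parabolic_D m t * SP + parabolic_D' m t * SQ + E)" using \<alpha> by (simp add: E_def)
    then show "\<exists>E. \<bar>E\<bar> \<le> L / lame_kappa k \<nu> ^ (n + 1) \<and>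
          lame_Es k \<nu> (m + 1) z / jacobi_cn k z = amplitude g (lame_kappa k \<nu>) *
            (parabolic_D m (lame_t k \<nu> z) * (\<Sum>s=0..n. poly (coeff_P k m s) (lame_t k \<nu> z) / lame_kappa k \<nu> ^ s)
             + deriv (parabolic_D m) (lame_t k \<nu> z) * (\<Sum>s=0..n. poly (coeff_Q k m s) (lame_t k \<nu> z) / lame_kappa k \<nu> ^ s)
             + E)"
      unfolding deriv_parabolic_D sum_over_powers cn \<kappa>_def[symmetric] t_def[symmetric] \<alpha>_def[symmetric] w_def[symmetric] SP_def[symmetric] SQ_def[symmetric]
      using Eb by blast
  qed
qed

end

theorem mainTheorem3:
  fixes k :: real and m :: nat
  assumes "0 < k" and "k < 1"
  shows
    "(\<exists>C S :: real \<Rightarrow> real.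
        local_expansion k m (\<lambda>\<nu> z. lame_Ec k \<nu> m z) C (coeff_A k m) (coeff_B k m) \<and>
        local_expansion k m (\<lambda>\<nu> z. lame_Es k \<nu> (m + 1) z / jacobi_cn k z) S
          (coeff_P k m) (coeff_Q k m) \<and>
        constant_expansion k m C \<and> constant_expansion k m S) \<and>
     (\<forall>s. even_poly (coeff_A k m s) \<and> odd_poly (coeff_B k m s) \<and>
          even_poly (coeff_P k m s) \<and> odd_poly (coeff_Q k m s)) \<and>
     coeff_A k m 0 = 1 \<and>
     (\<forall>t. poly (coeff_A k m 1) t = (k^2 + 1) / 32 * t^2) \<and>
     coeff_B k m 0 = 0 \<and>
     (\<forall>t. poly (coeff_B k m 1) t = (k^2 + 1) / 16 * (t^3 - (2 * real m + 1) * t)) \<and>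
     coeff_P k m 0 = 1 \<and>
     (\<forall>t. poly (coeff_P k m 1) t = (k^2 + 9) / 32 * t^2) \<and>
     coeff_Q k m 0 = 0 \<and>
     coeff_Q k m 1 = coeff_B k m 1 \<and>
     coeff_eta k m 1 = (3 - k^2) / 16 * (2 * real m + 1)"
proof -
  obtain \<mu> where "AB_recursion k m (coeff_A k m) (coeff_B k m) \<mu>" using coeff_AB_recursion by blast
  then interpret expansion k m \<mu> by unfold_locales (use assms in auto)
  \<comment> \<open>Both C and S will be the amplitude built from this g: the two boundary problems
    share the quasi-mode, hence the expansion of the norm.\<close>
  obtain g where g: "\<And>n. \<exists>B x1. \<forall>x\<ge>x1. \<bar>g x - (\<Sum>s\<le>n. coeff_eta k m s / x^s)\<bar> \<le> B / x^(n + 1)"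
    using asymptotic_series_realised[of "coeff_eta k m"] by blast
  have "\<exists>C S :: real \<Rightarrow> real.
        local_expansion k m (\<lambda>\<nu> z. lame_Ec k \<nu> m z) C (coeff_A k m) (coeff_B k m) \<and>
        local_expansion k m (\<lambda>\<nu> z. lame_Es k \<nu> (m + 1) z / jacobi_cn k z) S
          (coeff_P k m) (coeff_Q k m) \<and>
        constant_expansion k m C \<and> constant_expansion k m S"
    using local_expansion_Ec[OF g] local_expansion_Es[OF g] amplitude_expansion[OF g] by blast
  moreover have "even_poly (coeff_A k m s) \<and> odd_poly (coeff_B k m s) \<and> even_poly (coeff_P k m s) \<and> odd_poly (coeff_Q k m s)" for s
    unfolding even_poly_iff odd_poly_iff coeff_P_def coeff_Q_def by (intro conjI cn_quotient_parity coeff_A_even coeff_B_odd)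
  moreover have "poly (coeff_A k m 1) t = (k^2 + 1) / 32 * t^2" "poly (coeff_B k m 1) t = (k^2 + 1) / 16 * (t^3 - (2 * real m + 1) * t)" for t
    unfolding coeff_A_1 coeff_B_1 by (simp_all add: power2_eq_square power3_eq_cube field_simps)
  moreover have "poly (coeff_P k m 1) t = (k^2 + 9) / 32 * t^2" for t
    unfolding coeff_P_def cn_quotient_1 coeff_A_0 coeff_A_1 by (simp add: power2_eq_square field_simps)
  moreover have "coeff_Q k m 1 = coeff_B k m 1" unfolding coeff_Q_def cn_quotient_1 coeff_B_0 by simp
  moreover have "coeff_P k m 0 = 1" "coeff_Q k m 0 = 0" by (simp_all only: coeff_P_def coeff_Q_def cn_quotient_0 coeff_A_0 coeff_B_0)
  moreover note coeff_A_0 coeff_B_0 coeff_eta_1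
  ultimately show ?thesis by blast
qed



end
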